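(* Let $E/\mathbb{Q}$ be an elliptic curve with $j(E)=1728$, let $c\in\operatorname{Gal}(\overline{\mathbb{Q}}/\mathbb{Q})$ be a complex conjugation, and let $\gamma=\rho_{E,2^\infty}(c)$. Let $G_{E,2^\infty}$ be the image of $\rho_{E,2^\infty}$ and let $G_{E,K,2^\infty}=\rho_{E,2^\infty}(\operatorname{Gal}(\overline{\mathbb{Q}}/\mathbb{Q}(i)))$. Then there is a $\mathbb{Z}_2$-basis of $T_2(E)$ such that $G_{E,K,2^\infty}$ (contained in $\mathcal{C}_{-1,0}(2^\infty)$) is one of the following groups: - If $[\mathcal{C}_{-1,0}(2^\infty):G_{E,K,2^\infty}]=1$, then $G_{E,K,2^\infty}$ is all of $\mathcal{C}_{-1,0}(2^\infty)$, i.e., $$G_1=\left\{\begin{pmatrix}a&b\\-b&a\end{pmatrix}\in\operatorname{GL}(2,\mathbb{Z}_2):a^2+b^2\not\equiv0\bmod2\right\}.$$ - If $[\mathcal{C}_{-1,0}(2^\infty):G_{E,K,2^\infty}]=2$, then $G_{E,K,2^\infty}$ is one of $$G_{2,a}=\left\langle-\operatorname{Id},3\cdot\operatorname{Id},\begin{pmatrix}1&2\\-2&1\end{pmatrix}\right\rangle,\quad G_{2,b}=\left\langle-\operatorname{Id},3\cdot\operatorname{Id},\begin{pmatrix}2&1\\-1&2\end{pmatrix}\right\rangle.$$ - If $[\mathcal{C}_{-1,0}(2^\infty):G_{E,K,2^\infty}]=4$, then $G_{E,K,2^\infty}$ is one of $$G_{4,a}=\left\langle5\cdot\operatorname{Id},\begin{pmatrix}1&2\\-2&1\end{pmatrix}\right\rangle,\quad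 G_{4,b}=\left\langle5\cdot\operatorname{Id},\begin{pmatrix}-1&-2\\2&-1\end{pmatrix}\right\rangle,$$ $$G_{4,c}=\left\langle-3\cdot\operatorname{Id},\begin{pmatrix}2&-1\\1&2\end{pmatrix}\right\rangle,\quad G_{4,d}=\left\langle-3\cdot\operatorname{Id},\begin{pmatrix}-2&1\\-1&-2\end{pmatrix}\right\rangle.$$ Moreover, $G_{E,2^\infty}=\langle\gamma,G_{E,K,2^\infty}\rangle=\langle\gamma',G_{E,K,2^\infty}\rangle$ is generated by one of the groups above and an element $$\gamma'\in\left\{c_1=\begin{pmatrix}1&0\\0&-1\end{pmatrix},\ c_{-1}=\begin{pmatrix}-1&0\\0&1\end{pmatrix},\ c_1'=\begin{pmatrix}0&1\\1&0\end{pmatrix},\ c_{-1}'=\begin{pmatrix}0&-1\\-1&0\end{pmatrix}\right\}$$ such that $\gamma\equiv\gamma'\bmod4$.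
   Context: $T_2(E)=\varprojlim E[2^n]$, and $\rho_{E,2^\infty}\colon\operatorname{Gal}(\overline{\mathbb{Q}}/\mathbb{Q})\to\operatorname{Aut}(T_2(E))\cong\operatorname{GL}(2,\mathbb{Z}_2)$ is the Galois representation; all matrices, including $\gamma$, are with respect to the chosen $\mathbb{Z}_2$-basis. $\mathcal{C}_{-1,0}(2^\infty)=\left\{\begin{pmatrix}a&b\\-b&a\end{pmatrix}:a,b\in\mathbb{Z}_2,\ a^2+b^2\in\mathbb{Z}_2^\times\right\}$. Angle brackets denote the closed subgroup of $\operatorname{GL}(2,\mathbb{Z}_2)$ topologically generated. A complex conjugation is the element of order $2$ of $\operatorname{Gal}(\overline{\mathbb{Q}}/\mathbb{Q})$ induced by complex conjugation on $\mathbb{C}$ through an embedding $\overline{\mathbb{Q}}\hookrightarrow\mathbb{C}$. *)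

theory Defs
  imports
    "HOL-Analysis.Analysis"
    "HOL-Algebra.Coset"
    "HOL-Algebra.Algebraic_Closure_Type"
begin

section \<open>The ring of 2-adic integers\<close>

text \<open>
  The 2-adic integers are the inverse limit of the rings of integers modulo \<open>2 ^ n\<close>: an element is
  the sequence of its least non-negative residues. The condition forces \<open>0 \<le> x n < 2 ^ n\<close>.
\<close>

typedef z2 = "{x :: nat \<Rightarrow> int. \<forall>n. x (Suc n) mod 2 ^ n = x n}"
  morphisms residue Abs_z2
  by (rule exI[of _ "\<lambda>_. 0"]) simp

setup_lifting type_definition_z2

lemma z2_coherent_mod:
  assumes "\<And>n. (f (Suc n) :: int) mod 2 ^ n = f n mod 2 ^ n"
  shows "(f (Suc n) mod 2 ^ Suc n) mod 2 ^ n = f n mod 2 ^ n"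
  using assms[of n] by (simp add: mod_mod_cancel)

lemma z2_coherent_self:
  assumes "\<forall>n. (x (Suc n) :: int) mod 2 ^ n = x n"
  shows "x n mod 2 ^ n = x n"
  using assms by (metis mod_mod_trivial)

instantiation z2 :: comm_ring_1
begin

lift_definition zero_z2 :: z2 is "\<lambda>_. 0" by simp

lift_definition one_z2 :: z2 is "\<lambda>n. 1 mod 2 ^ n"
  by (intro allI z2_coherent_mod) simp

lift_definition plus_z2 :: "z2 \<Rightarrow> z2 \<Rightarrow> z2" is "\<lambda>x y n. (x n + y n) mod 2 ^ n"
  by (intro allI z2_coherent_mod) (metis mod_add_eq mod_mod_trivial)

lift_definition uminus_z2 :: "z2 \<Rightarrow> z2" is "\<lambda>x n. (- x n) mod 2 ^ n"
  by (intro allI z2_coherent_mod) (metis mod_minus_eq)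

lift_definition minus_z2 :: "z2 \<Rightarrow> z2 \<Rightarrow> z2" is "\<lambda>x y n. (x n - y n) mod 2 ^ n"
  by (intro allI z2_coherent_mod) (metis mod_diff_eq mod_mod_trivial)

lift_definition times_z2 :: "z2 \<Rightarrow> z2 \<Rightarrow> z2" is "\<lambda>x y n. (x n * y n) mod 2 ^ n"
  by (intro allI z2_coherent_mod) (metis mod_mult_eq mod_mod_trivial)

instance
proof
  fix a b c :: z2
  show "a * b * c = a * (b * c)"
    by transfer (simp add: fun_eq_iff mod_simps mult.assoc)
  show "a * b = b * a"
    by transfer (simp add: mult.commute)
  show "1 * a = a"
    by transfer (simp add: fun_eq_iff mod_mult_left_eq z2_coherent_self del: one_mod_2_pow_eq)
  show "a + b + c = a + (b + c)"
    by transfer (simp add: fun_eq_iff mod_simps add.assoc)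
  show "a + b = b + a"
    by transfer (simp add: add.commute)
  show "0 + a = a"
    by transfer (simp add: fun_eq_iff z2_coherent_self)
  show "- a + a = 0"
    by transfer (simp add: fun_eq_iff mod_simps)
  show "a - b = a + - b"
    by transfer (simp add: fun_eq_iff mod_simps)
  show "(a + b) * c = a * c + b * c"
    by transfer (simp add: fun_eq_iff mod_simps distrib_right)
  show "(0 :: z2) \<noteq> 1"
    by transfer (auto simp: fun_eq_iff intro!: exI[of _ 1])
qed

end

text \<open>The inverse limit topology: the residue classes modulo \<open>2 ^ n\<close> form a basis.\<close>

instantiation z2 :: topological_space
begin

definition open_z2 :: "z2 set \<Rightarrow> bool" where
  "open_z2 U \<longleftrightarrow> (\<forall>x\<in>U. \<exists>n. \<forall>y. residue y n = residue x n \<longrightarrow> y \<in> U)"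

lemma residue_eq_mono:
  assumes "residue x n = residue y n" "m \<le> n"
  shows "residue x m = residue y m"
  using assms(2,1)
proof (induction rule: dec_induct)
  case (step k)
  have "residue z (Suc k) mod 2 ^ k = residue z k" for z
    using residue[of z] by simp
  with step show ?case by metis
qed

instance
proof
  fix S T :: "z2 set"
  assume S: "open S" and T: "open T"
  show "open (S \<inter> T)"
    unfolding open_z2_def
  proof
    fix x assume "x \<in> S \<inter> T"
    then have "x \<in> S" "x \<in> T" by auto
    obtain m where m: "\<forall>y. residue y m = residue x m \<longrightarrow> y \<in> S"
      using S \<open>x \<in> S\<close> unfolding open_z2_def by auto
    obtain n where n: "\<forall>y. residue y n = residue x n \<longrightarrow> y \<in> T"
      using T \<open>x \<in> T\<close> unfolding open_z2_def by auto
    have "y \<in> S \<inter> T" if "residue y (max m n) = residue x (max m n)" for y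
      using residue_eq_mono[OF that, of m] residue_eq_mono[OF that, of n] m n by simp
    then show "\<exists>n. \<forall>y. residue y n = residue x n \<longrightarrow> y \<in> S \<inter> T"
      by blast
  qed
next
  fix K :: "z2 set set"
  assume "\<forall>S\<in>K. open S"
  then show "open (\<Union>K)" unfolding open_z2_def by (meson Union_iff)
qed (simp add: open_z2_def)

end


section \<open>Two by two matrices over the 2-adic integers\<close>

definition mat2 :: "'a::zero \<Rightarrow> 'a \<Rightarrow> 'a \<Rightarrow> 'a \<Rightarrow> 'a ^ 2 ^ 2" where
  "mat2 a b c d = vector [vector [a, b], vector [c, d]]"

definition GL2 :: "(z2 ^ 2 ^ 2) monoid" where
  "GL2 = \<lparr>carrier = {A. invertible A}, monoid.mult = (**), one = mat 1\<rparr>"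

text \<open>
  The closed subgroup topologically generated by a subset of \<open>GL2\<close>; the topology of \<open>GL2\<close> is
  induced from the space of all matrices, which carries the product topology.
\<close>

definition closed_gen :: "(z2 ^ 2 ^ 2) set \<Rightarrow> (z2 ^ 2 ^ 2) set" where
  "closed_gen S = \<Inter>{H. subgroup H GL2 \<and> closedin (top_of_set (carrier GL2)) H \<and> S \<subseteq> H}"

definition cartan :: "(z2 ^ 2 ^ 2) set" where
  "cartan = {mat2 a b (- b) a | a b. a\<^sup>2 + b\<^sup>2 dvd 1}"

text \<open>If there are infinitely many cosets, this is \<open>0\<close>.\<close>

definition index_in_cartan :: "(z2 ^ 2 ^ 2) set \<Rightarrow> nat" where
  "index_in_cartan H = card (rcosets\<^bsub>GL2\<lparr>carrier := cartan\<rparr>\<^esub> H)"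

definition mat_cong :: "z2 \<Rightarrow> z2 ^ 2 ^ 2 \<Rightarrow> z2 ^ 2 ^ 2 \<Rightarrow> bool" where
  "mat_cong m A B \<longleftrightarrow> (\<forall>i j. m dvd A $ i $ j - B $ i $ j)"

definition G1 :: "(z2 ^ 2 ^ 2) set" where
  "G1 = {mat2 a b (- b) a | a b. mat2 a b (- b) a \<in> carrier GL2 \<and> \<not> 2 dvd a\<^sup>2 + b\<^sup>2}"

definition G2a :: "(z2 ^ 2 ^ 2) set" where
  "G2a = closed_gen {mat (- 1), mat 3, mat2 1 2 (- 2) 1}"

definition G2b :: "(z2 ^ 2 ^ 2) set" where
  "G2b = closed_gen {mat (- 1), mat 3, mat2 2 1 (- 1) 2}"

definition G4a :: "(z2 ^ 2 ^ 2) set" where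
  "G4a = closed_gen {mat 5, mat2 1 2 (- 2) 1}"

definition G4b :: "(z2 ^ 2 ^ 2) set" where
  "G4b = closed_gen {mat 5, mat2 (- 1) (- 2) 2 (- 1)}"

definition G4c :: "(z2 ^ 2 ^ 2) set" where
  "G4c = closed_gen {mat (- 3), mat2 2 (- 1) 1 2}"

definition G4d :: "(z2 ^ 2 ^ 2) set" where
  "G4d = closed_gen {mat (- 3), mat2 (- 2) 1 (- 1) (- 2)}"


section \<open>Weierstrass curves and their points\<close>

text \<open>
  \<open>Weierstrass a1 a2 a3 a4 a6\<close> stands for the projective curve
  \<open>y\<^sup>2 + a1 x y + a3 y = x\<^sup>3 + a2 x\<^sup>2 + a4 x + a6\<close>.
\<close>

datatype 'a weierstrass =
  Weierstrass (coef1: 'a) (coef2: 'a) (coef3: 'a) (coef4: 'a) (coef6: 'a)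

definition b2 :: "'a::field weierstrass \<Rightarrow> 'a" where
  "b2 E = (coef1 E)\<^sup>2 + 4 * coef2 E"

definition b4 :: "'a::field weierstrass \<Rightarrow> 'a" where
  "b4 E = 2 * coef4 E + coef1 E * coef3 E"

definition b6 :: "'a::field weierstrass \<Rightarrow> 'a" where
  "b6 E = (coef3 E)\<^sup>2 + 4 * coef6 E"

definition b8 :: "'a::field weierstrass \<Rightarrow> 'a" where
  "b8 E = (coef1 E)\<^sup>2 * coef6 E + 4 * coef2 E * coef6 E - coef1 E * coef3 E * coef4 E
     + coef2 E * (coef3 E)\<^sup>2 - (coef4 E)\<^sup>2"

definition c4 :: "'a::field weierstrass \<Rightarrow> 'a" where
  "c4 E = (b2 E)\<^sup>2 - 24 * b4 E"

definition discriminant :: "'a::field weierstrass \<Rightarrow> 'a" where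
  "discriminant E = - (b2 E)\<^sup>2 * b8 E - 8 * b4 E ^ 3 - 27 * (b6 E)\<^sup>2 + 9 * b2 E * b4 E * b6 E"

definition elliptic_curve :: "'a::field weierstrass \<Rightarrow> bool" where
  "elliptic_curve E \<longleftrightarrow> discriminant E \<noteq> 0"

definition j_invariant :: "'a::field weierstrass \<Rightarrow> 'a" where
  "j_invariant E = c4 E ^ 3 / discriminant E"

datatype 'a point = Infinity | Affine 'a 'a

fun on_curve :: "'a::field weierstrass \<Rightarrow> 'a point \<Rightarrow> bool" where
  "on_curve E Infinity \<longleftrightarrow> True"
| "on_curve E (Affine x y) \<longleftrightarrow>
     y\<^sup>2 + coef1 E * x * y + coef3 E * y = x ^ 3 + coef2 E * x\<^sup>2 + coef4 E * x + coef6 E"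

text \<open>
  The chord and tangent law: \<open>y = l * x + n\<close> is the line through the two points, or the tangent
  line if they coincide; it is vertical exactly in the case where the sum is \<open>Infinity\<close>.
\<close>

fun point_add :: "'a::field weierstrass \<Rightarrow> 'a point \<Rightarrow> 'a point \<Rightarrow> 'a point" where
  "point_add E Infinity Q = Q"
| "point_add E P Infinity = P"
| "point_add E (Affine x1 y1) (Affine x2 y2) =
     (if x1 = x2 \<and> y1 + y2 + coef1 E * x2 + coef3 E = 0 then Infinity
      else
        let l = (if x1 = x2
                 then (3 * x1\<^sup>2 + 2 * coef2 E * x1 + coef4 E - coef1 E * y1)
                        / (2 * y1 + coef1 E * x1 + coef3 E)
                 else (y2 - y1) / (x2 - x1));
            n = y1 - l * x1;
            x3 = l\<^sup>2 + coef1 E * l - coef2 E - x1 - x2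
        in Affine x3 (- (l + coef1 E) * x3 - n - coef3 E))"

definition point_group :: "'a::field weierstrass \<Rightarrow> 'a point monoid" where
  "point_group E = \<lparr>carrier = {P. on_curve E P}, monoid.mult = point_add E, one = Infinity\<rparr>"


section \<open>The absolute Galois group of the rationals\<close>

type_synonym QQbar = "rat alg_closure"

text \<open>The group of automorphisms of \<open>QQbar\<close> fixing the subfield \<open>F\<close> pointwise.\<close>

definition Gal :: "QQbar set \<Rightarrow> (QQbar \<Rightarrow> QQbar) set" where
  "Gal F = {\<sigma>. bij \<sigma> \<and> (\<forall>x y. \<sigma> (x + y) = \<sigma> x + \<sigma> y) \<and> (\<forall>x y. \<sigma> (x * y) = \<sigma> x * \<sigma> y)
     \<and> (\<forall>x\<in>F. \<sigma> x = x)}"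

definition field_Q :: "QQbar set" where
  "field_Q = range to_ac"

text \<open>Both square roots of \<open>-1\<close> give the same subfield.\<close>

definition field_Qi :: "QQbar set" where
  "field_Qi = {to_ac a + to_ac b * z | a b z. z\<^sup>2 = - 1}"

definition field_embedding :: "(QQbar \<Rightarrow> complex) \<Rightarrow> bool" where
  "field_embedding \<iota> \<longleftrightarrow>
     \<iota> 1 = 1 \<and> (\<forall>x y. \<iota> (x + y) = \<iota> x + \<iota> y) \<and> (\<forall>x y. \<iota> (x * y) = \<iota> x * \<iota> y)"

definition complex_conjugation :: "(QQbar \<Rightarrow> QQbar) \<Rightarrow> bool" where
  "complex_conjugation c \<longleftrightarrow>
     c \<in> Gal field_Q \<and> (\<exists>\<iota>. field_embedding \<iota> \<and> (\<forall>x. \<iota> (c x) = cnj (\<iota> x)))"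


section \<open>The 2-adic Tate module and the Galois representation\<close>

definition geometric_points :: "rat weierstrass \<Rightarrow> QQbar point monoid" where
  "geometric_points E = point_group (map_weierstrass to_ac E)"

definition torsion :: "rat weierstrass \<Rightarrow> nat \<Rightarrow> QQbar point set" where
  "torsion E m = {P \<in> carrier (geometric_points E). P [^]\<^bsub>geometric_points E\<^esub> m = Infinity}"

text \<open>The inverse limit of the groups \<open>torsion E (2 ^ n)\<close> along multiplication by \<open>2\<close>.\<close>

definition tate :: "rat weierstrass \<Rightarrow> (nat \<Rightarrow> QQbar point) set" where
  "tate E = {t. \<forall>n. t n \<in> torsion E (2 ^ n) \<and> t (Suc n) [^]\<^bsub>geometric_points E\<^esub> (2::nat) = t n}"

definition tate_add ::
    "rat weierstrass \<Rightarrow> (nat \<Rightarrow> QQbar point) \<Rightarrow> (nat \<Rightarrow> QQbar point) \<Rightarrow> nat \<Rightarrow> QQbar point" where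
  "tate_add E s t = (\<lambda>n. s n \<otimes>\<^bsub>geometric_points E\<^esub> t n)"

definition tate_smult ::
    "rat weierstrass \<Rightarrow> z2 \<Rightarrow> (nat \<Rightarrow> QQbar point) \<Rightarrow> nat \<Rightarrow> QQbar point" where
  "tate_smult E a t = (\<lambda>n. t n [^]\<^bsub>geometric_points E\<^esub> nat (residue a n))"

definition tate_comb ::
    "rat weierstrass \<Rightarrow> (2 \<Rightarrow> nat \<Rightarrow> QQbar point) \<Rightarrow> z2 ^ 2 \<Rightarrow> nat \<Rightarrow> QQbar point" where
  "tate_comb E e v = tate_add E (tate_smult E (v $ 1) (e 1)) (tate_smult E (v $ 2) (e 2))"

definition tate_basis :: "rat weierstrass \<Rightarrow> (2 \<Rightarrow> nat \<Rightarrow> QQbar point) \<Rightarrow> bool" where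
  "tate_basis E e \<longleftrightarrow> (\<forall>j. e j \<in> tate E) \<and> (\<forall>t\<in>tate E. \<exists>!v. t = tate_comb E e v)"

definition tate_action :: "(QQbar \<Rightarrow> QQbar) \<Rightarrow> (nat \<Rightarrow> QQbar point) \<Rightarrow> nat \<Rightarrow> QQbar point" where
  "tate_action \<sigma> t = (\<lambda>n. map_point \<sigma> (t n))"

text \<open>
  The matrix of the action of \<open>\<sigma>\<close> on the Tate module with respect to a basis \<open>e\<close>; its columns
  are the coordinates of the images of the basis vectors.
\<close>

definition galois_rep ::
    "rat weierstrass \<Rightarrow> (2 \<Rightarrow> nat \<Rightarrow> QQbar point) \<Rightarrow> (QQbar \<Rightarrow> QQbar) \<Rightarrow> z2 ^ 2 ^ 2" where
  "galois_rep E e \<sigma> = (THE A. \<forall>j. tate_action \<sigma> (e j) = tate_comb E e (column j A))"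

end

theory Submission
  imports Defs "HOL-Number_Theory.Cong"
begin

text \<open>
  Over the algebraic closure the curve becomes \<open>y\<^sup>2 = x\<^sup>3 + x\<close>, and the two Galois actions differ by a cocycle
  with values in \<open>\<mu>\<^sub>4\<close>. The Tate module is free of rank one over \<open>\<int>\<^sub>2[i]\<close>. The group law is read off from
  the ideal classes of the coordinate ring. Multiplication by \<open>1 + i\<close> sends \<open>x\<close> to \<open>(x\<^sup>2 + 1) / (2 i x)\<close>, so
  the \<open>x\<close>-coordinates of the \<open>(1 + i)\<close>-power torsion points generate a tower of totally ramified quadratic
  extensions. The sizes of the Galois orbits force the image \<open>H\<close> of the absolute Galois group of \<open>\<rat>(i)\<close>
  to satisfy \<open>H \<mu>\<^sub>4 = \<int>\<^sub>2[i]\<^sup>\<times>\<close>. As \<open>H\<close> is closed and stable under complex conjugation, it is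
  determined by \<open>H \<inter> \<mu>\<^sub>4\<close> and by the multiples \<open>z (1 + 2 i)\<close> with \<open>z \<in> \<mu>\<^sub>4\<close> that it contains. Hilbert 90
  for complex conjugation yields a basis with \<open>\<gamma> = \<gamma>'\<close>.
\<close>

hide_const (open) Polynomials.degree Polynomials.lead_coeff up_ring.coeff up_ring.monom module.smult

section \<open>Products of ideals\<close>

text \<open>A direct proof of associativity for the chord and tangent law splits into many cases;
  ideal multiplication is associative from the start, and a tangent is merely a line with a repeated
  factor. The prime above 2 is seen only through integrality, invertibility modulo 1 + i and the
  power of 2 in a rational norm. The number whose conjugates are counted, \<open>bval\<close>, is
  insensitive to multiplication by i. Hence each level yields transitivity only up to fourth roots
  of unity, which is the same ambiguity as that of the quartic twist, so all curves with j = 1728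
  are treated at once. Stability under conjugation enters through a norm: the multiple of 1 + 2 i in
  H has norm 5, and the powers of 5 are dense in 1 + 4 Z_2, which contains -3; this is the origin of
  the scalar generators in the list. The basis is e, -i e, because there multiplication by a + b i
  has the rows (a, b) and (-b, a).\<close>

inductive_set ideal_times :: "'a::comm_ring_1 set \<Rightarrow> 'a set \<Rightarrow> 'a set" for I J where
  zero: "0 \<in> ideal_times I J"
| step: "a \<in> I \<Longrightarrow> b \<in> J \<Longrightarrow> x \<in> ideal_times I J \<Longrightarrow> a * b + x \<in> ideal_times I J"

definition is_ideal :: "'a::comm_ring_1 set \<Rightarrow> bool" where
  "is_ideal I \<longleftrightarrow> 0 \<in> I \<and> (\<forall>x\<in>I. \<forall>y\<in>I. x + y \<in> I) \<and> (\<forall>r. \<forall>x\<in>I. r * x \<in> I)"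

text \<open>Ideal classes are handled inside the ring: \<open>I\<close> and \<open>J\<close> lie in
  the same class when \<open>scaled u I = scaled v J\<close> for some nonzero \<open>u\<close> and
  \<open>v\<close>.\<close>

definition scaled :: "'a::comm_ring_1 \<Rightarrow> 'a set \<Rightarrow> 'a set" where
  "scaled c I = (*) c ` I"

lemma is_ideal_UNIV: "is_ideal UNIV"
  by (simp add: is_ideal_def)

lemma is_ideal_diff:
  assumes "is_ideal I" "x \<in> I" "y \<in> I"
  shows "x - y \<in> I"
proof -
  have "(- 1) * y \<in> I" using assms unfolding is_ideal_def by blast
  then have "x + (- 1) * y \<in> I" using assms unfolding is_ideal_def by blast
  then show ?thesis by simp
qed

lemma is_ideal_scaled: "is_ideal I \<Longrightarrow> is_ideal (scaled c I)"
  unfolding is_ideal_def scaled_def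
proof (safe, goal_cases)
  case 1 then show ?case by (metis image_eqI mult_zero_right)
next
  case (2 _ _ x y) then show ?case by (metis image_eqI distrib_left)
next
  case (3 r _ x) then show ?case by (metis image_eqI mult.left_commute)
qed

lemma ideal_times_mem: "a \<in> I \<Longrightarrow> b \<in> J \<Longrightarrow> a * b \<in> ideal_times I J"
  using ideal_times.step[OF _ _ ideal_times.zero] by fastforce

lemma ideal_times_add:
  "x \<in> ideal_times I J \<Longrightarrow> y \<in> ideal_times I J \<Longrightarrow> x + y \<in> ideal_times I J"
  by (induction rule: ideal_times.induct) (auto simp: add.assoc intro: ideal_times.step)

lemma ideal_times_subset:
  assumes "is_ideal T" "\<And>a b. a \<in> I \<Longrightarrow> b \<in> J \<Longrightarrow> a * b \<in> T"
  shows "ideal_times I J \<subseteq> T"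
proof
  fix x assume "x \<in> ideal_times I J"
  then show "x \<in> T"
    by induction (use assms in \<open>auto simp: is_ideal_def\<close>)
qed

lemma ideal_times_commute: "ideal_times I J = ideal_times J I"
proof -
  have "ideal_times I J \<subseteq> ideal_times J I" for I J :: "'a set"
  proof
    fix x assume "x \<in> ideal_times I J"
    then show "x \<in> ideal_times J I"
      by induction (auto simp: mult.commute intro: ideal_times.zero, metis ideal_times.step mult.commute)
  qed
  then show ?thesis by blast
qed

lemma is_ideal_times: "is_ideal I \<Longrightarrow> is_ideal (ideal_times I J)"
  unfolding is_ideal_def
proof (safe, goal_cases)
  case 1 show ?case by (rule ideal_times.zero)
next
  case 2 from ideal_times_add[OF 2(4,5)] show ?case .
next
  case (3 r x)
  from 3(4) show ?case
    by induction (auto simp: distrib_left mult.assoc[symmetric] 3 intro: ideal_times.intros)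
qed

lemma ideal_times_assoc:
  assumes "is_ideal I" "is_ideal J" "is_ideal K"
  shows "ideal_times (ideal_times I J) K = ideal_times I (ideal_times J K)"
proof
  have 1: "a * c \<in> ideal_times I (ideal_times J K)" if "a \<in> ideal_times I J" "c \<in> K" for a c
    using that(1)
  proof induction
    case (step x y z)
    then show ?case
      using ideal_times.step[OF step(1) ideal_times_mem[OF step(2) that(2)]]
      by (simp add: distrib_right mult.assoc)
  qed (simp add: ideal_times.zero)
  show "ideal_times (ideal_times I J) K \<subseteq> ideal_times I (ideal_times J K)"
    by (rule ideal_times_subset[OF is_ideal_times[OF assms(1)] 1])
  have 2: "a * c \<in> ideal_times (ideal_times I J) K" if "c \<in> ideal_times J K" "a \<in> I" for a c
    using that(1)
  proof induction
    case (step x y z)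
    then show ?case
      using ideal_times.step[OF ideal_times_mem[OF that(2) step(1)] step(2)]
      by (simp add: distrib_left mult.assoc)
  qed (simp add: ideal_times.zero)
  show "ideal_times I (ideal_times J K) \<subseteq> ideal_times (ideal_times I J) K"
    by (rule ideal_times_subset[OF is_ideal_times[OF is_ideal_times[OF assms(1)]] 2])
qed

lemma scaled_scaled: "scaled c (scaled d I) = scaled (c * d) I"
  by (auto simp: scaled_def mult.assoc image_image)

lemma scaled_ideal_times: "ideal_times (scaled c I) J = scaled c (ideal_times I J)"
proof
  show "ideal_times (scaled c I) J \<subseteq> scaled c (ideal_times I J)"
  proof
    fix x assume "x \<in> ideal_times (scaled c I) J"
    then show "x \<in> scaled c (ideal_times I J)"
    proof induction
      case zero
      show ?case unfolding scaled_def using ideal_times.zero by (metis image_eqI mult_zero_right)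
    next
      case (step a b x)
      then obtain a' x' where "a = c * a'" "a' \<in> I" "x = c * x'" "x' \<in> ideal_times I J"
        by (auto simp: scaled_def)
      then have "a * b + x = c * (a' * b + x')" "a' * b + x' \<in> ideal_times I J"
        using ideal_times.step[OF _ step(2)] by (auto simp: distrib_left mult.assoc)
      then show ?case by (simp add: scaled_def)
    qed
  qed
  show "scaled c (ideal_times I J) \<subseteq> ideal_times (scaled c I) J"
  proof
    fix x assume "x \<in> scaled c (ideal_times I J)"
    then obtain y where "x = c * y" and y: "y \<in> ideal_times I J" by (auto simp: scaled_def)
    from y have "c * y \<in> ideal_times (scaled c I) J"
      by induction
        (auto simp: distrib_left mult.assoc[symmetric] scaled_def intro!: ideal_times.intros)
    with \<open>x = c * y\<close> show "x \<in> ideal_times (scaled c I) J" by simp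
  qed
qed

lemma ideal_times_scaled: "ideal_times J (scaled c I) = scaled c (ideal_times J I)"
  by (metis ideal_times_commute scaled_ideal_times)

lemma ideal_times_UNIV: "is_ideal I \<Longrightarrow> ideal_times UNIV I = I"
proof
  assume I: "is_ideal I"
  show "ideal_times UNIV I \<subseteq> I"
    by (rule ideal_times_subset[OF I]) (use I in \<open>auto simp: is_ideal_def\<close>)
  show "I \<subseteq> ideal_times UNIV I"
    using ideal_times_mem[of 1 UNIV _ I] by auto
qed

lemma ideal_times_UNIV_right: "is_ideal I \<Longrightarrow> ideal_times I UNIV = I"
  by (metis ideal_times_UNIV ideal_times_commute)

section \<open>The coordinate ring of the curve \<open>y\<^sup>2 = x\<^sup>3 + x\<close>\<close>

definition cubic :: "'a::comm_ring_1 poly" where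
  "cubic = [:0, 1, 0, 1:]"

lemma poly_cubic: "poly cubic a = a ^ 3 + a"
  by (simp add: cubic_def algebra_simps power3_eq_cube)

text \<open>\<open>Crd A B\<close> stands for \<open>A(x) + B(x) y\<close>.\<close>

typedef (overloaded) 'a crd = "UNIV :: ('a::zero poly \<times> 'a poly) set"
  by simp

definition Crd :: "'a::zero poly \<Rightarrow> 'a poly \<Rightarrow> 'a crd" where
  "Crd A B = Abs_crd (A, B)"

definition cpart :: "'a::zero crd \<Rightarrow> 'a poly" where
  "cpart u = fst (Rep_crd u)"

definition ypart :: "'a::zero crd \<Rightarrow> 'a poly" where
  "ypart u = snd (Rep_crd u)"

lemma cpart_Crd [simp]: "cpart (Crd A B) = A"
  and ypart_Crd [simp]: "ypart (Crd A B) = B"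
  by (simp_all add: cpart_def ypart_def Crd_def Abs_crd_inverse)

lemma Crd_inject [simp]: "Crd A B = Crd A' B' \<longleftrightarrow> A = A' \<and> B = B'"
  by (metis cpart_Crd ypart_Crd)

lemma crd_cases [cases type: crd]:
  obtains A B where "u = Crd A B"
  by (metis Crd_def Rep_crd_inverse prod.collapse)

lemma Crd_parts [simp]: "Crd (cpart u) (ypart u) = u"
  by (cases u) simp

instantiation crd :: (comm_ring_1) comm_ring_1
begin

definition "0 = Crd 0 0"
definition "1 = Crd 1 0"
definition "u + v = Crd (cpart u + cpart v) (ypart u + ypart v)"
definition "- u = Crd (- cpart u) (- ypart u)"
definition "u - v = Crd (cpart u - cpart v) (ypart u - ypart v)"
definition "u * v = Crd (cpart u * cpart v + ypart u * ypart v * cubic)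
  (cpart u * ypart v + ypart u * cpart v)"

instance
  by standard
    (simp_all add: zero_crd_def one_crd_def plus_crd_def uminus_crd_def minus_crd_def
      times_crd_def algebra_simps)

end

lemmas crd_ops = zero_crd_def one_crd_def plus_crd_def uminus_crd_def minus_crd_def times_crd_def

definition emb :: "'a::comm_ring_1 poly \<Rightarrow> 'a crd" where
  "emb p = Crd p 0"

lemma emb_simps:
  "emb (p + q) = emb p + emb q" "emb (p - q) = emb p - emb q" "emb (p * q) = emb p * emb q"
  "emb 1 = 1" "emb 0 = 0"
  by (simp_all add: emb_def crd_ops)

definition ev :: "'a::comm_ring_1 \<Rightarrow> 'a \<Rightarrow> 'a crd \<Rightarrow> 'a" where
  "ev a b u = poly (cpart u) a + poly (ypart u) a * b"

definition conj_crd :: "'a::comm_ring_1 crd \<Rightarrow> 'a crd" where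
  "conj_crd u = Crd (cpart u) (- ypart u)"

definition norm_crd :: "'a::comm_ring_1 crd \<Rightarrow> 'a poly" where
  "norm_crd u = (cpart u)\<^sup>2 - (ypart u)\<^sup>2 * cubic"

lemma mult_conj_crd: "u * conj_crd u = emb (norm_crd u)"
  by (simp add: crd_ops conj_crd_def emb_def norm_crd_def power2_eq_square)

lemma conj_crd_mult: "conj_crd (u * v) = conj_crd u * conj_crd v"
  by (simp add: crd_ops conj_crd_def)

lemma conj_crd_add: "conj_crd (u + v) = conj_crd u + conj_crd v"
  by (simp add: crd_ops conj_crd_def)

lemma conj_crd_conj [simp]: "conj_crd (conj_crd u) = u"
  by (simp add: conj_crd_def)

text \<open>The curve equation is what makes evaluation at a point respect the rule that y times y
  is \<open>cubic\<close>.\<close>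

lemma ev_mult:
  assumes "b\<^sup>2 = a ^ 3 + a"
  shows "ev a b (u * v) = ev a b u * ev a b v"
proof -
  have "b * b = a ^ 3 + a" using assms by (simp add: power2_eq_square)
  then have "poly (ypart u) a * poly (ypart v) a * (a ^ 3 + a) = poly (ypart u) a * poly (ypart v) a * (b * b)"
    by simp
  then show ?thesis
    by (simp add: ev_def crd_ops poly_cubic algebra_simps)
qed

lemma ev_add: "ev a b (u + v) = ev a b u + ev a b v"
  by (simp add: ev_def crd_ops algebra_simps)

lemma degree_cubic: "degree (cubic :: 'a::comm_ring_1 poly) = 3"
  by (simp add: cubic_def)

lemma cubic_neq_0 [simp]: "(cubic :: 'a::comm_ring_1 poly) \<noteq> 0"
  by (simp add: cubic_def)

text \<open>The two summands of the norm have degrees of different parity, so nothing cancels.\<close>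

lemma degree_norm_crd:
  fixes u :: "'a::field crd"
  assumes "ypart u \<noteq> 0"
  shows "degree (norm_crd u) \<ge> 3"
proof -
  have dB: "degree ((ypart u)\<^sup>2 * cubic) = 2 * degree (ypart u) + 3"
    using assms by (simp add: degree_mult_eq degree_power_eq degree_cubic)
  have dA: "degree ((cpart u)\<^sup>2) = 2 * degree (cpart u)"
    by (cases "cpart u = 0") (simp_all add: degree_power_eq)
  have "2 * degree (cpart u) \<noteq> 2 * degree (ypart u) + 3" by presburger
  then consider "degree ((cpart u)\<^sup>2) < degree ((ypart u)\<^sup>2 * cubic)"
    | "degree ((cpart u)\<^sup>2) > degree ((ypart u)\<^sup>2 * cubic)"
    using dA dB by linarith
  then show ?thesis
  proof cases
    case 1
    then have "degree (norm_crd u) = degree ((ypart u)\<^sup>2 * cubic)"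
      unfolding norm_crd_def
      by (metis degree_add_eq_right degree_minus diff_conv_add_uminus)
    then show ?thesis using dB by simp
  next
    case 2
    then have "degree (norm_crd u) = degree ((cpart u)\<^sup>2)"
      unfolding norm_crd_def
      by (metis degree_add_eq_left degree_minus diff_conv_add_uminus)
    then show ?thesis using dB 2 by simp
  qed
qed

text \<open>A nonzero y-part forces degree at least three, and without a y-part the norm is a
  square. Through this fact and multiplicativity the coordinate ring inherits from k[x] that it has
  no zero divisors.\<close>

lemma norm_crd_eq_0_iff:
  fixes u :: "'a::field crd"
  shows "norm_crd u = 0 \<longleftrightarrow> u = 0"
proof
  assume n: "norm_crd u = 0"
  then have "ypart u = 0" using degree_norm_crd[of u] by fastforce
  with n show "u = 0" by (cases u) (simp add: norm_crd_def zero_crd_def)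
qed (simp add: norm_crd_def zero_crd_def)

lemma norm_crd_mult: "norm_crd (u * v) = norm_crd u * norm_crd v"
  by (simp add: norm_crd_def crd_ops power2_eq_square algebra_simps)

instance crd :: (field) idom
proof
  fix u v :: "'a crd" assume "u \<noteq> 0" "v \<noteq> 0"
  then have "norm_crd (u * v) \<noteq> 0" by (simp add: norm_crd_mult norm_crd_eq_0_iff)
  then show "u * v \<noteq> 0" by (simp add: norm_crd_eq_0_iff)
qed

lemma scaled_cancel:
  fixes c :: "'a::idom"
  assumes "c \<noteq> 0" "scaled c I = scaled c J"
  shows "I = J"
proof -
  have "inj ((*) c)" using assms(1) by (auto intro: injI)
  then show ?thesis using assms(2) by (simp add: scaled_def inj_image_eq_iff)
qed

section \<open>The ideal of a point\<close>

abbreviation E0 :: "'a::field weierstrass" where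
  "E0 \<equiv> Weierstrass 0 0 0 1 0"

fun point_ideal :: "'a::field point \<Rightarrow> 'a crd set" where
  "point_ideal Infinity = UNIV"
| "point_ideal (Affine a b) = {u. ev a b u = 0}"

fun neg_point :: "'a::field point \<Rightarrow> 'a point" where
  "neg_point Infinity = Infinity"
| "neg_point (Affine a b) = Affine a (- b)"

lemma on_curve_E0: "on_curve E0 (Affine a b) \<longleftrightarrow> b\<^sup>2 = a ^ 3 + a"
  by simp

lemma on_curve_neg: "on_curve E0 P \<Longrightarrow> on_curve E0 (neg_point P)"
  by (cases P) simp_all

lemma is_ideal_point:
  assumes "on_curve E0 P"
  shows "is_ideal (point_ideal P)"
proof (cases P)
  case (Affine a b)
  then have "b\<^sup>2 = a ^ 3 + a" using assms by simp
  then show ?thesis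
    by (auto simp: Affine is_ideal_def ev_add ev_mult) (simp add: ev_def zero_crd_def)
qed (simp add: is_ideal_UNIV)

abbreviation xm :: "'a::field \<Rightarrow> 'a crd" where
  "xm a \<equiv> emb [:- a, 1:]"

lemma in_scaled_xm_iff:
  "u \<in> scaled (xm a) UNIV \<longleftrightarrow> poly (cpart u) a = 0 \<and> poly (ypart u) a = 0"
proof
  assume "u \<in> scaled (xm a) UNIV"
  then show "poly (cpart u) a = 0 \<and> poly (ypart u) a = 0"
    by (auto simp: scaled_def emb_def crd_ops)
next
  assume *: "poly (cpart u) a = 0 \<and> poly (ypart u) a = 0"
  obtain A where A: "cpart u = [:- a, 1:] * A" using * by (metis poly_eq_0_iff_dvd dvdE)
  obtain B where B: "ypart u = [:- a, 1:] * B" using * by (metis poly_eq_0_iff_dvd dvdE)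
  have "u = xm a * Crd A B" using A B by (cases u) (simp add: emb_def crd_ops)
  then show "u \<in> scaled (xm a) UNIV" unfolding scaled_def by blast
qed

lemma ideal_mult_right: "is_ideal I \<Longrightarrow> x \<in> I \<Longrightarrow> x * r \<in> I"
  unfolding is_ideal_def by (metis mult.commute)

text \<open>This is the vertical line through a point and its negative. One inclusion is evaluation;
  the other, also for a point of order two, rests on nonsingularity of the curve.\<close>

lemma point_ideal_neg:
  fixes a b :: "'a::field_char_0"
  assumes "b\<^sup>2 = a ^ 3 + a"
  shows "ideal_times (point_ideal (Affine a b)) (point_ideal (Affine a (- b))) = scaled (xm a) UNIV"
    (is "?J = _")
proof
  have id: "is_ideal ?J"
    using assms by (intro is_ideal_times is_ideal_point) simp
  show "?J \<subseteq> scaled (xm a) UNIV"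
  proof (rule ideal_times_subset[OF is_ideal_scaled[OF is_ideal_UNIV]])
    fix u v assume "u \<in> point_ideal (Affine a b)" "v \<in> point_ideal (Affine a (- b))"
    then have u: "poly (cpart u) a = - poly (ypart u) a * b" and v: "poly (cpart v) a = poly (ypart v) a * b"
      by (simp_all add: ev_def eq_neg_iff_add_eq_0)
    have "poly (cubic) a = b * b" using assms by (simp add: poly_cubic power2_eq_square)
    then show "u * v \<in> scaled (xm a) UNIV"
      unfolding in_scaled_xm_iff by (simp add: crd_ops u v algebra_simps)
  qed
  define X0 where "X0 = xm a"
  have X1: "X0 \<in> point_ideal (Affine a b)" and X2: "X0 \<in> point_ideal (Affine a (- b))"
    by (simp_all add: X0_def emb_def ev_def)
  have y1: "Crd [:- b:] 1 \<in> point_ideal (Affine a b)" and y2: "Crd [:b:] 1 \<in> point_ideal (Affine a (- b))"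
    by (simp_all add: ev_def)
  have 1: "X0 * X0 \<in> ?J" using X1 X2 by (rule ideal_times_mem)
  have "X0 * Crd [:b:] 1 - Crd [:- b:] 1 * X0 \<in> ?J"
    using X1 X2 y1 y2 by (intro is_ideal_diff[OF id] ideal_times_mem)
  also have "X0 * Crd [:b:] 1 - Crd [:- b:] 1 * X0 = X0 * emb [:2 * b:]"
    by (simp add: X0_def emb_def crd_ops)
  finally have 2: "X0 * emb [:2 * b:] \<in> ?J" .
  have "Crd [:- b:] 1 * Crd [:b:] 1 - X0 * X0 * emb [:2 * a, 1:] \<in> ?J"
    using is_ideal_diff[OF id ideal_times_mem[OF y1 y2] ideal_mult_right[OF id 1]] .
  also have "Crd [:- b:] 1 * Crd [:b:] 1 - X0 * X0 * emb [:2 * a, 1:] = X0 * emb [:3 * a\<^sup>2 + 1:]"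
    using assms by (simp add: X0_def emb_def crd_ops cubic_def power2_eq_square power3_eq_cube algebra_simps)
  finally have 3: "X0 * emb [:3 * a\<^sup>2 + 1:] \<in> ?J" .
  \<comment> \<open>The multipliers come from \<open>(3 * a ^ 2 + 1) * (1 + 3 * a ^ 2 / 2) - 9 * a /
    2 * (a ^ 3 + a) = 1\<close>: the two partial derivatives of the curve equation generate the unit
    ideal at a point of the curve.\<close>
  have "X0 * emb [:3 * a\<^sup>2 + 1:] * emb [:1 + 3 * a\<^sup>2 / 2:] - X0 * emb [:2 * b:] * emb [:9 * a * b / 4:] \<in> ?J"
    using is_ideal_diff[OF id ideal_mult_right[OF id 3] ideal_mult_right[OF id 2]] .
  also have "X0 * emb [:3 * a\<^sup>2 + 1:] * emb [:1 + 3 * a\<^sup>2 / 2:] - X0 * emb [:2 * b:] * emb [:9 * a * b / 4:]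
     = X0 * emb ([:3 * a\<^sup>2 + 1:] * [:1 + 3 * a\<^sup>2 / 2:] - [:2 * b:] * [:9 * a * b / 4:])"
    by (simp only: emb_simps right_diff_distrib mult.assoc)
  also have "[:3 * a\<^sup>2 + 1:] * [:1 + 3 * a\<^sup>2 / 2:] - [:2 * b:] * [:9 * a * b / 4:] = 1"
  proof -
    have "(3 * a\<^sup>2 + 1) * (1 + 3 * a\<^sup>2 / 2) - (2 * b) * (9 * a * b / 4)
      = (3 * a\<^sup>2 + 1) * (1 + 3 * a\<^sup>2 / 2) - 9 * a / 2 * b\<^sup>2"
      by (simp add: power2_eq_square)
    also have "\<dots> = 1"
      unfolding assms by (simp add: divide_simps) (simp add: algebra_simps power2_eq_square power3_eq_cube)
    finally show ?thesis by (simp add: one_pCons mult.commute)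
  qed
  finally have "X0 \<in> ?J" by (simp add: emb_simps)
  then show "scaled (xm a) UNIV \<subseteq> ?J"
    unfolding X0_def[symmetric] scaled_def using ideal_mult_right[OF id] by auto
qed

text \<open>The ideal of a point on the line y = l x + n is generated by x - a and y - l x - n:
  modulo the line, an element becomes a polynomial in x that vanishes at a.\<close>

lemma point_ideal_decomp:
  assumes "u \<in> point_ideal (Affine a (l * a + n))"
  obtains p q where "u = xm a * emb p + Crd (- [:n, l:]) 1 * q"
proof -
  have "poly (cpart u + ypart u * [:n, l:]) a = 0"
    using assms by (simp add: ev_def algebra_simps)
  then obtain p where p: "cpart u + ypart u * [:n, l:] = [:- a, 1:] * p"
    by (metis poly_eq_0_iff_dvd dvdE)
  have "u = emb (cpart u + ypart u * [:n, l:]) + Crd (- [:n, l:]) 1 * emb (ypart u)"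
    by (cases u) (simp add: emb_def crd_ops)
  then show ?thesis using p that by (metis emb_simps(3))
qed

text \<open>Three collinear points have trivial product of classes. The hypothesis is a
  factorisation with possibly equal roots, so chords, tangents and inflection points are all
  covered.\<close>

lemma point_ideal_line:
  fixes a1 a2 a3 l n :: "'a::field_char_0"
  assumes fac: "cubic - [:n, l:]\<^sup>2 = [:- a1, 1:] * [:- a2, 1:] * [:- a3, 1:]"
  defines "I \<equiv> \<lambda>a. point_ideal (Affine a (l * a + n))"
  shows "ideal_times (ideal_times (I a1) (I a2)) (I a3) = scaled (Crd (- [:n, l:]) 1) UNIV"
    (is "?J = _")
proof
  define h where "h = Crd (- [:n, l:]) 1"
  define h' where "h' = Crd [:n, l:] 1"
  have on: "on_curve E0 (Affine a (l * a + n))" if "a \<in> {a1, a2, a3}" for a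
  proof -
    have "poly (cubic - [:n, l:]\<^sup>2) a = 0" using that unfolding fac poly_mult by auto
    then show ?thesis by (simp add: poly_cubic algebra_simps)
  qed
  have idI: "is_ideal (I a)" if "a \<in> {a1, a2, a3}" for a
    unfolding I_def by (rule is_ideal_point[OF on[OF that]])
  have id: "is_ideal ?J" by (intro is_ideal_times idI) simp
  have xxx: "xm a1 * xm a2 * xm a3 = h * h'"
  proof -
    have "h * h' = emb (cubic - [:n, l:]\<^sup>2)"
      by (simp add: h_def h'_def emb_def crd_ops power2_eq_square)
    then show ?thesis by (simp only: fac emb_simps)
  qed
  have "ideal_times (I a1) (ideal_times (I a2) (I a3)) \<subseteq> scaled h UNIV"
  proof (rule ideal_times_subset[OF is_ideal_scaled[OF is_ideal_UNIV]])
    fix u w assume u: "u \<in> I a1" and w: "w \<in> ideal_times (I a2) (I a3)"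
    obtain p1 q1 where u': "u = xm a1 * emb p1 + h * q1"
      using point_ideal_decomp u unfolding I_def h_def by blast
    have "is_ideal {w. u * w \<in> scaled h UNIV}"
      using is_ideal_scaled[OF is_ideal_UNIV, of h] unfolding is_ideal_def
      by (auto simp: distrib_left) (metis mult.left_commute)
    then have "ideal_times (I a2) (I a3) \<subseteq> {w. u * w \<in> scaled h UNIV}"
    proof (rule ideal_times_subset)
      fix v z assume v: "v \<in> I a2" and z: "z \<in> I a3"
      obtain p2 q2 where v': "v = xm a2 * emb p2 + h * q2"
        using point_ideal_decomp v unfolding I_def h_def by blast
      obtain p3 q3 where z': "z = xm a3 * emb p3 + h * q3"
        using point_ideal_decomp z unfolding I_def h_def by blast
      \<comment> \<open>After expansion only the product of the three terms in x - a1, x - a2, x -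
        a3 lacks a visible factor \<open>h\<close>; \<open>xxx\<close> supplies it.\<close>
      have "u * (v * z) = (xm a1 * xm a2 * xm a3) * (emb p1 * emb p2 * emb p3)
        + h * (q1 * (v * z) + xm a1 * emb p1 * (q2 * z + xm a2 * emb p2 * q3))"
        unfolding u' v' z' by (simp add: algebra_simps)
      also have "\<dots> = h * (h' * (emb p1 * emb p2 * emb p3) + (q1 * (v * z) + xm a1 * emb p1 * (q2 * z + xm a2 * emb p2 * q3)))"
        unfolding xxx by (simp add: algebra_simps)
      finally show "v * z \<in> {w. u * w \<in> scaled h UNIV}" by (auto simp: scaled_def)
    qed
    then show "u * w \<in> scaled h UNIV" using w by auto
  qed
  then show "?J \<subseteq> scaled (Crd (- [:n, l:]) 1) UNIV"
    by (simp add: ideal_times_assoc idI h_def)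
  \<comment> \<open>\<open>K\<close> is the quotient of \<open>?J\<close> by \<open>h\<close>; the
    missing inclusion amounts to \<open>1 \<in> K\<close>.\<close>
  define K where "K = {u. h * u \<in> ?J}"
  have idK: "is_ideal K"
    using id unfolding K_def is_ideal_def by (auto simp: distrib_left) (metis mult.left_commute)
  have Ka: "u + v \<in> K" and Kd: "u - v \<in> K" if "u \<in> K" "v \<in> K" for u v
    using that idK is_ideal_diff[OF idK] by (auto simp: is_ideal_def)
  have Km: "r * u \<in> K" if "u \<in> K" for u r
    using that idK by (auto simp: is_ideal_def)
  have h: "h \<in> I a" and x: "xm a \<in> I a" for a
    by (simp_all add: h_def I_def ev_def emb_def)
  have mem: "u * v * w \<in> ?J" if "u \<in> I a1" "v \<in> I a2" "w \<in> I a3" for u v w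
    using that by (intro ideal_times_mem)
  have "h * (xm a2 * xm a3) \<in> ?J" using mem[OF h x x] by (simp add: mult_ac)
  moreover have "h * (xm a1 * xm a3) \<in> ?J" using mem[OF x h x] by (simp add: mult_ac)
  moreover have "h * (xm a1 * xm a2) \<in> ?J" using mem[OF x x h] by (simp add: mult_ac)
  ultimately have s: "xm a2 * xm a3 + xm a1 * xm a3 + xm a1 * xm a2 \<in> K"
    unfolding K_def using id by (auto simp: is_ideal_def distrib_left)
  \<comment> \<open>The sum of pairwise products in \<open>s\<close> is the derivative of the
    product of the three linear factors, whether or not they are distinct.\<close>
  have "pderiv (cubic - [:n, l:]\<^sup>2) = [:- a2, 1:] * [:- a3, 1:] + [:- a1, 1:] * [:- a3, 1:] + [:- a1, 1:] * [:- a2, 1:]"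
    unfolding fac by (simp add: pderiv_mult pderiv_pCons algebra_simps)
  then have d1: "emb (pderiv (cubic - [:n, l:]\<^sup>2)) \<in> K" using s by (simp only: emb_simps)
  have dq: "pderiv (cubic - [:n, l:]\<^sup>2) = [:1, 0, 3:] - smult (2 * l) [:n, l:]"
    by (simp add: cubic_def pderiv_diff pderiv_mult pderiv_pCons power2_eq_square)
  have hh: "h * h \<in> K" using mem[OF h h h] by (simp add: K_def mult_ac)
  have "h * h' \<in> ?J" using mem[OF x x x] by (simp add: xxx)
  then have h': "h' \<in> K" by (simp add: K_def)
  \<comment> \<open>With L = l x + n, \<open>h\<close> is y - L and \<open>h'\<close> is y + L; then
    (y - L)^2 - (y - 3 L)(y + L) = 4 L^2.\<close>
  have "emb [:1/4:] * (h * h - (h - emb (smult 2 [:n, l:])) * h') \<in> K"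
    by (intro Km Kd hh h')
  also have "emb [:1/4:] * (h * h - (h - emb (smult 2 [:n, l:])) * h') = emb ([:n, l:]\<^sup>2)"
    by (simp add: h_def h'_def emb_def crd_ops power2_eq_square)
  finally have L: "emb ([:n, l:]\<^sup>2) \<in> K" .
  have "h * h' + emb ([:n, l:]\<^sup>2) \<in> K" by (intro Ka Km h' L)
  also have "h * h' + emb ([:n, l:]\<^sup>2) = emb cubic"
    by (simp add: h_def h'_def emb_def crd_ops power2_eq_square)
  finally have c: "emb cubic \<in> K" .
  \<comment> \<open>The derivative is 3 x^2 + 1 - 2 l L. Multiplying by 3 x^2 + 1 + 2 l L and adding
    4 l^2 L^2 leaves a square that no longer involves the line.\<close>
  have "emb ([:1, 0, 3:] + smult (2 * l) [:n, l:]) * emb ([:1, 0, 3:] - smult (2 * l) [:n, l:])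
      + emb [:4 * l\<^sup>2:] * emb ([:n, l:]\<^sup>2) \<in> K"
    using d1 unfolding dq by (intro Ka Km L)
  also have "emb ([:1, 0, 3:] + smult (2 * l) [:n, l:]) * emb ([:1, 0, 3:] - smult (2 * l) [:n, l:])
      + emb [:4 * l\<^sup>2:] * emb ([:n, l:]\<^sup>2) = emb ([:1, 0, 3:]\<^sup>2)"
    by (simp add: emb_def crd_ops power2_eq_square algebra_simps)
  finally have d2: "emb ([:1, 0, 3:]\<^sup>2) \<in> K" .
  \<comment> \<open>Bezout coefficients for x^3 + x and its derivative, which are coprime because
    the cubic has no double root. Squaring the identity gives 1 from \<open>c\<close> and
    \<open>d2\<close>.\<close>
  define v where "v = ([:1, 0, 3 / 2:] :: 'a poly)"
  define w where "w = ([:0, - 9 / 2:] :: 'a poly)"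
  have bez: "v * [:1, 0, 3:] + w * cubic = 1"
    by (simp add: v_def w_def cubic_def one_pCons)
  have "emb (v\<^sup>2) * emb ([:1, 0, 3:]\<^sup>2) + emb (2 * v * [:1, 0, 3:] * w + w\<^sup>2 * cubic) * emb cubic \<in> K"
    by (intro Ka Km d2 c)
  also have "emb (v\<^sup>2) * emb ([:1, 0, 3:]\<^sup>2) + emb (2 * v * [:1, 0, 3:] * w + w\<^sup>2 * cubic) * emb cubic
     = emb ((v * [:1, 0, 3:] + w * cubic)\<^sup>2)"
    unfolding emb_simps(1,3)[symmetric] by (simp only: power2_eq_square algebra_simps mult_2)
  finally have "1 \<in> K" unfolding bez by (simp add: emb_simps)
  then have "h \<in> ?J" by (simp add: K_def)
  then show "scaled (Crd (- [:n, l:]) 1) UNIV \<subseteq> ?J"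
    unfolding h_def[symmetric] scaled_def using ideal_mult_right[OF id] by auto
qed

lemma cubic_minus_line: "cubic - [:n, l:]\<^sup>2 = [:- (n\<^sup>2), 1 - 2 * l * n, - (l\<^sup>2), 1 :: 'a::comm_ring_1:]"
  by (simp add: cubic_def power2_eq_square algebra_simps)

lemma linear_factors_cubic:
  "[:- a, 1:] * [:- b, 1:] * [:- c, 1:] = [:- (a * b * c), a * b + a * c + b * c, - (a + b + c), 1 :: 'a::comm_ring_1:]"
  by (simp add: algebra_simps)

lemma cubic_minus_line_chord:
  fixes x1 x2 :: "'a::field"
  assumes "y1\<^sup>2 = x1 ^ 3 + x1" "y2\<^sup>2 = x2 ^ 3 + x2" "x1 \<noteq> x2" "y1 = l * x1 + n" "y2 = l * x2 + n"
  shows "cubic - [:n, l:]\<^sup>2 = [:- x1, 1:] * [:- x2, 1:] * [:- (l\<^sup>2 - x1 - x2), 1:]"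
proof -
  define x3 where "x3 = l\<^sup>2 - x1 - x2"
  \<comment> \<open>\<open>g0 + g1 * x\<close> is the difference of the two cubics, whose quadratic
    coefficients agree by the choice of \<open>x3\<close>; it vanishes at the two distinct
    abscissas.\<close>
  define g1 where "g1 = 1 - 2 * l * n - (x1 * x2 + x1 * x3 + x2 * x3)"
  define g0 where "g0 = x1 * x2 * x3 - n\<^sup>2"
  have 1: "g0 + g1 * x1 = 0"
    using assms(1) unfolding g0_def g1_def x3_def assms(4)
    by (simp add: algebra_simps power2_eq_square power3_eq_cube)
  have 2: "g0 + g1 * x2 = 0"
    using assms(2) unfolding g0_def g1_def x3_def assms(5)
    by (simp add: algebra_simps power2_eq_square power3_eq_cube)
  have "g1 * (x1 - x2) = (g0 + g1 * x1) - (g0 + g1 * x2)" by (simp add: right_diff_distrib)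
  then have g1: "g1 = 0" using assms(3) 1 2 by simp
  have "n\<^sup>2 = x1 * x2 * x3" using 1 g1 by (simp add: g0_def)
  moreover have "1 - 2 * l * n = x1 * x2 + x1 * x3 + x2 * x3" using g1 by (simp add: g1_def)
  moreover have "l\<^sup>2 = x1 + x2 + x3" by (simp add: x3_def)
  ultimately show ?thesis
    unfolding cubic_minus_line linear_factors_cubic x3_def[symmetric] by metis
qed

lemma cubic_minus_line_tangent:
  fixes x1 :: "'a::field"
  assumes "y1\<^sup>2 = x1 ^ 3 + x1" "y1 = l * x1 + n" "l * (2 * y1) = 3 * x1\<^sup>2 + 1"
  shows "cubic - [:n, l:]\<^sup>2 = [:- x1, 1:] * [:- x1, 1:] * [:- (l\<^sup>2 - x1 - x1), 1:]"
proof -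
  define x3 where "x3 = l\<^sup>2 - x1 - x1"
  define g1 where "g1 = 1 - 2 * l * n - (x1 * x1 + x1 * x3 + x1 * x3)"
  define g0 where "g0 = x1 * x1 * x3 - n\<^sup>2"
  \<comment> \<open>Here \<open>x1\<close> is a double root: the derivative of the difference at
    \<open>x1\<close> is \<open>g1\<close>, and the tangent slope says that it vanishes.\<close>
  have "l * (2 * (l * x1 + n)) = 3 * x1\<^sup>2 + 1" using assms(2,3) by simp
  then have g1: "g1 = 0" unfolding g1_def x3_def by (simp add: algebra_simps power2_eq_square)
  have 1: "g0 + g1 * x1 = 0"
    using assms(1) unfolding g0_def g1_def x3_def assms(2)
    by (simp add: algebra_simps power2_eq_square power3_eq_cube)
  have "n\<^sup>2 = x1 * x1 * x3" using 1 g1 by (simp add: g0_def)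
  moreover have "1 - 2 * l * n = x1 * x1 + x1 * x3 + x1 * x3" using g1 by (simp add: g1_def)
  moreover have "l\<^sup>2 = x1 + x1 + x3" by (simp add: x3_def)
  ultimately show ?thesis
    unfolding cubic_minus_line linear_factors_cubic x3_def[symmetric] by metis
qed
text \<open>Chord and tangent are brought into one form: a line, its three intersections counted
  with multiplicity, and the sum as the reflection of the third one.\<close>

lemma point_add_line:
  fixes x1 :: "'a::field_char_0"
  assumes "y1\<^sup>2 = x1 ^ 3 + x1" "y2\<^sup>2 = x2 ^ 3 + x2" "\<not> (x1 = x2 \<and> y1 + y2 = 0)"
  obtains l n x3 where
    "cubic - [:n, l:]\<^sup>2 = [:- x1, 1:] * [:- x2, 1:] * [:- x3, 1:]"
    "y1 = l * x1 + n" "y2 = l * x2 + n"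
    "point_add E0 (Affine x1 y1) (Affine x2 y2) = Affine x3 (- (l * x3 + n))"
proof (cases "x1 = x2")
  case True
  have "(y1 - y2) * (y1 + y2) = 0" using assms(1,2) True by (simp add: algebra_simps power2_eq_square)
  then have y: "y1 = y2" using assms(3) True by auto
  then have y0: "y1 \<noteq> 0" using assms(3) True by auto
  define l where "l = (3 * x1\<^sup>2 + 1) / (2 * y1)"
  have l: "l * (2 * y1) = 3 * x1\<^sup>2 + 1" using y0 by (simp add: l_def)
  show ?thesis
  proof (rule that[of "y1 - l * x1" l "l\<^sup>2 - x1 - x1"])
    show "cubic - [:y1 - l * x1, l:]\<^sup>2 = [:- x1, 1:] * [:- x2, 1:] * [:- (l\<^sup>2 - x1 - x1), 1:]"
      unfolding True[symmetric] by (rule cubic_minus_line_tangent[OF assms(1) _ l]) simp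
    show "point_add E0 (Affine x1 y1) (Affine x2 y2)
      = Affine (l\<^sup>2 - x1 - x1) (- (l * (l\<^sup>2 - x1 - x1) + (y1 - l * x1)))"
      using y0 by (simp add: Let_def l_def[symmetric] True[symmetric] y[symmetric])
  qed (simp_all add: True[symmetric] y[symmetric])
next
  case False
  define l where "l = (y2 - y1) / (x2 - x1)"
  have l: "l * (x2 - x1) = y2 - y1" using False by (simp add: l_def)
  show ?thesis
  proof (rule that[of "y1 - l * x1" l "l\<^sup>2 - x1 - x2"])
    show "cubic - [:y1 - l * x1, l:]\<^sup>2 = [:- x1, 1:] * [:- x2, 1:] * [:- (l\<^sup>2 - x1 - x2), 1:]"
      using l by (intro cubic_minus_line_chord[OF assms(1,2) False]) (simp_all add: algebra_simps)
    show "y2 = l * x2 + (y1 - l * x1)" using l by (simp add: algebra_simps)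
    show "point_add E0 (Affine x1 y1) (Affine x2 y2)
      = Affine (l\<^sup>2 - x1 - x2) (- (l * (l\<^sup>2 - x1 - x2) + (y1 - l * x1)))"
      using False by (simp add: Let_def l_def[symmetric])
  qed simp
qed

lemma line_point_on_curve:
  fixes l :: "'a::field_char_0"
  assumes "cubic - [:n, l:]\<^sup>2 = [:- x1, 1:] * [:- x2, 1:] * [:- x3, 1:]"
  shows "(l * x3 + n)\<^sup>2 = x3 ^ 3 + x3"
proof -
  have "poly (cubic - [:n, l:]\<^sup>2) x3 = 0" unfolding assms poly_mult by auto
  then show ?thesis by (simp add: poly_cubic algebra_simps)
qed

lemma on_curve_point_add:
  fixes P Q :: "'a::field_char_0 point"
  assumes "on_curve E0 P" "on_curve E0 Q"
  shows "on_curve E0 (point_add E0 P Q)"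
proof (cases P; cases Q)
  fix x1 y1 x2 y2 assume PQ: "P = Affine x1 y1" "Q = Affine x2 y2"
  show ?thesis
  proof (cases "x1 = x2 \<and> y1 + y2 = 0")
    case True then show ?thesis by (simp add: PQ)
  next
    case False
    obtain l n x3 where fac: "cubic - [:n, l:]\<^sup>2 = [:- x1, 1:] * [:- x2, 1:] * [:- x3, 1:]"
      and "point_add E0 P Q = Affine x3 (- (l * x3 + n))"
      using point_add_line[OF _ _ False] assms unfolding PQ on_curve_E0 by blast
    with line_point_on_curve[OF fac] show ?thesis by (simp only: on_curve_E0 power2_minus)
  qed
qed (use assms in simp_all)

lemma point_ideal_neg':
  fixes P :: "'a::field_char_0 point"
  assumes "on_curve E0 P"
  obtains p where "p \<noteq> 0" "ideal_times (point_ideal P) (point_ideal (neg_point P)) = scaled (emb p) UNIV"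
proof (cases P)
  case Infinity
  show ?thesis
    by (rule that[of 1]) (simp_all add: Infinity ideal_times_UNIV is_ideal_UNIV scaled_def emb_simps)
next
  case (Affine a b)
  show ?thesis
    by (rule that[of "[:- a, 1:]"]) (use point_ideal_neg[of b a] assms in \<open>simp_all add: Affine\<close>)
qed

lemma emb_neq_0: "p \<noteq> 0 \<Longrightarrow> emb p \<noteq> 0"
  by (simp add: emb_def zero_crd_def)

text \<open>In the ideal class group the class of \<open>P + Q\<close> is the product of the classes of \<open>P\<close> and \<open>Q\<close>.\<close>

lemma point_ideal_add:
  fixes P Q :: "'a::field_char_0 point"
  assumes P: "on_curve E0 P" and Q: "on_curve E0 Q"
  obtains u v where "u \<noteq> 0" "v \<noteq> 0"
    "scaled u (ideal_times (point_ideal P) (point_ideal Q)) = scaled v (point_ideal (point_add E0 P Q))"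
proof (cases "P = Infinity \<or> Q = Infinity")
  case True
  then have "ideal_times (point_ideal P) (point_ideal Q) = point_ideal (point_add E0 P Q)"
    using is_ideal_point[OF P] is_ideal_point[OF Q]
    by (cases P; cases Q) (simp_all add: ideal_times_UNIV ideal_times_UNIV_right is_ideal_UNIV)
  then show ?thesis by (intro that[of 1 1]) simp_all
next
  case False
  then obtain x1 y1 x2 y2 where PQ: "P = Affine x1 y1" "Q = Affine x2 y2"
    by (metis point.exhaust)
  show ?thesis
  proof (cases "x1 = x2 \<and> y1 + y2 = 0")
    case True
    then have "Q = neg_point P" and S: "point_add E0 P Q = Infinity"
      using PQ by (simp_all add: eq_neg_iff_add_eq_0 add.commute)
    with point_ideal_neg'[OF P] obtain p where
      "p \<noteq> 0" "ideal_times (point_ideal P) (point_ideal Q) = scaled (emb p) UNIV" by metis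
    then show ?thesis by (intro that[of 1 "emb p"]) (simp_all add: S emb_neq_0, simp add: scaled_def)
  next
    case ne: False
    obtain l n x3 where fac: "cubic - [:n, l:]\<^sup>2 = [:- x1, 1:] * [:- x2, 1:] * [:- x3, 1:]"
      and y: "y1 = l * x1 + n" "y2 = l * x2 + n"
      and S: "point_add E0 P Q = Affine x3 (- (l * x3 + n))"
      using point_add_line[OF _ _ ne] P Q unfolding PQ on_curve_E0 by blast
    define h where "h = Crd (- [:n, l:]) 1"
    define T where "T = Affine x3 (l * x3 + n)"
    have T: "on_curve E0 T" "point_add E0 P Q = neg_point T"
      unfolding T_def on_curve_E0 using line_point_on_curve[OF fac] S by simp_all
    have line: "ideal_times (ideal_times (point_ideal P) (point_ideal Q)) (point_ideal T) = scaled h UNIV"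
      using point_ideal_line[OF fac] by (simp add: PQ y T_def h_def)
    obtain p where p: "p \<noteq> 0"
      "ideal_times (point_ideal T) (point_ideal (neg_point T)) = scaled (emb p) UNIV"
      using point_ideal_neg'[OF T(1)] .
    note ids = is_ideal_point[OF P] is_ideal_point[OF Q] is_ideal_point[OF T(1)]
      is_ideal_point[OF on_curve_neg[OF T(1)]]
    \<comment> \<open>Multiplying the line relation by the ideal of -T makes the factor for T
      principal and leaves the ideal of P + Q on the other side.\<close>
    have "scaled (emb p) (ideal_times (point_ideal P) (point_ideal Q))
      = ideal_times (ideal_times (point_ideal P) (point_ideal Q)) (scaled (emb p) UNIV)"
      by (simp add: ideal_times_scaled ideal_times_UNIV_right is_ideal_times ids)
    also have "\<dots> = ideal_times (scaled h UNIV) (point_ideal (neg_point T))"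
      unfolding p(2)[symmetric] line[symmetric]
      by (rule ideal_times_assoc[symmetric]) (simp_all add: is_ideal_times ids)
    also have "\<dots> = scaled h (point_ideal (neg_point T))"
      by (simp add: scaled_ideal_times ideal_times_UNIV ids)
    finally have eq: "scaled (emb p) (ideal_times (point_ideal P) (point_ideal Q))
      = scaled h (point_ideal (point_add E0 P Q))" unfolding T(2) .
    have "h \<noteq> 0" by (simp add: h_def zero_crd_def)
    from that[OF emb_neq_0[OF p(1)] this eq] show ?thesis .
  qed
qed

lemma conj_scaled: "conj_crd ` scaled u I = scaled (conj_crd u) (conj_crd ` I)"
  unfolding scaled_def image_image by (simp add: conj_crd_mult)

lemma conj_ideal_times: "conj_crd ` ideal_times I J = ideal_times (conj_crd ` I) (conj_crd ` J)"
proof -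
  have 1: "conj_crd ` ideal_times I J \<subseteq> ideal_times (conj_crd ` I) (conj_crd ` J)" for I J :: "'a crd set"
  proof
    fix x assume "x \<in> conj_crd ` ideal_times I J"
    then obtain y where "x = conj_crd y" and y: "y \<in> ideal_times I J" by blast
    from y have "conj_crd y \<in> ideal_times (conj_crd ` I) (conj_crd ` J)"
    proof induction
      case zero
      have "conj_crd 0 = (0 :: 'a crd)" by (simp add: conj_crd_def crd_ops)
      then show ?case by (simp add: ideal_times.zero)
    next
      case (step a b z)
      then show ?case
        by (simp add: conj_crd_add conj_crd_mult ideal_times.step)
    qed
    then show "x \<in> ideal_times (conj_crd ` I) (conj_crd ` J)" using \<open>x = conj_crd y\<close> by simp
  qed
  have "conj_crd ` conj_crd ` K = K" for K :: "'a crd set"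
    by (simp add: image_image)
  then have "ideal_times (conj_crd ` I) (conj_crd ` J) \<subseteq> conj_crd ` ideal_times I J"
    using image_mono[OF 1[of "conj_crd ` I" "conj_crd ` J"], of conj_crd] by simp
  with 1 show ?thesis by blast
qed

lemma conj_point_ideal: "conj_crd ` point_ideal P = point_ideal (neg_point P)"
proof (cases P)
  case Infinity
  have "surj conj_crd" by (metis conj_crd_conj surjI)
  then show ?thesis by (simp add: Infinity)
next
  case (Affine a b)
  have "u \<in> conj_crd ` {u. ev a b u = 0} \<longleftrightarrow> ev a (- b) u = 0" for u
  proof
    assume "ev a (- b) u = 0"
    then have "ev a b (conj_crd u) = 0" by (simp add: ev_def conj_crd_def)
    then have "conj_crd (conj_crd u) \<in> conj_crd ` {u. ev a b u = 0}" by blast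
    then show "u \<in> conj_crd ` {u. ev a b u = 0}" by simp
  qed (auto simp: ev_def conj_crd_def eq_neg_iff_add_eq_0)
  then have "conj_crd ` {u. ev a b u = 0} = {u. ev a (- b) u = 0}" by blast
  then show ?thesis by (simp add: Affine)
qed

lemma scaled_UNIV_emb_eq:
  fixes p q :: "'a::field poly"
  assumes "scaled (emb p) UNIV = scaled (emb q) UNIV" "q \<noteq> 0"
  shows "degree p = degree q" "q dvd p"
proof -
  have dvd: "r dvd s" if "scaled (emb s) UNIV \<subseteq> scaled (emb r) UNIV" for r s :: "'a poly"
  proof -
    have "emb s * 1 \<in> scaled (emb s) UNIV" unfolding scaled_def by blast
    then have "emb s * 1 \<in> range ((*) (emb r))" using that unfolding scaled_def by blast
    then obtain w where "emb s = emb r * w" by (auto simp del: mult_cancel_left)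
    then have "s = r * cpart w" by (cases w) (simp add: emb_def crd_ops)
    then show ?thesis by simp
  qed
  show "q dvd p" using assms dvd by simp
  moreover have "p dvd q" using assms dvd by simp
  ultimately show "degree p = degree q"
    using assms(2) by (metis dvd_0_left_iff dvd_imp_degree_le order_antisym)
qed

text \<open>
  If \<open>P\<close> and \<open>Q\<close> have the same class, then \<open>I_P I_{-Q}\<close> is principal, and the norm of a generator has
  degree at most two, so that the generator is a polynomial in \<open>x\<close>.
\<close>

lemma point_ideal_class_inj:
  fixes P Q :: "'a::field_char_0 point"
  assumes P: "on_curve E0 P" and Q: "on_curve E0 Q" and uv: "u \<noteq> 0" "v \<noteq> 0"
    "scaled u (point_ideal P) = scaled v (point_ideal Q)"
  shows "P = Q"
proof -
  note ids = is_ideal_point[OF P] is_ideal_point[OF Q]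
    is_ideal_point[OF on_curve_neg[OF P]] is_ideal_point[OF on_curve_neg[OF Q]]
  define xp where "xp = (\<lambda>P. case P of Infinity \<Rightarrow> 1 | Affine a b \<Rightarrow> [:- a, 1 :: 'a:])"
  have xp0: "xp R \<noteq> 0" and dxp: "degree (xp R) \<le> 1" for R by (simp_all add: xp_def split: point.split)
  have xp: "ideal_times (point_ideal R) (point_ideal (neg_point R)) = scaled (emb (xp R)) UNIV"
    if "on_curve E0 R" for R
  proof (cases R)
    case Infinity
    then show ?thesis by (simp add: xp_def ideal_times_UNIV is_ideal_UNIV scaled_def emb_simps)
  next
    case (Affine a b)
    then show ?thesis using point_ideal_neg[of b a] that by (simp add: xp_def)
  qed
  define J where "J = ideal_times (point_ideal Q) (point_ideal (neg_point P))"
  have J: "scaled (u * emb (xp P)) UNIV = scaled v J"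
    unfolding J_def using uv(3) xp[OF P] by (metis scaled_ideal_times scaled_scaled)
  have "(u * emb (xp P)) * 1 \<in> scaled (u * emb (xp P)) UNIV" unfolding scaled_def by blast
  then have "(u * emb (xp P)) * 1 \<in> scaled v J" by (simp only: J)
  then have "(u * emb (xp P)) * 1 \<in> range ((*) v)" unfolding scaled_def by blast
  then obtain w where w: "u * emb (xp P) = v * w" by auto
  have "scaled v (scaled w UNIV) = scaled v J" using J by (simp add: scaled_scaled w)
  then have Jw: "J = scaled w UNIV" using uv(2) scaled_cancel by metis
  have w0: "w \<noteq> 0" using w uv(1) emb_neq_0[OF xp0[of P]] by auto
  have surj: "conj_crd ` UNIV = (UNIV :: 'a crd set)" by (metis conj_crd_conj surjI)
  have nn: "neg_point (neg_point R) = R" for R :: "'a point" by (cases R) simp_all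
  have "conj_crd ` J = ideal_times (point_ideal (neg_point Q)) (point_ideal P)"
    by (simp add: J_def conj_ideal_times conj_point_ideal nn)
  then have Jc: "ideal_times (point_ideal (neg_point Q)) (point_ideal P) = scaled (conj_crd w) UNIV"
    by (simp add: Jw conj_scaled surj)
  \<comment> \<open>The norm of \<open>w\<close> generates the product of \<open>J\<close> with its
    conjugate; regrouping the four ideals shows that it is \<open>xp P * xp Q\<close> up to a
    unit.\<close>
  have "scaled (emb (norm_crd w)) UNIV = ideal_times (scaled w UNIV) (scaled (conj_crd w) UNIV)"
    by (simp add: scaled_ideal_times ideal_times_scaled ideal_times_UNIV is_ideal_UNIV scaled_scaled
        mult.commute flip: mult_conj_crd)
  also have "\<dots> = ideal_times (ideal_times (point_ideal Q) (point_ideal (neg_point P)))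
    (ideal_times (point_ideal (neg_point Q)) (point_ideal P))"
    unfolding Jw[symmetric] Jc[symmetric] J_def ..
  also have "\<dots> = ideal_times (ideal_times (point_ideal Q) (point_ideal (neg_point Q)))
    (ideal_times (point_ideal P) (point_ideal (neg_point P)))"
    by (simp add: ideal_times_assoc is_ideal_times ids)
      (metis (no_types, lifting) ideal_times_assoc ideal_times_commute ids is_ideal_times)
  also have "\<dots> = scaled (emb (xp P * xp Q)) UNIV"
    by (simp add: xp P Q scaled_ideal_times ideal_times_scaled ideal_times_UNIV is_ideal_UNIV
        scaled_scaled emb_simps mult.commute)
  finally have nw: "scaled (emb (norm_crd w)) UNIV = scaled (emb (xp P * xp Q)) UNIV" .
  have xpp: "xp P * xp Q \<noteq> 0" using xp0 by simp
  have dn: "degree (norm_crd w) = degree (xp P) + degree (xp Q)"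
    using scaled_UNIV_emb_eq(1)[OF nw xpp] by (simp add: degree_mult_eq xp0)
  then have "degree (norm_crd w) \<le> 2" using dxp[of P] dxp[of Q] by simp
  then have "ypart w = 0" using degree_norm_crd[of w] by fastforce
  then have we: "w = emb (cpart w)" by (cases w) (simp add: emb_def)
  then have nc: "norm_crd w = (cpart w)\<^sup>2" by (simp add: norm_crd_def \<open>ypart w = 0\<close>)
  have c0: "cpart w \<noteq> 0" using w0 we by (metis emb_simps(5))
  have d: "2 * degree (cpart w) = degree (xp P) + degree (xp Q)"
    using dn by (simp add: nc degree_power_eq c0)
  show ?thesis
  proof (cases "P = Infinity \<or> Q = Infinity")
    case True
    \<comment> \<open>If exactly one point were at infinity, the right side of \<open>d\<close>
      would be 1, an odd number.\<close>
    with d show ?thesis by (cases P; cases Q) (auto simp: xp_def)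
  next
    case False
    then obtain a b a' b' where PQ: "P = Affine a b" "Q = Affine a' b'"
      by (metis point.exhaust)
    have deg: "degree (cpart w) = 1" using d by (simp add: PQ xp_def)
    have dvd: "xp P * xp Q dvd (cpart w)\<^sup>2" using scaled_UNIV_emb_eq(2)[OF nw xpp] by (simp add: nc)
    have "poly ((cpart w)\<^sup>2) a = 0" "poly ((cpart w)\<^sup>2) a' = 0"
      using dvd_mult_left[OF dvd] dvd_mult_right[OF dvd]
      by (simp_all only: poly_eq_0_iff_dvd PQ xp_def point.case)
    then have roots: "poly (cpart w) a = 0" "poly (cpart w) a' = 0" by simp_all
    obtain k where k: "cpart w = [:- a, 1:] * k" using roots by (metis poly_eq_0_iff_dvd dvdE)
    have "k \<noteq> 0" using c0 k by auto
    moreover have "degree k = 0"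
      using deg degree_mult_eq[of "[:- a, 1:]" k] \<open>k \<noteq> 0\<close> unfolding k by simp
    ultimately have "degree k = 0" "k \<noteq> 0" by simp_all
    then obtain m where m: "k = [:m:]" "m \<noteq> 0" by (metis degree_eq_zeroE pCons_0_0)
    have aa: "a' = a" using roots(2) m by (simp add: k)
    have unit: "scaled (emb [:m:]) UNIV = (UNIV :: 'a crd set)"
    proof -
      have "x \<in> scaled (emb [:m:]) UNIV" for x :: "'a crd"
      proof -
        have "x = emb [:m:] * (emb [:1 / m:] * x)"
          using m(2) by (simp add: mult.assoc[symmetric] emb_simps(3)[symmetric])
            (simp add: emb_simps flip: one_pCons)
        then show ?thesis unfolding scaled_def by blast
      qed
      then show ?thesis by blast
    qed
    have "J = scaled (xm a) UNIV"
      unfolding Jw by (subst we) (simp only: k m emb_simps scaled_scaled[symmetric] unit)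
    also have "\<dots> = ideal_times (point_ideal P) (point_ideal (neg_point P))"
      using xp[OF P] by (simp add: PQ xp_def)
    finally have JP: "J = ideal_times (point_ideal P) (point_ideal (neg_point P))" .
    \<comment> \<open>Multiplication by the ideal of \<open>P\<close> turns the factor for -P into
      the principal factor \<open>emb (xp P)\<close>, which can be cancelled.\<close>
    have eq: "ideal_times J (point_ideal P) = scaled (emb (xp P)) (point_ideal R)"
      if "J = ideal_times (point_ideal R) (point_ideal (neg_point P))" "is_ideal (point_ideal R)" for R
    proof -
      have "ideal_times J (point_ideal P) = ideal_times (point_ideal R) (ideal_times (point_ideal P) (point_ideal (neg_point P)))"
        by (simp add: that ideal_times_assoc ids) (metis ideal_times_commute)
      then show ?thesis
        by (simp add: xp P ideal_times_scaled ideal_times_UNIV_right that)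
    qed
    have "point_ideal P = point_ideal Q"
      using eq[OF JP] eq[OF J_def] ids scaled_cancel emb_neq_0[OF xp0[of P]] by metis
    moreover have "Crd [:- b:] 1 \<in> point_ideal P" by (simp add: PQ ev_def)
    ultimately show ?thesis by (simp add: PQ ev_def aa)
  qed
qed

lemma E0_add_commute:
  fixes P Q :: "'a::field_char_0 point"
  assumes P: "on_curve E0 P" and Q: "on_curve E0 Q"
  shows "point_add E0 P Q = point_add E0 Q P"
proof -
  obtain u v where 1: "u \<noteq> 0" "v \<noteq> 0"
    "scaled u (ideal_times (point_ideal P) (point_ideal Q)) = scaled v (point_ideal (point_add E0 P Q))"
    using point_ideal_add[OF P Q] .
  obtain u' v' where 2: "u' \<noteq> 0" "v' \<noteq> 0"
    "scaled u' (ideal_times (point_ideal Q) (point_ideal P)) = scaled v' (point_ideal (point_add E0 Q P))"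
    using point_ideal_add[OF Q P] .
  have "scaled (u' * v) (point_ideal (point_add E0 P Q)) = scaled (u * v') (point_ideal (point_add E0 Q P))"
    unfolding scaled_scaled[symmetric] 1(3)[symmetric] 2(3)[symmetric]
    by (simp add: scaled_scaled ideal_times_commute mult.commute)
  then show ?thesis
    by (rule point_ideal_class_inj[OF on_curve_point_add[OF P Q] on_curve_point_add[OF Q P], rotated 2])
      (simp_all add: 1(1,2) 2(1,2))
qed

text \<open>Both bracketings have the class of the product of the three ideals, and the class
  determines the point. The rest is bookkeeping of the scalars from four applications of
  \<open>point_ideal_add\<close>.\<close>

lemma E0_add_assoc:
  fixes P Q R :: "'a::field_char_0 point"
  assumes P: "on_curve E0 P" and Q: "on_curve E0 Q" and R: "on_curve E0 R"
  shows "point_add E0 (point_add E0 P Q) R = point_add E0 P (point_add E0 Q R)"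
proof -
  have PQ: "on_curve E0 (point_add E0 P Q)" and QR: "on_curve E0 (point_add E0 Q R)"
    using assms by (simp_all add: on_curve_point_add)
  obtain u v where 1: "u \<noteq> 0" "v \<noteq> 0"
    "scaled u (ideal_times (point_ideal P) (point_ideal Q)) = scaled v (point_ideal (point_add E0 P Q))"
    using point_ideal_add[OF P Q] .
  obtain u' v' where 2: "u' \<noteq> 0" "v' \<noteq> 0"
    "scaled u' (ideal_times (point_ideal (point_add E0 P Q)) (point_ideal R))
      = scaled v' (point_ideal (point_add E0 (point_add E0 P Q) R))"
    using point_ideal_add[OF PQ R] .
  obtain r s where 3: "r \<noteq> 0" "s \<noteq> 0"
    "scaled r (ideal_times (point_ideal Q) (point_ideal R)) = scaled s (point_ideal (point_add E0 Q R))"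
    using point_ideal_add[OF Q R] .
  obtain r' s' where 4: "r' \<noteq> 0" "s' \<noteq> 0"
    "scaled r' (ideal_times (point_ideal P) (point_ideal (point_add E0 Q R)))
      = scaled s' (point_ideal (point_add E0 P (point_add E0 Q R)))"
    using point_ideal_add[OF P QR] .
  define PQR where "PQR = ideal_times (ideal_times (point_ideal P) (point_ideal Q)) (point_ideal R)"
  have "scaled (v * v') (point_ideal (point_add E0 (point_add E0 P Q) R))
    = scaled u' (ideal_times (scaled v (point_ideal (point_add E0 P Q))) (point_ideal R))"
    by (simp only: scaled_scaled[symmetric] 2(3)[symmetric] scaled_ideal_times)
      (simp add: scaled_scaled mult.commute)
  also have "\<dots> = scaled (u * u') PQR"
    by (simp add: 1(3)[symmetric] PQR_def scaled_ideal_times scaled_scaled mult.commute)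
  finally have l: "scaled (v * v') (point_ideal (point_add E0 (point_add E0 P Q) R)) = scaled (u * u') PQR" .
  have "scaled (s * s') (point_ideal (point_add E0 P (point_add E0 Q R)))
    = scaled r' (ideal_times (point_ideal P) (scaled s (point_ideal (point_add E0 Q R))))"
    by (simp only: scaled_scaled[symmetric] 4(3)[symmetric] ideal_times_scaled)
      (simp add: scaled_scaled mult.commute)
  also have "\<dots> = scaled (r * r') PQR"
    by (simp add: 3(3)[symmetric] PQR_def ideal_times_scaled scaled_scaled mult.commute
        ideal_times_assoc is_ideal_point assms)
  finally have r: "scaled (s * s') (point_ideal (point_add E0 P (point_add E0 Q R))) = scaled (r * r') PQR" .
  have "scaled (r * r' * (v * v')) (point_ideal (point_add E0 (point_add E0 P Q) R))
    = scaled (r * r') (scaled (u * u') PQR)"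
    by (simp only: scaled_scaled[symmetric, of "r * r'" "v * v'"] l)
  also have "\<dots> = scaled (u * u') (scaled (r * r') PQR)"
    by (simp only: scaled_scaled mult_ac)
  also have "\<dots> = scaled (u * u' * (s * s')) (point_ideal (point_add E0 P (point_add E0 Q R)))"
    by (simp only: scaled_scaled[symmetric, of "u * u'" "s * s'"] r)
  finally have "scaled (r * r' * (v * v')) (point_ideal (point_add E0 (point_add E0 P Q) R))
    = scaled (u * u' * (s * s')) (point_ideal (point_add E0 P (point_add E0 Q R)))" .
  then show ?thesis
    by (rule point_ideal_class_inj[OF on_curve_point_add[OF PQ R] on_curve_point_add[OF P QR], rotated 2])
      (simp_all add: 1(1,2) 2(1,2) 3(1,2) 4(1,2))
qed

lemma E0_add_neg: "on_curve E0 P \<Longrightarrow> point_add E0 (neg_point P) P = Infinity"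
  by (cases P) simp_all

section \<open>Automorphisms of the algebraic closure of the rationals\<close>

text \<open>Subrings containing the rationals; as all elements are algebraic, these are exactly the
  intermediate fields (see \<open>over_Q_inverse\<close>).\<close>

definition over_Q :: "QQbar set \<Rightarrow> bool" where
  "over_Q L \<longleftrightarrow> range to_ac \<subseteq> L \<and> (\<forall>x\<in>L. \<forall>y\<in>L. x + y \<in> L) \<and> (\<forall>x\<in>L. \<forall>y\<in>L. x * y \<in> L)"

lemma over_Q_intros:
  assumes "over_Q L"
  shows "to_ac q \<in> L" "x \<in> L \<Longrightarrow> y \<in> L \<Longrightarrow> x + y \<in> L" "x \<in> L \<Longrightarrow> y \<in> L \<Longrightarrow> x * y \<in> L"
    "0 \<in> L" "1 \<in> L" "x \<in> L \<Longrightarrow> - x \<in> L" "x \<in> L \<Longrightarrow> y \<in> L \<Longrightarrow> x - y \<in> L"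
proof -
  show 1: "to_ac q \<in> L" for q using assms by (auto simp: over_Q_def)
  show a: "x \<in> L \<Longrightarrow> y \<in> L \<Longrightarrow> x + y \<in> L" for x y using assms by (auto simp: over_Q_def)
  show m: "x \<in> L \<Longrightarrow> y \<in> L \<Longrightarrow> x * y \<in> L" for x y using assms by (auto simp: over_Q_def)
  show "0 \<in> L" "1 \<in> L" using 1[of 0] 1[of 1] by simp_all
  show u: "x \<in> L \<Longrightarrow> - x \<in> L" for x using m[of "to_ac (- 1)" x] 1[of "- 1"] by simp
  show "x \<in> L \<Longrightarrow> y \<in> L \<Longrightarrow> x - y \<in> L" using a[OF _ u] by fastforce
qed

lemma over_Q_sum: "over_Q L \<Longrightarrow> (\<And>i. i \<in> A \<Longrightarrow> f i \<in> L) \<Longrightarrow> sum f A \<in> L"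
  by (induction A rule: infinite_finite_induct) (auto intro: over_Q_intros)

lemma over_Q_power: "over_Q L \<Longrightarrow> x \<in> L \<Longrightarrow> x ^ n \<in> L"
  by (induction n) (auto intro: over_Q_intros)

definition poly_over :: "'a::zero set \<Rightarrow> 'a poly \<Rightarrow> bool" where
  "poly_over L p \<longleftrightarrow> (\<forall>i. coeff p i \<in> L)"

lemma poly_over_poly: "over_Q L \<Longrightarrow> poly_over L p \<Longrightarrow> x \<in> L \<Longrightarrow> poly p x \<in> L"
  unfolding poly_altdef poly_over_def
  by (intro over_Q_sum over_Q_intros(3) over_Q_power) auto

lemma poly_over_mult: "over_Q L \<Longrightarrow> poly_over L p \<Longrightarrow> poly_over L q \<Longrightarrow> poly_over L (p * q)"
  unfolding poly_over_def coeff_mult by (intro allI over_Q_sum over_Q_intros(3)) auto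

lemma poly_over_add: "over_Q L \<Longrightarrow> poly_over L p \<Longrightarrow> poly_over L q \<Longrightarrow> poly_over L (p + q)"
  by (auto simp: poly_over_def intro: over_Q_intros)

lemma poly_over_diff: "over_Q L \<Longrightarrow> poly_over L p \<Longrightarrow> poly_over L q \<Longrightarrow> poly_over L (p - q)"
  by (auto simp: poly_over_def intro: over_Q_intros)

lemma poly_over_monom: "over_Q L \<Longrightarrow> c \<in> L \<Longrightarrow> poly_over L (monom c k)"
  by (auto simp: poly_over_def intro: over_Q_intros)

lemma poly_over_rat:
  assumes "over_Q L"
  shows "poly_over L (map_poly to_ac (p :: rat poly))"
proof -
  have "coeff (map_poly to_ac p) i = (to_ac (coeff p i) :: QQbar)" for i
    by (rule coeff_map_poly) (rule to_ac_0)
  then show ?thesis using over_Q_intros(1)[OF assms] by (simp only: poly_over_def) blast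
qed

lemma over_Q_range: "over_Q (range to_ac)"
  unfolding over_Q_def by (auto simp flip: to_ac_add to_ac_mult)

text \<open>An algebraic relation with nonzero constant term a reads a + x Q = 0 with Q in L and
  hence gives 1/x; a vanishing constant term is removed by dividing the relation by x.\<close>

lemma over_Q_inverse:
  assumes L: "over_Q L" and x: "x \<in> L"
  shows "inverse x \<in> L"
proof (cases "x = 0")
  case False
  obtain p :: "rat poly" where p: "p \<noteq> 0" "poly (map_poly to_ac p) x = 0"
    using alg_closure_algebraic by blast
  from p show ?thesis
  proof (induction p)
    case (pCons a q)
    define Q where "Q = poly (map_poly to_ac q) x"
    have Q: "Q \<in> L" unfolding Q_def by (intro poly_over_poly poly_over_rat L x)
    have eq: "to_ac a + x * Q = 0"
      using pCons.prems by (simp add: map_poly_pCons Q_def)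
    show ?case
    proof (cases "a = 0")
      case True
      then show ?thesis using eq False pCons by (simp add: Q_def)
    next
      case a: False
      have "inverse x = to_ac (- inverse a) * Q"
        using eq a False by (simp add: field_simps eq_neg_iff_add_eq_0)
      then show ?thesis using over_Q_intros(1,3)[OF L] Q by metis
    qed
  qed simp
qed (use over_Q_intros[OF L] in simp)

text \<open>Partial ring homomorphisms are represented by their graphs.\<close>

definition partial_hom :: "(QQbar \<times> QQbar) set \<Rightarrow> bool" where
  "partial_hom R \<longleftrightarrow> single_valued R \<and> (\<forall>q. (to_ac q, to_ac q) \<in> R)
     \<and> (\<forall>x y a b. (x, a) \<in> R \<longrightarrow> (y, b) \<in> R \<longrightarrow> (x + y, a + b) \<in> R \<and> (x * y, a * b) \<in> R)"

definition graph_fun :: "('a \<times> 'b) set \<Rightarrow> 'a \<Rightarrow> 'b" where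
  "graph_fun R x = (THE v. (x, v) \<in> R)"

lemma graph_fun_eq: "single_valued R \<Longrightarrow> (x, v) \<in> R \<Longrightarrow> graph_fun R x = v"
  unfolding graph_fun_def by (rule the_equality) (auto dest: single_valuedD)

lemma over_Q_Domain: "partial_hom R \<Longrightarrow> over_Q (Domain R)"
  unfolding partial_hom_def over_Q_def by blast

lemma graph_fun_hom:
  assumes R: "partial_hom R"
  shows "graph_fun R (to_ac q) = to_ac q"
    "x \<in> Domain R \<Longrightarrow> y \<in> Domain R \<Longrightarrow> graph_fun R (x + y) = graph_fun R x + graph_fun R y"
    "x \<in> Domain R \<Longrightarrow> y \<in> Domain R \<Longrightarrow> graph_fun R (x * y) = graph_fun R x * graph_fun R y"
    "graph_fun R 0 = 0"
proof -
  have sv: "single_valued R" using R by (simp add: partial_hom_def)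
  show 1: "graph_fun R (to_ac q) = to_ac q" for q
    using R by (intro graph_fun_eq[OF sv]) (simp add: partial_hom_def)
  then show "graph_fun R 0 = 0" by (metis to_ac_0)
  show "graph_fun R (x + y) = graph_fun R x + graph_fun R y"
    "graph_fun R (x * y) = graph_fun R x * graph_fun R y" if xy: "x \<in> Domain R" "y \<in> Domain R"
  proof -
    obtain a b where ab: "(x, a) \<in> R" "(y, b) \<in> R" using xy by blast
    then have "(x + y, a + b) \<in> R" "(x * y, a * b) \<in> R" using R by (auto simp: partial_hom_def)
    then show "graph_fun R (x + y) = graph_fun R x + graph_fun R y"
      "graph_fun R (x * y) = graph_fun R x * graph_fun R y"
      using ab by (simp_all add: graph_fun_eq[OF sv])
  qed
qed

lemma graph_fun_diff:
  assumes R: "partial_hom R" and "x \<in> Domain R" "y \<in> Domain R"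
  shows "graph_fun R (x - y) = graph_fun R x - graph_fun R y"
  using graph_fun_hom(2)[OF R over_Q_intros(7)[OF over_Q_Domain[OF R] assms(2,3)] assms(3)]
  by (simp add: algebra_simps)

lemma graph_fun_sum:
  assumes R: "partial_hom R" and "\<And>i. i \<in> A \<Longrightarrow> f i \<in> Domain R"
  shows "graph_fun R (sum f A) = (\<Sum>i\<in>A. graph_fun R (f i))"
  using assms(2)
  by (induction A rule: infinite_finite_induct)
    (auto simp: graph_fun_hom[OF R] over_Q_sum[OF over_Q_Domain[OF R]])

lemma map_graph_fun:
  assumes R: "partial_hom R" and p: "poly_over (Domain R) p" and q: "poly_over (Domain R) q"
  shows "map_poly (graph_fun R) (p + q) = map_poly (graph_fun R) p + map_poly (graph_fun R) q"
    "map_poly (graph_fun R) (p - q) = map_poly (graph_fun R) p - map_poly (graph_fun R) q"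
    "map_poly (graph_fun R) (p * q) = map_poly (graph_fun R) p * map_poly (graph_fun R) q"
proof -
  note [simp] = coeff_map_poly[of "graph_fun R", OF graph_fun_hom(4)[OF R]]
  have pq: "coeff p i \<in> Domain R" "coeff q i \<in> Domain R" for i
    using p q by (simp_all add: poly_over_def)
  show "map_poly (graph_fun R) (p + q) = map_poly (graph_fun R) p + map_poly (graph_fun R) q"
    by (rule poly_eqI) (simp add: graph_fun_hom[OF R] pq)
  show "map_poly (graph_fun R) (p - q) = map_poly (graph_fun R) p - map_poly (graph_fun R) q"
    by (rule poly_eqI) (simp add: graph_fun_diff[OF R] pq)
  show "map_poly (graph_fun R) (p * q) = map_poly (graph_fun R) p * map_poly (graph_fun R) q"
    by (rule poly_eqI)
      (simp add: coeff_mult graph_fun_sum[OF R] graph_fun_hom[OF R] pq over_Q_intros(3)[OF over_Q_Domain[OF R]])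
qed

definition minimal_over :: "QQbar set \<Rightarrow> QQbar \<Rightarrow> QQbar poly \<Rightarrow> bool" where
  "minimal_over L x p \<longleftrightarrow> poly_over L p \<and> lead_coeff p = 1 \<and> poly p x = 0
     \<and> (\<forall>g. poly_over L g \<longrightarrow> poly g x = 0 \<longrightarrow> g \<noteq> 0 \<longrightarrow> degree p \<le> degree g)"

lemma minimal_over_exists:
  assumes L: "over_Q L"
  obtains p where "minimal_over L x p"
proof -
  define S where "S = (\<lambda>g. poly_over L g \<and> poly g x = 0 \<and> g \<noteq> 0)"
  obtain q :: "rat poly" where q: "q \<noteq> 0" "poly (map_poly to_ac q) x = 0"
    using alg_closure_algebraic by blast
  then have "S (map_poly to_ac q)"
    unfolding S_def using poly_over_rat[OF L] by (simp add: map_poly_eq_0_iff)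
  then have "\<exists>g. S g \<and> (\<forall>h. S h \<longrightarrow> degree g \<le> degree h)" by (rule ex_has_least_nat)
  then obtain g where g: "S g" "\<And>h. S h \<Longrightarrow> degree g \<le> degree h" by blast
  define p where "p = monom (inverse (lead_coeff g)) 0 * g"
  have g0: "g \<noteq> 0" "poly_over L g" using g by (simp_all add: S_def)
  have "poly_over L p"
    unfolding p_def using g0 by (intro poly_over_mult poly_over_monom over_Q_inverse L) (simp add: poly_over_def)
  moreover have "lead_coeff p = 1" using g0 by (simp add: p_def lead_coeff_mult monom_0)
  moreover have "degree p = degree g" using g0 by (simp add: p_def monom_0)
  moreover have "poly p x = 0" using g by (simp add: p_def S_def)
  ultimately have "minimal_over L x p" using g(2) by (simp add: minimal_over_def S_def)
  then show ?thesis by (rule that)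
qed

text \<open>One step of division by \<open>p\<close> lowers the degree of \<open>g\<close> and is
  respected by the map on coefficients. This makes sending g(x) to the value at y of the image of g
  well defined.\<close>

lemma minimal_over_root:
  assumes R: "partial_hom R" and p: "minimal_over (Domain R) x p"
    and y: "poly (map_poly (graph_fun R) p) y = 0"
  shows "poly_over (Domain R) g \<Longrightarrow> poly g x = 0 \<Longrightarrow> poly (map_poly (graph_fun R) g) y = 0"
proof (induction "degree g" arbitrary: g rule: less_induct)
  case less
  note L = over_Q_Domain[OF R]
  have pp: "poly_over (Domain R) p" "lead_coeff p = 1" "poly p x = 0" using p by (simp_all add: minimal_over_def)
  show ?case
  proof (cases "g = 0")
    case False
    then have deg: "degree p \<le> degree g" using p less.prems by (simp add: minimal_over_def)
    define m where "m = monom (lead_coeff g) (degree g - degree p)"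
    define h where "h = g - m * p"
    have m: "poly_over (Domain R) m"
      using less.prems unfolding m_def by (intro poly_over_monom L) (simp add: poly_over_def)
    have h: "poly_over (Domain R) h" unfolding h_def by (intro poly_over_diff poly_over_mult L less.prems m pp)
    have "p \<noteq> 0" using pp by auto
    have "m \<noteq> 0" using False by (simp add: m_def)
    have dmp: "degree (m * p) = degree g"
    proof -
      have "degree m = degree g - degree p" using False by (simp add: m_def degree_monom_eq)
      then show ?thesis using deg \<open>p \<noteq> 0\<close> \<open>m \<noteq> 0\<close> by (simp add: degree_mult_eq)
    qed
    have "lead_coeff (m * p) = lead_coeff g" using pp by (simp add: lead_coeff_mult m_def degree_monom_eq False)
    then have "coeff h (degree g) = 0" by (simp add: h_def dmp)
    moreover have "degree h \<le> degree g" unfolding h_def by (intro degree_diff_le) (simp_all add: dmp)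
    ultimately have "h = 0 \<or> degree h < degree g" by (metis leading_coeff_0_iff order_le_less)
    moreover have "poly h x = 0" using less.prems pp by (simp add: h_def)
    ultimately have "poly (map_poly (graph_fun R) h) y = 0" using less.hyps h by fastforce
    moreover have "map_poly (graph_fun R) h = map_poly (graph_fun R) g - map_poly (graph_fun R) m * map_poly (graph_fun R) p"
      unfolding h_def using map_graph_fun(2)[OF R less.prems(1) poly_over_mult[OF L m pp(1)]]
        map_graph_fun(3)[OF R m pp(1)] by simp
    ultimately show ?thesis using y by simp
  qed simp
qed

text \<open>The extension to the ring generated by x is evaluation of polynomials: the graph pairs
  g(x) with the value at y, and \<open>minimal_over_root\<close> makes it single valued.\<close>

lemma partial_hom_adjoin:
  assumes R: "partial_hom R" and p: "minimal_over (Domain R) x p"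
    and y: "poly (map_poly (graph_fun R) p) y = 0"
  obtains R' where "partial_hom R'" "R \<subseteq> R'" "(x, y) \<in> R'"
proof -
  note L = over_Q_Domain[OF R]
  have sv: "single_valued R" using R by (simp add: partial_hom_def)
  define h where "h = (\<lambda>g. (poly g x, poly (map_poly (graph_fun R) g) y))"
  define R' where "R' = h ` {g. poly_over (Domain R) g}"
  have const: "poly_over (Domain R) [:a:]" if "a \<in> Domain R" for a
    using that over_Q_intros(4)[OF L] by (auto simp: poly_over_def coeff_pCons split: nat.split)
  have hc: "h [:a:] = (a, graph_fun R a)" for a
    by (simp add: h_def map_poly_pCons graph_fun_hom[OF R])
  have sub: "R \<subseteq> R'"
  proof
    fix z assume z: "z \<in> R"
    obtain a v where av: "z = (a, v)" by (cases z)
    then have "h [:a:] = z" "a \<in> Domain R" using z graph_fun_eq[OF sv] by (auto simp: hc)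
    then show "z \<in> R'" unfolding R'_def using const by blast
  qed
  have "partial_hom R'"
    unfolding partial_hom_def
  proof (intro conjI allI impI)
    show "single_valued R'"
    proof (rule single_valuedI)
      fix a b b' assume "(a, b) \<in> R'" "(a, b') \<in> R'"
      then obtain g g' where g: "poly_over (Domain R) g" "poly_over (Domain R) g'"
        "(a, b) = h g" "(a, b') = h g'" unfolding R'_def by blast
      have "poly (map_poly (graph_fun R) (g - g')) y = 0"
        using g by (intro minimal_over_root[OF R p y] poly_over_diff L) (simp_all add: h_def)
      then show "b = b'" using g by (simp add: map_graph_fun[OF R] h_def)
    qed
    show "(to_ac q, to_ac q) \<in> R'" for q using sub R by (auto simp: partial_hom_def)
    fix a b v w assume "(a, v) \<in> R'" "(b, w) \<in> R'"
    then obtain g g' where g: "poly_over (Domain R) g" "poly_over (Domain R) g'"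
      "(a, v) = h g" "(b, w) = h g'" unfolding R'_def by blast
    have "(a + b, v + w) = h (g + g')" "(a * b, v * w) = h (g * g')"
      using g by (simp_all add: map_graph_fun[OF R] h_def)
    then show "(a + b, v + w) \<in> R'" "(a * b, v * w) \<in> R'"
      unfolding R'_def using poly_over_add[OF L g(1,2)] poly_over_mult[OF L g(1,2)] by blast+
  qed
  moreover have "(x, y) \<in> R'"
  proof -
    have "poly_over (Domain R) [:0, 1:]"
      using over_Q_intros(4,5)[OF L] by (auto simp: poly_over_def coeff_pCons split: nat.split)
    moreover have "graph_fun R 1 = 1" using graph_fun_hom(1)[OF R, of 1] by simp
    then have "h [:0, 1:] = (x, y)"
      by (simp add: h_def map_poly_pCons graph_fun_hom[OF R])
    ultimately show ?thesis unfolding R'_def by (metis imageI mem_Collect_eq)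
  qed
  ultimately show ?thesis using sub that by blast
qed

text \<open>Injectivity comes from inverses. For surjectivity, an injective map permutes the finite
  set of roots of a rational polynomial.\<close>

lemma ring_hom_in_Gal:
  assumes add: "\<And>x y. \<sigma> (x + y) = \<sigma> x + \<sigma> y" and mult: "\<And>x y. \<sigma> (x * y) = \<sigma> x * \<sigma> y"
    and rat: "\<And>q. \<sigma> (to_ac q) = to_ac q"
  shows "\<sigma> \<in> Gal field_Q"
proof -
  have 0: "\<sigma> 0 = 0" and 1: "\<sigma> 1 = 1" using rat[of 0] rat[of 1] by simp_all
  have "x = 0" if "\<sigma> x = 0" for x
  proof (rule ccontr)
    assume "x \<noteq> 0"
    then have "\<sigma> (x * inverse x) = 1" by (simp add: 1)
    then show False using that by (simp add: mult)
  qed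
  moreover have neg: "\<sigma> (- x) = - \<sigma> x" for x using add[of x "- x"] 0 by (simp add: eq_neg_iff_add_eq_0 add.commute)
  have "\<sigma> (x - y) = \<sigma> x - \<sigma> y" for x y using add[of x "- y"] neg by simp
  ultimately have inj: "inj \<sigma>" by (intro injI) (metis right_minus_eq)
  have poly: "poly (map_poly to_ac p) (\<sigma> x) = \<sigma> (poly (map_poly to_ac p) x)" for p x
    by (induction p) (simp_all add: 0 map_poly_pCons add mult rat)
  have "y \<in> range \<sigma>" for y
  proof -
    obtain p :: "rat poly" where p: "p \<noteq> 0" "poly (map_poly to_ac p) y = 0"
      using alg_closure_algebraic by blast
    define S where "S = {x. poly (map_poly to_ac p) x = 0}"
    have "finite S" unfolding S_def using p by (intro poly_roots_finite) (simp add: map_poly_eq_0_iff)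
    moreover have "\<sigma> ` S \<subseteq> S" unfolding S_def by (auto simp: poly 0)
    ultimately have "\<sigma> ` S = S" using inj by (intro endo_inj_surj) (auto intro: inj_on_subset)
    moreover have "y \<in> S" using p by (simp add: S_def)
    ultimately show ?thesis by blast
  qed
  then have "bij \<sigma>" using inj by (auto simp: bij_def)
  then show ?thesis by (auto simp: Gal_def field_Q_def add mult rat)
qed

text \<open>A maximal extension exists by Zorn's lemma. Its domain is everything, since the image of
  a minimal polynomial has a root in the algebraically closed field.\<close>

lemma partial_hom_extend:
  assumes R: "partial_hom R"
  obtains \<sigma> where "\<sigma> \<in> Gal field_Q" "\<And>x v. (x, v) \<in> R \<Longrightarrow> \<sigma> x = v"
proof -
  have "\<exists>M\<in>{S. partial_hom S \<and> R \<subseteq> S}. \<forall>S\<in>{S. partial_hom S \<and> R \<subseteq> S}. M \<subseteq> S \<longrightarrow> S = M"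
  proof (rule subset_Zorn_nonempty)
    show "{S. partial_hom S \<and> R \<subseteq> S} \<noteq> {}" using R by blast
    fix C assume C: "C \<noteq> {}" and ch: "subset.chain {S. partial_hom S \<and> R \<subseteq> S} C"
    have CS: "partial_hom S" "R \<subseteq> S" if "S \<in> C" for S
      using ch that by (auto simp: subset.chain_def)
    have both: "\<exists>S\<in>C. z \<in> S \<and> w \<in> S" if "z \<in> \<Union>C" "w \<in> \<Union>C" for z w
      using ch that unfolding subset_chain_def by blast
    have "partial_hom (\<Union>C)"
      unfolding partial_hom_def
    proof (intro conjI allI impI)
      show "single_valued (\<Union>C)"
      proof (rule single_valuedI)
        fix x y z assume "(x, y) \<in> \<Union>C" "(x, z) \<in> \<Union>C"
        then obtain S where "S \<in> C" "(x, y) \<in> S" "(x, z) \<in> S" using both by blast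
        then show "y = z" using CS by (meson partial_hom_def single_valuedD)
      qed
      show "(to_ac q, to_ac q) \<in> \<Union>C" for q using C CS by (auto simp: partial_hom_def)
      fix x y a b assume "(x, a) \<in> \<Union>C" "(y, b) \<in> \<Union>C"
      then obtain S where S: "S \<in> C" "(x, a) \<in> S" "(y, b) \<in> S" using both by blast
      then have "(x + y, a + b) \<in> S" "(x * y, a * b) \<in> S" using CS by (auto simp: partial_hom_def)
      then show "(x + y, a + b) \<in> \<Union>C" "(x * y, a * b) \<in> \<Union>C" using S by blast+
    qed
    moreover obtain S where "S \<in> C" using C by blast
    then have "R \<subseteq> \<Union>C" using CS(2)[of S] by (meson Union_upper order_trans)
    ultimately show "\<Union>C \<in> {S. partial_hom S \<and> R \<subseteq> S}" by simp
  qed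
  then obtain M where M: "partial_hom M" "R \<subseteq> M"
    and max: "\<And>S. partial_hom S \<Longrightarrow> R \<subseteq> S \<Longrightarrow> M \<subseteq> S \<Longrightarrow> S = M"
    unfolding Bex_def mem_Collect_eq by (elim exE conjE) (metis (lifting) mem_Collect_eq)
  have sv: "single_valued M" using M by (simp add: partial_hom_def)
  have dom: "x \<in> Domain M" for x
  proof -
    obtain p where p: "minimal_over (Domain M) x p"
      using minimal_over_exists[OF over_Q_Domain[OF M(1)]] .
    then have lc: "lead_coeff p = 1" and px: "poly p x = 0" by (simp_all add: minimal_over_def)
    have "degree p > 0"
    proof (rule ccontr)
      assume "\<not> degree p > 0"
      then obtain a where a: "p = [:a:]" by (metis degree_0_id gr0I)
      then have "poly p x = 1" using lc by simp
      then show False using px by simp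
    qed
    moreover have "degree (map_poly (graph_fun M) p) = degree p"
      using lc graph_fun_hom(1)[OF M(1), of 1] by (intro map_poly_degree_eq) simp
    ultimately obtain y where "poly (map_poly (graph_fun M) p) y = 0"
      using alg_closed_imp_poly_has_root by metis
    with partial_hom_adjoin[OF M(1) p] obtain R' where "partial_hom R'" "M \<subseteq> R'" "(x, y) \<in> R'" by blast
    then show ?thesis using max[of R'] M by blast
  qed
  have "graph_fun M \<in> Gal field_Q"
    by (rule ring_hom_in_Gal) (simp_all add: graph_fun_hom[OF M(1)] dom)
  moreover have "graph_fun M x = v" if "(x, v) \<in> R" for x v
    using that M(2) graph_fun_eq[OF sv] by blast
  ultimately show ?thesis by (rule that)
qed

section \<open>Rules for Galois automorphisms, compactness, and the fixed field\<close>

lemma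
  assumes "\<sigma> \<in> Gal F"
  shows Gal_add: "\<sigma> (x + y) = \<sigma> x + \<sigma> y" and Gal_mult: "\<sigma> (x * y) = \<sigma> x * \<sigma> y"
    and Gal_bij: "bij \<sigma>" and Gal_fix: "z \<in> F \<Longrightarrow> \<sigma> z = z"
  using assms by (simp_all add: Gal_def)

text \<open>For an arbitrary set F this has to be derived: the image of 1 is a nonzero idempotent,
  which fixes the integers and then all quotients.\<close>

lemma Gal_rat:
  assumes \<sigma>: "\<sigma> \<in> Gal F"
  shows "\<sigma> (to_ac q) = to_ac q"
proof -
  have 0: "\<sigma> 0 = 0" using Gal_add[OF \<sigma>, of 0 0] by simp
  have inj: "inj \<sigma>" using Gal_bij[OF \<sigma>] by (rule bij_is_inj)
  have "\<sigma> 1 * \<sigma> 1 = \<sigma> 1" using Gal_mult[OF \<sigma>, of 1 1] by simp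
  moreover have "\<sigma> 1 \<noteq> 0" using inj 0 by (metis injD zero_neq_one)
  ultimately have 1: "\<sigma> 1 = 1" by simp
  have nat: "\<sigma> (of_nat n) = of_nat n" for n by (induction n) (simp_all add: 0 1 Gal_add[OF \<sigma>])
  have neg: "\<sigma> (- x) = - \<sigma> x" for x
    using Gal_add[OF \<sigma>, of x "- x"] 0 by (simp add: eq_neg_iff_add_eq_0 add.commute)
  have int: "\<sigma> (of_int k) = of_int k" for k by (cases k rule: int_cases2) (simp_all add: nat neg)
  obtain a b where q: "q = of_int a / of_int b" "b \<noteq> 0" by (cases q) (auto simp: Fract_of_int_quotient)
  then have "q * of_int b = of_int a" by simp
  then have "to_ac (q * of_int b) = to_ac (of_int a :: rat)" by (simp only:)
  then have "to_ac q * of_int b = of_int a" by (simp only: to_ac_mult to_ac_of_int)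
  then have "\<sigma> (to_ac q) * of_int b = of_int a" by (metis Gal_mult[OF \<sigma>] int)
  then show ?thesis using \<open>to_ac q * of_int b = of_int a\<close> q(2) by (metis mult_right_cancel of_int_eq_0_iff)
qed

text \<open>
  Compactness of the Galois group: the elements at which a sequence of automorphisms is eventually
  constant form a field, and the limit extends from there.
\<close>

lemma Gal_eventually_constant:
  assumes \<sigma>: "\<And>n :: nat. \<sigma> n \<in> Gal F"
  obtains \<tau> where "\<tau> \<in> Gal F" "\<And>x v. eventually (\<lambda>n. \<sigma> n x = v) sequentially \<Longrightarrow> \<tau> x = v"
proof -
  define R where "R = {(x, v). eventually (\<lambda>n. \<sigma> n x = v) sequentially}"
  have "partial_hom R"
    unfolding partial_hom_def
  proof (intro conjI allI impI)
    show "single_valued R"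
    proof (rule single_valuedI)
      fix x v w assume "(x, v) \<in> R" "(x, w) \<in> R"
      then have "eventually (\<lambda>n. \<sigma> n x = v \<and> \<sigma> n x = w) sequentially"
        by (simp add: R_def eventually_conj)
      then have "eventually (\<lambda>n :: nat. v = w) sequentially" by (rule eventually_mono) auto
      then show "v = w" by simp
    qed
    show "(to_ac q, to_ac q) \<in> R" for q by (simp add: R_def Gal_rat[OF \<sigma>])
    fix x y a b assume "(x, a) \<in> R" "(y, b) \<in> R"
    then have e: "eventually (\<lambda>n. \<sigma> n x = a \<and> \<sigma> n y = b) sequentially"
      by (simp add: R_def eventually_conj)
    from e have "eventually (\<lambda>n. \<sigma> n (x + y) = a + b) sequentially"
      by (rule eventually_mono) (simp add: Gal_add[OF \<sigma>])
    moreover from e have "eventually (\<lambda>n. \<sigma> n (x * y) = a * b) sequentially"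
      by (rule eventually_mono) (simp add: Gal_mult[OF \<sigma>])
    ultimately show "(x + y, a + b) \<in> R" "(x * y, a * b) \<in> R" by (simp_all add: R_def)
  qed
  then obtain \<tau> where \<tau>: "\<tau> \<in> Gal field_Q" "\<And>x v. (x, v) \<in> R \<Longrightarrow> \<tau> x = v"
    using partial_hom_extend by blast
  have lim: "\<tau> x = v" if "eventually (\<lambda>n. \<sigma> n x = v) sequentially" for x v
    using \<tau>(2) that by (simp add: R_def)
  have "\<tau> x = x" if "x \<in> F" for x
    using that by (intro lim) (simp add: Gal_fix[OF \<sigma>])
  then have "\<tau> \<in> Gal F" using \<tau>(1) by (simp add: Gal_def)
  then show ?thesis using that lim by blast
qed

text \<open>Every root of the minimal polynomial is a conjugate of x, hence x itself. If x were
  irrational it would be a multiple root, and the derivative would be a nonzero rational polynomial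
  of smaller degree vanishing at x.\<close>

lemma fixed_by_Gal_Q:
  assumes "\<And>\<sigma>. \<sigma> \<in> Gal field_Q \<Longrightarrow> \<sigma> x = x"
  shows "x \<in> range to_ac"
proof (rule ccontr)
  assume x: "x \<notin> range to_ac"
  define R where "R = (\<lambda>q :: rat. (to_ac q, to_ac q)) ` UNIV"
  have R: "partial_hom R"
    unfolding partial_hom_def R_def
    by (auto simp: single_valued_def simp flip: to_ac_add to_ac_mult)
  have dom: "Domain R = range to_ac" by (auto simp: R_def)
  obtain p where p: "minimal_over (Domain R) x p"
    using minimal_over_exists[OF over_Q_Domain[OF R]] .
  then have pp: "poly_over (range to_ac) p" "lead_coeff p = 1" "poly p x = 0" by (simp_all add: minimal_over_def dom)
  have gf: "graph_fun R (coeff p i) = coeff p i" for i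
  proof -
    obtain r where "coeff p i = to_ac r" using pp(1) by (auto simp: poly_over_def)
    then show ?thesis using graph_fun_hom(1)[OF R] by simp
  qed
  have mp: "map_poly (graph_fun R) p = p"
    by (rule poly_eqI) (simp add: coeff_map_poly graph_fun_hom[OF R] gf)
  have root: "y = x" if "poly p y = 0" for y
  proof -
    have "poly (map_poly (graph_fun R) p) y = 0" using that mp by simp
    then obtain R' where R': "partial_hom R'" "R \<subseteq> R'" "(x, y) \<in> R'" using partial_hom_adjoin[OF R p] by blast
    then obtain \<sigma> where "\<sigma> \<in> Gal field_Q" "\<sigma> x = y" using partial_hom_extend by metis
    then show ?thesis using assms by metis
  qed
  obtain q where q: "p = [:- x, 1:] * q" using pp(3) by (metis poly_eq_0_iff_dvd dvdE)
  have "p \<noteq> 0" using pp by auto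
  then have "q \<noteq> 0" using q by auto
  have dpq: "degree p = Suc (degree q)"
    unfolding q using degree_mult_eq[of "[:- x, 1:]" q] \<open>q \<noteq> 0\<close> by simp
  have "degree q > 0"
  proof (rule ccontr)
    assume "\<not> degree q > 0"
    then obtain c where c: "q = [:c:]" by (metis degree_0_id gr0I)
    then have "c = 1" using pp(2) \<open>q \<noteq> 0\<close> unfolding q by simp
    then have "coeff p 0 = - x" by (simp add: q c)
    then have "- x \<in> range to_ac" using pp(1) unfolding poly_over_def by (metis (no_types))
    then have "- (- x) \<in> range to_ac" by (rule over_Q_intros(6)[OF over_Q_range])
    then show False using x by simp
  qed
  then obtain y where "poly q y = 0" using alg_closed_imp_poly_has_root by metis
  moreover from this have "y = x" by (intro root) (simp add: q)
  moreover have "pderiv p = [:- x, 1:] * pderiv q + q" unfolding q pderiv_mult by (simp add: pderiv_pCons)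
  ultimately have "poly (pderiv p) x = 0" by simp
  moreover have "poly_over (range to_ac) (pderiv p)"
  proof -
    have "of_nat n \<in> (range to_ac :: QQbar set)" for n
      using over_Q_intros(1)[OF over_Q_range, of "of_nat n"] by simp
    then show ?thesis
      unfolding poly_over_def coeff_pderiv
      using pp(1) by (intro allI over_Q_intros(3)[OF over_Q_range]) (auto simp only: poly_over_def)
  qed
  moreover have "pderiv p \<noteq> 0" using dpq pderiv_eq_0_iff[of p] by simp
  ultimately have "degree p \<le> degree (pderiv p)" using p by (simp add: minimal_over_def dom)
  then show False using dpq by (simp add: degree_pderiv)
qed

section \<open>The ring \<open>\<int>\<^sub>2[i]\<close>\<close>

lemma residue_mod: "m \<le> n \<Longrightarrow> residue x n mod 2 ^ m = residue x m"
proof (induction n rule: nat_induct)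
  case (Suc n)
  have *: "residue x (Suc n) mod 2 ^ n = residue x n" using residue[of x] by simp
  show ?case
  proof (cases "m = Suc n")
    case True
    then show ?thesis using residue[of x] z2_coherent_self by blast
  next
    case False
    then have "m \<le> n" using Suc by simp
    then have "residue x (Suc n) mod 2 ^ m = (residue x (Suc n) mod 2 ^ n) mod 2 ^ m"
      by (simp add: mod_mod_cancel le_imp_power_dvd)
    then show ?thesis using Suc * \<open>m \<le> n\<close> by simp
  qed
qed (use residue[of x] z2_coherent_self in blast)

lemma residue_self: "residue x n mod 2 ^ n = residue x n"
  by (simp add: residue_mod)

lemma residue_bounds: "0 \<le> residue x n" "residue x n < 2 ^ n"
  by (metis residue_self pos_mod_sign zero_less_numeral zero_less_power)
    (metis residue_self pos_mod_bound zero_less_numeral zero_less_power)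

lemma residue_0: "residue x 0 = 0"
  using residue_self[of x 0] by simp

lemmas residue_ops = plus_z2.rep_eq minus_z2.rep_eq times_z2.rep_eq uminus_z2.rep_eq
  zero_z2.rep_eq one_z2.rep_eq

lemma z2_eqI: "(\<And>n. residue x n = residue y n) \<Longrightarrow> x = y"
  by (metis ext residue_inverse)

lemma residue_of_nat: "residue (of_nat k) n = int k mod 2 ^ n"
  by (induction k) (simp_all add: residue_ops mod_simps)

lemma residue_of_int: "residue (of_int k) n = k mod 2 ^ n"
  by (cases k rule: int_cases2) (simp_all add: residue_ops residue_of_nat mod_simps)

lemma residue_numeral: "residue (numeral k) n = numeral k mod 2 ^ n"
  using residue_of_int[of "numeral k" n] by simp

lemma z2_of_coherent:
  assumes "\<And>n. f (Suc n) mod 2 ^ n = f n"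
  obtains x where "\<And>n. residue x n = f n"
proof
  show "residue (Abs_z2 f) n = f n" for n using assms Abs_z2_inverse[of f] by simp
qed

lemma pow2_dvd_iff: "2 ^ n dvd x \<longleftrightarrow> residue x n = 0"
proof
  assume "2 ^ n dvd x"
  then obtain y where "x = 2 ^ n * y" by (elim dvdE)
  moreover have "residue (2 ^ n) n = 0"
    using residue_of_int[of "2 ^ n" n] by simp
  ultimately show "residue x n = 0" by (simp add: residue_ops)
next
  assume x: "residue x n = 0"
  \<comment> \<open>Division by \<open>2 ^ n\<close> costs n binary digits, so the m-th residue of
    the quotient is read from residue m + n.\<close>
  define f where "f = (\<lambda>m. residue x (m + n) div 2 ^ n)"
  have "f (Suc m) mod 2 ^ m = f m" for m
  proof -
    have "residue x (Suc m + n) mod 2 ^ (m + n) = residue x (m + n)" by (rule residue_mod) simp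
    then have "(residue x (Suc m + n) mod (2 ^ n * 2 ^ m)) div 2 ^ n = f m"
      by (simp add: f_def power_add mult.commute)
    then show ?thesis by (simp add: f_def zmod_zmult2_eq)
  qed
  then obtain y where y: "\<And>m. residue y m = f m" using z2_of_coherent by blast
  have "x = 2 ^ n * y"
  proof (rule z2_eqI)
    fix m
    have "residue x (m + n) mod 2 ^ n = 0" using x by (simp add: residue_mod)
    then have "2 ^ n * f m = residue x (m + n)" unfolding f_def by (metis mult_div_mod_eq add.right_neutral)
    then have "(2 ^ n * f m) mod 2 ^ m = residue x m" by (simp add: residue_mod)
    moreover have "residue (2 ^ n) m = 2 ^ n mod 2 ^ m" using residue_of_int[of "2 ^ n" m] by simp
    ultimately show "residue x m = residue (2 ^ n * y) m" by (simp add: residue_ops y mod_simps)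
  qed
  then show "2 ^ n dvd x" by simp
qed

lemma residue_eq_iff_dvd: "residue x n = residue y n \<longleftrightarrow> 2 ^ n dvd x - y"
proof -
  have "residue (x - y) n = 0 \<longleftrightarrow> residue x n mod 2 ^ n = residue y n mod 2 ^ n"
    by (simp add: residue_ops mod_eq_dvd_iff dvd_eq_mod_eq_0)
  then show ?thesis by (simp add: pow2_dvd_iff residue_self)
qed

text \<open>Halving costs one binary digit: the residue of x at n is determined by that of 2 x at n
  + 1.\<close>

lemma z2_two_cancel:
  fixes x :: z2
  assumes "2 * x = 0"
  shows "x = 0"
proof (rule z2_eqI)
  fix n
  have "residue (2 * x) (Suc n) = 0" by (simp add: assms residue_ops)
  then have "(2 * residue x (Suc n)) mod 2 ^ Suc n = 0"
    by (simp add: residue_ops residue_numeral mod_simps)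
  then have "residue x (Suc n) mod 2 ^ n = 0" by (simp add: mult_mod_right[symmetric])
  then show "residue x n = residue 0 n" by (simp add: residue_mod residue_ops)
qed

text \<open>An odd number has exactly one inverse modulo each power of 2; uniqueness makes these
  inverses coherent.\<close>

lemma z2_unit:
  assumes "residue x 1 = 1"
  shows "x dvd 1"
proof -
  have "odd (residue x (Suc n))" for n
    using residue_mod[of 1 "Suc n" x] assms by (simp add: odd_iff_mod_2_eq_one)
  then have cop: "coprime (residue x n) (2 ^ n)" for n by (cases n) (simp_all add: residue_0)
  define P where "P = (\<lambda>n v. v mod 2 ^ n = v \<and> (residue x n * v) mod 2 ^ n = 1 mod 2 ^ n)"
  have ex: "\<exists>v. P n v" for n
  proof -
    obtain v where "[residue x n * v = 1] (mod 2 ^ n)" using cong_solve_coprime_int[OF cop] by blast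
    then have "P n (v mod 2 ^ n)" by (simp add: P_def cong_def mod_simps)
    then show ?thesis by blast
  qed
  have uniq: "v = w" if "P n v" "P n w" for n v w
  proof -
    have "[residue x n * v = residue x n * w] (mod 2 ^ n)" using that by (simp add: P_def cong_def)
    then have "[v = w] (mod 2 ^ n)" using cop cong_mult_lcancel by blast
    then show ?thesis using that by (simp add: P_def cong_def)
  qed
  define f where "f = (\<lambda>n. SOME v. P n v)"
  have f: "P n (f n)" for n unfolding f_def using ex by (rule someI_ex)
  have "f (Suc n) mod 2 ^ n = f n" for n
  proof (rule uniq[OF _ f])
    have "(residue x (Suc n) * f (Suc n)) mod 2 ^ Suc n = 1 mod 2 ^ Suc n"
      using f[of "Suc n"] unfolding P_def by blast
    then have "(residue x (Suc n) * f (Suc n)) mod 2 ^ Suc n mod 2 ^ n = 1 mod 2 ^ Suc n mod 2 ^ n"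
      by (simp only:)
    moreover have "(2 :: int) ^ n dvd 2 ^ Suc n" by simp
    ultimately have "(residue x (Suc n) * f (Suc n)) mod 2 ^ n = 1 mod 2 ^ n"
      by (simp only: mod_mod_cancel)
    then have "((residue x (Suc n) mod 2 ^ n) * (f (Suc n) mod 2 ^ n)) mod 2 ^ n = 1 mod 2 ^ n"
      by (simp only: mod_mult_eq)
    then show "P n (f (Suc n) mod 2 ^ n)" by (simp add: P_def residue_mod)
  qed
  then obtain y where "\<And>n. residue y n = f n" using z2_of_coherent by blast
  then have "x * y = 1" using f by (intro z2_eqI) (simp add: P_def residue_ops)
  then show ?thesis by (metis dvdI)
qed

lemma residue_1_cases: "residue x 1 = 0 \<or> residue x 1 = 1"
  using residue_bounds[of x 1] by auto

section \<open>Gaussian integers over Z_2\<close>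

datatype gz = GZ (re: z2) (im: z2)

instantiation gz :: comm_ring_1
begin

definition "0 = GZ 0 0"
definition "1 = GZ 1 0"
definition "u + v = GZ (re u + re v) (im u + im v)"
definition "- u = GZ (- re u) (- im u)"
definition "u - v = GZ (re u - re v) (im u - im v)"
definition "u * v = GZ (re u * re v - im u * im v) (re u * im v + im u * re v)"

instance
  by standard
    (simp_all add: zero_gz_def one_gz_def plus_gz_def uminus_gz_def minus_gz_def
      times_gz_def algebra_simps)

end

lemmas gz_ops = zero_gz_def one_gz_def plus_gz_def uminus_gz_def minus_gz_def times_gz_def

lemma gz_numeral: "numeral k = GZ (numeral k) 0"
proof -
  have "of_nat n = GZ (of_nat n) 0" for n by (induction n) (simp_all add: gz_ops)
  from this[of "numeral k"] show ?thesis by simp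
qed

lemma gz_pow2: "2 ^ n = GZ (2 ^ n) 0"
  by (induction n) (simp_all add: gz_ops gz_numeral)

lemma gz_pow2_dvd_iff: "2 ^ n dvd w \<longleftrightarrow> 2 ^ n dvd re w \<and> 2 ^ n dvd im w"
proof
  assume "2 ^ n dvd re w \<and> 2 ^ n dvd im w"
  then obtain a b where "re w = 2 ^ n * a" "im w = 2 ^ n * b" by (elim conjE dvdE)
  then have "w = 2 ^ n * GZ a b" by (cases w) (simp add: gz_pow2 gz_ops)
  then show "2 ^ n dvd w" by simp
next
  assume "2 ^ n dvd w"
  then obtain v where "w = 2 ^ n * v" by (elim dvdE)
  then show "2 ^ n dvd re w \<and> 2 ^ n dvd im w" by (simp add: gz_pow2 gz_ops)
qed

definition gi :: gz where "gi = GZ 0 1"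

text \<open>The uniformizer 1 + i; its square is 2 up to the unit i.\<close>

definition gpi :: gz where "gpi = GZ 1 1"

definition gcnj :: "gz \<Rightarrow> gz" where "gcnj w = GZ (re w) (- im w)"

definition mu4 :: "gz set" where "mu4 = {1, - 1, gi, - gi}"

lemma gcnj_mult: "gcnj (v * w) = gcnj v * gcnj w"
  by (simp add: gcnj_def gz_ops)

lemma gi_sq: "gi * gi = - 1"
  by (simp add: gi_def gz_ops)

lemma gpi_sq: "gpi * gpi = 2 * gi"
  by (simp add: gpi_def gi_def gz_ops gz_numeral)

lemma mu4_mult: "x \<in> mu4 \<Longrightarrow> y \<in> mu4 \<Longrightarrow> x * y \<in> mu4"
  by (auto simp: mu4_def gi_sq)

lemma mu4_inverse: "x \<in> mu4 \<Longrightarrow> \<exists>y\<in>mu4. x * y = 1"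
  by (auto simp: mu4_def gi_sq)

text \<open>The residue field has two elements, and reduction sends a + b i to a + b modulo
  2.\<close>

lemma gpi_dvd_iff: "gpi dvd w \<longleftrightarrow> 2 dvd re w + im w"
proof
  assume "gpi dvd w"
  then obtain v where "w = gpi * v" by (elim dvdE)
  then have "re w + im w = 2 * re v" by (simp add: gpi_def gz_ops)
  then show "2 dvd re w + im w" by simp
next
  assume "2 dvd re w + im w"
  then obtain c where c: "re w + im w = 2 * c" by (elim dvdE)
  then have im: "im w = 2 * c - re w" by (simp add: algebra_simps)
  have "w = gpi * GZ c (c - re w)" by (cases w) (use im in \<open>simp add: gpi_def gz_ops\<close>)
  then show "gpi dvd w" by (rule dvdI)
qed

lemma two_dvd_z2_iff: "2 dvd x \<longleftrightarrow> residue x 1 = 0"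
  using pow2_dvd_iff[of 1 x] by simp

text \<open>Modulo 2 the norm a^2 + b^2 equals a + b; when it is odd, the conjugate divided by the
  norm is an inverse.\<close>

lemma gz_unit_iff: "w dvd 1 \<longleftrightarrow> \<not> gpi dvd w"
proof
  assume w: "w dvd 1"
  show "\<not> gpi dvd w"
  proof
    assume "gpi dvd w"
    then have "gpi dvd 1" using w dvd_trans by blast
    then show False by (simp add: gpi_dvd_iff two_dvd_z2_iff one_gz_def residue_ops)
  qed
next
  assume "\<not> gpi dvd w"
  then have "residue (re w + im w) 1 = 1" using residue_1_cases by (auto simp: gpi_dvd_iff two_dvd_z2_iff)
  then have "residue ((re w)\<^sup>2 + (im w)\<^sup>2) 1 = 1"
    using residue_1_cases[of "re w"] residue_1_cases[of "im w"]
    by (auto simp: residue_ops power2_eq_square)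
  then obtain v where v: "1 = ((re w)\<^sup>2 + (im w)\<^sup>2) * v" using z2_unit by (metis dvdE)
  have "w * (gcnj w * GZ v 0) = 1"
    using v by (simp add: gcnj_def gz_ops power2_eq_square algebra_simps)
  then show "w dvd 1" by (metis dvdI)
qed

lemma gz_odd_diff:
  assumes "\<not> gpi dvd v" "\<not> gpi dvd w"
  shows "gpi dvd v - w"
proof -
  have "residue (re v + im v) 1 = 1" "residue (re w + im w) 1 = 1"
    using assms residue_1_cases by (auto simp: gpi_dvd_iff two_dvd_z2_iff)
  moreover have "re (v - w) + im (v - w) = (re v + im v) - (re w + im w)" by (simp add: gz_ops)
  ultimately show ?thesis by (simp add: gpi_dvd_iff two_dvd_z2_iff minus_z2.rep_eq)
qed

lemma gz_odd_mult: "\<not> gpi dvd v \<Longrightarrow> \<not> gpi dvd w \<Longrightarrow> \<not> gpi dvd v * w"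
  unfolding gz_unit_iff[symmetric] using mult_dvd_mono[of v 1 w 1] by simp

lemma gpi_pow_even: "gpi ^ (2 * n) = 2 ^ n * gi ^ n"
  by (simp add: power_mult power2_eq_square gpi_sq power_mult_distrib)

lemma gi_pow_unit: "gi ^ n dvd 1"
proof -
  have "gi * (- gi) = 1" by (simp add: gi_sq)
  then have "gi dvd 1" by (metis dvdI)
  then show ?thesis by (rule dvd_power_same[where y = 1, simplified])
qed

lemma pow2_dvd_iff_gpi: "2 ^ n dvd w \<longleftrightarrow> gpi ^ (2 * n) dvd w"
proof -
  obtain u where "gi ^ n * u = 1" using gi_pow_unit by (metis dvdE)
  then have "gpi ^ (2 * n) * u = 2 ^ n" by (simp add: gpi_pow_even mult.assoc)
  then show ?thesis by (metis dvd_triv_left dvd_trans gpi_pow_even)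
qed

section \<open>Closed subgroups of the unit group of \<open>\<int>\<^sub>2[i]\<close>\<close>

text \<open>The last clause is topological closedness: an element that can be approximated from
  \<open>H\<close> modulo every power of 2 belongs to \<open>H\<close>.\<close>

definition closed_units :: "gz set \<Rightarrow> bool" where
  "closed_units H \<longleftrightarrow> 1 \<in> H \<and> (\<forall>x\<in>H. \<forall>y\<in>H. x * y \<in> H) \<and> (\<forall>x\<in>H. \<exists>y\<in>H. x * y = 1)
     \<and> (\<forall>x. (\<forall>n. \<exists>g\<in>H. 2 ^ n dvd x - g) \<longrightarrow> x \<in> H)"

lemma closed_unitsD:
  assumes "closed_units H"
  shows "1 \<in> H" "x \<in> H \<Longrightarrow> y \<in> H \<Longrightarrow> x * y \<in> H" "x \<in> H \<Longrightarrow> \<exists>y\<in>H. x * y = 1"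
    "(\<And>n. \<exists>g\<in>H. 2 ^ n dvd x - g) \<Longrightarrow> x \<in> H"
  using assms by (auto simp: closed_units_def)

lemma closed_units_unit: "closed_units H \<Longrightarrow> x \<in> H \<Longrightarrow> x dvd 1"
  using closed_unitsD(3) by (metis dvdI)

lemma closed_units_divide:
  assumes "closed_units H" "x \<in> H" "x * y \<in> H"
  shows "y \<in> H"
proof -
  obtain z where z: "z \<in> H" "x * z = 1" using closed_unitsD(3)[OF assms(1,2)] by blast
  then have "z * (x * y) \<in> H" using closed_unitsD(2)[OF assms(1)] assms(3) by blast
  then show ?thesis using z by (simp add: mult.assoc[symmetric] mult.commute[of z x])
qed

text \<open>\<open>H\<close> contains an element of exact level \<open>n\<close> in the filtration by the groups \<open>1 + (1 + i)\<^sup>n\<close>.\<close>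

definition has_level :: "gz set \<Rightarrow> nat \<Rightarrow> bool" where
  "has_level H n \<longleftrightarrow> (\<exists>u. \<not> gpi dvd u \<and> 1 + gpi ^ n * u \<in> H)"

text \<open>By squaring. As 2 = -i (1 + i)^2, the linear term moves to level n + 2, while the
  quadratic term has level 2 n, which is larger once n is at least 3.\<close>

lemma has_level_add_2:
  assumes H: "closed_units H" and n: "n \<ge> 3" "has_level H n"
  shows "has_level H (n + 2)"
proof -
  obtain u where u: "\<not> gpi dvd u" "1 + gpi ^ n * u \<in> H" using n(2) by (auto simp: has_level_def)
  define w where "w = - gi * u + gpi ^ (n - 2) * u\<^sup>2"
  obtain k where k: "n = k + 3" using n(1) by (metis add.commute le_Suc_ex)
  have two: "2 * v = - gi * (gpi * (gpi * v))" for v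
  proof -
    have "- gi * (gpi * (gpi * v)) = - gi * (gpi * gpi) * v" by (simp only: mult.assoc)
    also have "\<dots> = 2 * (- (gi * gi)) * v" by (simp add: gpi_sq mult_ac)
    finally show ?thesis by (simp add: gi_sq)
  qed
  define A where "A = gpi ^ k"
  have pow: "gpi ^ n = A * gpi * gpi * gpi" "gpi ^ (n + 2) = A * gpi * gpi * gpi * gpi * gpi"
    "gpi ^ (n - 2) = A * gpi"
    by (simp_all add: A_def k power_add numeral_eq_Suc)
  have "(1 + gpi ^ n * u) * (1 + gpi ^ n * u) = 1 + 2 * (gpi ^ n * u) + gpi ^ n * gpi ^ n * u\<^sup>2"
    by (simp add: algebra_simps power2_eq_square)
  also have "\<dots> = 1 + gpi ^ (n + 2) * w"
    unfolding w_def two pow by (simp add: algebra_simps power2_eq_square)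
  finally have "1 + gpi ^ (n + 2) * w \<in> H" using closed_unitsD(2)[OF H u(2) u(2)] by simp
  moreover have "\<not> gpi dvd w"
  proof
    assume w: "gpi dvd w"
    have "gpi dvd gpi ^ (n - 2) * u\<^sup>2" using k by (simp add: dvd_mult2)
    then have "gpi dvd w - gpi ^ (n - 2) * u\<^sup>2" using w dvd_diff by blast
    then have "gpi dvd (- gi) * (- gi * u)" unfolding w_def by (simp add: dvd_mult)
    then have "gpi dvd - u" by (simp add: mult.assoc[symmetric] gi_sq)
    then show False using u(1) by simp
  qed
  ultimately show ?thesis by (auto simp: has_level_def)
qed

text \<open>Once every positive level occurs, a unit is approximated one power of 1 + i at a time,
  since the residue field has only two elements. Levels 1 and 2 come from i, the levels from 5 on by
  repeated squaring.\<close>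

lemma units_subset_closed_units:
  assumes H: "closed_units H" and lev: "gi \<in> H" "has_level H 3" "has_level H 4" and x: "x dvd 1"
  shows "x \<in> H"
proof -
  have "- 1 \<in> H" using closed_unitsD(2)[OF H lev(1) lev(1)] by (simp add: gi_sq)
  have "\<not> gpi dvd gi" by (simp add: gpi_dvd_iff two_dvd_z2_iff gi_def residue_ops)
  \<comment> \<open>The witnesses are \<open>gi = 1 + gpi * gi\<close> here and
    \<open>- 1 = 1 + gpi ^ 2 * gi\<close> for level 2.\<close>
  have 1: "has_level H 1"
    unfolding has_level_def using lev(1) \<open>\<not> gpi dvd gi\<close>
    by (intro exI[of _ gi]) (simp add: gi_def gpi_def gz_ops)
  have 2: "has_level H 2"
    unfolding has_level_def using \<open>- 1 \<in> H\<close> \<open>\<not> gpi dvd gi\<close>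
    by (intro exI[of _ gi]) (simp add: power2_eq_square gpi_sq mult.assoc gi_sq)
  have ge3: "has_level H n" if "n \<ge> 3" for n
    using that
  proof (induction n rule: less_induct)
    case (less n)
    then consider "n = 3" | "n = 4" | "n \<ge> 5" by linarith
    then show ?case
    proof cases
      case 3
      then have "has_level H (n - 2)" "n - 2 \<ge> 3" using less by simp_all
      then have "has_level H (n - 2 + 2)" using has_level_add_2[OF H] by blast
      moreover have "n - 2 + 2 = n" using 3 by simp
      ultimately show ?thesis by metis
    qed (use lev in auto)
  qed
  have level: "has_level H n" if n: "n > 0" for n
  proof -
    consider "n = 1" | "n = 2" | "n \<ge> 3" using n by linarith
    then show ?thesis using 1 2 ge3 by cases auto
  qed
  have xo: "\<not> gpi dvd x" using x by (simp add: gz_unit_iff)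
  have approx: "\<exists>g\<in>H. gpi ^ n dvd x - g" for n
  proof (induction n)
    case 0
    show ?case using closed_unitsD(1)[OF H] by auto
  next
    case (Suc n)
    then obtain g y where g: "g \<in> H" "x - g = gpi ^ n * y" by (auto elim: dvdE)
    have go: "\<not> gpi dvd g" using closed_units_unit[OF H g(1)] by (simp add: gz_unit_iff)
    show ?case
    proof (cases "gpi dvd y")
      case True
      then have "gpi ^ Suc n dvd x - g" unfolding g(2) power_Suc2 by (rule mult_dvd_mono[OF dvd_refl])
      then show ?thesis using g(1) by blast
    next
      case False
      have "n > 0"
      proof (rule ccontr)
        assume "\<not> n > 0"
        then have "y = x - g" using g(2) by simp
        then show False using gz_odd_diff[OF xo go] False by simp
      qed
      \<comment> \<open>Both \<open>y\<close> and \<open>g * u\<close> are nonzero in the field with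
        two elements, so this factor cancels the error at level n.\<close>
      then obtain u where u: "\<not> gpi dvd u" "1 + gpi ^ n * u \<in> H" using level by (auto simp: has_level_def)
      have "x - g * (1 + gpi ^ n * u) = gpi ^ n * (y - g * u)" using g(2) by (simp add: algebra_simps)
      also have "gpi ^ Suc n dvd \<dots>"
        unfolding power_Suc2 using gz_odd_diff[OF False gz_odd_mult[OF go u(1)]]
        by (rule mult_dvd_mono[OF dvd_refl])
      finally show ?thesis using closed_unitsD(2)[OF H g(1) u(2)] by blast
    qed
  qed
  show ?thesis
    by (rule closed_unitsD(4)[OF H]) (use approx pow2_dvd_iff_gpi in blast)
qed

definition mu4_closure :: "gz set \<Rightarrow> gz set" where
  "mu4_closure H = {z * h | z h. z \<in> mu4 \<and> h \<in> H}"

lemma mu4_one: "1 \<in> mu4" and mu4_gi: "gi \<in> mu4"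
  by (simp_all add: mu4_def)

text \<open>For closedness, one fourth root of unity must serve all precisions. If each of the four
  failed at some precision, an approximation to the largest of these precisions would be a
  contradiction.\<close>

lemma closed_units_mu4_closure:
  assumes H: "closed_units H"
  shows "closed_units (mu4_closure H)"
  unfolding closed_units_def
proof (intro conjI ballI allI impI)
  show "1 \<in> mu4_closure H"
    unfolding mu4_closure_def using mu4_one closed_unitsD(1)[OF H] by (metis (mono_tags, lifting) mem_Collect_eq mult_1)
next
  fix x y assume "x \<in> mu4_closure H" "y \<in> mu4_closure H"
  then obtain z h z' h' where *: "x = z * h" "y = z' * h'" "z \<in> mu4" "z' \<in> mu4" "h \<in> H" "h' \<in> H"
    unfolding mu4_closure_def by blast
  then have "x * y = (z * z') * (h * h')" by (simp add: mult_ac)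
  then show "x * y \<in> mu4_closure H"
    unfolding mu4_closure_def using mu4_mult[OF *(3,4)] closed_unitsD(2)[OF H *(5,6)] by blast
next
  fix x assume "x \<in> mu4_closure H"
  then obtain z h where *: "x = z * h" "z \<in> mu4" "h \<in> H" unfolding mu4_closure_def by blast
  obtain z' h' where z: "z' \<in> mu4" "z * z' = 1" and h: "h' \<in> H" "h * h' = 1"
    using mu4_inverse[OF *(2)] closed_unitsD(3)[OF H *(3)] by blast
  have "x * (z' * h') = (z * z') * (h * h')" by (simp add: * mult_ac)
  then have "x * (z' * h') = 1" by (simp add: z h)
  then show "\<exists>y\<in>mu4_closure H. x * y = 1" unfolding mu4_closure_def using z h by blast
next
  fix x assume x: "\<forall>n. \<exists>g\<in>mu4_closure H. 2 ^ n dvd x - g"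
  have "\<exists>z\<in>mu4. \<forall>n. \<exists>h\<in>H. 2 ^ n dvd x - z * h"
  proof (rule ccontr)
    assume "\<not> ?thesis"
    then obtain N where N: "\<And>z. z \<in> mu4 \<Longrightarrow> \<not> (\<exists>h\<in>H. 2 ^ N z dvd x - z * h)" by metis
    define m where "m = Max (N ` mu4)"
    have "finite mu4" by (simp add: mu4_def)
    then have m: "N z \<le> m" if "z \<in> mu4" for z using that by (simp add: m_def)
    obtain z h where "z \<in> mu4" "h \<in> H" "2 ^ m dvd x - z * h" using x unfolding mu4_closure_def by blast
    then have "2 ^ N z dvd x - z * h" using m by (meson dvd_trans le_imp_power_dvd)
    then show False using N \<open>z \<in> mu4\<close> \<open>h \<in> H\<close> by blast
  qed
  then obtain z where z: "z \<in> mu4" "\<And>n. \<exists>h\<in>H. 2 ^ n dvd x - z * h" by blast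
  obtain z' where z': "z' \<in> mu4" "z * z' = 1" using mu4_inverse[OF z(1)] by blast
  have "z' * x \<in> H"
  proof (rule closed_unitsD(4)[OF H])
    fix n
    obtain h where h: "h \<in> H" "2 ^ n dvd x - z * h" using z(2) by blast
    have "z' * (x - z * h) = z' * x - (z * z') * h" by (simp add: algebra_simps)
    then have "2 ^ n dvd z' * x - h" using h(2) z'(2) by (metis dvd_mult mult_1)
    then show "\<exists>g\<in>H. 2 ^ n dvd z' * x - g" using h(1) by blast
  qed
  moreover have "x = z * (z' * x)" using z'(2) by (simp add: mult.assoc[symmetric])
  ultimately show "x \<in> mu4_closure H" unfolding mu4_closure_def using z(1) by blast
qed

lemma has_levelI: "1 + gpi ^ n * u \<in> H \<Longrightarrow> \<not> gpi dvd u \<Longrightarrow> has_level H n"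
  by (auto simp: has_level_def)

lemma gpi_not_dvd: "\<not> gpi dvd 1" "\<not> gpi dvd - 1" "\<not> gpi dvd gi"
  by (simp_all add: gpi_dvd_iff two_dvd_z2_iff gi_def gz_ops residue_ops)

text \<open>The element -a, with a = 1 + 2 i or 1 - 2 i, has exact level 3, and 5 = 1 + 4 and -3 = 1
  - 4 have exact level 4. Together with i these generate all units.\<close>

lemma mu4_cover:
  assumes H: "closed_units H" and z: "z \<in> mu4" and r: "r = 5 \<or> r = - 3" "r \<in> H"
    and a: "a = GZ 1 2 \<or> a = GZ 1 (- 2)" "z * a \<in> H" and x: "x dvd 1"
  obtains w where "w \<in> mu4" "w * x \<in> H"
proof -
  let ?K = "mu4_closure H"
  note K = closed_units_mu4_closure[OF H]
  have HK: "H \<subseteq> ?K" unfolding mu4_closure_def using mu4_one by (metis (mono_tags, lifting) mem_Collect_eq mult_1 subsetI)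
  have mK: "mu4 \<subseteq> ?K"
    unfolding mu4_closure_def using closed_unitsD(1)[OF H] by (metis (mono_tags, lifting) mem_Collect_eq mult_1_right subsetI)
  have "a \<in> ?K" using closed_units_divide[OF K _ subsetD[OF HK a(2)]] z mK by blast
  moreover have "- 1 \<in> ?K" using mK by (auto simp: mu4_def)
  ultimately have "- 1 * a \<in> ?K" using closed_unitsD(2)[OF K] by blast
  moreover have "- 1 * a = 1 + gpi ^ 3 * gi \<or> - 1 * a = 1 + gpi ^ 3 * 1"
    using a(1) by (auto simp: gpi_def gi_def gz_ops power3_eq_cube)
  ultimately have 3: "has_level ?K 3" using has_levelI gpi_not_dvd by metis
  have "gpi ^ 4 = GZ (- 4) 0" by (simp add: power4_eq_xxxx gpi_def gz_ops)
  then have "r = 1 + gpi ^ 4 * (- 1) \<or> r = 1 + gpi ^ 4 * 1"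
    using r(1) by (auto simp: gz_ops gz_numeral)
  then have 4: "has_level ?K 4" using has_levelI gpi_not_dvd r(2) HK by blast
  have "gi \<in> ?K" using mK mu4_gi by blast
  from units_subset_closed_units[OF K this 3 4 x] obtain w h where w: "w \<in> mu4" "h \<in> H" "x = w * h"
    unfolding mu4_closure_def by blast
  obtain w' where "w' \<in> mu4" "w * w' = 1" using mu4_inverse[OF w(1)] by blast
  then show ?thesis using that[of w'] w by (simp add: mult.assoc[symmetric] mult.commute[of w' w])
qed

text \<open>The powers of 5 are dense in 1 + 4 Z_2, which contains -3. An exponent is corrected one
  binary digit at a time by means of \<open>five\<close>.\<close>

lemma five_power_approx: "\<exists>k. (2 :: int) ^ n dvd 5 ^ k + 3"
proof -
  have five: "\<exists>u. odd u \<and> (5 :: int) ^ (2 ^ m) = 1 + 2 ^ (m + 2) * u" for m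
  proof (induction m)
    case 0
    show ?case by (intro exI[of _ 1]) simp
  next
    case (Suc m)
    then obtain u where u: "odd u" "(5 :: int) ^ (2 ^ m) = 1 + 2 ^ (m + 2) * u" by blast
    have "(5 :: int) ^ (2 ^ Suc m) = 5 ^ (2 * 2 ^ m)" by simp
    also have "\<dots> = (1 + 2 ^ (m + 2) * u)\<^sup>2" unfolding power_even_eq u(2) ..
    also have "\<dots> = 1 + 2 ^ (Suc m + 2) * (u + 2 ^ (m + 1) * u\<^sup>2)"
      by (simp add: power2_eq_square algebra_simps power_add)
    finally show ?case using u(1) by (intro exI[of _ "u + 2 ^ (m + 1) * u\<^sup>2"]) simp
  qed
  have "\<exists>k. (2 :: int) ^ (m + 3) dvd 5 ^ k + 3" for m
  proof (induction m)
    \<comment> \<open>The induction starts from 5 + 3 = 8, with exponent 1.\<close>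
    case 0
    show ?case by (intro exI[of _ 1]) simp
  next
    case (Suc m)
    then obtain k q where k: "(5 :: int) ^ k + 3 = 2 ^ (m + 3) * q" by (auto elim: dvdE)
    show ?case
    proof (cases "even q")
      case True
      then obtain q' where "q = 2 * q'" by (elim evenE)
      then have "(5 :: int) ^ k + 3 = 2 ^ (Suc m + 3) * q'" using k by (simp add: power_add)
      then show ?thesis by (metis dvd_triv_left)
    next
      case False
      \<comment> \<open>The factor 1 + 2^(m+3) u with odd u changes the parity of the quotient
        \<open>q\<close>.\<close>
      obtain u where u: "odd u" "(5 :: int) ^ (2 ^ (m + 1)) = 1 + 2 ^ (m + 3) * u"
        using five[of "m + 1"] by (auto simp: numeral_3_eq_3)
      have "(5 :: int) ^ (k + 2 ^ (m + 1)) + 3 = 5 ^ k * 5 ^ (2 ^ (m + 1)) + 3" by (simp only: power_add)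
      also have "\<dots> = (5 ^ k + 3) + 2 ^ (m + 3) * (5 ^ k * u)" unfolding u(2) by (simp add: algebra_simps)
      also have "\<dots> = 2 ^ (m + 3) * (q + 5 ^ k * u)" unfolding k by (simp add: distrib_left)
      finally have *: "(5 :: int) ^ (k + 2 ^ (m + 1)) + 3 = 2 ^ (m + 3) * (q + 5 ^ k * u)" .
      have "even (q + 5 ^ k * u)" using False u(1) by simp
      then obtain q' where "q + 5 ^ k * u = 2 * q'" by (elim evenE)
      then have "(5 :: int) ^ (k + 2 ^ (m + 1)) + 3 = 2 ^ (Suc m + 3) * q'" unfolding * by (simp add: power_add)
      then show ?thesis by (metis dvd_triv_left)
    qed
  qed
  from this[of n] show ?thesis by (meson dvd_trans le_add1 le_imp_power_dvd)
qed

lemma minus_three_mem: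
  assumes H: "closed_units H" and 5: "5 \<in> H"
  shows "- 3 \<in> H"
proof (rule closed_unitsD(4)[OF H])
  fix n
  have pow: "5 ^ k \<in> H" for k
    by (induction k) (use closed_unitsD(1)[OF H] closed_unitsD(2)[OF H 5] in simp_all)
  obtain k where "(2 :: int) ^ n dvd 5 ^ k + 3" using five_power_approx by blast
  then obtain q where "(5 :: int) ^ k + 3 = 2 ^ n * q" by (elim dvdE)
  then have "(of_int (5 ^ k + 3) :: gz) = of_int (2 ^ n * q)" by (simp only:)
  then have "(5 :: gz) ^ k + 3 = 2 ^ n * of_int q" by simp
  then have "- 3 - 5 ^ k = 2 ^ n * (- of_int q :: gz)" by (simp add: algebra_simps)
  then have "2 ^ n dvd - 3 - (5 :: gz) ^ k" by (rule dvdI)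
  then show "\<exists>g\<in>H. 2 ^ n dvd - 3 - g" using pow by blast
qed

text \<open>
  The closed subgroups of \<open>\<int>\<^sub>2[i]\<^sup>\<times>\<close> that are stable under conjugation and together with \<open>\<mu>\<^sub>4\<close> generate
  everything are classified by their intersection with \<open>\<mu>\<^sub>4\<close> and by the multiple of \<open>1 + 2 i\<close> they contain.
\<close>

definition topgen :: "gz set \<Rightarrow> gz set \<Rightarrow> bool" where
  "topgen S H \<longleftrightarrow> S \<subseteq> H \<and> (\<forall>K. closed_units K \<longrightarrow> S \<subseteq> K \<longrightarrow> H \<subseteq> K)"

lemma closed_units_Int: "closed_units H \<Longrightarrow> closed_units K \<Longrightarrow> closed_units (H \<inter> K)"
proof -
  assume H: "closed_units H" and K: "closed_units K"
  show ?thesis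
    unfolding closed_units_def
  proof (intro conjI ballI allI impI)
    fix x assume x: "x \<in> H \<inter> K"
    then obtain y where y: "y \<in> H" "x * y = 1" using closed_unitsD(3)[OF H] by blast
    then have "y \<in> K" using closed_units_divide[OF K, of x y] x closed_unitsD(1)[OF K] by auto
    then show "\<exists>y\<in>H \<inter> K. x * y = 1" using y by blast
  next
    show "1 \<in> H \<inter> K" using closed_unitsD(1)[OF H] closed_unitsD(1)[OF K] by simp
    show "x * y \<in> H \<inter> K" if "x \<in> H \<inter> K" "y \<in> H \<inter> K" for x y
      using that closed_unitsD(2)[OF H] closed_unitsD(2)[OF K] by simp
    show "x \<in> H \<inter> K" if "\<forall>n. \<exists>g\<in>H \<inter> K. 2 ^ n dvd x - g" for x
      using that by (intro IntI closed_unitsD(4)[OF H] closed_unitsD(4)[OF K]) blast+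
  qed
qed

text \<open>Applied to \<open>H \<inter> K\<close>, \<open>mu4_cover\<close> writes each element of
  \<open>H\<close> as one of \<open>K\<close> up to a root of unity in \<open>H\<close>. A
  generating set therefore only has to produce \<open>r\<close>, the roots of unity in
  \<open>H\<close>, and one multiple of a.\<close>

lemma topgenI:
  assumes H: "closed_units H" and S: "S \<subseteq> H" and r: "r = 5 \<or> r = - 3"
    and z: "z \<in> mu4" and a: "a = GZ 1 2 \<or> a = GZ 1 (- 2)" "z * a \<in> S"
    and mem: "\<And>K. closed_units K \<Longrightarrow> S \<subseteq> K \<Longrightarrow> r \<in> K \<and> mu4 \<inter> H \<subseteq> K"
  shows "topgen S H"
  unfolding topgen_def
proof (intro conjI allI impI)
  show "S \<subseteq> H" by (rule S)
  fix K assume K: "closed_units K" "S \<subseteq> K"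
  have HK: "closed_units (H \<inter> K)" using closed_units_Int H K by blast
  have r': "r \<in> H \<inter> K" using mem[OF H S] mem[OF K] by blast
  have a': "z * a \<in> H \<inter> K" using a(2) S K by blast
  show "H \<subseteq> K"
  proof
    fix h assume h: "h \<in> H"
    obtain w where w: "w \<in> mu4" "w * h \<in> H \<inter> K"
      using mu4_cover[OF HK z r r' a(1) a' closed_units_unit[OF H h]] .
    then have "h * w \<in> H" by (simp add: mult.commute)
    then have "w \<in> H" by (rule closed_units_divide[OF H h])
    then have "w \<in> K" using mem[OF K] w(1) by blast
    moreover have "w * h \<in> K" using w(2) by blast
    ultimately show "h \<in> K" by (rule closed_units_divide[OF K(1)])
  qed
qed

lemma closed_units_classification:
  assumes H: "closed_units H" and conj: "\<And>x. x \<in> H \<Longrightarrow> gcnj x \<in> H"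
    and cov: "\<And>x. x dvd 1 \<Longrightarrow> \<exists>z\<in>mu4. z * x \<in> H"
  shows "(mu4 \<subseteq> H \<and> H = {x. x dvd 1}) \<or>
    (mu4 \<inter> H = {1, - 1} \<and> (topgen {- 1, 3, GZ 1 2} H \<or> topgen {- 1, 3, GZ 2 1} H)) \<or>
    (mu4 \<inter> H = {1} \<and> (topgen {5, GZ 1 2} H \<or> topgen {5, GZ (- 1) (- 2)} H
       \<or> topgen {- 3, GZ 2 (- 1)} H \<or> topgen {- 3, GZ (- 2) 1} H))"
proof -
  have "\<not> gpi dvd GZ 1 2" by (simp add: gpi_dvd_iff two_dvd_z2_iff residue_ops residue_numeral)
  then obtain z where z: "z \<in> mu4" "z * GZ 1 2 \<in> H" using cov by (auto simp: gz_unit_iff)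
  have zc: "z * gcnj z = 1" using z(1) by (auto simp: mu4_def gcnj_def gi_def gz_ops)
  \<comment> \<open>Stability under conjugation places the norm of this element, which is 5 for
    every \<open>z\<close>, in \<open>H\<close>.\<close>
  have "(z * GZ 1 2) * gcnj (z * GZ 1 2) = (z * gcnj z) * (GZ 1 2 * gcnj (GZ 1 2))"
    by (simp add: gcnj_mult mult_ac)
  also have "GZ 1 2 * gcnj (GZ 1 2) = 5" by (simp add: gcnj_def gz_ops gz_numeral)
  finally have 5: "5 \<in> H" using closed_unitsD(2)[OF H z(2) conj[OF z(2)]] by (simp add: zc)
  then have m3: "- 3 \<in> H" by (rule minus_three_mem[OF H])
  note m = closed_unitsD(2)[OF H]
  have one: "1 \<in> H" by (rule closed_unitsD(1)[OF H])
  have mgi: "gi \<in> H" if "- gi \<in> H"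
    using m[OF m[OF that that] that] by (simp add: gi_sq)
  have gim: "- 1 \<in> H" if "gi \<in> H" using m[OF that that] by (simp add: gi_sq)
  show ?thesis
  proof (cases "gi \<in> H")
    case True
    then have "mu4 \<subseteq> H" using one gim m[OF True gim] by (auto simp: mu4_def)
    moreover have "H = {x. x dvd 1}"
    proof (intro equalityI subsetI CollectI)
      fix x assume "x \<in> {x :: gz. x dvd 1}"
      then obtain w where "w \<in> mu4" "w * x \<in> H" using cov by blast
      then show "x \<in> H" using closed_units_divide[OF H] \<open>mu4 \<subseteq> H\<close> by blast
    qed (rule closed_units_unit[OF H])
    ultimately show ?thesis by blast
  next
    case ngi: False
    show ?thesis
    proof (cases "- 1 \<in> H")
      case True
      have mu: "mu4 \<inter> H = {1, - 1}" using one True ngi mgi by (auto simp: mu4_def)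
      have 3: "3 \<in> H" using m[OF True m3] by simp
      have K: "- 3 \<in> K \<and> mu4 \<inter> H \<subseteq> K" if "closed_units K" "{- 1, 3, a} \<subseteq> K" for a K
        using closed_unitsD(1)[OF that(1)] closed_unitsD(2)[OF that(1), of "- 1" 3] that(2) by (auto simp: mu)
      have neg: "- x \<in> H \<longleftrightarrow> x \<in> H" for x using m[OF True, of x] m[OF True, of "- x"] by auto
      consider "z = 1 \<or> z = - 1" | "z = gi \<or> z = - gi" using z(1) by (auto simp: mu4_def)
      then have "topgen {- 1, 3, GZ 1 2} H \<or> topgen {- 1, 3, GZ 2 1} H"
      proof cases
        case 1
        then have "GZ 1 2 \<in> H" using z(2) neg[of "GZ 1 2"] by auto
        then have "{- 1, 3, GZ 1 2} \<subseteq> H" using True 3 by simp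
        then have "topgen {- 1, 3, GZ 1 2} H"
        proof (rule topgenI[OF H _ _ mu4_one, of _ "- 3" "GZ 1 2"])
          show "- 3 \<in> K \<and> mu4 \<inter> H \<subseteq> K" if "closed_units K" "{- 1, 3, GZ 1 2} \<subseteq> K" for K
            by (rule K[OF that])
        qed (simp_all)
        then show ?thesis ..
      next
        case 2
        then have "gi * GZ 1 2 \<in> H" using z(2) neg[of "gi * GZ 1 2"] by auto
        \<comment> \<open>Since i (1 + 2 i) = -2 + i, the listed generator 2 + i appears after
          conjugation and a change of sign. It also equals i (1 - 2 i), the form that
          \<open>topgenI\<close> expects.\<close>
        then have "- gcnj (gi * GZ 1 2) \<in> H" using conj neg by blast
        moreover have g: "- gcnj (gi * GZ 1 2) = GZ 2 1" "gi * GZ 1 (- 2) = GZ 2 1"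
          by (simp_all add: gcnj_def gi_def gz_ops)
        ultimately have "{- 1, 3, GZ 2 1} \<subseteq> H" using True 3 by simp
        then have "topgen {- 1, 3, GZ 2 1} H"
        proof (rule topgenI[OF H _ _ mu4_gi, of _ "- 3" "GZ 1 (- 2)"])
          show "- 3 \<in> K \<and> mu4 \<inter> H \<subseteq> K" if "closed_units K" "{- 1, 3, GZ 2 1} \<subseteq> K" for K
            by (rule K[OF that])
        qed (simp_all add: g)
        then show ?thesis ..
      qed
      with mu show ?thesis by blast
    next
      case False
      have mu: "mu4 \<inter> H = {1}" using one False ngi mgi by (auto simp: mu4_def)
      have K: "r \<in> K \<and> mu4 \<inter> H \<subseteq> K" if "closed_units K" "{r, a} \<subseteq> K" for r a K
        using closed_unitsD(1)[OF that(1)] that(2) by (auto simp: mu)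
      \<comment> \<open>Both 5 and -3 lie in \<open>H\<close> and either can be the scalar
        generator; the list takes 5 when z is 1 or -1 and -3 when z is i or -i.\<close>
      have t: "topgen {r, z * GZ 1 2} H" if "r = 5 \<or> r = - 3" for r
      proof (rule topgenI[OF H _ that z(1), where a = "GZ 1 2"])
        show "{r, z * GZ 1 2} \<subseteq> H" using that 5 m3 z(2) by auto
        show "r \<in> K \<and> mu4 \<inter> H \<subseteq> K" if "closed_units K" "{r, z * GZ 1 2} \<subseteq> K" for K
          by (rule K[OF that])
      qed simp_all
      have e: "- 1 * GZ 1 2 = GZ (- 1) (- 2)" "gi * GZ 1 2 = GZ (- 2) 1" "- gi * GZ 1 2 = GZ 2 (- 1)"
        by (simp_all add: gi_def gz_ops)
      consider "z = 1" | "z = - 1" | "z = gi" | "z = - gi" using z(1) by (auto simp: mu4_def)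
      then have "topgen {5, GZ 1 2} H \<or> topgen {5, GZ (- 1) (- 2)} H
         \<or> topgen {- 3, GZ 2 (- 1)} H \<or> topgen {- 3, GZ (- 2) 1} H"
        using t[of 5] t[of "- 3"] e by cases (simp_all only: mult_1 simp_thms)
      with mu show ?thesis by blast
    qed
  qed
qed

no_notation fps_nth (infixl "$" 75)

section \<open>Matrices over the 2-adic integers\<close>

lemma mat2_nth [simp]:
  "mat2 a b c d $ 1 $ 1 = a" "mat2 a b c d $ 1 $ 2 = b"
  "mat2 a b c d $ 2 $ 1 = c" "mat2 a b c d $ 2 $ 2 = d"
  by (simp_all add: mat2_def)

lemma mat22_eq_iff:
  fixes A B :: "'a ^ 2 ^ 2"
  shows "A = B \<longleftrightarrow> A $ 1 $ 1 = B $ 1 $ 1 \<and> A $ 1 $ 2 = B $ 1 $ 2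
    \<and> A $ 2 $ 1 = B $ 2 $ 1 \<and> A $ 2 $ 2 = B $ 2 $ 2"
  by (auto simp: vec_eq_iff forall_2)

lemma mat_nth2:
  "(mat a :: 'a::zero ^ 2 ^ 2) $ 1 $ 1 = a" "(mat a :: 'a::zero ^ 2 ^ 2) $ 2 $ 2 = a"
  "(mat a :: 'a::zero ^ 2 ^ 2) $ 1 $ 2 = 0" "(mat a :: 'a::zero ^ 2 ^ 2) $ 2 $ 1 = 0"
  by (simp_all add: mat_def)

lemma mat22_mult_nth:
  fixes A B :: "'a::semiring_1 ^ 2 ^ 2"
  shows "(A ** B) $ i $ j = A $ i $ 1 * B $ 1 $ j + A $ i $ 2 * B $ 2 $ j"
  by (simp add: matrix_matrix_mult_def sum_2)

text \<open>Multiplication by \<open>w\<close> in the basis 1, -i. The minus sign of the second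
  vector accounts for the signs in \<open>cartan\<close>.\<close>

definition gmat :: "gz \<Rightarrow> z2 ^ 2 ^ 2" where
  "gmat w = mat2 (re w) (im w) (- im w) (re w)"

lemma gmat_mult: "gmat (v * w) = gmat v ** gmat w"
  by (simp add: gmat_def mat22_eq_iff mat22_mult_nth gz_ops)

lemma gmat_GZ: "gmat (GZ a b) = mat2 a b (- b) a"
  by (simp add: gmat_def)

lemma gmat_scalar: "gmat (GZ a 0) = mat a"
  by (simp add: gmat_def mat22_eq_iff mat_nth2)

lemma gmat_one: "gmat 1 = mat 1"
  by (simp add: one_gz_def gmat_scalar)

lemma inj_gmat: "inj gmat"
  by (rule injI) (auto simp: gmat_def mat22_eq_iff gz.expand)

lemma invertible_gmat_iff: "invertible (gmat w) \<longleftrightarrow> w dvd 1"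
proof
  assume "invertible (gmat w)"
  then obtain B where "gmat w ** B = mat 1" by (auto simp: invertible_def)
  then have "det (gmat w) * det B = 1" by (metis det_mul det_I)
  then have d: "((re w)\<^sup>2 + (im w)\<^sup>2) * det B = 1" by (simp add: det_2 gmat_def power2_eq_square)
  have "w * (gcnj w * GZ (det B) 0) = 1"
    using d by (simp add: gcnj_def gz_ops power2_eq_square algebra_simps)
  then show "w dvd 1" by (metis dvdI)
next
  assume "w dvd 1"
  then obtain v where "w * v = 1" by (metis dvdE)
  then show "invertible (gmat w)"
    unfolding invertible_def by (metis gmat_mult gmat_one mult.commute)
qed

lemma gz_image_Collect: "{f (GZ a b) | a b. P (GZ a b)} = f ` {w. P w}"
proof (intro equalityI subsetI)
  fix x assume "x \<in> f ` {w. P w}"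
  then obtain w where "x = f w" "P w" by blast
  moreover have "w = GZ (re w) (im w)" by simp
  ultimately show "x \<in> {f (GZ a b) | a b. P (GZ a b)}" by (metis (mono_tags, lifting) mem_Collect_eq)
qed blast

lemma cartan_eq: "cartan = gmat ` {w. w dvd 1}"
proof -
  have "w dvd 1 \<longleftrightarrow> (re w)\<^sup>2 + (im w)\<^sup>2 dvd 1" for w
  proof
    assume "w dvd 1"
    then obtain v where "w * v = 1" by (metis dvdE)
    then have "(w * v) * gcnj (w * v) = 1" by (simp add: gcnj_def gz_ops)
    then have "(w * gcnj w) * (v * gcnj v) = 1" by (simp add: gcnj_mult mult_ac)
    then have "((re w)\<^sup>2 + (im w)\<^sup>2) * ((re v)\<^sup>2 + (im v)\<^sup>2) = 1"
      by (simp add: gcnj_def gz_ops power2_eq_square)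
    then show "(re w)\<^sup>2 + (im w)\<^sup>2 dvd 1" by (metis dvdI)
  next
    assume "(re w)\<^sup>2 + (im w)\<^sup>2 dvd 1"
    then obtain d where d: "((re w)\<^sup>2 + (im w)\<^sup>2) * d = 1" by (metis dvdE)
    have "w * (gcnj w * GZ d 0) = 1"
      using d by (simp add: gcnj_def gz_ops power2_eq_square algebra_simps)
    then show "w dvd 1" by (metis dvdI)
  qed
  from this[of "GZ _ _"] have iff: "GZ a b dvd 1 \<longleftrightarrow> a\<^sup>2 + b\<^sup>2 dvd 1" for a b by simp
  show ?thesis
    unfolding cartan_def gmat_GZ[symmetric] iff[symmetric] by (rule gz_image_Collect)
qed

lemma G1_eq: "G1 = gmat ` {w. w dvd 1}"
proof -
  have "\<not> 2 dvd a\<^sup>2 + b\<^sup>2" if "GZ a b dvd 1" for a b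
  proof -
    have "residue (a + b) 1 = 1"
      using that residue_1_cases by (auto simp: gz_unit_iff gpi_dvd_iff two_dvd_z2_iff)
    then show ?thesis
      using residue_1_cases[of a] residue_1_cases[of b]
      by (auto simp: two_dvd_z2_iff residue_ops power2_eq_square)
  qed
  then have iff: "gmat (GZ a b) \<in> carrier GL2 \<and> \<not> 2 dvd a\<^sup>2 + b\<^sup>2 \<longleftrightarrow> GZ a b dvd 1" for a b
    unfolding GL2_def using invertible_gmat_iff[of "GZ a b"] by auto
  show ?thesis
    unfolding G1_def gmat_GZ[symmetric] iff by (rule gz_image_Collect)
qed

lemma GL2_simps [simp]:
  "carrier GL2 = {A. invertible A}" "A \<otimes>\<^bsub>GL2\<^esub> B = A ** B" "\<one>\<^bsub>GL2\<^esub> = mat 1"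
  by (simp_all add: GL2_def)

lemma group_GL2: "Group.group GL2"
proof (rule groupI)
  fix A assume "A \<in> carrier GL2"
  then obtain B where "A ** B = mat 1" "B ** A = mat 1" by (auto simp: invertible_def)
  then show "\<exists>B\<in>carrier GL2. B \<otimes>\<^bsub>GL2\<^esub> A = \<one>\<^bsub>GL2\<^esub>" by (auto simp: invertible_def)
next
  show "\<one>\<^bsub>GL2\<^esub> \<in> carrier GL2" by (auto simp: invertible_def intro: exI[of _ "mat 1"])
qed (auto simp: matrix_mul_assoc invertible_mult)

lemma GL2_inv: "A ** B = mat 1 \<Longrightarrow> B ** A = mat 1 \<Longrightarrow> inv\<^bsub>GL2\<^esub> A = B"
  by (rule group.inv_equality[OF group_GL2]) (auto simp: invertible_def)

section \<open>The topology of GL2 in terms of congruences\<close>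

definition agree :: "nat \<Rightarrow> z2 ^ 2 ^ 2 \<Rightarrow> z2 ^ 2 ^ 2 \<Rightarrow> bool" where
  "agree n A B \<longleftrightarrow> (\<forall>i j. residue (A $ i $ j) n = residue (B $ i $ j) n)"

lemma agree_mono: "agree n A B \<Longrightarrow> m \<le> n \<Longrightarrow> agree m A B"
  unfolding agree_def using residue_eq_mono by blast

lemma open_residue: "open {y. residue y n = r}"
  unfolding open_z2_def by blast

lemma open_agree: "open {B. agree n A B}"
proof -
  have row: "open {v :: z2 ^ 2. \<forall>j. residue (v $ j) n = residue (a $ j) n}" for a
    unfolding open_vec_def
  proof (intro ballI)
    fix v assume "v \<in> {v :: z2 ^ 2. \<forall>j. residue (v $ j) n = residue (a $ j) n}"
    then show "\<exists>V. (\<forall>j. open (V j) \<and> v $ j \<in> V j)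
        \<and> (\<forall>y. (\<forall>j. y $ j \<in> V j) \<longrightarrow> y \<in> {v. \<forall>j. residue (v $ j) n = residue (a $ j) n})"
      by (intro exI[of _ "\<lambda>j. {y. residue y n = residue (a $ j) n}"]) (auto simp: open_residue)
  qed
  show ?thesis
  proof (subst open_vec_def, intro ballI)
    fix C assume "C \<in> {B. agree n A B}"
    then show "\<exists>V. (\<forall>i. open (V i) \<and> C $ i \<in> V i)
        \<and> (\<forall>B. (\<forall>i. B $ i \<in> V i) \<longrightarrow> B \<in> {B. agree n A B})"
      by (intro exI[of _ "\<lambda>i. {v. \<forall>j. residue (v $ j) n = residue (A $ i $ j) n}"])
        (auto simp: row agree_def)
  qed
qed

lemma open_contains_agree:
  assumes "open S" "A \<in> S"
  obtains n where "\<And>B. agree n A B \<Longrightarrow> B \<in> S"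
proof -
  obtain T where T: "\<And>i. open (T i)" "\<And>i. A $ i \<in> T i" "\<And>B. (\<And>i. B $ i \<in> T i) \<Longrightarrow> B \<in> S"
    using assms unfolding open_vec_def by metis
  have "\<exists>V. (\<forall>j. open (V j) \<and> A $ i $ j \<in> V j) \<and> (\<forall>v. (\<forall>j. v $ j \<in> V j) \<longrightarrow> v \<in> T i)" for i
    using T(1)[of i] T(2)[of i] unfolding open_vec_def by blast
  then obtain V where V: "\<And>i j. open (V i j)" "\<And>i j. A $ i $ j \<in> V i j"
    "\<And>i v. (\<And>j. v $ j \<in> V i j) \<Longrightarrow> v \<in> T i" by metis
  have "\<exists>n. \<forall>y. residue y n = residue (A $ i $ j) n \<longrightarrow> y \<in> V i j" for i j
    using V(1)[of i j] V(2)[of i j] unfolding open_z2_def by blast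
  then obtain N where N: "\<And>i j y. residue y (N i j) = residue (A $ i $ j) (N i j) \<Longrightarrow> y \<in> V i j"
    by metis
  define m where "m = Max (range (\<lambda>(i, j). N i j))"
  have m: "N i j \<le> m" for i j unfolding m_def by (intro Max_ge) (auto intro!: image_eqI[of _ _ "(i, j)"])
  have "B \<in> S" if B: "agree m A B" for B
  proof -
    have "B $ i $ j \<in> V i j" for i j
      using agree_mono[OF B m[of i j]] by (intro N) (simp add: agree_def)
    then show ?thesis using V(3) T(3) by blast
  qed
  then show ?thesis by (rule that)
qed

text \<open>Congruence classes modulo powers of 2 form a basis of the topology on matrices, so
  closedness becomes a statement about approximation.\<close>

lemma closedin_GL2_iff:
  assumes "H \<subseteq> carrier GL2"
  shows "closedin (top_of_set (carrier GL2)) H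
    \<longleftrightarrow> (\<forall>A\<in>carrier GL2. (\<forall>n. \<exists>B\<in>H. agree n A B) \<longrightarrow> A \<in> H)"
proof
  assume "closedin (top_of_set (carrier GL2)) H"
  then obtain T where T: "closed T" "H = carrier GL2 \<inter> T" by (auto simp: closedin_closed)
  show "\<forall>A\<in>carrier GL2. (\<forall>n. \<exists>B\<in>H. agree n A B) \<longrightarrow> A \<in> H"
  proof (intro ballI impI, rule ccontr)
    fix A assume A: "A \<in> carrier GL2" "\<forall>n. \<exists>B\<in>H. agree n A B" "A \<notin> H"
    then have "A \<in> - T" using T(2) by blast
    then obtain n where "\<And>B. agree n A B \<Longrightarrow> B \<in> - T"
      using open_contains_agree T(1) by (metis closed_def)
    then show False using A(2) T(2) by blast
  qed
next
  assume R: "\<forall>A\<in>carrier GL2. (\<forall>n. \<exists>B\<in>H. agree n A B) \<longrightarrow> A \<in> H"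
  define T where "T = {A. \<forall>n. \<exists>B\<in>H. agree n A B}"
  have "- T = (\<Union>n. \<Union>A\<in>{A. \<forall>B\<in>H. \<not> agree n A B}. {B. agree n A B})"
  proof (intro equalityI subsetI)
    fix A assume "A \<in> - T"
    then obtain n where "\<forall>B\<in>H. \<not> agree n A B" by (auto simp: T_def)
    moreover have "agree n A A" by (simp add: agree_def)
    ultimately show "A \<in> (\<Union>n. \<Union>A\<in>{A. \<forall>B\<in>H. \<not> agree n A B}. {B. agree n A B})" by blast
  next
    fix C assume "C \<in> (\<Union>n. \<Union>A\<in>{A. \<forall>B\<in>H. \<not> agree n A B}. {B. agree n A B})"
    then obtain n A where A: "\<forall>B\<in>H. \<not> agree n A B" "agree n A C" by blast
    then have "\<forall>B\<in>H. \<not> agree n C B" by (simp add: agree_def)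
    then show "C \<in> - T" by (auto simp: T_def)
  qed
  then have "open (- T)" by (auto intro: open_agree)
  then have "closed T" by (simp add: closed_def)
  moreover have "H = carrier GL2 \<inter> T"
    using R assms by (auto simp: T_def agree_def)
  ultimately show "closedin (top_of_set (carrier GL2)) H" by (auto simp: closedin_closed)
qed

definition closed_subgroup :: "(z2 ^ 2 ^ 2) set \<Rightarrow> bool" where
  "closed_subgroup H \<longleftrightarrow> subgroup H GL2 \<and> closedin (top_of_set (carrier GL2)) H"

lemma closed_gen_eqI:
  assumes "closed_subgroup H" "S \<subseteq> H" "\<And>Y. closed_subgroup Y \<Longrightarrow> S \<subseteq> Y \<Longrightarrow> H \<subseteq> Y"
  shows "H = closed_gen S"
  using assms unfolding closed_gen_def closed_subgroup_def by blast

lemma closed_subgroupI: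
  assumes "\<And>A. A \<in> H \<Longrightarrow> \<exists>B\<in>H. A ** B = mat 1 \<and> B ** A = mat 1" "mat 1 \<in> H"
    "\<And>A B. A \<in> H \<Longrightarrow> B \<in> H \<Longrightarrow> A ** B \<in> H"
    "\<And>A. invertible A \<Longrightarrow> (\<And>n. \<exists>B\<in>H. agree n A B) \<Longrightarrow> A \<in> H"
  shows "closed_subgroup H"
proof -
  have sub: "H \<subseteq> carrier GL2" using assms(1) by (auto simp: invertible_def)
  have "subgroup H GL2"
  proof (rule group.subgroupI[OF group_GL2 sub])
    show "inv\<^bsub>GL2\<^esub> A \<in> H" if "A \<in> H" for A
      using assms(1)[OF that] GL2_inv by auto
  qed (use assms in auto)
  moreover have "closedin (top_of_set (carrier GL2)) H"
    unfolding closedin_GL2_iff[OF sub] using assms(4) by simp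
  ultimately show ?thesis by (simp add: closed_subgroup_def)
qed

lemma closed_subgroupD:
  assumes "closed_subgroup H"
  shows "A \<in> H \<Longrightarrow> invertible A" "mat 1 \<in> H" "A \<in> H \<Longrightarrow> B \<in> H \<Longrightarrow> A ** B \<in> H"
    "A \<in> H \<Longrightarrow> A ** B = mat 1 \<Longrightarrow> B ** A = mat 1 \<Longrightarrow> B \<in> H"
    "invertible A \<Longrightarrow> (\<And>n. \<exists>B\<in>H. agree n A B) \<Longrightarrow> A \<in> H"
proof -
  have s: "subgroup H GL2" and c: "closedin (top_of_set (carrier GL2)) H"
    using assms by (simp_all add: closed_subgroup_def)
  note sub = subgroup.subset[OF s]
  show "A \<in> H \<Longrightarrow> invertible A" using sub by auto
  show "mat 1 \<in> H" using subgroup.one_closed[OF s] by simp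
  show "A \<in> H \<Longrightarrow> B \<in> H \<Longrightarrow> A ** B \<in> H" using subgroup.m_closed[OF s] by simp
  show "B \<in> H" if "A \<in> H" "A ** B = mat 1" "B ** A = mat 1"
    using subgroup.m_inv_closed[OF s that(1)] GL2_inv[OF that(2,3)] by simp
  show "A \<in> H" if i: "invertible A" and a: "\<And>n. \<exists>B\<in>H. agree n A B"
  proof -
    have "A \<in> carrier GL2" using i by simp
    then show ?thesis using c a unfolding closedin_GL2_iff[OF sub] by blast
  qed
qed

lemma agree_gmat: "agree n (gmat v) (gmat w) \<longleftrightarrow> 2 ^ n dvd v - w"
  unfolding agree_def gz_pow2_dvd_iff
  by (auto simp: forall_2 gmat_def residue_eq_iff_dvd gz_ops)
    (metis dvd_minus_iff minus_diff_eq)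

lemma closed_subgroup_gmat:
  assumes H: "closed_units H"
  shows "closed_subgroup (gmat ` H)"
proof (rule closed_subgroupI)
  fix A assume "A \<in> gmat ` H"
  then obtain w where w: "A = gmat w" "w \<in> H" by blast
  then obtain v where "v \<in> H" "w * v = 1" using closed_unitsD(3)[OF H] by blast
  then show "\<exists>B\<in>gmat ` H. A ** B = mat 1 \<and> B ** A = mat 1"
    using w by (metis gmat_mult gmat_one imageI mult.commute)
next
  show "mat 1 \<in> gmat ` H" using closed_unitsD(1)[OF H] gmat_one by (metis imageI)
next
  fix A B assume "A \<in> gmat ` H" "B \<in> gmat ` H"
  then show "A ** B \<in> gmat ` H" using closed_unitsD(2)[OF H] by (auto simp flip: gmat_mult)
next
  fix A assume A: "\<And>n. \<exists>B\<in>gmat ` H. agree n A B"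
  define w where "w = GZ (A $ 1 $ 1) (A $ 1 $ 2)"
  have "A $ 1 $ 1 = A $ 2 $ 2"
  proof (rule z2_eqI)
    fix n
    obtain v where "agree n A (gmat v)" using A by blast
    then show "residue (A $ 1 $ 1) n = residue (A $ 2 $ 2) n"
      by (simp add: agree_def forall_2 gmat_def)
  qed
  moreover have "- (A $ 1 $ 2) = A $ 2 $ 1"
  proof (rule z2_eqI)
    fix n
    obtain v where "agree n A (gmat v)" using A by blast
    then show "residue (- (A $ 1 $ 2)) n = residue (A $ 2 $ 1) n"
      by (simp add: agree_def forall_2 gmat_def residue_ops)
  qed
  ultimately have Aw: "A = gmat w" by (simp add: mat22_eq_iff gmat_def w_def)
  have "w \<in> H"
    by (rule closed_unitsD(4)[OF H]) (use A in \<open>auto simp: Aw agree_gmat\<close>)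
  then show "A \<in> gmat ` H" using Aw by blast
qed

lemma closed_units_vimage:
  assumes Y: "closed_subgroup Y"
  shows "closed_units {w. gmat w \<in> Y}"
  unfolding closed_units_def
proof (intro conjI ballI allI impI)
  show "1 \<in> {w. gmat w \<in> Y}" using closed_subgroupD(2)[OF Y] by (simp add: gmat_one)
  show "x * y \<in> {w. gmat w \<in> Y}" if "x \<in> {w. gmat w \<in> Y}" "y \<in> {w. gmat w \<in> Y}" for x y
    using that closed_subgroupD(3)[OF Y] by (simp add: gmat_mult)
  show "\<exists>y\<in>{w. gmat w \<in> Y}. x * y = 1" if x: "x \<in> {w. gmat w \<in> Y}" for x
  proof -
    have "x dvd 1" using closed_subgroupD(1)[OF Y] x by (simp flip: invertible_gmat_iff)
    then obtain y where y: "x * y = 1" by (metis dvdE)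
    then have "gmat x ** gmat y = mat 1" "gmat y ** gmat x = mat 1"
      by (metis gmat_mult gmat_one mult.commute)+
    then have "gmat y \<in> Y" using closed_subgroupD(4)[OF Y] x by blast
    then show ?thesis using y by blast
  qed
  show "x \<in> {w. gmat w \<in> Y}" if x: "\<forall>n. \<exists>g\<in>{w. gmat w \<in> Y}. 2 ^ n dvd x - g" for x
  proof -
    \<comment> \<open>A limit of units is a unit because it is congruent to one of them modulo 2;
      only then can closedness inside \<open>GL2\<close> be applied.\<close>
    obtain g where g: "gmat g \<in> Y" "2 ^ 1 dvd x - g" using x by blast
    have go: "\<not> gpi dvd g" using closed_subgroupD(1)[OF Y g(1)] by (simp add: invertible_gmat_iff gz_unit_iff)
    have "gpi dvd gpi ^ (2 * 1)" by (simp add: power2_eq_square)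
    then have "gpi dvd x - g" using g(2) dvd_trans unfolding pow2_dvd_iff_gpi by blast
    then have "\<not> gpi dvd x" using go by (metis dvd_diff diff_diff_eq2 add_diff_cancel_left')
    then have "invertible (gmat x)" by (simp add: invertible_gmat_iff gz_unit_iff)
    moreover have "\<exists>B\<in>Y. agree n (gmat x) B" for n using x agree_gmat by blast
    ultimately show ?thesis using closed_subgroupD(5)[OF Y] by blast
  qed
qed

section \<open>The index in the Cartan group\<close>

lemma card_mu4: "card mu4 = 4"
proof -
  have ne: "(1 :: z2) \<noteq> - 1"
  proof
    assume "(1 :: z2) = - 1"
    then have "(2 :: z2) * 1 = 0" by (metis add.right_inverse mult_2)
    then show False using z2_two_cancel by fastforce
  qed
  then have "- 1 \<noteq> (1 :: z2)" by metis
  with ne show ?thesis by (simp add: mu4_def gi_def gz_ops)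
qed

text \<open>Every coset of \<open>H\<close> in the unit group meets \<open>mu4\<close> by
  \<open>cov\<close>, and \<open>gmat\<close> is injective on sets of units.\<close>

lemma index_in_cartan_gmat:
  assumes H: "closed_units H" and cov: "\<And>x. x dvd 1 \<Longrightarrow> \<exists>z\<in>mu4. z * x \<in> H"
  shows "index_in_cartan (gmat ` H) = card ((\<lambda>z. (\<lambda>h. h * z) ` H) ` mu4)"
proof -
  define cos where "cos = (\<lambda>z. (\<lambda>h. h * z) ` H)"
  have co: "(gmat ` H) #>\<^bsub>GL2\<^esub> gmat w = gmat ` cos w" for w
    by (auto simp: r_coset_def GL2_def cos_def gmat_mult image_iff)
  have cos_eq: "cos (h * w) = cos w" if h: "h \<in> H" for h w
  proof (intro equalityI subsetI)
    fix x assume "x \<in> cos (h * w)"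
    then obtain g where "g \<in> H" "x = (g * h) * w" by (auto simp: cos_def mult.assoc)
    then show "x \<in> cos w" using closed_unitsD(2)[OF H _ h] by (auto simp: cos_def)
  next
    fix x assume "x \<in> cos w"
    then obtain g where g: "g \<in> H" "x = g * w" by (auto simp: cos_def)
    obtain k where k: "k \<in> H" "h * k = 1" using closed_unitsD(3)[OF H h] by blast
    have "(g * k) * (h * w) = g * (h * k) * w" by (simp only: mult_ac)
    then have "x = (g * k) * (h * w)" by (simp add: k(2) g(2))
    then show "x \<in> cos (h * w)" using closed_unitsD(2)[OF H g(1) k(1)] by (auto simp: cos_def)
  qed
  have units: "cos ` {w. w dvd 1} = cos ` mu4"
  proof (intro equalityI subsetI)
    fix C assume "C \<in> cos ` {w. w dvd 1}"
    then obtain w where w: "w dvd 1" "C = cos w" by blast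
    obtain z where z: "z \<in> mu4" "z * w \<in> H" using cov[OF w(1)] by blast
    obtain z' where z': "z' \<in> mu4" "z * z' = 1" using mu4_inverse[OF z(1)] by blast
    have "(z * w) * z' = (z * z') * w" by (simp only: mult_ac)
    then have "w = (z * w) * z'" by (simp add: z'(2))
    then have "C = cos z'" using cos_eq[OF z(2), of z'] w(2) by simp
    then show "C \<in> cos ` mu4" using z'(1) by blast
  next
    fix C assume "C \<in> cos ` mu4"
    moreover have "z dvd 1" if "z \<in> mu4" for z using mu4_inverse[OF that] by (metis dvdI)
    ultimately show "C \<in> cos ` {w. w dvd 1}" by blast
  qed
  have "rcosets\<^bsub>GL2\<lparr>carrier := cartan\<rparr>\<^esub> (gmat ` H) = (\<lambda>w. gmat ` cos w) ` {w. w dvd 1}"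
    unfolding RCOSETS_def by (simp add: cartan_eq co) blast
  also have "\<dots> = (\<lambda>C. gmat ` C) ` cos ` mu4" unfolding units[symmetric] by (simp add: image_image)
  finally have "index_in_cartan (gmat ` H) = card ((\<lambda>C. gmat ` C) ` cos ` mu4)"
    by (simp add: index_in_cartan_def)
  also have "\<dots> = card (cos ` mu4)"
    by (intro card_image inj_onI) (simp only: inj_image_eq_iff[OF inj_gmat])
  finally show ?thesis by (simp add: cos_def)
qed

lemma coset_eq_iff:
  assumes H: "closed_units H" and z: "z \<in> mu4" "z' \<in> mu4"
  shows "(\<lambda>h. h * z) ` H = (\<lambda>h. h * z') ` H \<longleftrightarrow> (\<exists>w\<in>mu4 \<inter> H. z = w * z')"
proof
  assume eq: "(\<lambda>h. h * z) ` H = (\<lambda>h. h * z') ` H"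
  have "1 * z \<in> (\<lambda>h. h * z) ` H" using closed_unitsD(1)[OF H] by blast
  then obtain h where h: "h \<in> H" "z = h * z'" using eq by auto
  obtain y where y: "y \<in> mu4" "z' * y = 1" using mu4_inverse[OF z(2)] by blast
  have "z * y = h" using h(2) y(2) by (simp add: mult.assoc)
  then have "h \<in> mu4" using mu4_mult[OF z(1) y(1)] by simp
  then show "\<exists>w\<in>mu4 \<inter> H. z = w * z'" using h by blast
next
  assume "\<exists>w\<in>mu4 \<inter> H. z = w * z'"
  then obtain w where w: "w \<in> H" "z = w * z'" by blast
  obtain v where v: "v \<in> H" "w * v = 1" using closed_unitsD(3)[OF H w(1)] by blast
  have "v * z = (w * v) * z'" by (simp only: w(2) mult_ac)
  then have z': "z' = v * z" by (simp add: v(2))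
  have "(\<lambda>h. h * (a * b)) ` H \<subseteq> (\<lambda>h. h * b) ` H" if a: "a \<in> H" for a b
  proof
    fix x assume "x \<in> (\<lambda>h. h * (a * b)) ` H"
    then obtain h where "h \<in> H" "x = (h * a) * b" by (auto simp: mult.assoc)
    then show "x \<in> (\<lambda>h. h * b) ` H" using closed_unitsD(2)[OF H _ a] by blast
  qed
  from this[OF w(1), of z', folded w(2)] this[OF v(1), of z, folded z']
  show "(\<lambda>h. h * z) ` H = (\<lambda>h. h * z') ` H" by (rule subset_antisym)
qed

text \<open>Two fourth roots of unity represent the same coset exactly when their quotient lies in
  \<open>H\<close>, so the index is that of \<open>mu4 \<inter> H\<close> in
  \<open>mu4\<close>.\<close>

lemma index_cases:
  assumes H: "closed_units H" and cov: "\<And>x. x dvd 1 \<Longrightarrow> \<exists>z\<in>mu4. z * x \<in> H"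
  shows "mu4 \<subseteq> H \<Longrightarrow> index_in_cartan (gmat ` H) = 1"
    "mu4 \<inter> H = {1, - 1} \<Longrightarrow> index_in_cartan (gmat ` H) = 2"
    "mu4 \<inter> H = {1} \<Longrightarrow> index_in_cartan (gmat ` H) = 4"
proof -
  define cos where "cos = (\<lambda>z. (\<lambda>h. h * z) ` H)"
  have ix: "index_in_cartan (gmat ` H) = card (cos ` mu4)"
    unfolding cos_def by (rule index_in_cartan_gmat[OF H cov])
  have ce: "cos z = cos z' \<longleftrightarrow> (\<exists>w\<in>mu4 \<inter> H. z = w * z')" if "z \<in> mu4" "z' \<in> mu4" for z z'
    unfolding cos_def by (rule coset_eq_iff[OF H that])
  have m1: "- 1 \<in> mu4" "- gi \<in> mu4" by (simp_all add: mu4_def)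
  show "index_in_cartan (gmat ` H) = 1" if mu: "mu4 \<subseteq> H"
  proof -
    have "cos z = cos 1" if z: "z \<in> mu4" for z
      unfolding ce[OF z mu4_one] using mu z by (intro bexI[of _ z]) auto
    then have "cos ` mu4 = {cos 1}" using mu4_one by blast
    then show ?thesis by (simp add: ix)
  qed
  show "index_in_cartan (gmat ` H) = 2" if mu: "mu4 \<inter> H = {1, - 1}"
  proof -
    have "cos (- 1) = cos 1" unfolding ce[OF m1(1) mu4_one] mu by simp
    moreover have "cos (- gi) = cos gi" unfolding ce[OF m1(2) mu4_gi] mu by simp
    ultimately have c: "cos ` mu4 = {cos gi, cos 1}" by (auto simp: mu4_def)
    have "gi \<noteq> 1" "gi \<noteq> - 1" by (simp_all add: gi_def gz_ops)
    then have "cos gi \<noteq> cos 1" unfolding ce[OF mu4_gi mu4_one] mu by simp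
    then show ?thesis by (simp add: ix c)
  qed
  show "index_in_cartan (gmat ` H) = 4" if mu: "mu4 \<inter> H = {1}"
  proof -
    have "inj_on cos mu4"
    proof (rule inj_onI)
      fix x y assume xy: "x \<in> mu4" "y \<in> mu4" and "cos x = cos y"
      then have "\<exists>w\<in>mu4 \<inter> H. x = w * y" using ce[OF xy] by blast
      then show "x = y" unfolding mu by simp
    qed
    then show ?thesis by (simp add: ix card_image card_mu4)
  qed
qed

section \<open>The group of points\<close>

text \<open>With a type of its own the set of points becomes an instance of
  \<open>ab_group_add\<close>.\<close>

typedef pt = "{P :: QQbar point. on_curve E0 P}" morphisms pnt Pt
  by (rule exI[of _ Infinity]) simp

setup_lifting type_definition_pt

instantiation pt :: ab_group_add
begin

lift_definition zero_pt :: pt is Infinity by simp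

lift_definition plus_pt :: "pt \<Rightarrow> pt \<Rightarrow> pt" is "point_add E0" by (rule on_curve_point_add)

lift_definition uminus_pt :: "pt \<Rightarrow> pt" is neg_point by (rule on_curve_neg)

lift_definition minus_pt :: "pt \<Rightarrow> pt \<Rightarrow> pt" is "\<lambda>P Q. point_add E0 P (neg_point Q)"
  by (intro on_curve_point_add on_curve_neg)

instance
proof
  fix P Q R :: pt
  show "P + Q + R = P + (Q + R)" by transfer (rule E0_add_assoc)
  show "P + Q = Q + P" by transfer (rule E0_add_commute)
  show "0 + P = P" by transfer simp
  show "- P + P = 0" by transfer (rule E0_add_neg)
  show "P - Q = P + - Q" by transfer simp
qed

end

lemma on_curve_pnt: "on_curve E0 (pnt P)"
  using pnt[of P] by simp

lemma pnt_eqI: "pnt P = pnt Q \<Longrightarrow> P = Q"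
  by (simp add: pnt_inject)

lemma pnt_eq_Infinity_iff: "pnt P = Infinity \<longleftrightarrow> P = 0"
  by (metis pnt_inject zero_pt.rep_eq)

section \<open>Multiplication by i on the curve\<close>

definition qi :: QQbar where
  "qi = (SOME z. z ^ 2 = - 1)"

lemma qi_sq: "qi * qi = - 1"
proof -
  have "\<exists>z :: QQbar. z ^ 2 = - 1" by (rule nth_root_exists) simp
  then have "qi ^ 2 = - 1" unfolding qi_def by (rule someI_ex)
  then show ?thesis by (simp add: power2_eq_square)
qed

lemma qi_neq_0: "qi \<noteq> 0"
  using qi_sq by auto

text \<open>The automorphisms \<open>(x, y) \<mapsto> (u\<^sup>2 x, u\<^sup>3 y)\<close> with \<open>u\<^sup>4 = 1\<close>.\<close>

fun scale_point :: "'a::field \<Rightarrow> 'a point \<Rightarrow> 'a point" where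
  "scale_point u Infinity = Infinity"
| "scale_point u (Affine x y) = Affine (u\<^sup>2 * x) (u ^ 3 * y)"

lemma on_curve_scale:
  assumes "u ^ 4 = 1" "on_curve E0 P"
  shows "on_curve E0 (scale_point u P)"
proof (cases P)
  case (Affine x y)
  have y: "y\<^sup>2 = x ^ 3 + x" using assms(2) by (simp add: Affine)
  have u6: "u ^ 6 = u\<^sup>2" using assms(1) power_add[of u 4 2] by simp
  have "(u ^ 3 * y)\<^sup>2 = u ^ 6 * y\<^sup>2" by (simp add: power_mult_distrib flip: power_mult)
  also have "\<dots> = u ^ 6 * x ^ 3 + u ^ 6 * x" by (simp add: y distrib_left)
  also have "\<dots> = (u\<^sup>2 * x) ^ 3 + u\<^sup>2 * x" by (simp add: power_mult_distrib u6 flip: power_mult)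
  finally show ?thesis by (simp add: Affine)
qed simp

text \<open>The slope of a chord or tangent is multiplied by u. For the tangent this uses u^4 = 1,
  which also keeps the coefficient of x unchanged.\<close>

lemma scale_point_add:
  fixes u :: "'a::field_char_0"
  assumes u: "u ^ 4 = 1"
  shows "scale_point u (point_add E0 P Q) = point_add E0 (scale_point u P) (scale_point u Q)"
proof (cases "P = Infinity \<or> Q = Infinity")
  case False
  then obtain x1 y1 x2 y2 where PQ: "P = Affine x1 y1" "Q = Affine x2 y2" by (metis point.exhaust)
  have u0: "u \<noteq> 0" using u by auto
  have uu: "u * u ^ 3 = 1" using u by (simp add: numeral_eq_Suc)
  have iff: "(u\<^sup>2 * x1 = u\<^sup>2 * x2 \<and> u ^ 3 * y1 + u ^ 3 * y2 = 0) \<longleftrightarrow> (x1 = x2 \<and> y1 + y2 = 0)"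
    using u0 by (simp flip: distrib_left)
  show ?thesis
  proof (cases "x1 = x2 \<and> y1 + y2 = 0")
    case True
    then show ?thesis using iff by (simp add: PQ)
  next
    case ne: False
    define l where "l = (if x1 = x2 then (3 * x1\<^sup>2 + 1) / (2 * y1) else (y2 - y1) / (x2 - x1))"
    define l' where "l' = (if u\<^sup>2 * x1 = u\<^sup>2 * x2 then (3 * (u\<^sup>2 * x1)\<^sup>2 + 1) / (2 * (u ^ 3 * y1))
      else (u ^ 3 * y2 - u ^ 3 * y1) / (u\<^sup>2 * x2 - u\<^sup>2 * x1))"
    have l': "l' = u * l"
    proof (cases "x1 = x2")
      case True
      have "(u\<^sup>2 * x1)\<^sup>2 = x1\<^sup>2" by (simp add: power_mult_distrib u flip: power_mult)
      then have "l' = (3 * x1\<^sup>2 + 1) / (2 * (u ^ 3 * y1))" by (simp add: l'_def True)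
      also have "\<dots> = u * (3 * x1\<^sup>2 + 1) / ((u * u ^ 3) * (2 * y1))" using u0 by (simp add: mult_ac)
      finally show ?thesis by (simp add: uu l_def True)
    next
      case False
      have "l' = (u\<^sup>2 * (u * (y2 - y1))) / (u\<^sup>2 * (x2 - x1))"
        using u0 False by (simp add: l'_def right_diff_distrib power2_eq_square power3_eq_cube mult.assoc)
      also have "\<dots> = u * (y2 - y1) / (x2 - x1)" using u0 by simp
      finally show ?thesis by (simp add: l_def False)
    qed
    have a: "point_add E0 P Q = Affine (l\<^sup>2 - x1 - x2) (- l * (l\<^sup>2 - x1 - x2) - (y1 - l * x1))"
      unfolding PQ point_add.simps l_def weierstrass.sel Let_def using ne by simp
    have b: "point_add E0 (scale_point u P) (scale_point u Q)
      = Affine (l'\<^sup>2 - u\<^sup>2 * x1 - u\<^sup>2 * x2)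
         (- l' * (l'\<^sup>2 - u\<^sup>2 * x1 - u\<^sup>2 * x2) - (u ^ 3 * y1 - l' * (u\<^sup>2 * x1)))"
    proof -
      have "\<not> (u\<^sup>2 * x1 = u\<^sup>2 * x2 \<and> u ^ 3 * y1 + u ^ 3 * y2 + 0 * (u\<^sup>2 * x2) + 0 = 0)"
        using iff ne by simp
      then show ?thesis
        unfolding PQ scale_point.simps point_add.simps weierstrass.sel Let_def l'_def
        by (simp only: if_False mult_zero_left add_0_right diff_0_right mult_zero_right)
    qed
    show ?thesis
      unfolding a b l' by (simp add: algebra_simps power2_eq_square power3_eq_cube)
  qed
next
  case True
  then show ?thesis by (cases P; cases Q) simp_all
qed

definition smap :: "QQbar \<Rightarrow> pt \<Rightarrow> pt" where
  "smap u P = Pt (scale_point u (pnt P))"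

lemma pnt_smap: "u ^ 4 = 1 \<Longrightarrow> pnt (smap u P) = scale_point u (pnt P)"
  unfolding smap_def by (rule Pt_inverse) (simp add: on_curve_scale on_curve_pnt)

lemma smap_add: "u ^ 4 = 1 \<Longrightarrow> smap u (P + Q) = smap u P + smap u Q"
  by (intro pnt_eqI) (simp add: pnt_smap plus_pt.rep_eq scale_point_add)

lemma smap_smap:
  assumes "u ^ 4 = 1" "v ^ 4 = 1"
  shows "smap u (smap v P) = smap (u * v) P"
proof (rule pnt_eqI)
  have "(u * v) ^ 4 = 1" using assms by (simp add: power_mult_distrib)
  then show "pnt (smap u (smap v P)) = pnt (smap (u * v) P)"
    using assms by (cases "pnt P") (simp_all add: pnt_smap power_mult_distrib)
qed

lemma smap_1: "smap 1 P = P"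
  by (intro pnt_eqI, cases "pnt P") (simp_all add: pnt_smap)

lemma smap_m1: "smap (- 1) P = - P"
  by (intro pnt_eqI, cases "pnt P") (simp_all add: pnt_smap uminus_pt.rep_eq)

text \<open>The sign makes this the map from (x, y) to (-x, i y).\<close>

definition iop :: "pt \<Rightarrow> pt" where
  "iop = smap (- qi)"

lemma qi_pow: "qi\<^sup>2 = - 1" "qi ^ 3 = - qi" "qi ^ 4 = 1"
  by (simp_all add: power2_eq_square qi_sq numeral_eq_Suc)

lemma pow4_eq_1:
  fixes u :: QQbar
  assumes "u ^ 4 = 1"
  shows "u = 1 \<or> u = - 1 \<or> u = qi \<or> u = - qi"
proof -
  have "(u - 1) * ((u + 1) * ((u - qi) * (u + qi))) = (u\<^sup>2 - 1) * (u\<^sup>2 - qi * qi)"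
    by (simp add: algebra_simps power2_eq_square)
  also have "\<dots> = u ^ 4 - 1" by (simp add: qi_sq algebra_simps flip: power_mult power_add)
  finally have "(u - 1) * ((u + 1) * ((u - qi) * (u + qi))) = 0" using assms by simp
  then show ?thesis by (simp add: eq_neg_iff_add_eq_0)
qed

lemma iop_add: "iop (P + Q) = iop P + iop Q"
  unfolding iop_def by (rule smap_add) (simp add: qi_pow)

lemma iop_iop: "iop (iop P) = - P"
  unfolding iop_def by (subst smap_smap) (simp_all add: qi_pow qi_sq smap_m1)

lemma pnt_iop: "pnt P = Affine x y \<Longrightarrow> pnt (iop P) = Affine (- x) (qi * y)"
  unfolding iop_def by (simp add: pnt_smap qi_pow)

lemma iop_0: "iop 0 = 0"
  using iop_add[of 0 0] by simp

lemma iop_minus: "iop (- P) = - iop P"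
  using iop_add[of P "- P"] by (simp add: iop_0 eq_neg_iff_add_eq_0 add.commute)

lemma smap_qi: "smap qi P = - iop P"
proof -
  have "smap (- 1) (smap (- qi) P) = smap qi P" by (subst smap_smap) (simp_all add: qi_pow)
  then show ?thesis by (simp add: smap_m1 iop_def)
qed

section \<open>Multiplication by 1 + i\<close>

definition piop :: "pt \<Rightarrow> pt" where
  "piop P = P + iop P"

lemma piop_0: "piop 0 = 0"
  by (simp add: piop_def iop_0)

lemma iop_piop: "iop (piop P) = piop (iop P)"
  by (simp add: piop_def iop_add)

lemma piop_piop: "piop (piop P) = iop P + iop P"
  by (simp add: piop_def iop_add iop_iop)

text \<open>The chord joins (x, y) and (-x, i y). The abscissas cancel, so the new one is the square
  of the slope l, where 2 x l = (1 - i) y.\<close>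

lemma pnt_piop:
  assumes P: "pnt P = Affine x y" and x: "x \<noteq> 0"
  obtains b where "pnt (piop P) = Affine ((x\<^sup>2 + 1) / (2 * qi * x)) b"
proof -
  have y: "y\<^sup>2 = x ^ 3 + x" using on_curve_pnt[of P] by (simp add: P)
  define l where "l = (qi * y - y) / (- x - x)"
  have d: "- x - x = - (2 * x)" by (simp only: mult_2 minus_add_distrib diff_conv_add_uminus)
  have "2 * x \<noteq> 0" using x by simp
  have ne: "x \<noteq> - x"
  proof
    assume "x = - x"
    then have "2 * x = 0" by (simp only: mult_2 eq_neg_iff_add_eq_0)
    with \<open>2 * x \<noteq> 0\<close> show False ..
  qed
  have add: "pnt (piop P) = Affine (l\<^sup>2 - x - (- x)) (- l * (l\<^sup>2 - x - (- x)) - (y - l * x))"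
    unfolding piop_def plus_pt.rep_eq P pnt_iop[OF P] point_add.simps weierstrass.sel Let_def l_def
    by (simp only: ne simp_thms if_False mult_zero_left add_0_right diff_0_right)
  have "l * (- (2 * x)) = qi * y - y" using \<open>2 * x \<noteq> 0\<close> unfolding l_def d by simp
  then have l: "l * (2 * x) = (1 - qi) * y" by (simp add: algebra_simps)
  have "(l\<^sup>2 * (2 * qi * x)) * (2 * x) = qi * ((l * (2 * x)) * (l * (2 * x)))"
    by (simp only: power2_eq_square mult_ac)
  also have "\<dots> = (qi * ((1 - qi) * (1 - qi))) * y\<^sup>2"
    unfolding l by (simp only: power2_eq_square mult_ac)
  \<comment> \<open>Since (1 - i)^2 = -2 i.\<close>
  also have "qi * ((1 - qi) * (1 - qi)) = 2"
  proof -
    have "qi * ((1 - qi) * (1 - qi)) = qi - 2 * (qi * qi) + qi * (qi * qi)"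
      by (simp add: algebra_simps)
    then show ?thesis unfolding qi_sq by simp
  qed
  also have "2 * y\<^sup>2 = (x\<^sup>2 + 1) * (2 * x)"
    unfolding y by (simp add: power2_eq_square power3_eq_cube algebra_simps)
  finally have "l\<^sup>2 * (2 * qi * x) = x\<^sup>2 + 1"
    using \<open>2 * x \<noteq> 0\<close> by (simp only: mult_cancel_right simp_thms)
  then have "l\<^sup>2 = (x\<^sup>2 + 1) / (2 * qi * x)" using x qi_neq_0 by (simp add: eq_divide_eq)
  then show ?thesis using that add by simp
qed

definition P0 :: pt where "P0 = Pt (Affine 0 0)"

lemma pnt_P0: "pnt P0 = Affine 0 0"
  unfolding P0_def by (rule Pt_inverse) simp

lemma pnt_x_0: "pnt P = Affine 0 y \<Longrightarrow> P = P0"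
  using on_curve_pnt[of P] by (intro pnt_eqI) (simp add: pnt_P0)

text \<open>By the formula for the abscissa, only x = 0 can lead to the point at infinity.\<close>

lemma piop_eq_0:
  assumes "piop P = 0"
  shows "P = 0 \<or> P = P0"
proof (cases "pnt P")
  case Infinity
  then show ?thesis by (simp add: pnt_eq_Infinity_iff)
next
  case (Affine x y)
  show ?thesis
  proof (cases "x = 0")
    case True
    then show ?thesis using Affine pnt_x_0 by simp
  next
    case False
    then obtain b where "pnt (piop P) = Affine ((x\<^sup>2 + 1) / (2 * qi * x)) b" using pnt_piop[OF Affine] by blast
    then show ?thesis using assms by (simp add: zero_pt.rep_eq)
  qed
qed

lemma iop_P0: "iop P0 = P0"
  by (intro pnt_eqI) (simp add: pnt_iop[OF pnt_P0] pnt_P0)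

lemma pt_same_x:
  assumes "pnt P = Affine x y" "pnt Q = Affine x z"
  shows "Q = P \<or> Q = - P"
proof -
  have "y\<^sup>2 = z\<^sup>2" using on_curve_pnt[of P] on_curve_pnt[of Q] assms by simp
  then have "z = y \<or> z = - y" by (auto simp: power2_eq_iff)
  then show ?thesis using assms by (auto intro!: pnt_eqI simp: uminus_pt.rep_eq)
qed

lemma piop_surj: "\<exists>P. piop P = Q"
proof (cases "pnt Q")
  case Infinity
  then show ?thesis using piop_0 by (metis pnt_eq_Infinity_iff)
next
  case (Affine a b)
  \<comment> \<open>The abscissa wanted is a root of x^2 - 2 i a x + 1, and \<open>r ^ 2\<close> is
    a quarter of its discriminant.\<close>
  obtain r :: QQbar where r: "r ^ 2 = - (a\<^sup>2) - 1" using nth_root_exists[of 2] by auto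
  define x where "x = qi * a + r"
  have "(x - qi * a)\<^sup>2 = x\<^sup>2 - 2 * qi * x * a + (qi * qi) * a\<^sup>2" by (simp add: power2_eq_square algebra_simps)
  then have x: "x\<^sup>2 + 1 = 2 * qi * x * a" using r by (simp add: x_def qi_sq algebra_simps)
  then have x0: "x \<noteq> 0" by auto
  obtain y :: QQbar where y: "y ^ 2 = x ^ 3 + x" using nth_root_exists[of 2] by auto
  define P where "P = Pt (Affine x y)"
  have P: "pnt P = Affine x y" unfolding P_def by (rule Pt_inverse) (simp add: y)
  obtain b' where "pnt (piop P) = Affine ((x\<^sup>2 + 1) / (2 * qi * x)) b'" using pnt_piop[OF P x0] by blast
  moreover have "(x\<^sup>2 + 1) / (2 * qi * x) = a" unfolding x using x0 qi_neq_0 by simp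
  \<comment> \<open>The abscissa determines the point only up to sign, which is repaired by passing
    to \<open>- P\<close>.\<close>
  ultimately have "Q = piop P \<or> Q = - piop P" using pt_same_x[OF _ Affine] by simp
  moreover have "piop (- P) = - piop P" by (simp add: piop_def iop_minus)
  ultimately have "piop P = Q \<or> piop (- P) = Q" by auto
  then show ?thesis by blast
qed

section \<open>The Tate module as a module over \<open>\<int>\<^sub>2[i]\<close>\<close>

primrec nsc :: "nat \<Rightarrow> 'a::ab_group_add \<Rightarrow> 'a" where
  "nsc 0 x = 0"
| "nsc (Suc n) x = x + nsc n x"

definition zsc :: "int \<Rightarrow> 'a::ab_group_add \<Rightarrow> 'a" where
  "zsc k x = nsc (nat k) x - nsc (nat (- k)) x"

lemma zsc_0 [simp]: "zsc 0 x = 0"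
  by (simp add: zsc_def)

lemma zsc_step: "zsc (k + 1) x = zsc k x + x"
proof (cases "k \<ge> 0")
  case True
  then have "nat (k + 1) = Suc (nat k)" "nat (- (k + 1)) = 0" "nat (- k) = 0" by simp_all
  then show ?thesis by (simp only: zsc_def nsc.simps) simp
next
  case False
  then have "nat (- k) = Suc (nat (- (k + 1)))" "nat k = 0" "nat (k + 1) = 0" by simp_all
  then show ?thesis by (simp only: zsc_def nsc.simps) simp
qed

lemma zsc_1 [simp]: "zsc 1 x = x"
  using zsc_step[of 0 x] by simp

lemma zsc_add: "zsc (k + l) x = zsc k x + zsc l x"
proof (induction l rule: int_induct[where k = 0])
  case (step1 l)
  then show ?case using zsc_step[of "k + l" x] zsc_step[of l x] by (simp add: add.assoc)
next
  case (step2 l)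
  then show ?case using zsc_step[of "k + (l - 1)" x] zsc_step[of "l - 1" x]
    by (simp add: add.assoc algebra_simps)
qed simp

lemma zsc_minus: "zsc (- k) x = - zsc k x"
  using zsc_add[of k "- k" x] by (simp add: eq_neg_iff_add_eq_0 add.commute)

lemma zsc_diff: "zsc (k - l) x = zsc k x - zsc l x"
  using zsc_add[of k "- l" x] by (simp add: zsc_minus)

lemma zsc_2: "zsc 2 x = x + x"
  using zsc_add[of 1 1 x] by simp

lemma zsc_mult: "zsc (k * l) x = zsc k (zsc l x)"
  by (induction k rule: int_induct[where k = 0])
    (simp_all add: distrib_right left_diff_distrib zsc_add zsc_diff)

lemma zsc_hom:
  assumes "\<And>x y. f (x + y) = f x + f y"
  shows "f (zsc k x) = zsc k (f x)"
proof -
  have 0: "f 0 = 0" using assms[of 0 0] by simp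
  have "f (x - y) = f x - f y" for x y using assms[of "x - y" y] by simp
  then show ?thesis
    by (induction k rule: int_induct[where k = 0]) (simp_all add: 0 assms zsc_add zsc_diff)
qed

lemma zsc_add_right: "zsc k (x + y) = zsc k x + zsc k y"
  by (induction k rule: int_induct[where k = 0]) (simp_all add: zsc_add zsc_diff algebra_simps)

lemma zsc_0_right [simp]: "zsc k 0 = 0"
  using zsc_add_right[of k 0 0] by simp

lemma zsc_minus_right: "zsc k (- x) = - zsc k x"
  using zsc_add_right[of k x "- x"] by (simp add: eq_neg_iff_add_eq_0 add.commute)

lemma zsc_cong:
  assumes "zsc m x = 0" "m dvd k - l"
  shows "zsc k x = zsc l x"
proof -
  obtain q where "k - l = q * m" using assms(2) by (metis dvd_def mult.commute)
  then have "zsc (k - l) x = 0" using assms(1) by (simp add: zsc_mult)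
  then show ?thesis by (simp add: zsc_diff)
qed

lemma iop_zsc: "iop (zsc k P) = zsc k (iop P)"
  by (rule zsc_hom) (rule iop_add)

text \<open>The action of the Gaussian integer a + b i, with \<open>iop\<close> in the role of
  i.\<close>

definition gsc :: "int \<Rightarrow> int \<Rightarrow> pt \<Rightarrow> pt" where
  "gsc a b P = zsc a P + iop (zsc b P)"

lemma gsc_add: "gsc (a + c) (b + d) P = gsc a b P + gsc c d P"
  by (simp add: gsc_def zsc_add iop_add algebra_simps)

lemma gsc_diff: "gsc (a - c) (b - d) P = gsc a b P - gsc c d P"
  using gsc_add[of "a - c" c "b - d" d P] by (simp add: algebra_simps)

lemma gsc_add_right: "gsc a b (P + Q) = gsc a b P + gsc a b Q"
  by (simp add: gsc_def zsc_add_right iop_add algebra_simps)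

lemma gsc_0_right: "gsc a b 0 = 0"
  by (simp add: gsc_def iop_0)

lemma gsc_gsc: "gsc a b (gsc c d P) = gsc (a * c - b * d) (a * d + b * c) P"
  by (simp add: gsc_def zsc_add_right iop_add zsc_add zsc_diff zsc_mult iop_zsc iop_iop
      zsc_minus_right algebra_simps)

lemma gsc_mult: "gsc (a * m) (b * m) P = gsc a b (zsc m P)"
  by (simp add: gsc_def zsc_mult)

lemma gsc_cong:
  "zsc m P = 0 \<Longrightarrow> m dvd a - c \<Longrightarrow> m dvd b - d \<Longrightarrow> gsc a b P = gsc c d P"
  unfolding gsc_def using zsc_cong[of m P] by metis

lemma gsc_hom:
  assumes "\<And>P Q. f (P + Q) = f P + f Q" "\<And>P. f (iop P) = iop (f P)"
  shows "f (gsc a b P) = gsc a b (f P)"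
  by (simp add: gsc_def assms zsc_hom[of f, OF assms(1)])

lemma gsc_antihom:
  assumes "\<And>P Q. f (P + Q) = f P + f Q" "\<And>P. f (iop P) = - iop (f P)"
  shows "f (gsc a b P) = gsc a (- b) (f P)"
  by (simp add: gsc_def assms zsc_hom[of f, OF assms(1)] zsc_minus iop_minus)

text \<open>A generator of the 2-torsion over Z[i]: it is killed by 2, whereas 1 + i sends it to the
  nonzero point \<open>P0\<close>.\<close>

definition E1 :: pt where "E1 = Pt (Affine qi 0)"

lemma pnt_E1: "pnt E1 = Affine qi 0"
  unfolding E1_def by (rule Pt_inverse) (simp add: qi_pow)

lemma pnt_iop_E1: "pnt (iop E1) = Affine (- qi) 0"
  using pnt_iop[OF pnt_E1] by simp

lemma qi_neq_neg: "qi \<noteq> - qi"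
proof
  assume "qi = - qi"
  then have "2 * qi = 0" by (simp only: mult_2 eq_neg_iff_add_eq_0)
  then show False using qi_neq_0 by simp
qed

lemma E1_double: "E1 + E1 = 0"
  by (intro pnt_eqI) (simp add: plus_pt.rep_eq pnt_E1 zero_pt.rep_eq)

lemma piop_E1: "E1 + iop E1 = P0"
  using qi_neq_neg by (intro pnt_eqI) (simp add: plus_pt.rep_eq pnt_E1 pnt_iop_E1 pnt_P0 Let_def)

lemma two_torsion:
  assumes "P + P = 0"
  obtains "P = 0" | "P = E1" | "P = iop E1" | "P = E1 + iop E1"
proof (cases "pnt P")
  case Infinity
  then show ?thesis using that(1) by (simp add: pnt_eq_Infinity_iff)
next
  case (Affine x y)
  have "P = - P" using assms by (simp add: eq_neg_iff_add_eq_0)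
  then have "pnt P = neg_point (pnt P)" by (metis uminus_pt.rep_eq)
  then have "y = - y" by (simp add: Affine)
  then have "2 * y = 0" by (simp only: mult_2 eq_neg_iff_add_eq_0)
  then have y: "y = 0" by simp
  then have "x ^ 3 + x = 0" using on_curve_pnt[of P] by (simp add: Affine)
  moreover have "x * ((x - qi) * (x + qi)) = x ^ 3 - (qi * qi) * x"
    by (simp add: power3_eq_cube algebra_simps)
  ultimately have "x * ((x - qi) * (x + qi)) = 0" unfolding qi_sq by simp
  then have "x = 0 \<or> x = qi \<or> x = - qi" by (simp add: eq_neg_iff_add_eq_0)
  then have "P = P0 \<or> P = E1 \<or> P = iop E1"
    using Affine y by (auto intro!: pnt_eqI simp: pnt_P0 pnt_E1 pnt_iop_E1)
  then show ?thesis using that(2-4) by (auto simp: piop_E1)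
qed

lemma gsc_E1_span:
  assumes "P + P = 0"
  obtains a b where "P = gsc a b E1"
proof -
  have g: "gsc 0 0 E1 = 0" "gsc 1 0 E1 = E1" "gsc 0 1 E1 = iop E1" "gsc 1 1 E1 = E1 + iop E1"
    by (simp_all add: gsc_def iop_0)
  show ?thesis
  proof (cases rule: two_torsion[OF assms])
    case 1
    then show ?thesis using that[of 0 0] g by simp
  next
    case 2
    then show ?thesis using that[of 1 0] g by simp
  next
    case 3
    then show ?thesis using that[of 0 1] g by simp
  next
    case 4
    then show ?thesis using that[of 1 1] g by simp
  qed
qed

lemma gsc_E1_eq_0:
  assumes "gsc a b E1 = 0"
  shows "even a \<and> even b"
proof -
  have two: "zsc 2 E1 = 0" by (simp add: zsc_2 E1_double)
  have ne: "E1 \<noteq> 0" "iop E1 \<noteq> 0" "E1 + iop E1 \<noteq> 0"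
    by (simp_all add: piop_E1 pnt_E1 pnt_iop_E1 pnt_P0 flip: pnt_eq_Infinity_iff)
  have "gsc (a mod 2) (b mod 2) E1 = 0"
    using assms gsc_cong[OF two, of "a mod 2" a "b mod 2" b] by (simp add: mod_eq_dvd_iff[symmetric])
  moreover have "a mod 2 = 0 \<or> a mod 2 = 1" "b mod 2 = 0 \<or> b mod 2 = 1" by presburger+
  ultimately show ?thesis
    using ne by (auto simp: gsc_def iop_0 even_iff_mod_2_eq_zero)
qed

text \<open>Up to the unit i, doubling is two applications of the surjective map
  \<open>piop\<close>.\<close>

lemma two_divisible: "\<exists>P :: pt. P + P = Q"
proof -
  obtain R where "piop R = Q" using piop_surj by blast
  moreover obtain S where "piop S = R" using piop_surj by blast
  ultimately have "iop S + iop S = Q" using piop_piop by metis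
  then show ?thesis by blast
qed

section \<open>Compatible sequences and their structure over Z_2[i]\<close>

definition tate_seq :: "(nat \<Rightarrow> pt) \<Rightarrow> bool" where
  "tate_seq t \<longleftrightarrow> t 0 = 0 \<and> (\<forall>n. t (Suc n) + t (Suc n) = t n)"

lemma tate_seq_torsion: "tate_seq t \<Longrightarrow> zsc (2 ^ n) (t n) = 0"
proof (induction n)
  case (Suc n)
  have "zsc (2 ^ Suc n) (t (Suc n)) = zsc (2 ^ n) (zsc 2 (t (Suc n)))"
    by (simp add: mult.commute flip: zsc_mult)
  also have "zsc 2 (t (Suc n)) = t n" using Suc.prems by (simp add: zsc_2 tate_seq_def)
  finally show ?case using Suc by simp
qed (simp add: tate_seq_def)

lemma tate_seq_descend: "tate_seq t \<Longrightarrow> zsc (2 ^ n) (t (Suc n)) = t 1"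
proof (induction n)
  case (Suc n)
  have "zsc (2 ^ Suc n) (t (Suc (Suc n))) = zsc (2 ^ n) (zsc 2 (t (Suc (Suc n))))"
    by (simp add: mult.commute flip: zsc_mult)
  also have "zsc 2 (t (Suc (Suc n))) = t (Suc n)" using Suc.prems by (simp add: zsc_2 tate_seq_def)
  finally show ?case using Suc by simp
qed simp

lemma tate_generator_exists: "\<exists>e. tate_seq e \<and> e 1 = E1"
proof -
  define f where "f = (\<lambda>Q :: pt. SOME P. P + P = Q)"
  have f: "f Q + f Q = Q" for Q unfolding f_def using two_divisible by (rule someI_ex)
  define e where "e = (\<lambda>n. case n of 0 \<Rightarrow> 0 | Suc k \<Rightarrow> (f ^^ k) E1)"
  have "e (Suc n) + e (Suc n) = e n" for n
    by (cases n) (simp_all add: e_def E1_double f)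
  then have "tate_seq e" by (simp add: tate_seq_def e_def)
  moreover have "e 1 = E1" by (simp add: e_def)
  ultimately show ?thesis by blast
qed

locale tate_gen =
  fixes e :: "nat \<Rightarrow> pt"
  assumes seq: "tate_seq e" and first: "e 1 = E1"
begin

text \<open>The double of P is a multiple of \<open>e n\<close> and lifts to a multiple Q of
  \<open>e (Suc n)\<close>. Then P - Q is 2-torsion, so a multiple of \<open>E1\<close>, which is
  \<open>2 ^ n\<close> times \<open>e (Suc n)\<close>. With \<open>gsc_eq_0\<close> this makes the
  2^n-torsion free of rank one over Z[i]/2^n.\<close>

lemma gsc_span: "zsc (2 ^ n) P = 0 \<Longrightarrow> \<exists>a b. P = gsc a b (e n)"
proof (induction n arbitrary: P)
  case 0
  then have "P = gsc 0 0 (e 0)" by (simp add: gsc_def iop_0)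
  then show ?case by blast
next
  case (Suc n)
  have "zsc (2 ^ n) (P + P) = 0"
  proof -
    have "zsc (2 ^ n) (P + P) = zsc (2 ^ n * 2) P" by (simp only: zsc_mult zsc_2)
    then show ?thesis using Suc.prems by (simp add: mult.commute)
  qed
  then obtain a b where ab: "P + P = gsc a b (e n)" using Suc.IH by blast
  define Q where "Q = gsc a b (e (Suc n))"
  have "Q + Q = gsc a b (e n)" using seq by (simp add: Q_def tate_seq_def flip: gsc_add_right)
  then have "(P - Q) + (P - Q) = 0" using ab by (simp add: algebra_simps)
  then obtain c d where "P - Q = gsc c d E1" by (rule gsc_E1_span)
  also have "\<dots> = gsc (c * 2 ^ n) (d * 2 ^ n) (e (Suc n))"
    using tate_seq_descend[OF seq, of n] by (simp add: gsc_mult first[unfolded One_nat_def])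
  finally have "P = gsc (c * 2 ^ n) (d * 2 ^ n) (e (Suc n)) + Q" by (simp add: algebra_simps)
  then have "P = gsc (c * 2 ^ n + a) (d * 2 ^ n + b) (e (Suc n))" by (simp add: Q_def gsc_add)
  then show ?case by blast
qed

text \<open>Doubling gives divisibility of the coefficients by \<open>2 ^ n\<close>; the quotients
  then annihilate \<open>E1\<close> and must be even.\<close>

lemma gsc_eq_0: "gsc a b (e n) = 0 \<Longrightarrow> 2 ^ n dvd a \<and> 2 ^ n dvd b"
proof (induction n)
  case (Suc n)
  have "gsc a b (e n) = gsc a b (e (Suc n)) + gsc a b (e (Suc n))"
    using seq by (simp add: tate_seq_def flip: gsc_add_right)
  then have "gsc a b (e n) = 0" using Suc.prems by simp
  then obtain a' b' where ab: "a = a' * 2 ^ n" "b = b' * 2 ^ n"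
    using Suc.IH by (metis dvd_def mult.commute)
  have "gsc a' b' E1 = 0"
    using Suc.prems tate_seq_descend[OF seq, of n] by (simp add: ab gsc_mult first[unfolded One_nat_def])
  then have "even a'" "even b'" using gsc_E1_eq_0 by blast+
  then show ?case by (simp add: ab mult.commute mult_dvd_mono)
qed simp

end

text \<open>At level n the point is killed by \<open>2 ^ n\<close>, so a 2-adic scalar acts through
  its residues there.\<close>

definition act :: "gz \<Rightarrow> (nat \<Rightarrow> pt) \<Rightarrow> nat \<Rightarrow> pt" where
  "act w t n = gsc (residue (re w) n) (residue (im w) n) (t n)"

lemma act_eqI:
  assumes "tate_seq t" "a mod 2 ^ n = residue (re w) n" "b mod 2 ^ n = residue (im w) n"
  shows "act w t n = gsc a b (t n)"
  unfolding act_def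
proof (rule gsc_cong[OF tate_seq_torsion[OF assms(1)]])
  show "2 ^ n dvd residue (re w) n - a"
    using assms(2) residue_self[of "re w" n] by (simp add: mod_eq_dvd_iff[symmetric])
  show "2 ^ n dvd residue (im w) n - b"
    using assms(3) residue_self[of "im w" n] by (simp add: mod_eq_dvd_iff[symmetric])
qed

lemma tate_seq_act:
  assumes t: "tate_seq t"
  shows "tate_seq (act w t)"
  unfolding tate_seq_def
proof (intro conjI allI)
  show "act w t 0 = 0" using t by (simp add: act_def tate_seq_def gsc_0_right)
  fix n
  have "act w t n = gsc (residue (re w) (Suc n)) (residue (im w) (Suc n)) (t n)"
    by (rule act_eqI[OF t]) (simp_all add: residue_mod)
  then show "act w t (Suc n) + act w t (Suc n) = act w t n"
    using t by (simp add: act_def tate_seq_def flip: gsc_add_right)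
qed

lemma act_mult: "tate_seq t \<Longrightarrow> act (v * w) t = act v (act w t)"
proof
  fix n assume t: "tate_seq t"
  have "act v (act w t) n = gsc (residue (re v) n * residue (re w) n - residue (im v) n * residue (im w) n)
    (residue (re v) n * residue (im w) n + residue (im v) n * residue (re w) n) (t n)"
    by (simp add: act_def gsc_gsc)
  also have "\<dots> = act (v * w) t n"
    by (rule act_eqI[OF t, symmetric]) (simp_all add: gz_ops residue_ops mod_simps)
  finally show "act (v * w) t n = act v (act w t) n" ..
qed

lemma act_1: "tate_seq t \<Longrightarrow> act 1 t = t"
proof
  fix n assume t: "tate_seq t"
  have "act 1 t n = gsc 1 0 (t n)" by (rule act_eqI[OF t]) (simp_all add: gz_ops residue_ops)
  then show "act 1 t n = t n" by (simp add: gsc_def iop_0)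
qed

lemma act_hom:
  assumes "\<And>P Q. f (P + Q) = f P + f Q" "\<And>P. f (iop P) = iop (f P)"
  shows "f (act w t n) = act w (\<lambda>n. f (t n)) n"
  unfolding act_def by (rule gsc_hom[OF assms])

lemma tate_seq_hom:
  assumes "\<And>P Q. f (P + Q) = f P + f Q" "tate_seq t"
  shows "tate_seq (\<lambda>n. f (t n))"
proof -
  have "f 0 = 0" using assms(1)[of 0 0] by simp
  then show ?thesis using assms(2) by (simp add: tate_seq_def flip: assms(1))
qed

lemma act_antihom:
  assumes f: "\<And>P Q. f (P + Q) = f P + f Q" "\<And>P. f (iop P) = - iop (f P)" and t: "tate_seq t"
  shows "f (act w t n) = act (gcnj w) (\<lambda>n. f (t n)) n"
proof -
  have "act (gcnj w) (\<lambda>n. f (t n)) n = gsc (residue (re w) n) (- residue (im w) n) (f (t n))"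
    by (rule act_eqI[OF tate_seq_hom[OF f(1) t]]) (simp_all add: gcnj_def residue_ops residue_self)
  then show ?thesis unfolding act_def by (simp add: gsc_antihom[OF f])
qed

context tate_gen
begin

lemma act_level_eq_iff: "act v e n = act w e n \<longleftrightarrow> 2 ^ n dvd v - w"
proof -
  have "act v e n - act w e n = gsc (residue (re v) n - residue (re w) n) (residue (im v) n - residue (im w) n) (e n)"
    by (simp add: act_def gsc_diff)
  moreover have "2 ^ n dvd residue x n - residue y n \<longleftrightarrow> residue x n = residue y n" for x y
    using residue_self[of x n] residue_self[of y n] by (simp add: mod_eq_dvd_iff[symmetric])
  moreover have "gsc 0 0 (e n) = 0" by (simp add: gsc_def iop_0)
  ultimately have "act v e n = act w e n \<longleftrightarrow> residue (re v) n = residue (re w) n \<and> residue (im v) n = residue (im w) n"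
    using gsc_eq_0[of "residue (re v) n - residue (re w) n" "residue (im v) n - residue (im w) n" n]
    by (auto simp: act_def)
  then show ?thesis unfolding gz_pow2_dvd_iff by (simp add: residue_eq_iff_dvd gz_ops)
qed

lemma act_inj:
  assumes "act v e = act w e"
  shows "v = w"
proof -
  have d: "2 ^ n dvd v - w" for n using assms act_level_eq_iff[of v n w] by simp
  have "re v = re w"
    by (rule z2_eqI) (use d in \<open>simp add: gz_pow2_dvd_iff residue_eq_iff_dvd gz_ops\<close>)
  moreover have "im v = im w"
    by (rule z2_eqI) (use d in \<open>simp add: gz_pow2_dvd_iff residue_eq_iff_dvd gz_ops\<close>)
  ultimately show ?thesis by (simp add: gz.expand)
qed

text \<open>Coefficients at level n are unique modulo \<open>2 ^ n\<close> by
  \<open>gsc_eq_0\<close>, hence coherent, and they assemble to 2-adic integers.\<close>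

lemma act_surj:
  assumes t: "tate_seq t"
  obtains w where "t = act w e"
proof -
  have "\<forall>n. \<exists>a b. t n = gsc a b (e n)" using gsc_span[OF tate_seq_torsion[OF t]] by blast
  then obtain a b where ab: "\<And>n. t n = gsc (a n) (b n) (e n)" by metis
  have d: "2 ^ n dvd a (Suc n) - a n \<and> 2 ^ n dvd b (Suc n) - b n" for n
  proof (rule gsc_eq_0)
    have "gsc (a (Suc n)) (b (Suc n)) (e n) = t (Suc n) + t (Suc n)"
      using seq by (simp add: ab[of "Suc n"] tate_seq_def flip: gsc_add_right)
    also have "\<dots> = gsc (a n) (b n) (e n)" using t ab[of n] by (simp add: tate_seq_def)
    finally show "gsc (a (Suc n) - a n) (b (Suc n) - b n) (e n) = 0" by (simp add: gsc_diff)
  qed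
  have coh: "(f (Suc n) mod 2 ^ Suc n) mod 2 ^ n = f n mod 2 ^ n" if "2 ^ n dvd f (Suc n) - f n" for f :: "nat \<Rightarrow> int" and n
    using that by (simp add: mod_mod_cancel mod_eq_dvd_iff)
  obtain x where x: "\<And>n. residue x n = a n mod 2 ^ n"
    using z2_of_coherent[of "\<lambda>n. a n mod 2 ^ n"] coh[of _ a] d by blast
  obtain y where y: "\<And>n. residue y n = b n mod 2 ^ n"
    using z2_of_coherent[of "\<lambda>n. b n mod 2 ^ n"] coh[of _ b] d by blast
  have "t = act (GZ x y) e"
  proof
    fix n
    have "act (GZ x y) e n = gsc (a n) (b n) (e n)" by (rule act_eqI[OF seq]) (simp_all add: x y)
    then show "t n = act (GZ x y) e n" using ab by simp
  qed
  then show ?thesis by (rule that)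
qed

end

section \<open>Integral elements\<close>

definition int_span :: "QQbar set \<Rightarrow> QQbar set" where
  "int_span B = {\<Sum>b\<in>B. of_int (f b) * b | f. True}"

lemma int_spanI: "x = (\<Sum>b\<in>B. of_int (f b) * b) \<Longrightarrow> x \<in> int_span B"
  unfolding int_span_def by blast

lemma int_spanE:
  assumes "x \<in> int_span B"
  obtains f where "x = (\<Sum>b\<in>B. of_int (f b) * b)"
  using assms unfolding int_span_def by blast

lemma int_span_add:
  assumes "x \<in> int_span B" "y \<in> int_span B"
  shows "x + y \<in> int_span B"
proof -
  obtain f g where "x = (\<Sum>b\<in>B. of_int (f b) * b)" "y = (\<Sum>b\<in>B. of_int (g b) * b)"
    using assms by (elim int_spanE)
  then have "x + y = (\<Sum>b\<in>B. of_int (f b + g b) * b)" by (simp add: sum.distrib distrib_right)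
  then show ?thesis by (rule int_spanI)
qed

lemma int_span_mult_int:
  assumes "x \<in> int_span B"
  shows "of_int k * x \<in> int_span B"
proof -
  obtain f where "x = (\<Sum>b\<in>B. of_int (f b) * b)" using assms by (elim int_spanE)
  then have "of_int k * x = (\<Sum>b\<in>B. of_int (k * f b) * b)" by (simp add: sum_distrib_left mult.assoc)
  then show ?thesis by (rule int_spanI)
qed

lemma int_span_0: "0 \<in> int_span B"
  by (rule int_spanI[of _ "\<lambda>_. 0"]) simp

lemma int_span_sum: "(\<And>i. i \<in> A \<Longrightarrow> h i \<in> int_span B) \<Longrightarrow> sum h A \<in> int_span B"
  by (induction A rule: infinite_finite_induct) (simp_all add: int_span_0 int_span_add)

lemma int_span_base:
  assumes "finite B" "b \<in> B"
  shows "b \<in> int_span B"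
proof (rule int_spanI)
  have "(\<Sum>c\<in>B. of_int (if c = b then 1 else 0) * c) = (\<Sum>c\<in>B. if c = b then c else 0)"
    by (intro sum.cong) simp_all
  then show "b = (\<Sum>c\<in>B. of_int (if c = b then 1 else 0) * c)" using assms by simp
qed

lemma int_span_mult_mem:
  assumes "x \<in> int_span B" "\<And>b. b \<in> B \<Longrightarrow> b * y \<in> int_span D"
  shows "x * y \<in> int_span D"
proof -
  obtain f where f: "x = (\<Sum>b\<in>B. of_int (f b) * b)" using assms(1) by (elim int_spanE)
  have "x * y = (\<Sum>b\<in>B. of_int (f b) * (b * y))" unfolding f by (simp add: sum_distrib_right mult.assoc)
  also have "\<dots> \<in> int_span D" by (intro int_span_sum int_span_mult_int assms(2))
  finally show ?thesis .
qed

lemma int_span_mono: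
  assumes "x \<in> int_span B" "\<And>b. b \<in> B \<Longrightarrow> b \<in> int_span D"
  shows "x \<in> int_span D"
  using int_span_mult_mem[OF assms(1), of 1 D] assms(2) by simp

definition int_order :: "QQbar set \<Rightarrow> bool" where
  "int_order B \<longleftrightarrow> finite B \<and> 1 \<in> int_span B \<and> (\<forall>b\<in>B. \<forall>c\<in>B. b * c \<in> int_span B)"

lemma int_order_mult:
  assumes B: "int_order B" and x: "x \<in> int_span B" and y: "y \<in> int_span B"
  shows "x * y \<in> int_span B"
proof (rule int_span_mult_mem[OF x])
  fix b assume b: "b \<in> B"
  have "y * b \<in> int_span B"
    using B b by (intro int_span_mult_mem[OF y]) (auto simp: int_order_def)
  then show "b * y \<in> int_span B" by (simp add: mult.commute)
qed

text \<open>Algebraic integers, described as members of a subring that is finitely generated as an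
  abelian group. Closure under sums and products then reduces to finding a common order.\<close>

definition intg :: "QQbar \<Rightarrow> bool" where
  "intg x \<longleftrightarrow> (\<exists>B. int_order B \<and> x \<in> int_span B)"

text \<open>The products of the two finite generating sets span a ring that contains both
  orders.\<close>

lemma common_order:
  assumes "intg x" "intg y"
  obtains D where "int_order D" "x \<in> int_span D" "y \<in> int_span D"
proof -
  obtain B where B: "int_order B" "x \<in> int_span B" using assms(1) by (auto simp: intg_def)
  obtain C where C: "int_order C" "y \<in> int_span C" using assms(2) by (auto simp: intg_def)
  define D where "D = (\<lambda>(b, c). b * c) ` (B \<times> C)"
  have fin: "finite D" using B C by (simp add: D_def int_order_def)
  have mem: "v * w \<in> int_span D" if v: "v \<in> int_span B" and w: "w \<in> int_span C" for v w
  proof (rule int_span_mult_mem[OF v])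
    fix b assume b: "b \<in> B"
    have "w * b \<in> int_span D"
    proof (rule int_span_mult_mem[OF w])
      fix c assume "c \<in> C"
      then have "b * c \<in> D" using b unfolding D_def by (intro image_eqI[of _ _ "(b, c)"]) auto
      then show "c * b \<in> int_span D" using int_span_base[OF fin] by (simp add: mult.commute)
    qed
    then show "b * w \<in> int_span D" by (simp add: mult.commute)
  qed
  have one: "1 \<in> int_span B" "1 \<in> int_span C" using B C by (simp_all add: int_order_def)
  have "int_order D"
    unfolding int_order_def
  proof (intro conjI ballI fin)
    show "1 \<in> int_span D" using mem[OF one] by simp
    fix z w assume "z \<in> D" "w \<in> D"
    then obtain b c b' c' where zw: "z = b * c" "w = b' * c'" "b \<in> B" "b' \<in> B" "c \<in> C" "c' \<in> C"
      unfolding D_def by auto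
    have "b * b' \<in> int_span B" "c * c' \<in> int_span C" using B C zw by (simp_all add: int_order_def)
    then have "(b * b') * (c * c') \<in> int_span D" by (rule mem)
    then show "z * w \<in> int_span D" by (simp add: zw mult_ac)
  qed
  moreover have "x \<in> int_span D" using mem[OF B(2) one(2)] by simp
  moreover have "y \<in> int_span D" using mem[OF one(1) C(2)] by simp
  ultimately show ?thesis by (rule that)
qed

lemma intg_add: "intg x \<Longrightarrow> intg y \<Longrightarrow> intg (x + y)"
  by (erule (1) common_order) (auto simp: intg_def intro: int_span_add)

lemma intg_mult: "intg x \<Longrightarrow> intg y \<Longrightarrow> intg (x * y)"
  by (erule (1) common_order) (auto simp: intg_def intro: int_order_mult)

lemma intg_of_int: "intg (of_int k)"
proof -
  have o: "int_order {1}"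
    unfolding int_order_def using int_span_base[of "{1}" 1] by simp
  then have "of_int k * 1 \<in> int_span {1}" by (intro int_span_mult_int) (simp add: int_order_def)
  then show ?thesis unfolding intg_def using o by auto
qed

lemma intg_0: "intg 0" and intg_1: "intg 1"
  using intg_of_int[of 0] intg_of_int[of 1] by simp_all

lemma intg_minus: "intg x \<Longrightarrow> intg (- x)"
  using intg_mult[OF intg_of_int[of "- 1"]] by simp

lemma intg_diff: "intg x \<Longrightarrow> intg y \<Longrightarrow> intg (x - y)"
  using intg_add[OF _ intg_minus] by fastforce

lemma intg_prod: "(\<And>i. i \<in> A \<Longrightarrow> intg (h i)) \<Longrightarrow> intg (prod h A)"
  by (induction A rule: infinite_finite_induct) (simp_all add: intg_1 intg_mult)

text \<open>If B spans an order containing p and q, then B together with x B spans one too, since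
  the equation rewrites x times x.\<close>

lemma intg_quadratic:
  assumes "intg p" "intg q" and x: "x * x = p * x + q"
  shows "intg x"
proof -
  obtain B where B: "int_order B" "p \<in> int_span B" "q \<in> int_span B" using common_order assms(1,2) by blast
  define D where "D = B \<union> (*) x ` B"
  have fin: "finite B" "finite D" using B(1) by (simp_all add: D_def int_order_def)
  have m1: "z \<in> int_span D" if "z \<in> int_span B" for z
  proof (rule int_span_mono[OF that])
    fix b assume "b \<in> B"
    then have "b \<in> D" by (simp add: D_def)
    then show "b \<in> int_span D" by (rule int_span_base[OF fin(2)])
  qed
  have m2: "z * x \<in> int_span D" if "z \<in> int_span B" for z
  proof (rule int_span_mult_mem[OF that])
    fix b assume "b \<in> B"
    then have "x * b \<in> D" unfolding D_def by (intro UnI2 imageI)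
    then show "b * x \<in> int_span D" using int_span_base[OF fin(2)] by (simp add: mult.commute)
  qed
  have one: "1 \<in> int_span B" using B by (simp add: int_order_def)
  have bc: "b * c \<in> int_span B" if "b \<in> B" "c \<in> B" for b c using B that by (simp add: int_order_def)
  have "int_order D"
    unfolding int_order_def
  proof (intro conjI ballI fin)
    show "1 \<in> int_span D" by (rule m1[OF one])
    fix z w assume "z \<in> D" "w \<in> D"
    then consider b c where "z = b" "w = c" "b \<in> B" "c \<in> B"
      | b c where "z = b" "w = x * c" "b \<in> B" "c \<in> B"
      | b c where "z = x * b" "w = c" "b \<in> B" "c \<in> B"
      | b c where "z = x * b" "w = x * c" "b \<in> B" "c \<in> B"
      unfolding D_def by blast
    then show "z * w \<in> int_span D"
    proof cases
      case 1
      then show ?thesis using m1[OF bc] by simp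
    next
      case 2
      then show ?thesis using m2[OF bc[of b c]] by (simp add: mult_ac)
    next
      case 3
      then show ?thesis using m2[OF bc[of b c]] by (simp add: mult_ac)
    next
      case 4
      have "(p * (b * c)) * x + q * (b * c) \<in> int_span D"
        by (intro int_span_add m1 m2 int_order_mult[OF B(1)] B(2,3) bc 4)
      also have "(p * (b * c)) * x + q * (b * c) = (x * x) * (b * c)"
        unfolding x by (simp add: algebra_simps)
      finally show ?thesis by (simp add: 4 mult_ac)
    qed
  qed
  moreover have "1 * x \<in> int_span D" by (rule m2[OF one])
  ultimately show ?thesis by (auto simp: intg_def)
qed

section \<open>Automorphisms acting on integral elements, and rational integral elements\<close>

lemma Gal_0: "\<sigma> \<in> Gal F \<Longrightarrow> \<sigma> 0 = 0"
  using Gal_rat[of \<sigma> F 0] by simp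

lemma Gal_1: "\<sigma> \<in> Gal F \<Longrightarrow> \<sigma> 1 = 1"
  using Gal_rat[of \<sigma> F 1] by simp

lemma Gal_of_int: "\<sigma> \<in> Gal F \<Longrightarrow> \<sigma> (of_int k) = of_int k"
  using Gal_rat[of \<sigma> F "of_int k"] by simp

lemma Gal_minus: "\<sigma> \<in> Gal F \<Longrightarrow> \<sigma> (- x) = - \<sigma> x"
  using Gal_mult[of \<sigma> F "of_int (- 1)" x] by (simp add: Gal_of_int[of \<sigma> F "- 1", simplified])

lemma Gal_diff: "\<sigma> \<in> Gal F \<Longrightarrow> \<sigma> (x - y) = \<sigma> x - \<sigma> y"
  using Gal_add[of \<sigma> F x "- y"] by (simp add: Gal_minus)

lemma Gal_sum: "\<sigma> \<in> Gal F \<Longrightarrow> \<sigma> (sum f A) = (\<Sum>i\<in>A. \<sigma> (f i))"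
  by (induction A rule: infinite_finite_induct) (simp_all add: Gal_0 Gal_add)

lemma Gal_prod: "\<sigma> \<in> Gal F \<Longrightarrow> \<sigma> (prod f A) = (\<Prod>i\<in>A. \<sigma> (f i))"
  by (induction A rule: infinite_finite_induct) (simp_all add: Gal_1 Gal_mult)

lemma Gal_power: "\<sigma> \<in> Gal F \<Longrightarrow> \<sigma> (x ^ n) = \<sigma> x ^ n"
  by (induction n) (simp_all add: Gal_1 Gal_mult)

lemma Gal_inj: "\<sigma> \<in> Gal F \<Longrightarrow> \<sigma> x = \<sigma> y \<longleftrightarrow> x = y"
  using Gal_bij[of \<sigma> F] by (metis bij_is_inj inj_eq)

lemma intg_Gal:
  assumes \<sigma>: "\<sigma> \<in> Gal F" and "intg x"
  shows "intg (\<sigma> x)"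
proof -
  obtain B where B: "int_order B" "x \<in> int_span B" using assms(2) by (auto simp: intg_def)
  have inj: "inj_on \<sigma> B" using Gal_inj[OF \<sigma>] by (simp add: inj_on_def)
  have img: "\<sigma> z \<in> int_span (\<sigma> ` B)" if z: "z \<in> int_span B" for z
  proof -
    obtain f where f: "z = (\<Sum>b\<in>B. of_int (f b) * b)" using z by (elim int_spanE)
    have "\<sigma> z = (\<Sum>b\<in>B. of_int (f b) * \<sigma> b)"
      unfolding f by (simp add: Gal_sum[OF \<sigma>] Gal_mult[OF \<sigma>] Gal_of_int[OF \<sigma>])
    also have "\<dots> = (\<Sum>c\<in>\<sigma> ` B. of_int (f (inv_into B \<sigma> c)) * c)"
      by (simp add: sum.reindex[OF inj] inv_into_f_f[OF inj])
    finally show ?thesis by (rule int_spanI)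
  qed
  have "int_order (\<sigma> ` B)"
    unfolding int_order_def
  proof (intro conjI ballI)
    show "finite (\<sigma> ` B)" using B(1) by (simp add: int_order_def)
    show "1 \<in> int_span (\<sigma> ` B)" using img[of 1] B(1) by (simp add: int_order_def Gal_1[OF \<sigma>])
    fix z w assume "z \<in> \<sigma> ` B" "w \<in> \<sigma> ` B"
    then obtain b c where bc: "z = \<sigma> b" "w = \<sigma> c" "b \<in> B" "c \<in> B" by blast
    have "b * c \<in> int_span B" using B(1) bc by (simp add: int_order_def)
    from img[OF this] show "z * w \<in> int_span (\<sigma> ` B)" by (simp add: bc Gal_mult[OF \<sigma>])
  qed
  then show ?thesis using img[OF B(2)] by (auto simp: intg_def)
qed

text \<open>A rational-linear projection onto the rationals, used in \<open>intg_rat\<close> to read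
  off a rational number from a relation between irrational generators.\<close>

lemma rational_functional_exists:
  obtains g :: "QQbar \<Rightarrow> rat" where "\<And>x y. g (x + y) = g x + g y" "\<And>q x. g (to_ac q * x) = q * g x" "g 1 = 1"
proof -
  interpret vs: vector_space_pair "\<lambda>(q :: rat) (x :: QQbar). to_ac q * x" "(*) :: rat \<Rightarrow> rat \<Rightarrow> rat"
    by unfold_locales (simp_all add: algebra_simps)
  have "vs.vs1.independent {1}"
    by (rule vs.vs1.independent_insertI) (simp_all add: vs.vs1.independent_empty)
  from vs.linear_independent_extend[OF this, of "\<lambda>_. 1"]
  obtain g where g: "Vector_Spaces.linear (\<lambda>(q :: rat) (x :: QQbar). to_ac q * x) (*) g" "g 1 = 1"
    by blast
  interpret l: Vector_Spaces.linear "\<lambda>(q :: rat) (x :: QQbar). to_ac q * x" "(*)" g by (rule g(1))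
  show ?thesis by (rule that[of g]) (simp_all add: l.add l.scale g(2))
qed

text \<open>All powers of the reduced denominator b divide N. A denominator of at least 2 would give
  2^N \<le> b^N \<le> N.\<close>

lemma rat_bounded_denominator:
  fixes r :: rat
  assumes N: "N > 0" and int: "\<And>k. of_int N * r ^ k \<in> \<int>"
  shows "r \<in> \<int>"
proof -
  obtain a b :: int where ab: "r = of_int a / of_int b" "b > 0" "coprime a b"
    by (cases r) (auto simp: Fract_of_int_quotient)
  have "b ^ k dvd N" for k
  proof -
    obtain m where m: "of_int N * r ^ k = of_int m" using int[of k] by (elim Ints_cases)
    have b0: "(of_int b :: rat) ^ k \<noteq> 0" using ab(2) by simp
    have "of_int N * of_int a ^ k = (of_int m * of_int b ^ k :: rat)"
      using m b0 unfolding ab(1) power_divide by (simp add: field_simps)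
    then have "N * a ^ k = m * b ^ k" by (simp flip: of_int_mult of_int_power)
    then have "b ^ k dvd N * a ^ k" by simp
    moreover have "coprime (b ^ k) (a ^ k)" using ab(3) by (simp add: coprime_commute)
    ultimately show ?thesis by (simp add: coprime_dvd_mult_left_iff)
  qed
  then have le: "b ^ k \<le> N" for k using N by (simp add: zdvd_imp_le)
  have "b = 1"
  proof (rule ccontr)
    assume "b \<noteq> 1"
    then have "2 \<le> b" using ab(2) by simp
    then have "2 ^ nat N \<le> b ^ nat N" by (intro power_mono) simp_all
    moreover have "int (nat N) < 2 ^ nat N" using of_nat_less_two_power by blast
    ultimately show False using le[of "nat N"] N by simp
  qed
  then show ?thesis using ab(1) by simp
qed

text \<open>All powers of r lie in one finitely generated group. A linear functional fixing 1 takes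
  the generators to rationals with a common denominator \<open>N\<close>, so \<open>N\<close> clears
  the denominators of all powers at once.\<close>

lemma intg_rat:
  assumes "intg (to_ac r)"
  shows "r \<in> \<int>"
proof -
  obtain B where B: "int_order B" "to_ac r \<in> int_span B" using assms by (auto simp: intg_def)
  then have fin: "finite B" by (simp add: int_order_def)
  obtain g :: "QQbar \<Rightarrow> rat" where add: "\<And>x y. g (x + y) = g x + g y"
    and scale: "\<And>q x. g (to_ac q * x) = q * g x" and one: "g 1 = 1"
    using rational_functional_exists by blast
  have sum: "g (sum h A) = (\<Sum>i\<in>A. g (h i))" for h and A :: "QQbar set"
    using scale[of 0 0] by (induction A rule: infinite_finite_induct) (simp_all add: add)
  define den where "den = (\<lambda>q :: rat. snd (quotient_of q))"
  have den: "den q > 0" "of_int (den q) * q \<in> \<int>" for q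
  proof -
    obtain a b where q: "quotient_of q = (a, b)" by (cases "quotient_of q")
    then have "b > 0" "q = of_int a / of_int b" using quotient_of_denom_pos quotient_of_div by blast+
    then show "den q > 0" "of_int (den q) * q \<in> \<int>" using q by (simp_all add: den_def)
  qed
  define N where "N = (\<Prod>b\<in>B. den (g b))"
  have N: "N > 0" unfolding N_def by (intro prod_pos) (simp add: den)
  have Ng: "of_int N * g b \<in> \<int>" if b: "b \<in> B" for b
  proof -
    have "N = den (g b) * (\<Prod>c\<in>B - {b}. den (g c))" unfolding N_def by (rule prod.remove[OF fin b])
    then have "of_int N = (of_int (den (g b)) * of_int (\<Prod>c\<in>B - {b}. den (g c)) :: rat)"
      by (simp only: of_int_mult)
    then have e: "of_int N * g b = of_int (\<Prod>c\<in>B - {b}. den (g c)) * (of_int (den (g b)) * g b)"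
      by (simp only: mult_ac)
    show ?thesis unfolding e by (intro Ints_mult Ints_of_int den(2))
  qed
  have "of_int N * r ^ k \<in> \<int>" for k
  proof -
    have "to_ac r ^ k \<in> int_span B"
      by (induction k) (use B int_order_mult[OF B(1)] in \<open>simp_all add: int_order_def\<close>)
    then obtain f where f: "to_ac r ^ k = (\<Sum>b\<in>B. of_int (f b) * b)" by (elim int_spanE)
    have "r ^ k = r ^ k * g 1" by (simp add: one)
    also have "\<dots> = g (to_ac (r ^ k) * 1)" by (rule scale[symmetric])
    also have "\<dots> = (\<Sum>b\<in>B. g (to_ac (of_int (f b)) * b))" by (simp add: f sum)
    also have "\<dots> = (\<Sum>b\<in>B. of_int (f b) * g b)" by (simp only: scale)
    finally have "of_int N * r ^ k = (\<Sum>b\<in>B. of_int (f b) * (of_int N * g b))"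
      by (simp add: sum_distrib_left mult_ac)
    also have "\<dots> \<in> \<int>" by (intro Ints_sum Ints_mult[OF Ints_of_int Ng])
    finally show ?thesis .
  qed
  with N show ?thesis by (rule rat_bounded_denominator)
qed

lemma qi_qi: "qi * (qi * x) = - x"
  by (simp add: qi_sq flip: mult.assoc)

text \<open>
  Elements that are invertible modulo \<open>1 + i\<close>. They stand in for units at the prime above \<open>2\<close>, so that no
  valuation has to be extended to the algebraic closure.
\<close>

definition local_unit :: "QQbar \<Rightarrow> bool" where
  "local_unit u \<longleftrightarrow> intg u \<and> (\<exists>v g. intg v \<and> intg g \<and> u * v = 1 + (1 + qi) * g)"

lemma intg_qi: "intg qi"
  by (rule intg_quadratic[OF intg_0 intg_of_int[of "- 1"]]) (simp add: qi_sq)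

lemma local_unit_1: "local_unit 1"
  unfolding local_unit_def using intg_0 intg_1 by (intro conjI exI[of _ 1] exI[of _ 0]) simp_all

lemma local_unit_mult:
  assumes "local_unit u" "local_unit u'"
  shows "local_unit (u * u')"
proof -
  obtain v g where v: "intg u" "intg v" "intg g" "u * v = 1 + (1 + qi) * g" using assms(1) by (auto simp: local_unit_def)
  obtain v' g' where v': "intg u'" "intg v'" "intg g'" "u' * v' = 1 + (1 + qi) * g'" using assms(2) by (auto simp: local_unit_def)
  have "(u * u') * (v * v') = (u * v) * (u' * v')" by (simp only: mult_ac)
  also have "\<dots> = 1 + (1 + qi) * (g + g' + (1 + qi) * (g * g'))"
    unfolding v(4) v'(4) by (simp add: algebra_simps)
  finally have "(u * u') * (v * v') = 1 + (1 + qi) * (g + g' + (1 + qi) * (g * g'))" .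
  moreover have "intg (g + g' + (1 + qi) * (g * g'))"
    by (intro intg_add intg_mult intg_1 intg_qi v v')
  ultimately show ?thesis
    unfolding local_unit_def using intg_mult[OF v(1) v'(1)] intg_mult[OF v(2) v'(2)] by blast
qed

lemma local_unit_power: "local_unit u \<Longrightarrow> local_unit (u ^ n)"
  by (induction n) (simp_all add: local_unit_1 local_unit_mult)

lemma local_unit_prod: "(\<And>i. i \<in> A \<Longrightarrow> local_unit (h i)) \<Longrightarrow> local_unit (prod h A)"
  by (induction A rule: infinite_finite_induct) (simp_all add: local_unit_1 local_unit_mult)

lemma Gal_qi:
  assumes \<sigma>: "\<sigma> \<in> Gal F"
  shows "\<sigma> qi = qi \<or> \<sigma> qi = - qi"
proof -
  have "\<sigma> qi * \<sigma> qi = - 1" using Gal_mult[OF \<sigma>, of qi qi] by (simp add: qi_sq Gal_minus[OF \<sigma>] Gal_1[OF \<sigma>])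
  then have "(\<sigma> qi - qi) * (\<sigma> qi + qi) = 0" by (simp add: algebra_simps qi_sq qi_qi)
  then show ?thesis by (simp add: eq_neg_iff_add_eq_0)
qed

text \<open>The conjugate 1 - i equals -i (1 + i), so invertibility modulo 1 + i is preserved even
  by automorphisms that move i.\<close>

lemma local_unit_Gal:
  assumes \<sigma>: "\<sigma> \<in> Gal F" and u: "local_unit u"
  shows "local_unit (\<sigma> u)"
proof -
  obtain v g where v: "intg u" "intg v" "intg g" "u * v = 1 + (1 + qi) * g" using u by (auto simp: local_unit_def)
  have "\<exists>c. intg c \<and> 1 + \<sigma> qi = (1 + qi) * c"
  proof (cases "\<sigma> qi = qi")
    case True
    then show ?thesis using intg_1 by (intro exI[of _ 1]) simp
  next
    case False
    then have "1 + \<sigma> qi = (1 + qi) * (- qi)" using Gal_qi[OF \<sigma>] by (simp add: algebra_simps qi_sq qi_qi)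
    then show ?thesis using intg_minus[OF intg_qi] by blast
  qed
  then obtain c where c: "intg c" "1 + \<sigma> qi = (1 + qi) * c" by blast
  have "\<sigma> u * \<sigma> v = \<sigma> (1 + (1 + qi) * g)" by (simp only: Gal_mult[OF \<sigma>, symmetric] v(4))
  also have "\<dots> = 1 + (1 + \<sigma> qi) * \<sigma> g" by (simp add: Gal_add[OF \<sigma>] Gal_mult[OF \<sigma>] Gal_1[OF \<sigma>])
  also have "\<dots> = 1 + (1 + qi) * (c * \<sigma> g)" unfolding c(2) by (simp only: mult.assoc)
  finally have "\<sigma> u * \<sigma> v = 1 + (1 + qi) * (c * \<sigma> g)" .
  moreover have "intg (c * \<sigma> g)" "intg (\<sigma> u)" "intg (\<sigma> v)" by (intro intg_mult c intg_Gal[OF \<sigma>] v)+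
  ultimately show ?thesis unfolding local_unit_def by blast
qed

lemma half_not_intg: "\<not> intg (1 / 2)"
proof
  assume "intg (1 / 2)"
  then have "intg (to_ac (1 / 2))" by simp
  then have "(1 / 2 :: rat) \<in> \<int>" by (rule intg_rat)
  then obtain k :: int where "1 / 2 = (of_int k :: rat)" by (elim Ints_cases)
  then have "1 = (2 * of_int k :: rat)" by (simp add: field_simps)
  then have "1 = 2 * k" by (metis of_int_1 of_int_eq_iff of_int_mult of_int_numeral)
  then show False by presburger
qed

text \<open>If m were even, then 1 + i would be invertible among the integral elements; squaring its
  inverse would make 1/2 integral.\<close>

lemma local_unit_odd:
  assumes "local_unit (of_int m)"
  shows "odd m"
proof
  assume "even m"
  then obtain k where k: "m = 2 * k" by (elim evenE)
  obtain v g where v: "intg v" "intg g" "of_int m * v = 1 + (1 + qi) * g" using assms by (auto simp: local_unit_def)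
  \<comment> \<open>From 2 = (1 + i)(1 - i): this is the inverse of 1 + i extracted from m v = 1 +
    (1 + i) g.\<close>
  define r where "r = (1 - qi) * (of_int k * v) - g"
  have r: "intg r" unfolding r_def by (intro intg_diff intg_mult intg_1 intg_qi intg_of_int v)
  have "(1 + qi) * r = ((1 + qi) * (1 - qi)) * (of_int k * v) - (1 + qi) * g"
    by (simp add: r_def algebra_simps)
  also have "(1 + qi) * (1 - qi) = 2" by (simp add: algebra_simps qi_sq qi_qi)
  also have "2 * (of_int k * v) - (1 + qi) * g = 1" using v(3) by (simp add: k algebra_simps)
  finally have one: "(1 + qi) * r = 1" .
  have "2 * (qi * (r * r)) = ((1 + qi) * r) * ((1 + qi) * r)" by (simp add: algebra_simps qi_sq qi_qi)
  then have "qi * (r * r) = 1 / 2" unfolding one by (simp add: field_simps)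
  moreover have "intg (qi * (r * r))" by (intro intg_mult intg_qi r)
  ultimately have "intg (1 / 2)" by (simp only:)
  with half_not_intg show False ..
qed

section \<open>Galois orbits and the power of 2 in a norm\<close>

definition orbit :: "QQbar set \<Rightarrow> QQbar \<Rightarrow> QQbar set" where
  "orbit F x = (\<lambda>\<sigma>. \<sigma> x) ` Gal F"

lemma Gal_poly_root:
  assumes \<sigma>: "\<sigma> \<in> Gal F" and "poly (map_poly to_ac p) x = 0"
  shows "poly (map_poly to_ac (p :: rat poly)) (\<sigma> x) = 0"
proof -
  have "poly (map_poly to_ac p) (\<sigma> x) = \<sigma> (poly (map_poly to_ac p) x)"
    by (induction p) (simp_all add: Gal_0[OF \<sigma>] map_poly_pCons Gal_add[OF \<sigma>] Gal_mult[OF \<sigma>] Gal_rat[OF \<sigma>])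
  then show ?thesis using assms(2) by (simp add: Gal_0[OF \<sigma>])
qed

lemma finite_orbit: "finite (orbit F x)"
proof -
  obtain p :: "rat poly" where p: "p \<noteq> 0" "poly (map_poly to_ac p) x = 0"
    using alg_closure_algebraic by blast
  have "finite {y. poly (map_poly to_ac p) y = (0 :: QQbar)}"
    using p by (intro poly_roots_finite) (simp add: map_poly_eq_0_iff)
  moreover have "orbit F x \<subseteq> {y. poly (map_poly to_ac p) y = 0}"
    unfolding orbit_def using Gal_poly_root p(2) by blast
  ultimately show ?thesis by (rule rev_finite_subset)
qed

lemma Gal_comp: "\<sigma> \<in> Gal F \<Longrightarrow> \<tau> \<in> Gal F \<Longrightarrow> \<sigma> \<circ> \<tau> \<in> Gal F"
  unfolding Gal_def by (auto intro: bij_comp)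

lemma Gal_id: "id \<in> Gal F"
  by (simp add: Gal_def)

lemma orbit_image:
  assumes \<sigma>: "\<sigma> \<in> Gal F"
  shows "\<sigma> ` orbit F x = orbit F x"
proof (rule endo_inj_surj[OF finite_orbit])
  show "\<sigma> ` orbit F x \<subseteq> orbit F x"
  proof
    fix y assume "y \<in> \<sigma> ` orbit F x"
    then obtain \<tau> where "\<tau> \<in> Gal F" "y = \<sigma> (\<tau> x)" by (auto simp: orbit_def)
    then have "y = (\<sigma> \<circ> \<tau>) x" "\<sigma> \<circ> \<tau> \<in> Gal F" using Gal_comp[OF \<sigma>] by simp_all
    then show "y \<in> orbit F x" unfolding orbit_def by blast
  qed
  show "inj_on \<sigma> (orbit F x)" using Gal_inj[OF \<sigma>] by (simp add: inj_on_def)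
qed

text \<open>
  If \<open>x\<close> is an \<open>m\<close>-th root of \<open>2\<close> up to a local unit, then \<open>m\<close> divides the degree of \<open>x\<close>: compare the
  powers of \<open>2\<close> in the norm of \<open>x\<close>.
\<close>

lemma dvd_card_orbit:
  assumes x: "intg x" "x ^ m = 2 * u" and u: "local_unit u"
  shows "m dvd card (orbit field_Q x)"
proof -
  define B where "B = orbit field_Q x"
  have fin: "finite B" by (simp add: B_def finite_orbit)
  have "\<exists>\<sigma>\<in>Gal field_Q. y = \<sigma> x" if "y \<in> B" for y using that by (auto simp: B_def orbit_def)
  then have el: "intg y \<and> y ^ m = 2 * (y ^ m / 2) \<and> local_unit (y ^ m / 2)" if y: "y \<in> B" for y
  proof -
    obtain \<sigma> where \<sigma>: "\<sigma> \<in> Gal field_Q" "y = \<sigma> x" using y by (auto simp: B_def orbit_def)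
    have "y ^ m = \<sigma> (x ^ m)" using \<sigma> by (simp add: Gal_power)
    also have "\<dots> = 2 * \<sigma> u" using Gal_of_int[OF \<sigma>(1), of 2] by (simp add: x(2) Gal_mult[OF \<sigma>(1)])
    finally have "y ^ m / 2 = \<sigma> u" by simp
    then show ?thesis using local_unit_Gal[OF \<sigma>(1) u] intg_Gal[OF \<sigma>(1) x(1)] \<sigma>(2) by simp
  qed
  \<comment> \<open>The product over the orbit is the norm; being fixed by all automorphisms and
    integral, it is an ordinary integer.\<close>
  have inv: "\<sigma> (\<Prod>y\<in>B. y) = (\<Prod>y\<in>B. y)" if \<sigma>: "\<sigma> \<in> Gal field_Q" for \<sigma>
  proof -
    have "\<sigma> (\<Prod>y\<in>B. y) = (\<Prod>y\<in>B. \<sigma> y)" by (rule Gal_prod[OF \<sigma>])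
    also have "\<dots> = (\<Prod>y\<in>\<sigma> ` B. y)"
      using Gal_inj[OF \<sigma>] by (subst prod.reindex) (simp_all add: inj_on_def)
    also have "\<sigma> ` B = B" unfolding B_def by (rule orbit_image[OF \<sigma>])
    finally show ?thesis .
  qed
  have "(\<Prod>y\<in>B. y) \<in> range to_ac" by (rule fixed_by_Gal_Q) (rule inv)
  then obtain r where r: "(\<Prod>y\<in>B. y) = to_ac r" by blast
  have "intg (\<Prod>y\<in>B. y)" using el by (intro intg_prod) blast
  then have "r \<in> \<int>" unfolding r by (rule intg_rat)
  then obtain n where n: "r = of_int n" by (elim Ints_cases)
  define U where "U = (\<Prod>y\<in>B. y ^ m / 2)"
  have U: "local_unit U" unfolding U_def using el by (intro local_unit_prod) blast
  have nm: "of_int n ^ m = 2 ^ card B * U"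
  proof -
    have "of_int n = (\<Prod>y\<in>B. y)" using r n by simp
    then have "of_int n ^ m = (\<Prod>y\<in>B. y) ^ m" by (simp only:)
    also have "\<dots> = (\<Prod>y\<in>B. y ^ m)" by (rule prod_power_distrib)
    finally have "of_int n ^ m = (\<Prod>y\<in>B. y ^ m)" .
    also have "(\<Prod>y\<in>B. y ^ m) = (\<Prod>y\<in>B. 2 * (y ^ m / 2))" by simp
    also have "\<dots> = 2 ^ card B * U" unfolding U_def prod.distrib by simp
    finally show ?thesis .
  qed
  have Ueq: "U = to_ac (of_int (n ^ m) / 2 ^ card B)" using nm by simp
  have "intg (to_ac (of_int (n ^ m) / 2 ^ card B))"
    using U unfolding Ueq local_unit_def by (rule conjunct1)
  then have "(of_int (n ^ m) / 2 ^ card B :: rat) \<in> \<int>" by (rule intg_rat)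
  then obtain k where k': "(of_int (n ^ m) / 2 ^ card B :: rat) = of_int k" by (elim Ints_cases)
  have Uk: "U = of_int k" unfolding Ueq k' by simp
  have k: "odd k" using U unfolding Uk by (rule local_unit_odd)
  have "(of_int (n ^ m) :: QQbar) = of_int (2 ^ card B * k)" using nm by (simp add: Uk)
  then have nk: "n ^ m = 2 ^ card B * k" by (simp only: of_int_eq_iff)
  have "n ^ m \<noteq> 0" using k by (simp add: nk) auto
  have two: "prime_elem (2 :: int)" by simp
  show ?thesis
  proof (cases "m = 0")
    \<comment> \<open>For m = 0 the claim says that the cardinality is 0, and
      \<open>n ^ 0 = 1\<close> leaves no factor 2.\<close>
    case True
    then have "1 = 2 ^ card B * k" using nk by simp
    have "card B = 0"
    proof (rule ccontr)
      assume "card B \<noteq> 0"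
      then have "even (2 ^ card B * k)" by simp
      with \<open>1 = 2 ^ card B * k\<close> have "even (1 :: int)" by (simp only:)
      then show False by simp
    qed
    then show ?thesis by (simp add: B_def)
  next
    case False
    then have "n \<noteq> 0" using \<open>n ^ m \<noteq> 0\<close> by auto
    \<comment> \<open>Counting factors of 2 in \<open>n ^ m = 2 ^ card B * k\<close> with odd k
      shows that the cardinality is a multiple of m.\<close>
    have "multiplicity 2 (n ^ m) = m * multiplicity 2 n"
      using two \<open>n \<noteq> 0\<close> by (rule prime_elem_multiplicity_power_distrib)
    moreover have "multiplicity 2 (2 ^ card B * k) = card B"
      using k by (intro multiplicity_eqI) auto
    ultimately show ?thesis unfolding B_def[symmetric] nk by (metis dvd_triv_left)
  qed
qed

text \<open>
  The recursion \<open>s\<^sub>k\<^sub>+\<^sub>1\<^sup>2 + 1 = 2 i s\<^sub>k s\<^sub>k\<^sub>+\<^sub>1\<close> holds for the \<open>x\<close>-coordinates of a compatible sequence of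
  \<open>(1 + i)\<close>-power torsion points. The reciprocal differences \<open>2 s\<^sub>3 / (s\<^sub>k - s\<^sub>k\<^sub>-\<^sub>1)\<close> are uniformizers
  in a tower of totally ramified quadratic extensions.
\<close>

lemma uniformizer_tower:
  fixes s :: "nat \<Rightarrow> QQbar"
  assumes rec: "\<And>k. 2 \<le> k \<Longrightarrow> k < n \<Longrightarrow> s (Suc k) * s (Suc k) + 1 = 2 * qi * s k * s (Suc k)"
    and s3: "s 3 * s 3 = 1" and n: "3 \<le> n"
  defines "b \<equiv> \<lambda>k. 2 * s 3 / (s k - s (k - 1))"
  shows "3 \<le> k \<Longrightarrow> k \<le> n \<Longrightarrow> intg (s k) \<and> (\<exists>w. intg w \<and> s k * w = 1) \<and> s k \<noteq> s (k - 1) \<and> intg (b k)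
    \<and> (\<exists>u. local_unit u \<and> b k ^ (2 ^ (k - 2)) = 2 * u)"
proof (induction k rule: dec_induct)
  case base
  have s3': "intg (s 3)" by (rule intg_quadratic[OF intg_0 intg_1]) (simp add: s3)
  have "s 3 * s 3 + 1 = 2 * qi * s 2 * s 3" using rec[of 2] base n by (simp add: numeral_3_eq_3)
  then have "qi * s 2 * s 3 = 1" unfolding s3 by (simp add: mult.assoc)
  then have "(qi * s 3) * (qi * s 2 * s 3) = qi * s 3" by simp
  moreover have "(qi * s 3) * (qi * s 2 * s 3) = (qi * qi) * (s 3 * s 3) * s 2" by (simp only: mult_ac)
  ultimately have "(qi * qi) * (s 3 * s 3) * s 2 = qi * s 3" by (simp only:)
  then have "- s 2 = qi * s 3" unfolding qi_sq s3 by simp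
  then have "- (- s 2) = - (qi * s 3)" by (simp only:)
  then have s2: "s 2 = - qi * s 3" by simp
  have d: "s 3 - s 2 = s 3 * (1 + qi)" by (simp add: s2 algebra_simps)
  have q: "(1 + qi) * (1 - qi) = 2" by (simp add: algebra_simps qi_sq qi_qi)
  then have q0: "1 + qi \<noteq> 0" by auto
  have s30: "s 3 \<noteq> 0" using s3 by auto
  \<comment> \<open>The difference of the first two terms is \<open>s 3 * (1 + qi)\<close>, so
    \<open>b 3\<close> is 2 / (1 + i), whose square is 2 times the unit -i.\<close>
  have b3: "b 3 = 1 - qi"
    unfolding b_def using d s30 q0 q by (simp add: divide_eq_eq mult_ac)
  have "b 3 ^ (2 ^ (3 - 2)) = 2 * (- qi)"
    by (simp add: b3 power2_eq_square algebra_simps qi_sq qi_qi)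
  moreover have "local_unit (- qi)"
    unfolding local_unit_def using intg_qi intg_minus[OF intg_qi] intg_0
    by (intro conjI exI[of _ qi] exI[of _ 0]) (simp_all add: qi_sq)
  moreover have "intg (b 3)" unfolding b3 by (intro intg_diff intg_1 intg_qi)
  moreover have "s 3 \<noteq> s (3 - 1)" using d s30 q0 by auto
  ultimately show ?case using s3 s3' by blast
next
  case (step k)
  then have k: "3 \<le> k" "k < n" by simp_all
  define S where "S = s (Suc k)"
  define d where "d = s k - s (k - 1)"
  define d' where "d' = S - s k"
  obtain w u where IH: "intg (s k)" "intg w" "s k * w = 1" "d \<noteq> 0" "intg (b k)" "local_unit u"
    "b k ^ (2 ^ (k - 2)) = 2 * u"
    using step by (auto simp: d_def)
  have r1: "S * S = 2 * qi * s k * S - 1" using rec[of k] k by (simp add: S_def eq_diff_eq)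
  have "Suc (k - 1) = k" using k by simp
  then have r0: "s k * s k = 2 * qi * s (k - 1) * s k - 1" using rec[of "k - 1"] k by (simp add: eq_diff_eq)
  have S: "intg S"
    by (rule intg_quadratic[of "2 * qi * s k" "- 1"])
      (use intg_of_int[of 2] intg_of_int[of "- 1"] in \<open>auto intro!: intg_mult intg_qi IH simp: r1\<close>)
  \<comment> \<open>By Vieta the other root of the quadratic for \<open>S\<close> is its inverse, so
    every \<open>s k\<close> is a unit among the integral elements.\<close>
  have W: "intg (2 * qi * s k - S)"
    using intg_of_int[of 2] by (auto intro!: intg_diff intg_mult intg_qi IH S)
  have SW: "S * (2 * qi * s k - S) = 1" using r1 by (simp add: algebra_simps)
  \<comment> \<open>Subtracting two consecutive recursions gives an equation between consecutive
    differences alone, apart from \<open>s k\<close>.\<close>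
  have quad: "d' * d' = 2 * (qi - 1) * s k * d' + 2 * qi * s k * d"
  proof -
    have "d' * d' - (2 * (qi - 1) * s k * d' + 2 * qi * s k * d)
      = (S * S - 2 * qi * s k * S + 1) - (s k * s k - 2 * qi * s (k - 1) * s k + 1) * 1
        + 2 * s k * s k - 2 * s k * s k"
      by (simp add: d'_def d_def algebra_simps) 
    then show ?thesis unfolding r1 r0 by simp
  qed
  have sk0: "s k \<noteq> 0" using IH(3) by auto
  have d'0: "d' \<noteq> 0"
  proof
    assume "d' = 0"
    then have "2 * qi * s k * d = 0" using quad by simp
    then show False using qi_neq_0 sk0 IH(4) by simp
  qed
  have bk: "b k = 2 * s 3 / d" "b (Suc k) = 2 * s 3 / d'" by (simp_all add: b_def d_def d'_def S_def)
  \<comment> \<open>The quotient of \<open>b (Suc k)\<close> squared by \<open>b k\<close>, found by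
    dividing \<open>quad\<close> by the square of \<open>d'\<close> and by \<open>d\<close>. Modulo
    1 + i it is the unit \<open>- (qi * s 3 * w)\<close>.\<close>
  define lam where "lam = - ((1 + qi) * b (Suc k) + qi * s 3 * w)"
  have rel: "b (Suc k) * b (Suc k) = b k * lam"
  proof -
    define D where "D = 1 / d"
    define D' where "D' = 1 / d'"
    have D: "d * D = 1" "d' * D' = 1" using IH(4) d'0 by (simp_all add: D_def D'_def)
    have B: "b k = 2 * s 3 * D" "b (Suc k) = 2 * s 3 * D'" by (simp_all add: bk D_def D'_def)
    have "(d' * d') * (D' * D' * D * w) = (2 * (qi - 1) * s k * d' + 2 * qi * s k * d) * (D' * D' * D * w)"
      unfolding quad ..
    moreover have "(d' * d') * (D' * D' * D * w) = (d' * D') * (d' * D') * (D * w)" by (simp only: mult_ac)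
    moreover have "(2 * (qi - 1) * s k * d' + 2 * qi * s k * d) * (D' * D' * D * w)
      = 2 * (qi - 1) * (s k * w) * (d' * D') * (D' * D) + 2 * qi * (s k * w) * (d * D) * (D' * D')"
      by (simp add: algebra_simps)
    ultimately have "(d' * D') * (d' * D') * (D * w)
      = 2 * (qi - 1) * (s k * w) * (d' * D') * (D' * D) + 2 * qi * (s k * w) * (d * D) * (D' * D')"
      by (simp only:)
    then have e: "D * w = 2 * (qi - 1) * (D' * D) + 2 * qi * (D' * D')"
      unfolding D IH(3) by simp
    have "b k * lam = - (4 * (1 + qi) * (s 3 * s 3) * (D * D')) - 2 * qi * (s 3 * s 3) * (D * w)"
      unfolding lam_def B by (simp add: algebra_simps)
    also have "\<dots> = - (4 * (1 + qi) * (D * D')) - 2 * qi * (2 * (qi - 1) * (D' * D) + 2 * qi * (D' * D'))"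
      unfolding s3 e by simp
    also have "\<dots> = - 4 * (qi * qi) * (D' * D') - 4 * (1 + qi * qi) * (D * D')"
      by (simp add: algebra_simps)
    also have "\<dots> = 4 * (s 3 * s 3) * (D' * D')" unfolding qi_sq s3 by simp
    also have "\<dots> = b (Suc k) * b (Suc k)" unfolding B by (simp add: algebra_simps)
    finally show ?thesis ..
  qed
  have s3': "intg (s 3)" by (rule intg_quadratic[OF intg_0 intg_1]) (simp add: s3)
  have b: "intg (b (Suc k))"
  proof (rule intg_quadratic)
    show "b (Suc k) * b (Suc k) = (- ((1 + qi) * b k)) * b (Suc k) + (- (qi * s 3 * w * b k))"
      unfolding rel lam_def by (simp add: algebra_simps)
  qed (intro intg_minus intg_mult intg_add intg_1 intg_qi IH s3')+
  have lam: "local_unit lam"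
    unfolding local_unit_def
  proof (intro conjI exI)
    show "intg lam" unfolding lam_def by (intro intg_minus intg_add intg_mult intg_1 intg_qi b s3' IH)
    \<comment> \<open>This is the inverse of \<open>- (qi * s 3 * w)\<close>, because
      \<open>s k * w\<close> and the square of \<open>s 3\<close> are both 1.\<close>
    show "intg (qi * s k * s 3)" "intg (- (qi * b (Suc k) * s k * s 3))"
      by (intro intg_minus intg_mult intg_qi b s3' IH)+
    have "lam * (qi * s k * s 3) = - ((1 + qi) * (qi * b (Suc k) * s k * s 3)) - (qi * qi) * (s 3 * s 3) * (s k * w)"
      unfolding lam_def by (simp add: algebra_simps)
    then show "lam * (qi * s k * s 3) = 1 + (1 + qi) * - (qi * b (Suc k) * s k * s 3)"
      unfolding qi_sq s3 IH(3) by simp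
  qed
  \<comment> \<open>Squaring once leads back to \<open>b k\<close> up to a local unit, so the
    exponent doubles at each step while the right side remains 2 times a local unit.\<close>
  have "b (Suc k) ^ (2 ^ (Suc k - 2)) = (b (Suc k) * b (Suc k)) ^ (2 ^ (k - 2))"
  proof -
    have "Suc k - 2 = Suc (k - 2)" using k by simp
    then show ?thesis by (simp add: power_mult power2_eq_square)
  qed
  also have "\<dots> = 2 * (u * lam ^ (2 ^ (k - 2)))" unfolding rel power_mult_distrib IH(7) by (simp only: mult.assoc)
  finally have "b (Suc k) ^ (2 ^ (Suc k - 2)) = 2 * (u * lam ^ (2 ^ (k - 2)))" .
  moreover have "local_unit (u * lam ^ (2 ^ (k - 2)))" by (intro local_unit_mult local_unit_power IH lam)
  moreover have "s (Suc k) \<noteq> s (Suc k - 1)" using d'0 by (simp add: d'_def S_def)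
  ultimately show ?case using S W SW b unfolding S_def by blast
qed

section \<open>Galois action on the points\<close>

definition gact :: "(QQbar \<Rightarrow> QQbar) \<Rightarrow> pt \<Rightarrow> pt" where
  "gact \<sigma> P = Pt (map_point \<sigma> (pnt P))"

lemma Gal_inverse:
  assumes "\<sigma> \<in> Gal F"
  shows "\<sigma> (x / y) = \<sigma> x / \<sigma> y"
proof (cases "y = 0")
  case False
  then have "\<sigma> (x / y) * \<sigma> y = \<sigma> x" by (simp flip: Gal_mult[OF assms])
  moreover have "\<sigma> y \<noteq> 0" using Gal_inj[OF assms, of y 0] False by (simp add: Gal_0[OF assms])
  ultimately show ?thesis by (simp add: eq_divide_eq)
qed (simp add: Gal_0[OF assms])

lemma Gal_numeral: "\<sigma> \<in> Gal F \<Longrightarrow> \<sigma> (numeral k) = numeral k"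
  using Gal_of_int[of \<sigma> F "numeral k"] by simp

lemma pnt_gact:
  assumes \<sigma>: "\<sigma> \<in> Gal F"
  shows "pnt (gact \<sigma> P) = map_point \<sigma> (pnt P)"
  unfolding gact_def
proof (rule Pt_inverse)
  show "map_point \<sigma> (pnt P) \<in> {P. on_curve E0 P}"
  proof (cases "pnt P")
    case (Affine x y)
    have "y ^ 2 = x ^ 3 + x" using on_curve_pnt[of P] by (simp add: Affine)
    then have "\<sigma> (y ^ 2) = \<sigma> (x ^ 3 + x)" by (simp only:)
    then show ?thesis by (simp add: Affine Gal_power[OF \<sigma>] Gal_add[OF \<sigma>])
  qed simp
qed

lemma gact_add:
  assumes \<sigma>: "\<sigma> \<in> Gal F"
  shows "gact \<sigma> (P + Q) = gact \<sigma> P + gact \<sigma> Q"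
proof (rule pnt_eqI)
  note ops = Gal_add[OF \<sigma>] Gal_mult[OF \<sigma>] Gal_diff[OF \<sigma>] Gal_minus[OF \<sigma>] Gal_inverse[OF \<sigma>]
    Gal_power[OF \<sigma>] Gal_0[OF \<sigma>] Gal_1[OF \<sigma>] Gal_numeral[OF \<sigma>]
  have eq: "\<sigma> x1 = \<sigma> x2 \<longleftrightarrow> x1 = x2" for x1 x2 by (rule Gal_inj[OF \<sigma>])
  have "map_point \<sigma> (point_add E0 R S) = point_add E0 (map_point \<sigma> R) (map_point \<sigma> S)" for R S
  proof (cases "R = Infinity \<or> S = Infinity")
    case True
    then show ?thesis by (cases R; cases S) simp_all
  next
    case False
    then obtain x1 y1 x2 y2 where RS: "R = Affine x1 y1" "S = Affine x2 y2" by (metis point.exhaust)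
    have z: "\<sigma> y1 + \<sigma> y2 = 0 \<longleftrightarrow> y1 + y2 = 0" using eq[of "y1 + y2" 0] by (simp add: ops)
    show ?thesis
      unfolding RS point.map point_add.simps weierstrass.sel Let_def
      by (simp only: eq z mult_zero_left add_0_right diff_0_right if_distrib[of "map_point \<sigma>"] point.map
          if_distrib[of \<sigma>] ops cong: if_cong)
  qed
  then show "pnt (gact \<sigma> (P + Q)) = pnt (gact \<sigma> P + gact \<sigma> Q)"
    by (simp add: pnt_gact[OF \<sigma>] plus_pt.rep_eq)
qed

lemma Gal_Qi_iff: "\<sigma> \<in> Gal field_Qi \<longleftrightarrow> \<sigma> \<in> Gal field_Q \<and> \<sigma> qi = qi"
proof
  assume \<sigma>: "\<sigma> \<in> Gal field_Qi"
  have "qi \<in> field_Qi"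
    unfolding field_Qi_def using qi_pow(1) by (intro CollectI exI[of _ 0] exI[of _ 1] exI[of _ qi]) simp
  then show "\<sigma> \<in> Gal field_Q \<and> \<sigma> qi = qi"
    using \<sigma> Gal_rat[OF \<sigma>] by (auto simp: Gal_def field_Q_def)
next
  assume \<sigma>: "\<sigma> \<in> Gal field_Q \<and> \<sigma> qi = qi"
  then have s: "\<sigma> \<in> Gal field_Q" "\<sigma> qi = qi" by simp_all
  have "\<sigma> x = x" if x_in: "x \<in> field_Qi" for x
  proof -
    obtain a b z where x: "x = to_ac a + to_ac b * z" "z ^ 2 = - 1" using x_in by (auto simp: field_Qi_def)
    have "(z - qi) * (z + qi) = 0" using x(2) by (simp add: algebra_simps qi_sq power2_eq_square)
    then have "z = qi \<or> z = - qi" by (simp add: eq_neg_iff_add_eq_0)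
    then have "\<sigma> z = z" using s by (auto simp: Gal_minus)
    then show ?thesis by (simp add: x Gal_add[OF s(1)] Gal_mult[OF s(1)] Gal_rat[OF s(1)])
  qed
  then show "\<sigma> \<in> Gal field_Qi" using s(1) by (simp add: Gal_def)
qed

lemma gact_iop:
  assumes \<sigma>: "\<sigma> \<in> Gal F"
  shows "\<sigma> qi = qi \<Longrightarrow> gact \<sigma> (iop P) = iop (gact \<sigma> P)"
    "\<sigma> qi = - qi \<Longrightarrow> gact \<sigma> (iop P) = - iop (gact \<sigma> P)"
proof -
  have *: "pnt (gact \<sigma> (iop P)) = map_point \<sigma> (pnt (iop P))" "pnt (iop (gact \<sigma> P)) = scale_point (- qi) (map_point \<sigma> (pnt P))"
    "pnt (iop P) = scale_point (- qi) (pnt P)"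
    by (simp_all add: pnt_gact[OF \<sigma>] iop_def pnt_smap qi_pow)
  show "gact \<sigma> (iop P) = iop (gact \<sigma> P)" if "\<sigma> qi = qi"
    by (rule pnt_eqI, cases "pnt P")
      (simp_all add: * qi_pow that Gal_mult[OF \<sigma>] Gal_minus[OF \<sigma>] Gal_1[OF \<sigma>])
  show "gact \<sigma> (iop P) = - iop (gact \<sigma> P)" if "\<sigma> qi = - qi"
    by (rule pnt_eqI, cases "pnt P")
      (simp_all add: * qi_pow that Gal_mult[OF \<sigma>] Gal_minus[OF \<sigma>] Gal_1[OF \<sigma>] uminus_pt.rep_eq)
qed

text \<open>The value 0 at infinity agrees with the abscissa of \<open>P0\<close>, so vanishing of
  \<open>xc\<close> detects exactly the kernel of 1 + i.\<close>

definition xc :: "pt \<Rightarrow> QQbar" where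
  "xc P = (case pnt P of Infinity \<Rightarrow> 0 | Affine x y \<Rightarrow> x)"

lemma xc_eq_0: "xc P = 0 \<longleftrightarrow> P = 0 \<or> P = P0"
proof
  assume "xc P = 0"
  then show "P = 0 \<or> P = P0"
    by (cases "pnt P") (auto simp: xc_def pnt_eq_Infinity_iff dest: pnt_x_0)
qed (auto simp: xc_def pnt_P0 zero_pt.rep_eq)

lemma xc_piop:
  assumes "xc P \<noteq> 0"
  shows "xc P * xc P + 1 = 2 * qi * xc (piop P) * xc P"
proof (cases "pnt P")
  case (Affine x y)
  then have x: "x \<noteq> 0" "xc P = x" using assms by (simp_all add: xc_def)
  obtain b where "pnt (piop P) = Affine ((x\<^sup>2 + 1) / (2 * qi * x)) b" using pnt_piop[OF Affine x(1)] .
  then have "xc (piop P) = (x\<^sup>2 + 1) / (2 * qi * x)" by (simp add: xc_def)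
  then have "xc (piop P) * (2 * qi * x) = x\<^sup>2 + 1" using x(1) qi_neq_0 by simp
  then show ?thesis by (simp add: x power2_eq_square mult_ac)
qed (use assms in \<open>simp add: xc_def\<close>)

lemma xc_iop: "xc (iop P) = - xc P"
proof (cases "pnt P")
  case Infinity
  then have "P = 0" by (simp add: pnt_eq_Infinity_iff)
  then show ?thesis by (simp add: iop_0 xc_def zero_pt.rep_eq)
qed (simp add: xc_def pnt_iop)

lemma xc_gact: "\<sigma> \<in> Gal F \<Longrightarrow> xc (gact \<sigma> P) = \<sigma> (xc P)"
  by (cases "pnt P") (simp_all add: xc_def pnt_gact Gal_0)

lemma xc_eq_imp: "xc P = xc Q \<Longrightarrow> xc P \<noteq> 0 \<Longrightarrow> P = Q \<or> P = - Q"
  using pt_same_x[of Q _ _ P] by (cases "pnt P"; cases "pnt Q") (auto simp: xc_def)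

lemma piop_gact:
  assumes \<sigma>: "\<sigma> \<in> Gal field_Qi"
  shows "piop (gact \<sigma> P) = gact \<sigma> (piop P)"
proof -
  have "\<sigma> qi = qi" using \<sigma> by (simp add: Gal_Qi_iff)
  then show ?thesis by (simp add: piop_def gact_add[OF \<sigma>] gact_iop(1)[OF \<sigma>])
qed

lemma piop_P0: "piop P0 = 0"
  unfolding piop_def iop_P0 by (intro pnt_eqI) (simp add: plus_pt.rep_eq pnt_P0 zero_pt.rep_eq)

lemma funpow_commute:
  assumes "\<And>x. f (g x) = g (f x)"
  shows "(f ^^ n) (g x) = g ((f ^^ n) x)"
  by (induction n) (simp_all add: assms)

lemma piop_act: "tate_seq t \<Longrightarrow> piop (act w t n) = act (gpi * w) t n"
proof -
  assume t: "tate_seq t"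
  have "act (gpi * w) t n = act gpi (act w t) n" by (simp add: act_mult[OF t])
  also have "\<dots> = gsc 1 1 (act w t n)"
    by (rule act_eqI[OF tate_seq_act[OF t]]) (simp_all add: gpi_def residue_ops)
  finally show ?thesis by (simp add: gsc_def piop_def)
qed

lemma iop_act: "tate_seq t \<Longrightarrow> iop (act w t n) = act (gi * w) t n"
proof -
  assume t: "tate_seq t"
  have "act (gi * w) t n = act gi (act w t) n" by (simp add: act_mult[OF t])
  also have "\<dots> = gsc 0 1 (act w t n)"
    by (rule act_eqI[OF tate_seq_act[OF t]]) (simp_all add: gi_def residue_ops)
  finally show ?thesis by (simp add: gsc_def)
qed

lemma piop_funpow_act: "tate_seq t \<Longrightarrow> (piop ^^ j) (act w t n) = act (gpi ^ j * w) t n"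
  by (induction j) (simp_all add: piop_act mult.assoc)

lemma gpi_cancel:
  assumes "gpi * w = 0"
  shows "w = 0"
proof -
  have "2 * (gi * w) = gpi * (gpi * w)" by (simp add: gpi_sq flip: mult.assoc)
  then have "2 * (gi * w) = 0" using assms by simp
  then have "2 * im w = 0" "2 * re w = 0"
    by (simp_all add: gz_ops gz_numeral gi_def)
  then show ?thesis using z2_two_cancel by (cases w) (simp add: zero_gz_def)
qed

lemma gpi_pow_dvd: "gpi ^ Suc j dvd gpi ^ j * w \<Longrightarrow> gpi dvd w"
proof (induction j)
  case (Suc j)
  then obtain q where "gpi ^ Suc j * w = gpi ^ Suc (Suc j) * q" by (elim dvdE)
  then have "gpi * (gpi ^ j * w - gpi ^ Suc j * q) = 0" by (simp add: algebra_simps)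
  then have "gpi ^ j * w - gpi ^ Suc j * q = 0" by (rule gpi_cancel)
  then have "gpi ^ j * w = gpi ^ Suc j * q" by simp
  then have "gpi ^ Suc j dvd gpi ^ j * w" by (metis dvd_triv_left)
  then show ?case by (rule Suc.IH)
qed simp

text \<open>All possible \<open>x\<close>-coordinates of points of exact order \<open>(1 + i)\<^sup>j\<^sup>+\<^sup>3\<close> above a fixed point of order \<open>(1 + i)\<^sup>3\<close>.\<close>

primrec xset :: "nat \<Rightarrow> QQbar set" where
  "xset 0 = {1}"
| "xset (Suc j) = (\<Union>s\<in>xset j. {T. T * T + 1 = 2 * qi * s * T})"

lemma card_xset: "finite (xset j) \<and> card (xset j) \<le> 2 ^ j"
proof (induction j)
  case (Suc j)
  have two: "finite {T. T * T + 1 = 2 * qi * s * T} \<and> card {T. T * T + 1 = 2 * qi * s * T} \<le> 2" for s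
  proof (cases "{T. T * T + 1 = 2 * qi * s * T} = {}")
    case False
    then obtain T0 where T0: "T0 * T0 + 1 = 2 * qi * s * T0" by blast
    have "{T. T * T + 1 = 2 * qi * s * T} \<subseteq> {T0, 2 * qi * s - T0}"
    proof
      fix T assume "T \<in> {T. T * T + 1 = 2 * qi * s * T}"
      then have T: "T * T + 1 = 2 * qi * s * T" by simp
      have "(T - T0) * (T - (2 * qi * s - T0)) = (T * T + 1 - 2 * qi * s * T) - (T0 * T0 + 1 - 2 * qi * s * T0)"
        by (simp add: algebra_simps)
      then have "(T - T0) * (T - (2 * qi * s - T0)) = 0" unfolding T T0 by simp
      then show "T \<in> {T0, 2 * qi * s - T0}" by simp
    qed
    moreover have "card {T0, 2 * qi * s - T0} \<le> 2" by (simp add: card_insert_if)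
    moreover have "finite {T0, 2 * qi * s - T0}" by simp
    ultimately show ?thesis by (meson card_mono finite_subset order_trans)
  qed simp
  have "card (xset (Suc j)) \<le> (\<Sum>s\<in>xset j. card {T. T * T + 1 = 2 * qi * s * T})"
    using Suc by (simp add: card_UN_le)
  also have "\<dots> \<le> (\<Sum>s\<in>xset j. 2)" using two by (intro sum_mono) blast
  also have "\<dots> \<le> 2 ^ Suc j" using Suc by simp
  finally show ?case using Suc two by simp
qed simp

section \<open>Galois transitivity on the points of exact order 2^n, up to fourth roots of
  unity\<close>

context tate_gen
begin

context
  fixes n :: nat
  assumes n: "n \<ge> 2"
begin

text \<open>For a unit v the point has exact order (1 + i)^(2n); after 2 n - k steps the order is (1
  + i)^k, and for k at least 2 such a point is not in the kernel of 1 + i.\<close>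

lemma level_points:
  assumes v: "v dvd 1" and k: "2 \<le> k" "k \<le> 2 * n"
  shows "xc ((piop ^^ (2 * n - k)) (act v e n)) \<noteq> 0"
proof
  assume "xc ((piop ^^ (2 * n - k)) (act v e n)) = 0"
  then have "piop ((piop ^^ (2 * n - k)) (act v e n)) = 0"
    by (auto simp: xc_eq_0 piop_0 piop_P0)
  then have "(piop ^^ Suc (2 * n - k)) (act v e n) = 0" by simp
  then have "act (gpi ^ Suc (2 * n - k) * v) e n = 0" by (simp only: piop_funpow_act[OF seq])
  then have "act (gpi ^ Suc (2 * n - k) * v) e n = act 0 e n"
    by (simp add: act_def gsc_def zero_gz_def residue_ops iop_0)
  then have "2 ^ n dvd gpi ^ Suc (2 * n - k) * v" by (simp only: act_level_eq_iff) simp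
  then have "gpi ^ (2 * n) dvd gpi ^ Suc (2 * n - k) * v" by (simp only: pow2_dvd_iff_gpi)
  moreover have "gpi ^ Suc (Suc (2 * n - k)) dvd gpi ^ (2 * n)" using k by (intro le_imp_power_dvd) simp
  ultimately have "gpi ^ Suc (Suc (2 * n - k)) dvd gpi ^ Suc (2 * n - k) * v" by (metis dvd_trans)
  then have "gpi dvd v" by (rule gpi_pow_dvd)
  then show False using v by (simp add: gz_unit_iff)
qed

text \<open>The index k is the exact order (1 + i)^k of the point whose abscissa is
  \<open>s k\<close>. These are the two hypotheses of \<open>uniformizer_tower\<close>.\<close>

lemma level_recursion:
  assumes v: "v dvd 1"
  defines "s \<equiv> \<lambda>k. xc ((piop ^^ (2 * n - k)) (act v e n))"
  shows "2 \<le> k \<Longrightarrow> k < 2 * n \<Longrightarrow> s (Suc k) * s (Suc k) + 1 = 2 * qi * s k * s (Suc k)"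
    "s 3 * s 3 = 1"
proof -
  have rec: "s (Suc k) * s (Suc k) + 1 = 2 * qi * s k * s (Suc k)" if k: "1 \<le> k" "k < 2 * n" for k
  proof -
    have "2 * n - k = Suc (2 * n - Suc k)" using k by simp
    then have "s k = xc (piop ((piop ^^ (2 * n - Suc k)) (act v e n)))" by (simp add: s_def)
    then show ?thesis using xc_piop[OF level_points[OF v, of "Suc k"]] k by (simp add: s_def)
  qed
  then show "2 \<le> k \<Longrightarrow> k < 2 * n \<Longrightarrow> s (Suc k) * s (Suc k) + 1 = 2 * qi * s k * s (Suc k)" by simp
  have "piop ((piop ^^ (2 * n - 1)) (act v e n)) = (piop ^^ (2 * n)) (act v e n)"
    using n by (cases "2 * n") simp_all
  also have "\<dots> = act (gpi ^ (2 * n) * v) e n" by (rule piop_funpow_act[OF seq])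
  also have "\<dots> = act 0 e n"
    unfolding act_level_eq_iff pow2_dvd_iff_gpi by simp
  also have "\<dots> = 0" by (simp add: act_def gsc_def zero_gz_def residue_ops iop_0)
  finally have "s 1 = 0" unfolding s_def using piop_eq_0 xc_eq_0 by blast
  then have s2: "s 2 * s 2 + 1 = 0" using rec[of 1] n by (simp add: numeral_2_eq_2)
  have s3: "s 3 * s 3 + 1 = 2 * qi * s 2 * s 3" using rec[of 2] n by (simp add: numeral_3_eq_3 numeral_2_eq_2)
  \<comment> \<open>As \<open>s 2\<close> squares to -1, the quadratic for \<open>s 3\<close> has
    the double root \<open>qi * s 2\<close>.\<close>
  have "(s 3 - qi * s 2) * (s 3 - qi * s 2) = (s 3 * s 3 + 1 - 2 * qi * s 2 * s 3) - (s 2 * s 2 + 1)"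
    by (simp add: algebra_simps qi_qi)
  then have "s 3 - qi * s 2 = 0" unfolding s2 s3 by simp
  then have "s 3 = qi * s 2" by simp
  then have "s 3 * s 3 = (qi * qi) * (s 2 * s 2)" by (simp only: mult_ac)
  then show "s 3 * s 3 = 1" using s2 unfolding qi_sq by (simp add: add_eq_0_iff)
qed

text \<open>The top element b of \<open>uniformizer_tower\<close>. Its numerator
  \<open>2 * s 3\<close> changes sign under \<open>iop\<close> together with the denominator, so the
  value is the same for all multiples of Q by fourth roots of unity.\<close>

definition bval :: "pt \<Rightarrow> QQbar" where
  "bval Q = 2 * xc ((piop ^^ (2 * n - 3)) Q) / (xc Q - xc (piop Q))"

lemma bval_iop: "bval (iop Q) = bval Q"
proof -
  have "(piop ^^ j) (iop Q) = iop ((piop ^^ j) Q)" for j by (rule funpow_commute) (simp add: iop_piop)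
  moreover have "piop (iop Q) = iop (piop Q)" by (simp add: iop_piop)
  ultimately have "bval (iop Q) = (- (2 * xc ((piop ^^ (2 * n - 3)) Q))) / (- (xc Q - xc (piop Q)))"
    by (simp add: bval_def xc_iop)
  moreover have "(- a) / (- b) = a / b" for a b :: QQbar by simp
  ultimately show ?thesis unfolding bval_def by (simp only:)
qed

lemma bval_gact:
  assumes \<sigma>: "\<sigma> \<in> Gal field_Qi"
  shows "bval (gact \<sigma> Q) = \<sigma> (bval Q)"
proof -
  have "(piop ^^ j) (gact \<sigma> Q) = gact \<sigma> ((piop ^^ j) Q)" for j
    by (rule funpow_commute) (rule piop_gact[OF \<sigma>])
  then show ?thesis
    by (simp add: bval_def piop_gact[OF \<sigma>] xc_gact[OF \<sigma>] Gal_inverse[OF \<sigma>] Gal_mult[OF \<sigma>]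
        Gal_diff[OF \<sigma>] Gal_numeral[OF \<sigma>])
qed

text \<open>Over the rationals the orbit size is a multiple of 2^(2n-2). The automorphisms fixing i
  and their composites with c cover the whole group, so over Q(i) at least half of the orbit
  remains.\<close>

lemma card_orbit_Qi:
  assumes v: "v dvd 1" and c: "c \<in> Gal field_Q" "c qi = - qi" "\<And>x. c (c x) = x"
  shows "card (orbit field_Qi (bval (act v e n))) \<ge> 2 ^ (2 * n - 3)"
proof -
  define x where "x = bval (act v e n)"
  define s where "s = (\<lambda>k. xc ((piop ^^ (2 * n - k)) (act v e n)))"
  have "3 \<le> 2 * n" using n by simp
  have s2n: "s (2 * n - 1) = xc (piop (act v e n))"
    using n by (simp add: s_def)
  have "intg (2 * s 3 / (s (2 * n) - s (2 * n - 1)))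
    \<and> (\<exists>u. local_unit u \<and> (2 * s 3 / (s (2 * n) - s (2 * n - 1))) ^ (2 ^ (2 * n - 2)) = 2 * u)"
    using uniformizer_tower[of "2 * n" s "2 * n"] level_recursion[OF v] \<open>3 \<le> 2 * n\<close> unfolding s_def by blast
  moreover have "2 * s 3 / (s (2 * n) - s (2 * n - 1)) = x"
    unfolding s2n by (simp add: x_def bval_def s_def)
  ultimately obtain u where "intg x" "local_unit u" "x ^ (2 ^ (2 * n - 2)) = 2 * u" by auto
  then have dvd: "2 ^ (2 * n - 2) dvd card (orbit field_Q x)" by (intro dvd_card_orbit)
  have "x \<in> orbit field_Q x" unfolding orbit_def using Gal_id by (metis id_apply imageI)
  then have "card (orbit field_Q x) > 0" using finite_orbit card_gt_0_iff by blast
  then have le: "2 ^ (2 * n - 2) \<le> card (orbit field_Q x)" using dvd by (rule dvd_imp_le[rotated])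
  have "orbit field_Q x \<subseteq> orbit field_Qi x \<union> c ` orbit field_Qi x"
  proof
    fix y assume "y \<in> orbit field_Q x"
    then obtain \<sigma> where \<sigma>: "\<sigma> \<in> Gal field_Q" "y = \<sigma> x" by (auto simp: orbit_def)
    show "y \<in> orbit field_Qi x \<union> c ` orbit field_Qi x"
    proof (cases "\<sigma> qi = qi")
      case True
      then show ?thesis using \<sigma> Gal_Qi_iff by (auto simp: orbit_def)
    next
      case False
      then have "(c \<circ> \<sigma>) qi = qi" using Gal_qi[OF \<sigma>(1)] c(2) by (auto simp: Gal_minus[OF c(1)])
      then have "c \<circ> \<sigma> \<in> Gal field_Qi" using Gal_comp[OF c(1) \<sigma>(1)] Gal_Qi_iff by blast
      then have "(c \<circ> \<sigma>) x \<in> orbit field_Qi x" unfolding orbit_def by (rule imageI)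
      then have "c ((c \<circ> \<sigma>) x) \<in> c ` orbit field_Qi x" by (rule imageI)
      then show ?thesis using c(3) \<sigma>(2) by simp
    qed
  qed
  then have "card (orbit field_Q x) \<le> card (orbit field_Qi x \<union> c ` orbit field_Qi x)"
    by (intro card_mono) (simp_all add: finite_orbit)
  also have "\<dots> \<le> card (orbit field_Qi x) + card (c ` orbit field_Qi x)" by (rule card_Un_le)
  also have "\<dots> \<le> 2 * card (orbit field_Qi x)" using card_image_le[OF finite_orbit] by simp
  finally have "card (orbit field_Q x) \<le> 2 * card (orbit field_Qi x)" .
  moreover have "(2 :: nat) ^ (2 * n - 2) = 2 * 2 ^ (2 * n - 3)"
  proof -
    have "2 * n - 2 = Suc (2 * n - 3)" using n by simp
    then show ?thesis by (simp only: power_Suc)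
  qed
  ultimately show ?thesis using le unfolding x_def by linarith
qed

lemma xset_mem:
  assumes v: "v dvd 1" and norm: "xc ((piop ^^ (2 * n - 3)) (act v e n)) = 1"
  shows "xc (act v e n) \<in> xset (2 * n - 3)"
proof -
  define s where "s = (\<lambda>k. xc ((piop ^^ (2 * n - k)) (act v e n)))"
  have "3 + j \<le> 2 * n \<Longrightarrow> s (3 + j) \<in> xset j" for j
  proof (induction j)
    case 0
    then show ?case using norm by (simp add: s_def)
  next
    case (Suc j)
    then have "s (Suc (3 + j)) * s (Suc (3 + j)) + 1 = 2 * qi * s (3 + j) * s (Suc (3 + j))"
      unfolding s_def by (intro level_recursion(1)[OF v]) simp_all
    moreover have "s (3 + j) \<in> xset j" using Suc by simp
    ultimately show ?case by auto
  qed
  from this[of "2 * n - 3"] show ?thesis using n by (simp add: s_def)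
qed

text \<open>\<open>s 3\<close> is 1 or -1, and multiplication by i exchanges the two without
  changing \<open>bval\<close>. With value 1 the abscissas fall into \<open>xset\<close>.\<close>

lemma normalize_point:
  assumes v: "v dvd 1"
  obtains w where "w = v \<or> w = gi * v" "w dvd 1" "bval (act w e n) = bval (act v e n)"
    "xc ((piop ^^ (2 * n - 3)) (act w e n)) = 1"
proof -
  define t where "t = xc ((piop ^^ (2 * n - 3)) (act v e n))"
  have "t * t = 1" using level_recursion(2)[OF v] by (simp add: t_def)
  then have "(t - 1) * (t + 1) = 0" by (simp add: algebra_simps)
  then consider "t = 1" | "t = - 1" by (auto simp: eq_neg_iff_add_eq_0)
  then show ?thesis
  proof cases
    case 1
    then show ?thesis using that[of v] v by (simp add: t_def)
  next
    case 2
    have "gi dvd 1" using gi_pow_unit[of 1] by simp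
    then have u: "gi * v dvd 1" using v mult_dvd_mono[of gi 1 v 1] by simp
    have "(piop ^^ j) (iop Q) = iop ((piop ^^ j) Q)" for j Q by (rule funpow_commute) (simp add: iop_piop)
    then have "xc ((piop ^^ (2 * n - 3)) (act (gi * v) e n)) = 1"
      using 2 by (simp add: t_def xc_iop flip: iop_act[OF seq])
    moreover have "bval (act (gi * v) e n) = bval (act v e n)"
      by (simp add: bval_iop flip: iop_act[OF seq])
    ultimately show ?thesis using that[of "gi * v"] u by simp
  qed
qed

text \<open>For a point with \<open>s 3 = 1\<close>, \<open>bval\<close> depends only on the
  abscissa x; the subtracted term is the abscissa of its multiple by 1 + i.\<close>

definition beta :: "QQbar \<Rightarrow> QQbar" where
  "beta x = 2 / (x - (x * x + 1) / (2 * qi * x))"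

lemma bval_eq_beta:
  assumes v: "v dvd 1" and norm: "xc ((piop ^^ (2 * n - 3)) (act v e n)) = 1"
  shows "bval (act v e n) = beta (xc (act v e n))"
proof -
  have x0: "xc (act v e n) \<noteq> 0" using level_points[OF v, of "2 * n"] n by simp
  then have "xc (piop (act v e n)) = (xc (act v e n) * xc (act v e n) + 1) / (2 * qi * xc (act v e n))"
    using xc_piop[OF x0] qi_neq_0 by (simp add: eq_divide_eq mult_ac)
  then show ?thesis by (simp add: bval_def norm beta_def)
qed

text \<open>The multiplier is a unit: if 1 + i divided it, the image of (1 + i) \<open>E1\<close> =
  \<open>P0\<close> would be the point at infinity.\<close>

lemma gact_e:
  assumes \<sigma>: "\<sigma> \<in> Gal field_Qi"
  obtains w where "w dvd 1" "\<And>m. gact \<sigma> (e m) = act w e m"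
proof -
  have add: "gact \<sigma> (P + Q) = gact \<sigma> P + gact \<sigma> Q" for P Q by (rule gact_add[OF \<sigma>])
  have io: "gact \<sigma> (iop P) = iop (gact \<sigma> P)" for P
    using gact_iop(1)[OF \<sigma>] \<sigma> by (simp add: Gal_Qi_iff)
  obtain w where w: "(\<lambda>m. gact \<sigma> (e m)) = act w e" using act_surj[OF tate_seq_hom[OF add seq]] .
  then have wm: "gact \<sigma> (e m) = act w e m" for m by (rule fun_cong)
  have "w dvd 1"
  proof (rule ccontr)
    assume "\<not> w dvd 1"
    then have "gpi dvd w" by (simp add: gz_unit_iff)
    then obtain q where q: "w = gpi * q" by (elim dvdE)
    have "act (gpi * w) e 1 = act 0 e 1"
      unfolding act_level_eq_iff by (simp add: q gpi_sq flip: mult.assoc)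
    then have "piop (act w e 1) = 0"
      unfolding piop_act[OF seq] by (simp add: act_def gsc_def zero_gz_def residue_ops iop_0)
    then have "piop (gact \<sigma> (e 1)) = 0" by (simp add: wm)
    then have "gact \<sigma> (piop (e 1)) = 0" by (simp add: piop_gact[OF \<sigma>])
    then have "map_point \<sigma> (pnt P0) = Infinity"
      by (simp add: first[unfolded One_nat_def] piop_def piop_E1 zero_pt.rep_eq flip: pnt_gact[OF \<sigma>])
    then show False by (simp add: pnt_P0)
  qed
  then show ?thesis using that wm by blast
qed

text \<open>The orbit has at least 2^(2n-3) elements and lies in the image of \<open>xset\<close>,
  which has at most as many. Equality forces the orbit to be all of it and \<open>beta\<close> to be
  injective.\<close>

lemma Gal_transitive_level:
  assumes v: "v dvd 1" and c: "c \<in> Gal field_Q" "c qi = - qi" "\<And>x. c (c x) = x"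
  obtains \<sigma> z where "\<sigma> \<in> Gal field_Qi" "z \<in> mu4" "gact \<sigma> (e n) = act (z * v) e n"
proof -
  have e1: "e n = act 1 e n" by (simp add: act_1[OF seq])
  define x where "x = bval (act 1 e n)"
  let ?A = "xset (2 * n - 3)"
  have A: "finite ?A" "card ?A \<le> 2 ^ (2 * n - 3)" using card_xset by simp_all
  have orb: "orbit field_Qi x \<subseteq> beta ` ?A"
  proof
    fix y assume "y \<in> orbit field_Qi x"
    then obtain \<sigma> where \<sigma>: "\<sigma> \<in> Gal field_Qi" "y = \<sigma> x" by (auto simp: orbit_def)
    obtain w where w: "w dvd 1" "gact \<sigma> (e n) = act w e n" using gact_e[OF \<sigma>(1)] by metis
    have "y = bval (act w e n)" by (simp add: \<sigma>(2) x_def w(2) flip: bval_gact[OF \<sigma>(1)] e1)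
    moreover obtain w' where "w' dvd 1" "bval (act w' e n) = bval (act w e n)"
      "xc ((piop ^^ (2 * n - 3)) (act w' e n)) = 1"
      using normalize_point[OF w(1)] by metis
    ultimately have "y = beta (xc (act w' e n))" "xc (act w' e n) \<in> ?A"
      using bval_eq_beta xset_mem by simp_all
    then show "y \<in> beta ` ?A" by (rule image_eqI)
  qed
  have lower: "2 ^ (2 * n - 3) \<le> card (orbit field_Qi x)" unfolding x_def by (rule card_orbit_Qi[OF _ c]) simp
  have "card (beta ` ?A) \<le> card ?A" by (rule card_image_le[OF A(1)])
  then have cb: "card (beta ` ?A) \<le> card (orbit field_Qi x)" "card (beta ` ?A) \<le> card ?A"
    using lower A(2) by linarith+
  have fb: "finite (beta ` ?A)" using A(1) by simp
  have eq: "orbit field_Qi x = beta ` ?A" by (rule card_seteq[OF fb orb cb(1)])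
  then have "card (beta ` ?A) = card ?A" using lower A(2) cb(2) by simp
  then have inj: "inj_on beta ?A" by (rule eq_card_imp_inj_on[OF A(1)])
  obtain v' where v': "v' = v \<or> v' = gi * v" "v' dvd 1" "xc ((piop ^^ (2 * n - 3)) (act v' e n)) = 1"
    using normalize_point[OF v] by metis
  have v'A: "xc (act v' e n) \<in> ?A" using xset_mem v' by simp
  then have "beta (xc (act v' e n)) \<in> orbit field_Qi x" unfolding eq by (rule imageI)
  then obtain \<sigma> where \<sigma>: "\<sigma> \<in> Gal field_Qi" "beta (xc (act v' e n)) = \<sigma> x" by (auto simp: orbit_def)
  obtain w where w: "w dvd 1" "gact \<sigma> (e n) = act w e n" using gact_e[OF \<sigma>(1)] by metis
  obtain w' where w': "w' = w \<or> w' = gi * w" "w' dvd 1" "bval (act w' e n) = bval (act w e n)"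
    "xc ((piop ^^ (2 * n - 3)) (act w' e n)) = 1"
    using normalize_point[OF w(1)] by metis
  have "\<sigma> x = bval (act w e n)" by (simp add: x_def w(2) flip: bval_gact[OF \<sigma>(1)] e1)
  then have "beta (xc (act w' e n)) = beta (xc (act v' e n))" using \<sigma>(2) w' bval_eq_beta by simp
  \<comment> \<open>Injectivity of \<open>beta\<close> recovers the abscissa, hence the point up to
    sign; the normalizations cost at most further factors i.\<close>
  then have "xc (act w' e n) = xc (act v' e n)" using inj v'A xset_mem w' by (simp add: inj_on_eq_iff)
  moreover have "xc (act w' e n) \<noteq> 0" using level_points[OF w'(2), of "2 * n"] n by simp
  ultimately have pm: "act w' e n = act v' e n \<or> act w' e n = - act v' e n" by (rule xc_eq_imp)
  have neg: "- act q e n = act (- 1 * q) e n" for q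
    using iop_act[OF seq, of q n] iop_act[OF seq, of "gi * q" n] iop_iop[of "act q e n"]
    by (simp add: gi_sq flip: mult.assoc)
  obtain y where y: "y \<in> mu4" "act w' e n = act (y * v) e n"
  proof -
    have "\<exists>y. y \<in> mu4 \<and> act w' e n = act (y * v) e n"
      using pm v'(1)
      by (elim disjE) (simp_all only: neg, auto simp: mu4_def intro: exI[of _ 1] exI[of _ gi] exI[of _ "- 1"] exI[of _ "- gi"])
    then show ?thesis using that by blast
  qed
  have "\<exists>z. z \<in> mu4 \<and> act w e n = act (z * v) e n"
  proof (cases "w' = w")
    case True
    then show ?thesis using y by blast
  next
    case False
    then have "iop (act w e n) = act (y * v) e n" using w'(1) y(2) by (simp add: iop_act[OF seq])
    then have "iop (iop (act w e n)) = act (gi * (y * v)) e n" by (simp add: iop_act[OF seq])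
    then have "- (- act w e n) = - act (gi * (y * v)) e n" by (simp only: iop_iop)
    then have "act w e n = - act (gi * (y * v)) e n" by simp
    then have "act w e n = act ((- 1 * gi * y) * v) e n" unfolding neg by (simp only: mult.assoc)
    moreover have "- 1 * gi * y \<in> mu4" using y(1) by (intro mu4_mult) (simp_all add: mu4_def)
    ultimately show ?thesis by blast
  qed
  then show ?thesis using that[OF \<sigma>(1)] w(2) by auto
qed

end

end

section \<open>Complex conjugation\<close>

lemma gz_two_cancel:
  fixes v w :: gz
  assumes "2 * v = 2 * w"
  shows "v = w"
proof -
  have "2 * (re v - re w) = 0" "2 * (im v - im w) = 0"
    using assms by (simp_all add: gz_ops gz_numeral algebra_simps)
  then have "re v - re w = 0" "im v - im w = 0" using z2_two_cancel by blast+
  then show ?thesis by (simp add: gz.expand)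
qed

text \<open>The solution is v = (1 + u) / 2, since u (1 + conj u) = u + 1. The real part being 1
  modulo 4 makes the division possible, and the norm equation makes the imaginary part of v even and
  v a unit.\<close>

lemma norm_one_aux:
  assumes u: "u * gcnj u = 1" and re: "residue (re u) 2 = 1"
  obtains v where "v dvd 1" "u * gcnj v = v"
proof -
  have "2 ^ 2 dvd re u - 1"
    using re unfolding residue_eq_iff_dvd[symmetric] by (simp add: residue_ops)
  then obtain k where k: "re u - 1 = 2 ^ 2 * k" by (elim dvdE)
  then have a: "re u = 1 + 2 * (2 * k)" by (simp add: algebra_simps)
  have norm: "re u * re u + im u * im u = 1" using u by (simp add: gcnj_def gz_ops)
  have ra: "residue (re u) 1 = 1" by (simp add: a residue_ops residue_numeral)
  have rb: "residue (im u) 1 = 0"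
  proof -
    have "residue (re u * re u + im u * im u) 1 = 1" by (simp add: norm residue_ops)
    then show ?thesis using residue_1_cases[of "im u"] ra by (auto simp: residue_ops)
  qed
  then obtain m where m: "im u = 2 * m" using two_dvd_z2_iff by (metis dvdE)
  have "2 * (2 * (m * m + 2 * (k + 2 * (k * k)))) = (re u * re u + im u * im u) - 1"
    unfolding a m by (simp add: algebra_simps)
  then have "2 * (2 * (m * m + 2 * (k + 2 * (k * k)))) = 0" unfolding norm by simp
  then have mm: "m * m + 2 * (k + 2 * (k * k)) = 0" by (rule z2_two_cancel[OF z2_two_cancel])
  have rm: "residue m 1 = 0"
  proof -
    have "m * m = - (2 * (k + 2 * (k * k)))" using mm by (simp only: eq_neg_iff_add_eq_0)
    then have "m * m = 2 * (- (k + 2 * (k * k)))" by simp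
    then have "2 dvd m * m" by (rule dvdI)
    then have "residue (m * m) 1 = 0" by (simp only: two_dvd_z2_iff)
    then show ?thesis using residue_1_cases[of m] by (auto simp: residue_ops)
  qed
  define v where "v = GZ (1 + 2 * k) m"
  have v2: "2 * v = 1 + u" by (cases u) (use a m in \<open>simp add: v_def gz_ops gz_numeral algebra_simps\<close>)
  have "residue (re v + im v) 1 = 1" using rm by (simp add: v_def residue_ops residue_numeral)
  then have "v dvd 1" by (simp add: gz_unit_iff gpi_dvd_iff two_dvd_z2_iff)
  moreover have "2 * (u * gcnj v) = 2 * v"
  proof -
    have "2 * gcnj v = gcnj (2 * v)" by (simp add: gcnj_def gz_ops gz_numeral)
    also have "\<dots> = 1 + gcnj u" unfolding v2 by (simp add: gcnj_def gz_ops)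
    finally have "2 * (u * gcnj v) = u * (1 + gcnj u)" by (simp add: mult.left_commute)
    then show ?thesis unfolding v2 by (simp add: distrib_left u add.commute)
  qed
  then have "u * gcnj v = v" by (rule gz_two_cancel)
  ultimately show ?thesis by (rule that)
qed

text \<open>Hilbert 90 for \<open>\<int>\<^sub>2[i]\<close> up to the fourth roots of unity: \<open>v = (1 + u) / 2\<close> once \<open>u\<close> is close to \<open>1\<close>.\<close>

lemma norm_one:
  assumes u: "u * gcnj u = 1"
  obtains v z where "v dvd 1" "z \<in> mu4" "u * gcnj v = z * v"
proof -
  note goal = that
  have main: thesis if x: "x * gcnj x = 1" "residue (re x) 1 = 1" and z: "z \<in> mu4" "u = z * x" for x z
  proof -
    have "residue (re x) 2 mod 2 = 1" using x(2) residue_mod[of 1 2 "re x"] by simp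
    moreover have "0 \<le> residue (re x) 2" "residue (re x) 2 < 4" using residue_bounds[of "re x" 2] by simp_all
    ultimately have "residue (re x) 2 = 1 \<or> residue (re x) 2 = 3" by presburger
    then consider "residue (re x) 2 = 1" | "residue (re x) 2 = 3" by blast
    then show thesis
    proof cases
      case 1
      obtain v where "v dvd 1" "x * gcnj v = v" using norm_one_aux[OF x(1) 1] .
      then show thesis using goal[of v z] z by (simp add: mult.assoc)
    next
      case 2
      \<comment> \<open>A change of sign moves the real part from 3 to 1 modulo 4; the sign goes
        into the root of unity.\<close>
      have "(- x) * gcnj (- x) = 1" using x(1) by (simp add: gcnj_def gz_ops)
      moreover have "residue (re (- x)) 2 = 1" using 2 by (simp add: gz_ops residue_ops)
      ultimately obtain v where v: "v dvd 1" "(- x) * gcnj v = v" by (rule norm_one_aux)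
      have "- z \<in> mu4" using mu4_mult[of "- 1" z] z(1) by (simp add: mu4_def)
      moreover have "u * gcnj v = - z * ((- x) * gcnj v)" by (simp add: z(2) mult.assoc)
      then have "u * gcnj v = - z * v" unfolding v(2) .
      ultimately show thesis using goal[OF v(1)] by blast
    qed
  qed
  show thesis
  proof (cases "residue (re u) 1 = 1")
    case True
    then show thesis using main[of u 1] u mu4_one by simp
  next
    case False
    then have r: "residue (re u) 1 = 0" using residue_1_cases by blast
    have norm: "re u * re u + im u * im u = 1" using u by (simp add: gcnj_def gz_ops)
    have "residue (re u * re u + im u * im u) 1 = 1" by (simp add: norm residue_ops)
    then have i: "residue (im u) 1 = 1" using residue_1_cases[of "im u"] r by (auto simp: residue_ops)
    \<comment> \<open>Exactly one of the two coordinates of u is odd; multiplying by -i makes it the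
      real part.\<close>
    define x where "x = - gi * u"
    have "x * gcnj x = (gi * gcnj gi) * (u * gcnj u)" by (simp add: x_def gcnj_def gz_ops gi_def algebra_simps)
    then have "x * gcnj x = 1" using u by (simp add: gcnj_def gi_def gz_ops)
    moreover have "residue (re x) 1 = 1" using i by (simp add: x_def gi_def gz_ops)
    moreover have "u = gi * x" by (simp add: x_def gi_sq flip: mult.assoc)
    ultimately show thesis using main mu4_gi by blast
  qed
qed

section \<open>Adjoining an involution to a closed subgroup\<close>

lemma agree_mult:
  assumes "agree n A B"
  shows "agree n (A ** M) (B ** M)"
  using assms by (simp add: agree_def mat22_mult_nth residue_ops)

text \<open>An involution normalizing H produces a group of two cosets, and a union of two closed
  sets is closed.\<close>

lemma closed_subgroup_extend:
  assumes H: "closed_subgroup H" and g: "g ** g = mat 1" and conj: "\<And>B. B \<in> H \<Longrightarrow> g ** B ** g \<in> H"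
  shows "H \<union> (\<lambda>B. B ** g) ` H = closed_gen (insert g H)"
proof (rule closed_gen_eqI)
  let ?G = "H \<union> (\<lambda>B. B ** g) ` H"
  have gH: "g ** B = (g ** B ** g) ** g" for B
    by (simp add: g flip: matrix_mul_assoc)
  have left: "g ** B \<in> (\<lambda>B. B ** g) ` H" if "B \<in> H" for B
    using conj[OF that] gH[of B] by (rule image_eqI[rotated])
  note mul = closed_subgroupD(3)[OF H]
  show "closed_subgroup ?G"
  proof (rule closed_subgroupI)
    show "mat 1 \<in> ?G" using closed_subgroupD(2)[OF H] by simp
    have HA: "\<exists>C\<in>H. B ** C = mat 1 \<and> C ** B = mat 1" if B: "B \<in> H" for B
    proof -
      obtain C where C: "B ** C = mat 1" "C ** B = mat 1"
        using closed_subgroupD(1)[OF H B] by (auto simp: invertible_def)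
      then show ?thesis using closed_subgroupD(4)[OF H B C] by blast
    qed
    show "\<exists>C\<in>?G. A ** C = mat 1 \<and> C ** A = mat 1" if A: "A \<in> ?G" for A
    proof (cases "A \<in> H")
      case True
      then show ?thesis using HA by blast
    next
      case False
      then obtain B where B: "B \<in> H" "A = B ** g" using A by blast
      obtain C where C: "C \<in> H" "B ** C = mat 1" "C ** B = mat 1" using HA[OF B(1)] by blast
      have "A ** (g ** C) = B ** (g ** g) ** C" by (simp add: B(2) matrix_mul_assoc)
      then have 1: "A ** (g ** C) = mat 1" by (simp add: g C)
      have "(g ** C) ** A = g ** (C ** B) ** g" by (simp add: B(2) matrix_mul_assoc)
      then have 2: "(g ** C) ** A = mat 1" by (simp add: g C)
      show ?thesis using 1 2 left[OF C(1)] by blast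
    qed
    show "A ** B \<in> ?G" if A: "A \<in> ?G" and B: "B \<in> ?G" for A B
    proof -
      consider "A \<in> H" "B \<in> H" | C where "A \<in> H" "C \<in> H" "B = C ** g"
        | C where "C \<in> H" "A = C ** g" "B \<in> H" | C D where "C \<in> H" "A = C ** g" "D \<in> H" "B = D ** g"
        using A B by (elim UnE imageE) auto
      then show ?thesis
      proof cases
        case 1
        then show ?thesis using mul by blast
      next
        case 2
        then have "A ** B = (A ** C) ** g" by (simp add: matrix_mul_assoc)
        then show ?thesis using mul[OF 2(1,2)] by blast
      next
        case 3
        then have "A ** B = C ** (g ** B)" by (simp add: matrix_mul_assoc)
        also have "\<dots> = (C ** (g ** B ** g)) ** g" by (simp add: g flip: matrix_mul_assoc)
        finally show ?thesis using mul[OF 3(1) conj[OF 3(3)]] by blast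
      next
        case 4
        then have "A ** B = C ** (g ** D ** g)" by (simp add: matrix_mul_assoc)
        then show ?thesis using mul[OF 4(1) conj[OF 4(3)]] by simp
      qed
    qed
    show "A \<in> ?G" if inv: "invertible A" and app: "\<And>n. \<exists>B\<in>?G. agree n A B" for A
    proof (cases "\<forall>n. \<exists>B\<in>H. agree n A B")
      case True
      then show ?thesis using closed_subgroupD(5)[OF H inv] by blast
    next
      case False
      \<comment> \<open>Beyond precision N all approximations come from the coset of g; multiplying
        by g brings them back to \<open>H\<close>.\<close>
      then obtain N where N: "\<not> (\<exists>B\<in>H. agree N A B)" by blast
      have "\<exists>B\<in>H. agree n (A ** g) B" for n
      proof -
        obtain B where B: "B \<in> ?G" "agree (max n N) A B" using app by blast
        then have "B \<notin> H" using N agree_mono[OF B(2), of N] by auto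
        then obtain C where C: "C \<in> H" "B = C ** g" using B(1) by blast
        have "agree (max n N) (A ** g) (B ** g)" by (rule agree_mult[OF B(2)])
        also have "B ** g = C" by (simp add: C(2) g flip: matrix_mul_assoc)
        finally show ?thesis using agree_mono[of "max n N" "A ** g" C n] C(1) by auto
      qed
      moreover have "invertible (A ** g)"
        using inv g by (intro invertible_mult) (auto simp: invertible_def)
      ultimately have "A ** g \<in> H" using closed_subgroupD(5)[OF H] by blast
      moreover have "A = (A ** g) ** g" by (simp add: g flip: matrix_mul_assoc)
      ultimately show ?thesis by blast
    qed
  qed
  have "g = mat 1 ** g" by simp
  then show "insert g H \<subseteq> ?G" using closed_subgroupD(2)[OF H] by blast
  show "?G \<subseteq> Y" if Y: "closed_subgroup Y" "insert g H \<subseteq> Y" for Y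
    using closed_subgroupD(3)[OF Y(1)] Y(2) by blast
qed

section \<open>Curves with \<open>j\<close>-invariant 1728\<close>

text \<open>By 1728 Delta = c4^3 - c6^2, the value 1728 of j means c6 = 0; the first relation is
  this solved for b6.\<close>

lemma j_1728_relations:
  fixes E :: "rat weierstrass"
  assumes "elliptic_curve E" "j_invariant E = 1728"
  shows "216 * b6 E = - (b2 E ^ 3) + 36 * b2 E * b4 E" "c4 E \<noteq> 0"
proof -
  have D: "discriminant E \<noteq> 0" using assms(1) by (simp add: elliptic_curve_def)
  then have c4: "c4 E ^ 3 = 1728 * discriminant E"
    using assms(2) by (simp add: j_invariant_def divide_eq_eq)
  then show "c4 E \<noteq> 0" using D by auto
  have b8: "4 * b8 E = b2 E * b6 E - (b4 E)\<^sup>2"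
    by (simp add: b2_def b4_def b6_def b8_def power2_eq_square algebra_simps)
  have "1728 * discriminant E = - 432 * (b2 E)\<^sup>2 * (4 * b8 E) - 13824 * b4 E ^ 3 - 46656 * (b6 E)\<^sup>2
      + 15552 * b2 E * b4 E * b6 E"
    by (simp add: discriminant_def algebra_simps)
  then have D': "1728 * discriminant E = - 432 * (b2 E)\<^sup>2 * (b2 E * b6 E - (b4 E)\<^sup>2) - 13824 * b4 E ^ 3
      - 46656 * (b6 E)\<^sup>2 + 15552 * b2 E * b4 E * b6 E"
    unfolding b8 .
  define c6 where "c6 = - (b2 E ^ 3) + 36 * b2 E * b4 E - 216 * b6 E"
  have "c6\<^sup>2 = c4 E ^ 3 - 1728 * discriminant E"
    unfolding D' c6_def c4_def by (simp add: power2_eq_square power3_eq_cube algebra_simps)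
  then have "c6\<^sup>2 = 0" using c4 by simp
  then have "c6 = 0" by simp
  then show "216 * b6 E = - (b2 E ^ 3) + 36 * b2 E * b4 E" by (simp add: c6_def)
qed

text \<open>
  Over the algebraic closure the curve becomes \<open>Y\<^sup>2 = X\<^sup>3 + X\<close> with \<open>X = (x + b\<^sub>2 / 12) / u\<^sup>2\<close> and
  \<open>Y = (y + (a\<^sub>1 x + a\<^sub>3) / 2) / u\<^sup>3\<close>, where \<open>u\<^sup>4 = - c\<^sub>4 / 48\<close>.
\<close>

locale curve_1728 =
  fixes E :: "rat weierstrass" and u :: QQbar
  assumes rel6: "216 * b6 E = - (b2 E ^ 3) + 36 * b2 E * b4 E"
    and u4: "u ^ 4 = to_ac (- c4 E / 48)" and u0: "u \<noteq> 0"
begin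

abbreviation bE :: "QQbar weierstrass" where "bE \<equiv> map_weierstrass to_ac E"

definition sh :: QQbar where "sh = to_ac (b2 E / 12)"

fun psi' :: "QQbar point \<Rightarrow> QQbar point" where
  "psi' Infinity = Infinity"
| "psi' (Affine x y) = Affine ((x + sh) / u\<^sup>2) ((y + (coef1 bE * x + coef3 bE) / 2) / u ^ 3)"

fun phi' :: "QQbar point \<Rightarrow> QQbar point" where
  "phi' Infinity = Infinity"
| "phi' (Affine x y) = Affine (u\<^sup>2 * x - sh) (u ^ 3 * y - (coef1 bE * (u\<^sup>2 * x - sh) + coef3 bE) / 2)"

lemma phi_psi': "phi' (psi' P) = P"
  using u0 by (cases P) simp_all

lemma psi_phi': "psi' (phi' P) = P"
  using u0 by (cases P) simp_all

text \<open>These compare the coefficients of (x + sh)^3 + u^4 (x + sh) with those of the equation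
  after completing the square in y. The constant term is where c6 = 0 is used.\<close>

lemma coefs:
  "3 * sh = (coef1 bE)\<^sup>2 / 4 + coef2 bE"
  "3 * sh\<^sup>2 + u ^ 4 = coef4 bE + coef1 bE * coef3 bE / 2"
  "sh ^ 3 + u ^ 4 * sh = (coef3 bE)\<^sup>2 / 4 + coef6 bE"
proof -
  have sel: "coef1 bE = to_ac (coef1 E)" "coef2 bE = to_ac (coef2 E)" "coef3 bE = to_ac (coef3 E)"
    "coef4 bE = to_ac (coef4 E)" "coef6 bE = to_ac (coef6 E)"
    by (cases E; simp)+
  define t where "t = b2 E / 12"
  have t: "b2 E = 12 * t" by (simp add: t_def)
  have 1: "3 * (b2 E / 12) = (coef1 E)\<^sup>2 / 4 + coef2 E" by (simp add: b2_def add_divide_distrib)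
  have "3 * t\<^sup>2 + (- c4 E / 48) = b4 E / 2"
    unfolding c4_def t by (simp add: power2_eq_square diff_divide_distrib)
  also have "\<dots> = coef4 E + coef1 E * coef3 E / 2" by (simp add: b4_def add_divide_distrib)
  finally have 2: "3 * (b2 E / 12)\<^sup>2 + (- c4 E / 48) = coef4 E + coef1 E * coef3 E / 2" unfolding t_def .
  have c4t: "- c4 E / 48 = b4 E / 2 - 3 * t\<^sup>2"
    unfolding c4_def t by (simp add: power2_eq_square diff_divide_distrib)
  have "t ^ 3 + (- c4 E / 48) * t = - 2 * t ^ 3 + b4 E * t / 2"
    unfolding c4t by (simp add: power2_eq_square power3_eq_cube left_diff_distrib)
  also have "\<dots> = (- (b2 E ^ 3) + 36 * b2 E * b4 E) / 864"
    unfolding t by (simp add: power3_eq_cube add_divide_distrib diff_divide_distrib)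
  finally have "(b2 E / 12) ^ 3 + (- c4 E / 48) * (b2 E / 12) = (- (b2 E ^ 3) + 36 * b2 E * b4 E) / 864"
    unfolding t_def .
  then have 3: "(b2 E / 12) ^ 3 + (- c4 E / 48) * (b2 E / 12) = (coef3 E)\<^sup>2 / 4 + coef6 E"
    unfolding rel6[symmetric] by (simp add: b6_def add_divide_distrib)
  show "3 * sh = (coef1 bE)\<^sup>2 / 4 + coef2 bE"
    using arg_cong[OF 1, of to_ac] by (simp add: sel sh_def)
  show "3 * sh\<^sup>2 + u ^ 4 = coef4 bE + coef1 bE * coef3 bE / 2"
    using arg_cong[OF 2, of to_ac] by (simp add: sel sh_def u4)
  show "sh ^ 3 + u ^ 4 * sh = (coef3 bE)\<^sup>2 / 4 + coef6 bE"
    using arg_cong[OF 3, of to_ac] by (simp add: sel sh_def u4)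
qed

lemma on_curve_psi': "on_curve E0 (psi' P) \<longleftrightarrow> on_curve bE P"
proof (cases P)
  case (Affine x y)
  define a1 a2 a3 a4 a6 where "a1 = coef1 bE" "a2 = coef2 bE" "a3 = coef3 bE" "a4 = coef4 bE" "a6 = coef6 bE"
  note a = this
  have c: "3 * sh = a1\<^sup>2 / 4 + a2" "3 * sh\<^sup>2 + u ^ 4 = a4 + a1 * a3 / 2" "sh ^ 3 + u ^ 4 * sh = a3\<^sup>2 / 4 + a6"
    using coefs by (simp_all add: a)
  define Y where "Y = y + (a1 * x + a3) / 2"
  have u6: "u ^ 6 \<noteq> 0" using u0 by simp
  have X: "((x + sh) / u\<^sup>2) ^ 3 + (x + sh) / u\<^sup>2 = ((x + sh) ^ 3 + u ^ 4 * (x + sh)) / u ^ 6"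
  proof -
    have "((x + sh) / u\<^sup>2) ^ 3 = (x + sh) ^ 3 / u ^ 6" by (simp add: power_divide flip: power_mult)
    moreover have "(x + sh) / u\<^sup>2 = u ^ 4 * (x + sh) / u ^ 6"
    proof -
      have "u ^ 6 = u ^ 4 * u\<^sup>2" using power_add[of u 4 2] by simp
      moreover have "u ^ 4 * (x + sh) / (u ^ 4 * u\<^sup>2) = (x + sh) / u\<^sup>2"
        using u0 by (intro mult_divide_mult_cancel_left) simp
      ultimately show ?thesis by (simp only:)
    qed
    ultimately show ?thesis by (simp only: add_divide_distrib)
  qed
  have "on_curve E0 (psi' P) \<longleftrightarrow> (Y / u ^ 3)\<^sup>2 = ((x + sh) / u\<^sup>2) ^ 3 + (x + sh) / u\<^sup>2"
    by (simp add: Affine Y_def a)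
  also have "\<dots> \<longleftrightarrow> Y\<^sup>2 / u ^ 6 = ((x + sh) ^ 3 + u ^ 4 * (x + sh)) / u ^ 6"
    unfolding X by (simp add: power_divide flip: power_mult)
  also have "\<dots> \<longleftrightarrow> Y\<^sup>2 = (x + sh) ^ 3 + u ^ 4 * (x + sh)" using u6 by simp
  also have "(x + sh) ^ 3 + u ^ 4 * (x + sh) = x ^ 3 + (3 * sh) * x\<^sup>2 + (3 * sh\<^sup>2 + u ^ 4) * x + (sh ^ 3 + u ^ 4 * sh)"
    by (simp add: power2_eq_square power3_eq_cube algebra_simps)
  also have "\<dots> = x ^ 3 + a2 * x\<^sup>2 + a4 * x + a6 + (a1 * x + a3)\<^sup>2 / 4"
    unfolding c by (simp add: power2_eq_square algebra_simps add_divide_distrib)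
  also have "Y\<^sup>2 = y\<^sup>2 + a1 * x * y + a3 * y + (a1 * x + a3)\<^sup>2 / 4"
    unfolding Y_def by (simp add: power2_eq_square algebra_simps add_divide_distrib)
  finally show ?thesis by (simp only: Affine on_curve.simps a add_right_cancel)
qed simp

text \<open>Completing the square shifts the slope by a1 / 2 and scaling multiplies it by u: l + a1
  / 2 = u L. Chord and tangent only differ in the proof of this relation.\<close>

lemma psi'_add:
  assumes on: "on_curve bE P" "on_curve bE Q"
  shows "psi' (point_add bE P Q) = point_add E0 (psi' P) (psi' Q)"
proof (cases "P = Infinity \<or> Q = Infinity")
  case True
  then show ?thesis by (cases P; cases Q) simp_all
next
  case False
  then obtain x1 y1 x2 y2 where PQ: "P = Affine x1 y1" "Q = Affine x2 y2" by (metis point.exhaust)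
  define h a2 g a4 where "h = coef1 bE / 2" "a2 = coef2 bE" "g = coef3 bE / 2" "a4 = coef4 bE"
  then have a: "coef1 bE = 2 * h" "coef2 bE = a2" "coef3 bE = 2 * g" "coef4 bE = a4"
    by (simp_all add: mult.commute)
  have c: "3 * sh = h\<^sup>2 + a2" "3 * sh\<^sup>2 + u ^ 4 = a4 + 2 * (h * g)"
    using coefs(1,2) unfolding a by (simp_all add: power_mult_distrib)
  define X1 X2 where "X1 = (x1 + sh) / u\<^sup>2" "X2 = (x2 + sh) / u\<^sup>2"
  note Xd = this
  define Y1 Y2 where "Y1 = (y1 + (h * x1 + g)) / u ^ 3" "Y2 = (y2 + (h * x2 + g)) / u ^ 3"
  note Yd = this
  have half: "(2 * h * x + 2 * g) / 2 = h * x + g" for x by simp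
  have pP: "psi' P = Affine X1 Y1" "psi' Q = Affine X2 Y2"
    unfolding PQ psi'.simps a half Xd Yd by simp_all
  have U: "u\<^sup>2 \<noteq> 0" "u ^ 3 \<noteq> 0" using u0 by simp_all
  have xX: "x1 = u\<^sup>2 * X1 - sh" "x2 = u\<^sup>2 * X2 - sh" using U by (simp_all add: Xd)
  have yY: "y1 = u ^ 3 * Y1 - (h * x1 + g)" "y2 = u ^ 3 * Y2 - (h * x2 + g)"
    using U by (simp_all add: Yd)
  have xeq: "x1 = x2 \<longleftrightarrow> X1 = X2" using U by (simp add: xX)
  have ysum: "y1 + y2 + 2 * h * x2 + 2 * g = u ^ 3 * (Y1 + Y2)" if "x1 = x2"
    unfolding yY using that by (simp add: algebra_simps)
  show ?thesis
  proof (cases "X1 = X2 \<and> Y1 + Y2 = 0")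
    case True
    then have x: "x1 = x2" using xeq by simp
    then have "y1 + y2 + 2 * h * x2 + 2 * g = 0" using ysum True by simp
    then have "point_add bE P Q = Infinity" unfolding PQ point_add.simps a using x by simp
    moreover have "point_add E0 (psi' P) (psi' Q) = Infinity" unfolding pP using True by simp
    ultimately show ?thesis by simp
  next
    case ne: False
    have ne': "\<not> (x1 = x2 \<and> y1 + y2 + 2 * h * x2 + 2 * g = 0)"
    proof
      assume *: "x1 = x2 \<and> y1 + y2 + 2 * h * x2 + 2 * g = 0"
      then have "u ^ 3 * (Y1 + Y2) = 0" using ysum by simp
      then have "Y1 + Y2 = 0" using U by simp
      then show False using ne xeq * by simp
    qed
    define l where "l = (if x1 = x2 then (3 * x1\<^sup>2 + 2 * a2 * x1 + a4 - 2 * h * y1) / (2 * y1 + 2 * h * x1 + 2 * g)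
      else (y2 - y1) / (x2 - x1))"
    define L where "L = (if X1 = X2 then (3 * X1\<^sup>2 + 1) / (2 * Y1) else (Y2 - Y1) / (X2 - X1))"
    have "l + h = u * L"
    proof (cases "x1 = x2")
      case True
      then have XX: "X1 = X2" using xeq by simp
      have den: "2 * y1 + 2 * h * x1 + 2 * g = u ^ 3 * (2 * Y1)" unfolding yY by (simp add: algebra_simps)
      have Y: "Y1 \<noteq> 0"
      proof
        assume "Y1 = 0"
        have "Y2\<^sup>2 = X2 ^ 3 + X2" "Y1\<^sup>2 = X1 ^ 3 + X1" using on unfolding on_curve_psi'[symmetric] pP by simp_all
        then have "Y2\<^sup>2 = Y1\<^sup>2" unfolding XX by simp
        then have "Y2 = 0" using \<open>Y1 = 0\<close> by simp
        then show False using ne XX \<open>Y1 = 0\<close> by simp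
      qed
      \<comment> \<open>Adding h times the denominator completes the square, after which
        \<open>c\<close> identifies the rest with the derivative of x^3 + x at \<open>X1\<close>,
        scaled by u^4.\<close>
      have num: "3 * x1\<^sup>2 + 2 * a2 * x1 + a4 - 2 * h * y1 + h * (2 * y1 + 2 * h * x1 + 2 * g) = u ^ 4 * (3 * X1\<^sup>2 + 1)"
      proof -
        have "3 * x1\<^sup>2 + 2 * a2 * x1 + a4 - 2 * h * y1 + h * (2 * y1 + 2 * h * x1 + 2 * g)
          = 3 * x1\<^sup>2 + 2 * (h\<^sup>2 + a2) * x1 + (a4 + 2 * (h * g))"
          by (simp add: power2_eq_square algebra_simps)
        also have "\<dots> = 3 * (x1 + sh)\<^sup>2 + u ^ 4"
          unfolding c[symmetric] by (simp add: power2_eq_square algebra_simps)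
        also have "x1 + sh = u\<^sup>2 * X1" by (simp add: xX)
        also have "3 * (u\<^sup>2 * X1)\<^sup>2 = u ^ 4 * (3 * X1\<^sup>2)" by (simp add: power_mult_distrib flip: power_mult)
        finally show ?thesis by (simp add: distrib_left)
      qed
      have d0: "u ^ 3 * (2 * Y1) \<noteq> 0" using Y U by simp
      have "l * (u ^ 3 * (2 * Y1)) = 3 * x1\<^sup>2 + 2 * a2 * x1 + a4 - 2 * h * y1"
        using d0 unfolding l_def den if_P[OF True] by simp
      then have "(l + h) * (u ^ 3 * (2 * Y1)) = u ^ 4 * (3 * X1\<^sup>2 + 1)"
        unfolding num[symmetric] den by (simp only: distrib_right)
      also have "\<dots> = (u * u ^ 3) * (L * (2 * Y1))"
      proof -
        have "L * (2 * Y1) = 3 * X1\<^sup>2 + 1" using Y unfolding L_def if_P[OF XX] by simp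
        moreover have "u * u ^ 3 = u ^ 4" by (simp flip: power_Suc)
        ultimately show ?thesis by (simp only:)
      qed
      also have "\<dots> = (u * L) * (u ^ 3 * (2 * Y1))" by (simp only: mult_ac)
      finally show ?thesis using d0 by (simp only: mult_cancel_right simp_thms)
    next
      case False
      then have XX: "X1 \<noteq> X2" using xeq by simp
      have dx: "x2 - x1 = u\<^sup>2 * (X2 - X1)" by (simp add: xX algebra_simps)
      have "(l + h) * (x2 - x1) = (y2 - y1) + h * (x2 - x1)" using False by (simp add: l_def distrib_right)
      also have "\<dots> = u ^ 3 * (Y2 - Y1)" unfolding yY by (simp add: algebra_simps)
      also have "Y2 - Y1 = L * (X2 - X1)" using XX by (simp add: L_def)
      also have "u ^ 3 * (L * (X2 - X1)) = (u * L) * (x2 - x1)"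
        unfolding dx by (simp add: power2_eq_square power3_eq_cube mult_ac)
      finally have e: "(l + h) * (x2 - x1) = (u * L) * (x2 - x1)" .
      have "x2 - x1 \<noteq> 0" using False by simp
      with e show ?thesis by (simp only: mult_cancel_right simp_thms)
    qed
    then have lL: "l = u * L - h" by (simp add: eq_diff_eq)
    define x3 where "x3 = l\<^sup>2 + 2 * h * l - a2 - x1 - x2"
    define X3 where "X3 = L\<^sup>2 - X1 - X2"
    have addE: "point_add bE P Q = Affine x3 (- (l + 2 * h) * x3 - (y1 - l * x1) - 2 * g)"
      unfolding PQ point_add.simps a Let_def x3_def l_def
      by (simp only: ne' if_False)
    have add0: "point_add E0 (psi' P) (psi' Q) = Affine X3 (- L * X3 - (Y1 - L * X1))"
      unfolding pP point_add.simps weierstrass.sel Let_def X3_def L_def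
      using ne by (simp only: mult_zero_left mult_zero_right add_0_right diff_0_right if_False simp_thms)
    have xx3: "x3 + sh = u\<^sup>2 * X3"
    proof -
      have "x3 + sh = u\<^sup>2 * L\<^sup>2 - (h\<^sup>2 + a2) + 3 * sh - u\<^sup>2 * X1 - u\<^sup>2 * X2"
        unfolding x3_def lL xX by (simp add: power2_eq_square algebra_simps)
      then show ?thesis unfolding c(1) X3_def by (simp add: algebra_simps)
    qed
    have yy3: "- (l + 2 * h) * x3 - (y1 - l * x1) - 2 * g + (h * x3 + g) = u ^ 3 * (- L * X3 - (Y1 - L * X1))"
    proof -
      have "- (l + 2 * h) * x3 - (y1 - l * x1) - 2 * g + (h * x3 + g)
        = - (u * L) * (x3 + sh) - u ^ 3 * Y1 + (u * L) * (x1 + sh)"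
        unfolding lL yY(1) by (simp add: algebra_simps)
      also have "x1 + sh = u\<^sup>2 * X1" by (simp add: xX)
      finally show ?thesis unfolding xx3 by (simp add: algebra_simps power2_eq_square power3_eq_cube)
    qed
    show ?thesis unfolding addE add0 psi'.simps a half xx3 yy3 using U by simp
  qed
qed

end

lemma monoid_pow_simps:
  fixes G :: "('a, 'b) monoid_scheme"
  shows "x [^]\<^bsub>G\<^esub> Suc n = (x [^]\<^bsub>G\<^esub> n) \<otimes>\<^bsub>G\<^esub> x" "x [^]\<^bsub>G\<^esub> (0 :: nat) = \<one>\<^bsub>G\<^esub>"
  by (simp_all add: nat_pow_def)

lemma Gal_inv:
  assumes \<sigma>: "\<sigma> \<in> Gal F"
  shows "inv_into UNIV \<sigma> \<in> Gal F"
proof -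
  have b: "bij \<sigma>" by (rule Gal_bij[OF \<sigma>])
  have s: "\<sigma> (inv_into UNIV \<sigma> x) = x" for x using b by (simp add: bij_is_surj surj_f_inv_f)
  have i: "inv_into UNIV \<sigma> (\<sigma> x) = x" for x using b by (simp add: bij_is_inj)
  have "inv_into UNIV \<sigma> (x + y) = inv_into UNIV \<sigma> x + inv_into UNIV \<sigma> y" for x y
    using i[of "inv_into UNIV \<sigma> x + inv_into UNIV \<sigma> y"] by (simp add: Gal_add[OF \<sigma>] s)
  moreover have "inv_into UNIV \<sigma> (x * y) = inv_into UNIV \<sigma> x * inv_into UNIV \<sigma> y" for x y
    using i[of "inv_into UNIV \<sigma> x * inv_into UNIV \<sigma> y"] by (simp add: Gal_mult[OF \<sigma>] s)
  moreover have "inv_into UNIV \<sigma> x = x" if "x \<in> F" for x using i[of x] Gal_fix[OF \<sigma> that] by simp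
  ultimately show ?thesis using bij_imp_bij_inv[OF b] by (simp add: Gal_def)
qed

section \<open>Transport of points, Tate module and Galois action to y^2 = x^3 + x\<close>

context curve_1728
begin

definition psi :: "QQbar point \<Rightarrow> pt" where "psi P = Pt (psi' P)"

definition phi :: "pt \<Rightarrow> QQbar point" where "phi Q = phi' (pnt Q)"

lemma pnt_psi: "on_curve bE P \<Longrightarrow> pnt (psi P) = psi' P"
  unfolding psi_def by (rule Pt_inverse) (simp add: on_curve_psi')

lemma on_curve_phi: "on_curve bE (phi Q)"
  using on_curve_pnt[of Q] by (simp add: phi_def psi_phi' flip: on_curve_psi')

lemma psi_phi: "psi (phi Q) = Q"
  by (rule pnt_eqI) (simp add: pnt_psi[OF on_curve_phi], simp add: phi_def psi_phi')

lemma phi_psi: "on_curve bE P \<Longrightarrow> phi (psi P) = P"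
  by (simp add: phi_def pnt_psi phi_psi')

lemma psi_inj: "on_curve bE P \<Longrightarrow> on_curve bE Q \<Longrightarrow> psi P = psi Q \<longleftrightarrow> P = Q"
  by (metis phi_psi)

lemma psi_add:
  assumes "on_curve bE P" "on_curve bE Q"
  shows "on_curve bE (point_add bE P Q)" "psi (point_add bE P Q) = psi P + psi Q"
proof -
  show o: "on_curve bE (point_add bE P Q)"
    using on_curve_point_add[of "psi' P" "psi' Q"] assms by (simp add: on_curve_psi' flip: psi'_add)
  show "psi (point_add bE P Q) = psi P + psi Q"
    by (rule pnt_eqI) (simp add: pnt_psi o assms plus_pt.rep_eq psi'_add)
qed

lemma psi_Infinity: "psi Infinity = 0"
  by (rule pnt_eqI) (simp add: pnt_psi zero_pt.rep_eq)

lemma geometric_points_simps: "carrier (geometric_points E) = {P. on_curve bE P}" "\<one>\<^bsub>geometric_points E\<^esub> = Infinity"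
  "x \<otimes>\<^bsub>geometric_points E\<^esub> y = point_add bE x y"
  by (simp_all add: geometric_points_def point_group_def)

lemma psi_pow:
  assumes P: "on_curve bE P"
  shows "on_curve bE (P [^]\<^bsub>geometric_points E\<^esub> (k :: nat)) \<and> psi (P [^]\<^bsub>geometric_points E\<^esub> k) = zsc (int k) (psi P)"
proof (induction k)
  case 0
  show ?case by (simp add: monoid_pow_simps geometric_points_simps psi_Infinity)
next
  case (Suc k)
  have "int (Suc k) = int k + 1" by simp
  then show ?case using Suc psi_add P by (simp only: monoid_pow_simps geometric_points_simps zsc_step)
qed

lemma tate_iff: "t \<in> tate E \<longleftrightarrow> (\<forall>n. on_curve bE (t n)) \<and> tate_seq (\<lambda>n. psi (t n))"
proof
  assume "t \<in> tate E"
  then have t: "t n \<in> torsion E (2 ^ n)" "t (Suc n) [^]\<^bsub>geometric_points E\<^esub> (2 :: nat) = t n" for n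
    by (auto simp: tate_def)
  have on: "on_curve bE (t n)" for n using t(1)[of n] by (simp add: torsion_def geometric_points_simps)
  have "psi (t (Suc n)) + psi (t (Suc n)) = psi (t n)" for n
    using psi_pow[OF on[of "Suc n"], of 2] t(2)[of n] by (simp add: zsc_2)
  moreover have "psi (t 0) = 0"
  proof -
    have "t 0 [^]\<^bsub>geometric_points E\<^esub> (1 :: nat) = Infinity" using t(1)[of 0] by (simp add: torsion_def)
    then show ?thesis using psi_pow[OF on[of 0], of 1] by (simp add: psi_Infinity)
  qed
  ultimately show "(\<forall>n. on_curve bE (t n)) \<and> tate_seq (\<lambda>n. psi (t n))" using on by (simp add: tate_seq_def)
next
  assume t: "(\<forall>n. on_curve bE (t n)) \<and> tate_seq (\<lambda>n. psi (t n))"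
  then have on: "on_curve bE (t n)" and s: "tate_seq (\<lambda>n. psi (t n))" for n by auto
  have "t n [^]\<^bsub>geometric_points E\<^esub> ((2 :: nat) ^ n) = Infinity" for n
  proof -
    have "psi (t n [^]\<^bsub>geometric_points E\<^esub> ((2 :: nat) ^ n)) = 0"
      using psi_pow[OF on[of n], of "2 ^ n"] tate_seq_torsion[OF s, of n] by simp
    then have "psi (t n [^]\<^bsub>geometric_points E\<^esub> ((2 :: nat) ^ n)) = psi Infinity" by (simp add: psi_Infinity)
    moreover have "on_curve bE Infinity" by simp
    ultimately show ?thesis using psi_inj[OF conjunct1[OF psi_pow[OF on[of n], of "2 ^ n"]]] by blast
  qed
  moreover have "t (Suc n) [^]\<^bsub>geometric_points E\<^esub> (2 :: nat) = t n" for n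
  proof -
    have "psi (t (Suc n) [^]\<^bsub>geometric_points E\<^esub> (2 :: nat)) = psi (t n)"
      using psi_pow[OF on[of "Suc n"], of 2] s by (simp add: zsc_2 tate_seq_def)
    then show ?thesis using psi_inj[OF conjunct1[OF psi_pow[OF on[of "Suc n"], of 2]] on[of n]] by blast
  qed
  ultimately show "t \<in> tate E" using on by (simp add: tate_def torsion_def geometric_points_simps)
qed

lemma tate_comb_psi:
  assumes e: "\<And>j n. on_curve bE (eb j n)"
  shows "on_curve bE (tate_comb E eb v n)"
    "psi (tate_comb E eb v n) = zsc (residue (v $ 1) n) (psi (eb 1 n)) + zsc (residue (v $ 2) n) (psi (eb 2 n))"
proof -
  have p: "on_curve bE (tate_smult E a (eb j) n)" "psi (tate_smult E a (eb j) n) = zsc (residue a n) (psi (eb j n))" for a j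
    using psi_pow[OF e[of j n], of "nat (residue a n)"] residue_bounds(1)[of a n]
    by (simp_all add: tate_smult_def)
  show "on_curve bE (tate_comb E eb v n)"
    unfolding tate_comb_def tate_add_def geometric_points_simps by (intro psi_add p)
  show "psi (tate_comb E eb v n) = zsc (residue (v $ 1) n) (psi (eb 1 n)) + zsc (residue (v $ 2) n) (psi (eb 2 n))"
    unfolding tate_comb_def tate_add_def geometric_points_simps by (simp add: psi_add p)
qed

text \<open>The action of \<open>\<sigma>\<close> on the points of \<open>E\<close>, transported to \<open>y\<^sup>2 = x\<^sup>3 + x\<close>.\<close>

definition tw :: "(QQbar \<Rightarrow> QQbar) \<Rightarrow> pt \<Rightarrow> pt" where
  "tw \<sigma> P = smap (\<sigma> u / u) (gact \<sigma> P)"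

lemma cocycle_pow_4:
  assumes \<sigma>: "\<sigma> \<in> Gal F"
  shows "(\<sigma> u / u) ^ 4 = 1"
proof -
  have "\<sigma> (u ^ 4) = u ^ 4" unfolding u4 by (rule Gal_rat[OF \<sigma>])
  then have "\<sigma> u ^ 4 = u ^ 4" by (simp only: Gal_power[OF \<sigma>])
  then show ?thesis using u0 by (simp add: power_divide)
qed

lemma psi_map_point:
  assumes \<sigma>: "\<sigma> \<in> Gal F" and P: "on_curve bE P"
  shows "on_curve bE (map_point \<sigma> P)" "psi (map_point \<sigma> P) = tw \<sigma> (psi P)"
proof -
  note ops = Gal_add[OF \<sigma>] Gal_mult[OF \<sigma>] Gal_inverse[OF \<sigma>] Gal_power[OF \<sigma>] Gal_numeral[OF \<sigma>] Gal_rat[OF \<sigma>]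
  have sel: "coef1 bE = to_ac (coef1 E)" "coef3 bE = to_ac (coef3 E)" by (cases E; simp)+
  have su: "\<sigma> u \<noteq> 0" using Gal_inj[OF \<sigma>, of u 0] u0 by (simp add: Gal_0[OF \<sigma>])
  have eq: "psi' (map_point \<sigma> P) = scale_point (\<sigma> u / u) (map_point \<sigma> (psi' P))"
  proof (cases P)
    case (Affine x y)
    define Y where "Y = y + (coef1 bE * x + coef3 bE) / 2"
    have "\<sigma> Y = \<sigma> y + (coef1 bE * \<sigma> x + coef3 bE) / 2" unfolding Y_def sel by (simp add: ops)
    moreover have "\<sigma> (x + sh) = \<sigma> x + sh" by (simp add: ops sh_def)
    ultimately show ?thesis
      using su by (simp add: Affine power_divide Gal_inverse[OF \<sigma>] Gal_power[OF \<sigma>] flip: Y_def)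
  qed simp
  have pP: "pnt (psi P) = psi' P" by (rule pnt_psi[OF P])
  have tw: "pnt (tw \<sigma> (psi P)) = psi' (map_point \<sigma> P)"
    by (simp add: tw_def pnt_smap[OF cocycle_pow_4[OF \<sigma>]] pnt_gact[OF \<sigma>] pP eq)
  then show o: "on_curve bE (map_point \<sigma> P)" using on_curve_pnt[of "tw \<sigma> (psi P)"] by (simp add: on_curve_psi')
  show "psi (map_point \<sigma> P) = tw \<sigma> (psi P)" by (rule pnt_eqI) (simp add: pnt_psi[OF o] tw)
qed

lemma tw_add: "\<sigma> \<in> Gal F \<Longrightarrow> tw \<sigma> (P + Q) = tw \<sigma> P + tw \<sigma> Q"
  by (simp add: tw_def gact_add smap_add cocycle_pow_4)

lemma smap_iop: "z ^ 4 = 1 \<Longrightarrow> smap z (iop P) = iop (smap z P)"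
  unfolding iop_def by (simp add: smap_smap qi_pow mult.commute)

lemma smap_minus: "z ^ 4 = 1 \<Longrightarrow> smap z (- P) = - smap z P"
  using smap_add[of z P "- P"] smap_add[of z 0 0] by (simp add: eq_neg_iff_add_eq_0 add.commute)

lemma tw_iop:
  assumes \<sigma>: "\<sigma> \<in> Gal F"
  shows "\<sigma> qi = qi \<Longrightarrow> tw \<sigma> (iop P) = iop (tw \<sigma> P)" "\<sigma> qi = - qi \<Longrightarrow> tw \<sigma> (iop P) = - iop (tw \<sigma> P)"
  by (simp_all add: tw_def gact_iop[OF \<sigma>] smap_iop smap_minus cocycle_pow_4[OF \<sigma>])

text \<open>On E the automorphisms act directly on coordinates; transporting that action yields the
  cocycle relation of the twist.\<close>

lemma tw_comp:
  assumes \<sigma>: "\<sigma> \<in> Gal F" and \<tau>: "\<tau> \<in> Gal F"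
  shows "tw (\<sigma> \<circ> \<tau>) Q = tw \<sigma> (tw \<tau> Q)"
proof -
  have st: "\<sigma> \<circ> \<tau> \<in> Gal F" by (rule Gal_comp[OF \<sigma> \<tau>])
  have "tw (\<sigma> \<circ> \<tau>) (psi P) = tw \<sigma> (tw \<tau> (psi P))" if P: "on_curve bE P" for P
    using psi_map_point[OF st P] psi_map_point[OF \<sigma> psi_map_point(1)[OF \<tau> P]] psi_map_point(2)[OF \<tau> P]
    by (simp add: point.map_comp)
  from this[OF on_curve_phi[of Q]] show ?thesis by (simp add: psi_phi)
qed

lemma tw_id: "tw id Q = Q"
proof -
  have "psi (map_point id (phi Q)) = tw id (psi (phi Q))" by (rule psi_map_point(2)[OF Gal_id on_curve_phi])
  then show ?thesis by (simp add: psi_phi point.map_id)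
qed

lemma tw_act_Qi:
  assumes \<sigma>: "\<sigma> \<in> Gal field_Qi"
  shows "tw \<sigma> (act w t n) = act w (\<lambda>n. tw \<sigma> (t n)) n"
  using tw_add[OF \<sigma>] tw_iop(1)[OF \<sigma>] \<sigma> by (intro act_hom) (simp_all add: Gal_Qi_iff)

lemma tw_act_conj:
  assumes \<sigma>: "\<sigma> \<in> Gal F" "\<sigma> qi = - qi" and t: "tate_seq t"
  shows "tw \<sigma> (act w t n) = act (gcnj w) (\<lambda>n. tw \<sigma> (t n)) n"
  using tw_add[OF \<sigma>(1)] tw_iop(2)[OF \<sigma>] t by (intro act_antihom) simp_all

end

lemma complex_conjugation_props:
  assumes "complex_conjugation c"
  shows "c \<in> Gal field_Q" "c qi = - qi" "c (c x) = x"
proof -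
  show c: "c \<in> Gal field_Q" using assms by (simp add: complex_conjugation_def)
  obtain f where f: "field_embedding f" and cf: "\<And>x. f (c x) = cnj (f x)"
    using assms by (auto simp: complex_conjugation_def)
  have add: "f (x + y) = f x + f y" and mult: "f (x * y) = f x * f y" and one: "f 1 = 1" for x y
    using f by (auto simp: field_embedding_def)
  have 0: "f 0 = 0" using add[of 0 0] by simp
  have neg: "f (- x) = - f x" for x using add[of x "- x"] 0 by (simp add: eq_neg_iff_add_eq_0 add.commute)
  have nz: "f x \<noteq> 0" if "x \<noteq> 0" for x
  proof
    assume "f x = 0"
    then have "f (x * inverse x) = 0" by (simp add: mult)
    then show False using that one by simp
  qed
  have inj: "x = y" if "f x = f y" for x y
  proof (rule ccontr)
    assume "x \<noteq> y"
    then have "f (x - y) \<noteq> 0" using nz[of "x - y"] by simp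
    then show False using that add[of x "- y"] by (simp add: neg)
  qed
  show "c (c x) = x" by (rule inj) (simp add: cf)
  have "f qi * f qi = - 1" by (simp add: qi_sq neg one flip: mult)
  then have "(f qi - \<i>) * (f qi + \<i>) = 0" by (simp add: algebra_simps)
  then have "f qi = \<i> \<or> f qi = - \<i>" by (simp add: eq_neg_iff_add_eq_0)
  then have "f (c qi) = f (- qi)" by (auto simp: cf neg)
  then show "c qi = - qi" by (rule inj)
qed

text \<open>
  A generator of the Tate module on which complex conjugation acts through \<open>\<mu>\<^sub>4\<close>.
\<close>

locale tate_curve = curve_1728 E u + tate_gen e for E u e +
  fixes c :: "QQbar \<Rightarrow> QQbar" and z :: gz
  assumes c: "c \<in> Gal field_Q" "c qi = - qi" "\<And>x. c (c x) = x"
    and z: "z \<in> mu4" "\<And>n. tw c (e n) = act z e n"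
begin

text \<open>The basis e, -i e, in which the scalar w has the matrix \<open>gmat w\<close>.\<close>

definition eb :: "2 \<Rightarrow> nat \<Rightarrow> QQbar point" where
  "eb j n = (if j = 1 then phi (e n) else phi (- iop (e n)))"

lemma eb_on: "on_curve bE (eb j n)"
  by (simp add: eb_def on_curve_phi)

lemma psi_eb: "psi (eb 1 n) = e n" "psi (eb 2 n) = - iop (e n)"
  by (simp_all add: eb_def psi_phi)

text \<open>The coordinates v1, v2 with respect to e, -i e stand for the scalar v1 - v2 i.\<close>

lemma psi_comb: "psi (tate_comb E eb v n) = act (GZ (v $ 1) (- v $ 2)) e n"
proof -
  have "act (GZ (v $ 1) (- v $ 2)) e n = gsc (residue (v $ 1) n) (- residue (v $ 2) n) (e n)"
    by (rule act_eqI[OF seq]) (simp_all add: residue_self residue_ops)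
  then show ?thesis
    by (simp add: tate_comb_psi(2)[OF eb_on] psi_eb gsc_def zsc_minus zsc_minus_right iop_minus iop_zsc)
qed

lemma eq_comb_iff:
  assumes "\<And>n. on_curve bE (t n)"
  shows "t = tate_comb E eb v \<longleftrightarrow> (\<lambda>n. psi (t n)) = act (GZ (v $ 1) (- v $ 2)) e"
proof -
  have "t n = tate_comb E eb v n \<longleftrightarrow> psi (t n) = act (GZ (v $ 1) (- v $ 2)) e n" for n
    using psi_inj[OF assms[of n] tate_comb_psi(1)[where eb = eb and v = v and n = n, OF eb_on]] by (simp add: psi_comb)
  then show ?thesis by (simp add: fun_eq_iff)
qed

lemma neg_iop_e: "- iop (e n) = act (- gi) e n"
proof -
  have "act (- gi) e n = gsc 0 (- 1) (e n)"
    by (rule act_eqI[OF seq]) (simp_all add: gi_def gz_ops residue_ops)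
  then show ?thesis by (simp add: gsc_def zsc_minus iop_minus)
qed

lemma tate_basis_eb: "tate_basis E eb"
  unfolding tate_basis_def
proof (intro conjI allI ballI)
  fix j
  have "tate_seq (\<lambda>n. psi (eb j n))"
  proof (cases "j = 1")
    case True
    then show ?thesis using seq by (simp add: psi_eb)
  next
    case False
    then have "psi (eb j n) = act (- gi) e n" for n by (simp add: eb_def psi_phi neg_iop_e)
    then show ?thesis using tate_seq_act[OF seq] by simp
  qed
  then show "eb j \<in> tate E" by (simp add: tate_iff eb_on)
next
  fix t assume "t \<in> tate E"
  then have t: "\<And>n. on_curve bE (t n)" "tate_seq (\<lambda>n. psi (t n))" by (simp_all add: tate_iff)
  obtain w where w: "(\<lambda>n. psi (t n)) = act w e" using act_surj[OF t(2)] .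
  show "\<exists>!v. t = tate_comb E eb v"
  proof (rule ex1I[of _ "vector [re w, - im w]"])
    show "t = tate_comb E eb (vector [re w, - im w])"
      unfolding eq_comb_iff[OF t(1)] w by simp
    fix v assume "t = tate_comb E eb v"
    then have "act w e = act (GZ (v $ 1) (- v $ 2)) e" unfolding eq_comb_iff[OF t(1)] w .
    then have "w = GZ (v $ 1) (- v $ 2)" by (rule act_inj)
    then show "v = vector [re w, - im w]" by (simp add: vec_eq_iff forall_2)
  qed
qed

definition rho :: "(QQbar \<Rightarrow> QQbar) \<Rightarrow> gz" where
  "rho \<sigma> = (THE w. \<forall>n. tw \<sigma> (e n) = act w e n)"

lemma rhoI: "(\<And>n. tw \<sigma> (e n) = act w e n) \<Longrightarrow> rho \<sigma> = w"
  unfolding rho_def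
proof (rule the_equality)
  fix w' assume "\<And>n. tw \<sigma> (e n) = act w e n" "\<forall>n. tw \<sigma> (e n) = act w' e n"
  then have "act w' e n = act w e n" for n by metis
  then have "act w' e = act w e" by (rule ext)
  then show "w' = w" by (rule act_inj)
qed simp

lemma rho: "\<sigma> \<in> Gal F \<Longrightarrow> tw \<sigma> (e n) = act (rho \<sigma>) e n"
proof -
  assume \<sigma>: "\<sigma> \<in> Gal F"
  obtain w where w: "(\<lambda>n. tw \<sigma> (e n)) = act w e"
    using act_surj[OF tate_seq_hom[of "tw \<sigma>", OF tw_add[OF \<sigma>] seq]] .
  have wn: "tw \<sigma> (e n) = act w e n" for n using w by (rule fun_cong)
  then have "rho \<sigma> = w" by (rule rhoI)
  then show ?thesis using wn by simp
qed

lemma galois_rep_eq: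
  assumes \<sigma>: "\<sigma> \<in> Gal F" and w2: "\<And>n. tw \<sigma> (- iop (e n)) = act w2 e n"
  shows "galois_rep E eb \<sigma> = mat2 (re (rho \<sigma>)) (re w2) (- im (rho \<sigma>)) (- im w2)"
proof -
  have on: "on_curve bE (tate_action \<sigma> (eb j) n)" for j n
    unfolding tate_action_def by (rule psi_map_point(1)[OF \<sigma> eb_on])
  have p: "psi (tate_action \<sigma> (eb j) n) = tw \<sigma> (psi (eb j n))" for j n
    unfolding tate_action_def by (rule psi_map_point(2)[OF \<sigma> eb_on])
  have iff: "(\<forall>j. tate_action \<sigma> (eb j) = tate_comb E eb (column j A)) \<longleftrightarrow>
    rho \<sigma> = GZ (A $ 1 $ 1) (- A $ 2 $ 1) \<and> w2 = GZ (A $ 1 $ 2) (- A $ 2 $ 2)" for A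
  proof -
    have 1: "(\<lambda>n. psi (tate_action \<sigma> (eb 1) n)) = act (rho \<sigma>) e" by (rule ext) (simp add: p psi_eb rho[OF \<sigma>])
    have 2: "(\<lambda>n. psi (tate_action \<sigma> (eb 2) n)) = act w2 e" by (rule ext) (simp add: p psi_eb w2)
    have i: "act v e = act w e \<longleftrightarrow> v = w" for v w using act_inj by blast
    show ?thesis
      unfolding forall_2 eq_comb_iff[OF on] 1 2 i by (simp add: column_def)
  qed
  show ?thesis
    unfolding galois_rep_def iff
  proof (rule the_equality)
    show "rho \<sigma> = GZ (mat2 (re (rho \<sigma>)) (re w2) (- im (rho \<sigma>)) (- im w2) $ 1 $ 1)
        (- mat2 (re (rho \<sigma>)) (re w2) (- im (rho \<sigma>)) (- im w2) $ 2 $ 1) \<and>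
      w2 = GZ (mat2 (re (rho \<sigma>)) (re w2) (- im (rho \<sigma>)) (- im w2) $ 1 $ 2)
        (- mat2 (re (rho \<sigma>)) (re w2) (- im (rho \<sigma>)) (- im w2) $ 2 $ 2)"
      by simp
    fix A :: "z2 ^ 2 ^ 2"
    assume A: "rho \<sigma> = GZ (A $ 1 $ 1) (- A $ 2 $ 1) \<and> w2 = GZ (A $ 1 $ 2) (- A $ 2 $ 2)"
    show "A = mat2 (re (rho \<sigma>)) (re w2) (- im (rho \<sigma>)) (- im w2)"
      by (rule iffD2[OF mat22_eq_iff]) (simp add: A)
  qed
qed

lemma galois_rep_Qi:
  assumes \<sigma>: "\<sigma> \<in> Gal field_Qi"
  shows "galois_rep E eb \<sigma> = gmat (rho \<sigma>)"
proof -
  have "tw \<sigma> (- iop (e n)) = act (- gi * rho \<sigma>) e n" for n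
  proof -
    have "tw \<sigma> (- iop (e n)) = act (- gi) (\<lambda>n. tw \<sigma> (e n)) n" unfolding neg_iop_e by (rule tw_act_Qi[OF \<sigma>])
    also have "(\<lambda>n. tw \<sigma> (e n)) = act (rho \<sigma>) e" by (rule ext) (rule rho[OF \<sigma>])
    finally show ?thesis by (simp only: act_mult[OF seq])
  qed
  from galois_rep_eq[OF \<sigma> this] show ?thesis by (simp add: gmat_def gi_def gz_ops)
qed

text \<open>The action is semilinear: coordinates are conjugated first, which fixes 1 and negates
  -i, and then multiplied by \<open>rho \<sigma>\<close>.\<close>

lemma galois_rep_conj:
  assumes \<sigma>: "\<sigma> \<in> Gal F" "\<sigma> qi = - qi"
  shows "galois_rep E eb \<sigma> = gmat (rho \<sigma>) ** mat2 1 0 0 (- 1)"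
proof -
  have "tw \<sigma> (- iop (e n)) = act (gi * rho \<sigma>) e n" for n
  proof -
    have "tw \<sigma> (- iop (e n)) = act (gcnj (- gi)) (\<lambda>n. tw \<sigma> (e n)) n"
      unfolding neg_iop_e by (rule tw_act_conj[OF \<sigma> seq])
    also have "(\<lambda>n. tw \<sigma> (e n)) = act (rho \<sigma>) e" by (rule ext) (rule rho[OF \<sigma>(1)])
    also have "gcnj (- gi) = gi" by (simp add: gcnj_def gi_def gz_ops)
    finally show ?thesis by (simp only: act_mult[OF seq])
  qed
  from galois_rep_eq[OF \<sigma>(1) this] show ?thesis
    by (simp add: mat22_eq_iff mat22_mult_nth gmat_def gi_def gz_ops)
qed

section \<open>The image of the Galois group of Q(i) as a closed group of units\<close>

definition HK :: "gz set" where "HK = rho ` Gal field_Qi"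

lemma rho_comp:
  assumes \<sigma>: "\<sigma> \<in> Gal field_Q" "\<sigma> qi = qi" and \<tau>: "\<tau> \<in> Gal field_Q"
  shows "rho (\<sigma> \<circ> \<tau>) = rho \<tau> * rho \<sigma>"
proof (rule rhoI)
  fix n
  have K: "\<sigma> \<in> Gal field_Qi" using \<sigma> Gal_Qi_iff by blast
  have "tw (\<sigma> \<circ> \<tau>) (e n) = tw \<sigma> (act (rho \<tau>) e n)" by (simp add: tw_comp[OF \<sigma>(1) \<tau>] rho[OF \<tau>])
  also have "\<dots> = act (rho \<tau>) (\<lambda>n. tw \<sigma> (e n)) n" by (rule tw_act_Qi[OF K])
  also have "(\<lambda>n. tw \<sigma> (e n)) = act (rho \<sigma>) e" by (rule ext) (rule rho[OF \<sigma>(1)])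
  finally show "tw (\<sigma> \<circ> \<tau>) (e n) = act (rho \<tau> * rho \<sigma>) e n" by (simp only: act_mult[OF seq])
qed

lemma rho_comp_conj:
  assumes \<sigma>: "\<sigma> \<in> Gal field_Q" "\<sigma> qi = - qi" and \<tau>: "\<tau> \<in> Gal field_Q"
  shows "rho (\<sigma> \<circ> \<tau>) = gcnj (rho \<tau>) * rho \<sigma>"
proof (rule rhoI)
  fix n
  have "tw (\<sigma> \<circ> \<tau>) (e n) = tw \<sigma> (act (rho \<tau>) e n)" by (simp add: tw_comp[OF \<sigma>(1) \<tau>] rho[OF \<tau>])
  also have "\<dots> = act (gcnj (rho \<tau>)) (\<lambda>n. tw \<sigma> (e n)) n" by (rule tw_act_conj[OF \<sigma> seq])
  also have "(\<lambda>n. tw \<sigma> (e n)) = act (rho \<sigma>) e" by (rule ext) (rule rho[OF \<sigma>(1)])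
  finally show "tw (\<sigma> \<circ> \<tau>) (e n) = act (gcnj (rho \<tau>) * rho \<sigma>) e n" by (simp only: act_mult[OF seq])
qed

lemma rho_c: "rho c = z"
  by (rule rhoI) (rule z(2))

lemma rho_id: "rho id = 1"
  by (rule rhoI) (simp add: tw_id act_1[OF seq])

lemma z_norm: "z * gcnj z = 1"
  using z(1) by (auto simp: mu4_def gcnj_def gi_def gz_ops)

lemma Qi_Q: "\<sigma> \<in> Gal field_Qi \<Longrightarrow> \<sigma> \<in> Gal field_Q" "\<sigma> \<in> Gal field_Qi \<Longrightarrow> \<sigma> qi = qi"
  by (simp_all add: Gal_Qi_iff)

text \<open>Closedness uses compactness of the Galois group: automorphisms whose multipliers
  converge to x have a limit with multiplier x.\<close>

lemma closed_units_HK: "closed_units HK"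
  unfolding closed_units_def
proof (intro conjI ballI allI impI)
  show "1 \<in> HK" unfolding HK_def using rho_id Gal_id by (metis imageI)
next
  fix x y assume "x \<in> HK" "y \<in> HK"
  then obtain \<sigma> \<tau> where s: "\<sigma> \<in> Gal field_Qi" "x = rho \<sigma>" "\<tau> \<in> Gal field_Qi" "y = rho \<tau>" by (auto simp: HK_def)
  have "rho (\<tau> \<circ> \<sigma>) = x * y" using rho_comp[OF Qi_Q[OF s(3)] Qi_Q(1)[OF s(1)]] s by simp
  then show "x * y \<in> HK" unfolding HK_def using Gal_comp[OF s(3,1)] by (metis imageI)
next
  fix x assume "x \<in> HK"
  then obtain \<sigma> where s: "\<sigma> \<in> Gal field_Qi" "x = rho \<sigma>" by (auto simp: HK_def)
  have i: "inv_into UNIV \<sigma> \<in> Gal field_Qi" by (rule Gal_inv[OF s(1)])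
  have "inv_into UNIV \<sigma> \<circ> \<sigma> = id" using Gal_bij[OF s(1)] by (simp add: bij_is_inj)
  then have "x * rho (inv_into UNIV \<sigma>) = 1" using rho_comp[OF Qi_Q[OF i] Qi_Q(1)[OF s(1)]] s(2) rho_id by simp
  then show "\<exists>y\<in>HK. x * y = 1" unfolding HK_def using i by blast
next
  fix x assume "\<forall>n. \<exists>g\<in>HK. 2 ^ n dvd x - g"
  then have "\<forall>n. \<exists>\<sigma>. \<sigma> \<in> Gal field_Qi \<and> 2 ^ n dvd x - rho \<sigma>" unfolding HK_def by blast
  then obtain s where s: "\<And>n. s n \<in> Gal field_Qi" "\<And>n. 2 ^ n dvd x - rho (s n)" by metis
  obtain \<tau> where \<tau>: "\<tau> \<in> Gal field_Qi" "\<And>a v. eventually (\<lambda>n. s n a = v) sequentially \<Longrightarrow> \<tau> a = v"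
  proof (rule Gal_eventually_constant[where \<sigma> = s, OF s(1)])
    fix \<tau>
    assume "\<tau> \<in> Gal field_Qi" "\<And>a v. eventually (\<lambda>n. s n a = v) sequentially \<Longrightarrow> \<tau> a = v"
    then show ?thesis by (rule that)
  qed
  have "tw \<tau> (e m) = act x e m" for m
  proof -
    \<comment> \<open>At level m the multiplier matters only modulo \<open>2 ^ m\<close>, so from m
      on all these automorphisms send the point of E to the same place; its coordinates are
      eventually constant.\<close>
    have sn: "map_point (s n) (phi (e m)) = phi (act x e m)" if n: "m \<le> n" for n
    proof -
      have on: "on_curve bE (map_point (s n) (phi (e m)))" by (rule psi_map_point(1)[OF s(1) on_curve_phi])
      have "2 ^ m dvd rho (s n) - x"
        using s(2)[of n] n by (metis dvd_minus_iff minus_diff_eq dvd_trans le_imp_power_dvd)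
      then have "act (rho (s n)) e m = act x e m" by (simp add: act_level_eq_iff)
      moreover have "psi (map_point (s n) (phi (e m))) = act (rho (s n)) e m"
        by (simp add: psi_map_point(2)[OF s(1) on_curve_phi] psi_phi rho[OF s(1)])
      ultimately show ?thesis using phi_psi[OF on] by simp
    qed
    have "map_point \<tau> (phi (e m)) = phi (act x e m)"
    proof (cases "phi (e m)")
      case Infinity
      then show ?thesis using sn[of m] by simp
    next
      case (Affine a b)
      obtain a' b' where p: "phi (act x e m) = Affine a' b'"
        using sn[of m] by (cases "phi (act x e m)") (simp_all add: Affine)
      have "s n a = a'" "s n b = b'" if "m \<le> n" for n using sn[OF that] by (simp_all add: Affine p)
      then have "\<tau> a = a'" "\<tau> b = b'" by (auto intro!: \<tau>(2) eventually_sequentiallyI[of m])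
      then show ?thesis by (simp add: Affine p)
    qed
    then have "psi (map_point \<tau> (phi (e m))) = act x e m" by (simp add: psi_phi)
    then show ?thesis by (simp add: psi_map_point(2)[OF \<tau>(1) on_curve_phi] psi_phi)
  qed
  then have "rho \<tau> = x" by (rule rhoI)
  then show "x \<in> HK" unfolding HK_def using \<tau>(1) by blast
qed

text \<open>Conjugating an automorphism by c conjugates its multiplier; the root of unity belonging
  to c drops out because it has norm 1.\<close>

lemma HK_conj: "x \<in> HK \<Longrightarrow> gcnj x \<in> HK"
proof -
  assume "x \<in> HK"
  then obtain \<sigma> where s: "\<sigma> \<in> Gal field_Qi" "x = rho \<sigma>" by (auto simp: HK_def)
  note sQ = Qi_Q[OF s(1)]
  have sc: "\<sigma> \<circ> c \<in> Gal field_Q" by (rule Gal_comp[OF sQ(1) c(1)])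
  have csc: "c \<circ> (\<sigma> \<circ> c) \<in> Gal field_Q" by (rule Gal_comp[OF c(1) sc])
  have "(c \<circ> (\<sigma> \<circ> c)) qi = qi" by (simp add: c Gal_minus[OF sQ(1)] sQ(2) Gal_minus[OF c(1)])
  then have K: "c \<circ> (\<sigma> \<circ> c) \<in> Gal field_Qi" using csc Gal_Qi_iff by blast
  have "rho (c \<circ> (\<sigma> \<circ> c)) = gcnj (z * x) * z"
    by (simp add: rho_comp_conj[OF c(1,2) sc] rho_comp[OF sQ c(1)] rho_c s(2))
  also have "\<dots> = (z * gcnj z) * gcnj x" by (simp add: gcnj_mult mult_ac)
  finally have "rho (c \<circ> (\<sigma> \<circ> c)) = gcnj x" by (simp add: z_norm)
  then show ?thesis unfolding HK_def using K by (metis imageI)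
qed

lemma smap_mu4:
  assumes "s ^ 4 = 1"
  obtains y where "y \<in> mu4" "\<And>w n. smap s (act w e n) = act (y * w) e n"
proof -
  have neg: "- act w e n = act (- 1 * w) e n" for w n
    using iop_act[OF seq, of w n] iop_act[OF seq, of "gi * w" n] iop_iop[of "act w e n"]
    by (simp add: gi_sq flip: mult.assoc)
  have io: "iop (act w e n) = act (gi * w) e n" for w n by (rule iop_act[OF seq])
  from pow4_eq_1[OF assms] consider "s = 1" | "s = - 1" | "s = qi" | "s = - qi" by blast
  then show ?thesis
  proof cases
    case 1
    then show ?thesis using that[of 1] by (simp add: smap_1 mu4_def)
  next
    case 2
    then show ?thesis using that[of "- 1"] neg by (simp add: smap_m1 mu4_def)
  next
    case 3
    have "smap s (act w e n) = act (- gi * w) e n" for w n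
      unfolding 3 smap_qi io neg by simp
    then show ?thesis using that[of "- gi"] by (simp add: mu4_def)
  next
    case 4
    have "smap s (act w e n) = act (gi * w) e n" for w n
      unfolding 4 by (simp add: io flip: iop_def)
    then show ?thesis using that[of gi] by (simp add: mu4_def)
  qed
qed

text \<open>Transitivity at level m approximates x by a Galois multiplier up to a fourth root of
  unity, and passing from \<open>gact\<close> to \<open>tw\<close> costs only another one. The
  closed group \<open>mu4_closure HK\<close> then contains x itself.\<close>

lemma HK_cover:
  assumes x: "x dvd 1"
  shows "\<exists>w\<in>mu4. w * x \<in> HK"
proof -
  have "x \<in> mu4_closure HK"
  proof (rule closed_unitsD(4)[OF closed_units_mu4_closure[OF closed_units_HK]])
    fix n :: nat
    \<comment> \<open>The transitivity result needs a level of at least 2.\<close>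
    define m where "m = n + 2"
    obtain \<sigma> w where \<sigma>: "\<sigma> \<in> Gal field_Qi" "w \<in> mu4" "gact \<sigma> (e m) = act (w * x) e m"
      by (rule Gal_transitive_level[where n = m, OF _ x c]) (simp add: m_def)
    obtain y where y: "y \<in> mu4" "\<And>w n. smap (\<sigma> u / u) (act w e n) = act (y * w) e n"
      using smap_mu4[OF cocycle_pow_4[OF \<sigma>(1)]] by blast
    have "act (rho \<sigma>) e m = act (y * (w * x)) e m"
      by (simp add: tw_def \<sigma>(3) y(2) flip: rho[OF \<sigma>(1)])
    then have d: "2 ^ m dvd rho \<sigma> - (y * w) * x" by (simp add: act_level_eq_iff mult.assoc)
    obtain y' where y': "y' \<in> mu4" "(y * w) * y' = 1" using mu4_inverse[OF mu4_mult[OF y(1) \<sigma>(2)]] by blast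
    have "x - y' * rho \<sigma> = - (y' * (rho \<sigma> - (y * w) * x)) + x - ((y * w) * y') * x"
      by (simp add: algebra_simps)
    then have "x - y' * rho \<sigma> = - (y' * (rho \<sigma> - (y * w) * x))" by (simp add: y'(2))
    then have "2 ^ m dvd x - y' * rho \<sigma>" using d by simp
    moreover have "(2 :: gz) ^ n dvd 2 ^ m" by (simp add: m_def le_imp_power_dvd)
    ultimately have "2 ^ n dvd x - y' * rho \<sigma>" by (rule dvd_trans[rotated])
    moreover have "y' * rho \<sigma> \<in> mu4_closure HK"
      unfolding mu4_closure_def HK_def using y'(1) \<sigma>(1) by blast
    ultimately show "\<exists>g\<in>mu4_closure HK. 2 ^ n dvd x - g" by blast
  qed
  then obtain w h where w: "w \<in> mu4" "h \<in> HK" "x = w * h" unfolding mu4_closure_def by blast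
  obtain y where y: "y \<in> mu4" "w * y = 1" using mu4_inverse[OF w(1)] by blast
  have "y * x = (w * y) * h" by (simp add: w(3) mult_ac)
  then have "y * x = h" by (simp add: y(2))
  then show ?thesis using y(1) w(2) by blast
qed

lemma GK_eq: "galois_rep E eb ` Gal field_Qi = gmat ` HK"
  unfolding HK_def image_image by (rule image_cong) (simp_all add: galois_rep_Qi)

section \<open>Complex conjugation and the full image\<close>

definition gam :: "z2 ^ 2 ^ 2" where "gam = gmat z ** mat2 1 0 0 (- 1)"

lemma gam_eq: "galois_rep E eb c = gam"
  by (simp add: galois_rep_conj[OF c(1,2)] rho_c gam_def)

lemma flip_gmat: "mat2 1 0 0 (- 1) ** gmat w = gmat (gcnj w) ** mat2 1 0 0 (- 1)"
  by (simp add: mat22_eq_iff mat22_mult_nth gmat_def gcnj_def)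

lemma flip_flip: "mat2 1 0 0 (- 1) ** mat2 1 0 0 (- 1) = (mat 1 :: z2 ^ 2 ^ 2)"
  by (simp add: mat22_eq_iff mat22_mult_nth mat_nth2)

lemma gam_gmat_gam: "gam ** gmat w ** gam = gmat (gcnj w)"
proof -
  let ?C = "mat2 1 0 0 (- 1) :: z2 ^ 2 ^ 2"
  have "gam ** gmat w ** gam = gmat z ** (?C ** gmat w) ** (gmat z ** ?C)"
    by (simp add: gam_def matrix_mul_assoc)
  also have "\<dots> = gmat z ** gmat (gcnj w) ** (?C ** gmat z) ** ?C"
    by (subst flip_gmat) (simp add: matrix_mul_assoc)
  also have "\<dots> = gmat z ** gmat (gcnj w) ** gmat (gcnj z) ** (?C ** ?C)"
    unfolding flip_gmat by (simp add: matrix_mul_assoc)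
  also have "\<dots> = gmat ((z * gcnj z) * gcnj w)"
    unfolding flip_flip by (simp add: mult_ac flip: gmat_mult)
  finally show ?thesis by (simp add: z_norm)
qed

text \<open>An automorphism that moves i becomes one over Q(i) after composition with c, so the full
  image consists of two cosets.\<close>

lemma G_eq: "galois_rep E eb ` Gal field_Q = gmat ` HK \<union> (\<lambda>B. B ** gam) ` gmat ` HK"
proof (intro equalityI subsetI)
  fix A assume "A \<in> galois_rep E eb ` Gal field_Q"
  then obtain \<sigma> where \<sigma>: "\<sigma> \<in> Gal field_Q" "A = galois_rep E eb \<sigma>" by blast
  show "A \<in> gmat ` HK \<union> (\<lambda>B. B ** gam) ` gmat ` HK"
  proof (cases "\<sigma> qi = qi")
    case True
    then have "\<sigma> \<in> Gal field_Qi" using \<sigma>(1) Gal_Qi_iff by blast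
    then show ?thesis unfolding GK_eq[symmetric] using \<sigma>(2) by blast
  next
    case False
    then have s: "\<sigma> qi = - qi" using Gal_qi[OF \<sigma>(1)] by blast
    have sc: "\<sigma> \<circ> c \<in> Gal field_Q" by (rule Gal_comp[OF \<sigma>(1) c(1)])
    have "(\<sigma> \<circ> c) qi = qi" by (simp add: c(2) Gal_minus[OF \<sigma>(1)] s)
    then have K: "\<sigma> \<circ> c \<in> Gal field_Qi" using sc Gal_Qi_iff by blast
    have cc: "(\<sigma> \<circ> c) \<circ> c = \<sigma>" using c(3) by (simp add: fun_eq_iff)
    have "rho \<sigma> = z * rho (\<sigma> \<circ> c)" using rho_comp[OF Qi_Q[OF K] c(1)] unfolding cc rho_c .
    then have "A = gmat (rho (\<sigma> \<circ> c)) ** gam"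
      by (simp add: \<sigma>(2) galois_rep_conj[OF \<sigma>(1) s] gam_def gmat_mult matrix_mul_assoc mult.commute[of z])
    moreover have "rho (\<sigma> \<circ> c) \<in> HK" unfolding HK_def using K by (rule imageI)
    ultimately show ?thesis by blast
  qed
next
  fix A assume A: "A \<in> gmat ` HK \<union> (\<lambda>B. B ** gam) ` gmat ` HK"
  show "A \<in> galois_rep E eb ` Gal field_Q"
  proof (cases "A \<in> gmat ` HK")
    case True
    then show ?thesis unfolding GK_eq[symmetric] using Qi_Q(1) by blast
  next
    case False
    then obtain \<sigma> where \<sigma>: "\<sigma> \<in> Gal field_Qi" "A = gmat (rho \<sigma>) ** gam" using A by (auto simp: HK_def)
    note sQ = Qi_Q[OF \<sigma>(1)]
    have sc: "\<sigma> \<circ> c \<in> Gal field_Q" by (rule Gal_comp[OF sQ(1) c(1)])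
    have s: "(\<sigma> \<circ> c) qi = - qi" by (simp add: c(2) Gal_minus[OF sQ(1)] sQ(2))
    have "galois_rep E eb (\<sigma> \<circ> c) = gmat (rho \<sigma>) ** gam"
      unfolding galois_rep_conj[OF sc s] rho_comp[OF sQ c(1)] rho_c gam_def
      by (simp add: gmat_mult matrix_mul_assoc mult.commute[of z])
    then show ?thesis using \<sigma>(2) sc by (metis imageI)
  qed
qed

lemma G_closed_gen: "galois_rep E eb ` Gal field_Q = closed_gen (insert gam (gmat ` HK))"
proof -
  have cs: "closed_subgroup (gmat ` HK)" by (rule closed_subgroup_gmat[OF closed_units_HK])
  have "gcnj 1 = 1" by (simp add: gcnj_def one_gz_def)
  then have sq: "gam ** gam = mat 1" using gam_gmat_gam[of 1] by (simp add: gmat_one)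
  have conj: "gam ** B ** gam \<in> gmat ` HK" if B: "B \<in> gmat ` HK" for B
  proof -
    obtain w where w: "w \<in> HK" "B = gmat w" using B by blast
    have "gmat (gcnj w) \<in> gmat ` HK" by (rule imageI[OF HK_conj[OF w(1)]])
    then show ?thesis unfolding w(2) by (simp only: gam_gmat_gam)
  qed
  show ?thesis unfolding G_eq by (rule closed_subgroup_extend[OF cs sq conj])
qed

text \<open>The rows are (re z, -im z) and (-im z, -re z), and the four roots of unity z give the
  four listed matrices.\<close>

lemma gam_cases: "gam \<in> {mat2 1 0 0 (- 1), mat2 (- 1) 0 0 1, mat2 0 1 1 0, mat2 0 (- 1) (- 1) 0}"
proof -
  have "gam = mat2 (re z) (- im z) (- im z) (- re z)"
    unfolding gam_def mat22_eq_iff by (simp add: mat22_mult_nth gmat_def)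
  note eq = this
  have re_im: "re z = re w" "im z = im w" if "z = w" for w by (rule arg_cong[OF that])+
  from z(1) consider "z = 1" | "z = - 1" | "z = gi" | "z = - gi" unfolding mu4_def by blast
  then show ?thesis
  proof cases
    case 1
    have "gam = mat2 1 0 0 (- 1)"
      unfolding eq using re_im[OF 1] by (simp add: gz_ops gi_def)
    then show ?thesis by blast
  next
    case 2
    have "gam = mat2 (- 1) 0 0 1"
      unfolding eq using re_im[OF 2] by (simp add: gz_ops gi_def)
    then show ?thesis by blast
  next
    case 3
    have "gam = mat2 0 (- 1) (- 1) 0"
      unfolding eq using re_im[OF 3] by (simp add: gz_ops gi_def)
    then show ?thesis by blast
  next
    case 4
    have "gam = mat2 0 1 1 0"
      unfolding eq using re_im[OF 4] by (simp add: gz_ops gi_def)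
    then show ?thesis by blast
  qed
qed

lemma topgen_closed_gen:
  assumes H: "closed_units H" and S: "topgen S H"
  shows "gmat ` H = closed_gen (gmat ` S)"
proof (rule closed_gen_eqI[OF closed_subgroup_gmat[OF H]])
  show "gmat ` S \<subseteq> gmat ` H" using S by (auto simp: topgen_def)
  fix Y assume Y: "closed_subgroup Y" "gmat ` S \<subseteq> Y"
  then have "S \<subseteq> {w. gmat w \<in> Y}" by blast
  then have "H \<subseteq> {w. gmat w \<in> Y}" using S closed_units_vimage[OF Y(1)] by (simp add: topgen_def)
  then show "gmat ` H \<subseteq> Y" by blast
qed

lemma classification:
  "index_in_cartan (gmat ` HK) = 1 \<and> gmat ` HK = G1 \<or>
   index_in_cartan (gmat ` HK) = 2 \<and> gmat ` HK \<in> {G2a, G2b} \<or>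
   index_in_cartan (gmat ` HK) = 4 \<and> gmat ` HK \<in> {G4a, G4b, G4c, G4d}"
proof -
  note H = closed_units_HK
  have ix: "mu4 \<subseteq> HK \<Longrightarrow> index_in_cartan (gmat ` HK) = 1"
    "mu4 \<inter> HK = {1, - 1} \<Longrightarrow> index_in_cartan (gmat ` HK) = 2"
    "mu4 \<inter> HK = {1} \<Longrightarrow> index_in_cartan (gmat ` HK) = 4"
    by (rule index_cases[OF H], rule HK_cover, assumption+)+
  note tg = topgen_closed_gen[OF H]
  have s: "gmat (- 1) = mat (- 1)" "gmat 3 = mat 3" "gmat 5 = mat 5" "gmat (- 3) = mat (- 3)"
    by (simp_all add: gz_numeral one_gz_def uminus_gz_def gmat_scalar)
  have "(mu4 \<subseteq> HK \<and> HK = {x. x dvd 1}) \<or>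
    (mu4 \<inter> HK = {1, - 1} \<and> (topgen {- 1, 3, GZ 1 2} HK \<or> topgen {- 1, 3, GZ 2 1} HK)) \<or>
    (mu4 \<inter> HK = {1} \<and> (topgen {5, GZ 1 2} HK \<or> topgen {5, GZ (- 1) (- 2)} HK
       \<or> topgen {- 3, GZ 2 (- 1)} HK \<or> topgen {- 3, GZ (- 2) 1} HK))"
    by (rule closed_units_classification[OF H HK_conj HK_cover])
  then show ?thesis
  proof (elim disjE conjE)
    assume a: "mu4 \<subseteq> HK" "HK = {x. x dvd 1}"
    have "gmat ` HK = G1" unfolding a(2) by (rule G1_eq[symmetric])
    then show ?thesis using ix(1)[OF a(1)] by simp
  next
    assume a: "mu4 \<inter> HK = {1, - 1}" "topgen {- 1, 3, GZ 1 2} HK"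
    have "gmat ` HK = G2a" unfolding tg[OF a(2)] G2a_def by (simp add: s gmat_GZ)
    then show ?thesis using ix(2)[OF a(1)] by simp
  next
    assume a: "mu4 \<inter> HK = {1, - 1}" "topgen {- 1, 3, GZ 2 1} HK"
    have "gmat ` HK = G2b" unfolding tg[OF a(2)] G2b_def by (simp add: s gmat_GZ)
    then show ?thesis using ix(2)[OF a(1)] by simp
  next
    assume a: "mu4 \<inter> HK = {1}" "topgen {5, GZ 1 2} HK"
    have "gmat ` HK = G4a" unfolding tg[OF a(2)] G4a_def by (simp add: s gmat_GZ)
    then show ?thesis using ix(3)[OF a(1)] by simp
  next
    assume a: "mu4 \<inter> HK = {1}" "topgen {5, GZ (- 1) (- 2)} HK"
    have "gmat ` HK = G4b" unfolding tg[OF a(2)] G4b_def by (simp add: s gmat_GZ)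
    then show ?thesis using ix(3)[OF a(1)] by simp
  next
    assume a: "mu4 \<inter> HK = {1}" "topgen {- 3, GZ 2 (- 1)} HK"
    have "gmat ` HK = G4c" unfolding tg[OF a(2)] G4c_def by (simp add: s gmat_GZ)
    then show ?thesis using ix(3)[OF a(1)] by simp
  next
    assume a: "mu4 \<inter> HK = {1}" "topgen {- 3, GZ (- 2) 1} HK"
    have "gmat ` HK = G4d" unfolding tg[OF a(2)] G4d_def by (simp add: s gmat_GZ)
    then show ?thesis using ix(3)[OF a(1)] by simp
  qed
qed

lemma GK_subset_cartan: "gmat ` HK \<subseteq> cartan"
  unfolding cartan_eq using closed_units_unit[OF closed_units_HK] by blast

end

text \<open>Since c is an involution, its multiplier w on any generator satisfies w times conj w =
  1. By \<open>norm_one\<close> a change of generator by v replaces w by a fourth root of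
  unity.\<close>

lemma (in curve_1728) tate_curve_exists:
  assumes c: "c \<in> Gal field_Q" "c qi = - qi" "\<And>x. c (c x) = x"
  obtains e z where "tate_curve E u e c z"
proof -
  obtain e0 where e0: "tate_seq e0" "e0 1 = E1" using tate_generator_exists by blast
  interpret g0: tate_gen e0 by unfold_locales (rule e0)+
  have tws: "tate_seq (\<lambda>n. tw c (e0 n))" by (rule tate_seq_hom[OF tw_add[OF c(1)] e0(1)])
  obtain w where "(\<lambda>n. tw c (e0 n)) = act w e0" using g0.act_surj[OF tws] .
  then have w: "tw c (e0 n) = act w e0 n" for n by (rule fun_cong)
  have semi: "tw c (act v e0 n) = act (gcnj v * w) e0 n" for v n
  proof -
    have "tw c (act v e0 n) = act (gcnj v) (\<lambda>n. tw c (e0 n)) n" by (rule tw_act_conj[OF c(1,2) e0(1)])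
    also have "(\<lambda>n. tw c (e0 n)) = act w e0" by (rule ext) (rule w)
    finally show ?thesis by (simp only: act_mult[OF e0(1)])
  qed
  have "c \<circ> c = id" using c(3) by (simp add: fun_eq_iff)
  then have "tw c (tw c (e0 n)) = e0 n" for n using tw_comp[OF c(1,1), of "e0 n"] by (simp add: tw_id)
  then have "act (gcnj w * w) e0 n = act 1 e0 n" for n by (simp add: w semi act_1[OF e0(1)])
  then have "act (gcnj w * w) e0 = act 1 e0" by (rule ext)
  then have "gcnj w * w = 1" by (rule g0.act_inj)
  then have "w * gcnj w = 1" by (simp add: mult.commute)
  then obtain v0 z0 where v0: "v0 dvd 1" "z0 \<in> mu4" "w * gcnj v0 = z0 * v0" by (rule norm_one)
  \<comment> \<open>The new generator must still start at \<open>E1\<close>, so v is wanted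
    congruent to 1 modulo 2. When the real part is even, i v is used in place of v, at the cost of
    replacing z by -z.\<close>
  have "\<exists>v z. 2 dvd v - 1 \<and> z \<in> mu4 \<and> w * gcnj v = z * v"
  proof (cases "residue (re v0) 1 = 1")
    case True
    have "residue (re v0 + im v0) 1 = 1"
      using v0(1) residue_1_cases by (auto simp: gz_unit_iff gpi_dvd_iff two_dvd_z2_iff)
    then have "residue (im v0) 1 = 0" using residue_1_cases[of "im v0"] True by (auto simp: residue_ops)
    then have "2 ^ 1 dvd v0 - 1"
      unfolding gz_pow2_dvd_iff using True by (simp add: gz_ops two_dvd_z2_iff residue_ops)
    then show ?thesis using v0 by auto
  next
    case False
    have "residue (re v0 + im v0) 1 = 1"
      using v0(1) residue_1_cases by (auto simp: gz_unit_iff gpi_dvd_iff two_dvd_z2_iff)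
    moreover have r: "residue (re v0) 1 = 0" using False residue_1_cases by blast
    ultimately have "residue (im v0) 1 = 1" using residue_1_cases[of "im v0"] by (auto simp: residue_ops)
    then have "(2 :: gz) ^ 1 dvd gi * v0 - 1"
      unfolding gz_pow2_dvd_iff using r by (simp add: gz_ops gi_def two_dvd_z2_iff residue_ops)
    then have "2 dvd gi * v0 - 1" by simp
    moreover have "w * gcnj (gi * v0) = (- z0) * (gi * v0)"
    proof -
      have "gcnj (gi * v0) = - gi * gcnj v0" by (simp add: gcnj_mult) (simp add: gcnj_def gi_def gz_ops)
      then have "w * gcnj (gi * v0) = - gi * (w * gcnj v0)" by (simp add: mult.left_commute)
      then show ?thesis unfolding v0(3) by (simp add: mult_ac)
    qed
    moreover have "- z0 \<in> mu4" using v0(2) by (auto simp: mu4_def)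
    ultimately show ?thesis by blast
  qed
  then obtain v z where v: "2 dvd v - 1" "z \<in> mu4" "w * gcnj v = z * v" by blast
  define e where "e = act v e0"
  have seq: "tate_seq e" unfolding e_def by (rule tate_seq_act[OF e0(1)])
  have "e 1 = act 1 e0 1" unfolding e_def g0.act_level_eq_iff using v(1) by simp
  then have first: "e 1 = E1" by (simp only: act_1[OF e0(1)] e0(2))
  have "tw c (e n) = act z e n" for n
  proof -
    have "tw c (e n) = act (gcnj v * w) e0 n" by (simp add: e_def semi)
    also have "gcnj v * w = z * v" using v(3) by (simp add: mult.commute)
    finally show ?thesis by (simp only: e_def act_mult[OF e0(1)])
  qed
  then have "tate_curve E u e c z"
    using c v(2) seq first by unfold_locales simp_all
  then show ?thesis by (rule that)
qed

theorem theorem1p7: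
  fixes E :: "rat weierstrass" and c :: "QQbar \<Rightarrow> QQbar"
  assumes "elliptic_curve E" and "j_invariant E = 1728" and "complex_conjugation c"
  shows "\<exists>e. tate_basis E e \<and>
    (let \<gamma> = galois_rep E e c;
         G = galois_rep E e ` Gal field_Q;
         GK = galois_rep E e ` Gal field_Qi
     in GK \<subseteq> cartan \<and>
        (index_in_cartan GK = 1 \<and> GK = G1 \<or>
         index_in_cartan GK = 2 \<and> GK \<in> {G2a, G2b} \<or>
         index_in_cartan GK = 4 \<and> GK \<in> {G4a, G4b, G4c, G4d}) \<and>
        G = closed_gen (insert \<gamma> GK) \<and>
        (\<exists>\<gamma>' \<in> {mat2 1 0 0 (- 1), mat2 (- 1) 0 0 1, mat2 0 1 1 0, mat2 0 (- 1) (- 1) 0}.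
           G = closed_gen (insert \<gamma>' GK) \<and> mat_cong 4 \<gamma> \<gamma>'))"
proof -
  \<comment> \<open>The scaling that turns the coefficient of x into 1; its fourth power is
    rational, so the twist takes values in the fourth roots of unity.\<close>
  obtain u :: QQbar where u: "u ^ 4 = to_ac (- c4 E / 48)" using nth_root_exists[of 4] by auto
  have "to_ac (- c4 E / 48) \<noteq> (0 :: QQbar)" using j_1728_relations(2)[OF assms(1,2)] by simp
  then have "u \<noteq> 0" using u by auto
  then interpret curve_1728 E u
    using j_1728_relations(1)[OF assms(1,2)] u by unfold_locales
  obtain e z where "tate_curve E u e c z"
    using tate_curve_exists[OF complex_conjugation_props[OF assms(3)]] .
  then interpret T: tate_curve E u e c z .
  show ?thesis
    unfolding Let_def
  proof (intro exI conjI)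
    show "tate_basis E T.eb" by (rule T.tate_basis_eb)
    show "galois_rep E T.eb ` Gal field_Qi \<subseteq> cartan"
      unfolding T.GK_eq by (rule T.GK_subset_cartan)
    show "index_in_cartan (galois_rep E T.eb ` Gal field_Qi) = 1 \<and> galois_rep E T.eb ` Gal field_Qi = G1 \<or>
      index_in_cartan (galois_rep E T.eb ` Gal field_Qi) = 2 \<and> galois_rep E T.eb ` Gal field_Qi \<in> {G2a, G2b} \<or>
      index_in_cartan (galois_rep E T.eb ` Gal field_Qi) = 4 \<and>
        galois_rep E T.eb ` Gal field_Qi \<in> {G4a, G4b, G4c, G4d}"
      unfolding T.GK_eq by (rule T.classification)
    show gen: "galois_rep E T.eb ` Gal field_Q =
      closed_gen (insert (galois_rep E T.eb c) (galois_rep E T.eb ` Gal field_Qi))"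
      unfolding T.GK_eq T.gam_eq by (rule T.G_closed_gen)
    show "\<exists>\<gamma>'\<in>{mat2 1 0 0 (- 1), mat2 (- 1) 0 0 1, mat2 0 1 1 0, mat2 0 (- 1) (- 1) 0}.
      galois_rep E T.eb ` Gal field_Q = closed_gen (insert \<gamma>' (galois_rep E T.eb ` Gal field_Qi)) \<and>
      mat_cong 4 (galois_rep E T.eb c) \<gamma>'"
    proof (intro bexI conjI)
      show "galois_rep E T.eb ` Gal field_Q =
        closed_gen (insert (galois_rep E T.eb c) (galois_rep E T.eb ` Gal field_Qi))" by (rule gen)
      \<comment> \<open>The witness is the matrix of c itself: in this basis it already is one of
        the four matrices, so the congruence is an equality.\<close>
      show "mat_cong 4 (galois_rep E T.eb c) (galois_rep E T.eb c)" by (simp add: mat_cong_def)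
      show "galois_rep E T.eb c \<in> {mat2 1 0 0 (- 1), mat2 (- 1) 0 0 1, mat2 0 1 1 0, mat2 0 (- 1) (- 1) 0}"
        unfolding T.gam_eq by (rule T.gam_cases)
    qed
  qed
qed

end
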